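(* For every integer $N\ge1$, setting $\omega=e^{2\pi i/N}$, $$\mathfrak{sf}\big(\gamma^{(N)}\big)=\sum_{k=0}^{N-1}\lambda_\gamma(\omega^k).$$
   Context: Let $(M,g)$ be a semi-Riemannian manifold of dimension $n$, with Levi-Civita covariant derivative $\tfrac{D}{dt}$ along curves and curvature $R(X,Y)=[\nabla_X,\nabla_Y]-\nabla_{[X,Y]}$. Let $\gamma:[0,1]\to M$ be a closed geodesic, extended $1$-periodically, which is orientation preserving. Fix a smooth $1$-periodic family of isomorphisms $T_t:\mathbb R^n\to T_{\gamma(t)}M$ with $g(T_te_i,T_te_j)=\epsilon_i\delta_{ij}$, $\epsilon_i\in\{\pm1\}$. Put $G=\mathrm{diag}(\epsilon_i)$, $G(u,v)=\sum_j\epsilon_ju_j\bar v_j$ on $\mathbb C^n$. Let $\overline R_t=T_t^{-1}\circ R(\dot\gamma(t),T_t\,\cdot\,)\dot\gamma(t)$ and $\Gamma_t$ defined by $T_t^{-1}\tfrac{D}{dt}\big(T_t\overline V(t)\big)=\overline V'(t)+\Gamma_t\overline V(t)$ (smooth, $1$-periodic, $G$-symmetric resp. $G$-antisymmetric, extended $\mathbb C$-linearly). Let $\mathcal H=H^1([0,1],\mathbb C^n)$ with inner product $\langle V,W\rangle=V(0)\cdot\overline{W(0)}+\int_0^1V'\cdot\overline{W'}\,dr$; $\mathcal H_z=\{V:V(1)=zV(0)\}$ for $z\in\mathbb S^1$. For $t\ge0$, $B_t(V,W)=\int_0^1\big[G(V',W')+tG(\Gamma_{tr}V,W')+tG(V',\Gamma_{tr}W)+t^2G(\Gamma_{tr}V,\Gamma_{tr}W)+t^2G(\overline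 R_{tr}V,W)\big]dr$. Spectral flow of a continuous path of Fredholm Hermitian forms on a closed subspace of $\mathcal H$ is that of the representing self-adjoint operators (Phillips' endpoint convention); each $B_t|_{\mathcal H_z\times\mathcal H_z}$ is a compact perturbation of the form represented by the symmetry $V\mapsto GV$. For $N\ge1$, $\mathfrak{sf}(\gamma^{(N)})$ (the spectral flow of the $N$-th iterate $\gamma^{(N)}(t)=\gamma(Nt)$) is the spectral flow of $[0,1]\ni t\mapsto B_{Nt}|_{\mathcal H_1\times\mathcal H_1}$. $\lambda_\gamma(z)$ is the spectral flow of $[0,1]\ni t\mapsto B_t|_{\mathcal H_z\times\mathcal H_z}$. *)

theory Defs
  imports "HOL-Analysis.Analysis" "HOL-Library.Function_Algebras"
begin

type_synonym 'n cfun = "real \<Rightarrow> complex ^ 'n"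
type_synonym 'n cform = "'n cfun \<Rightarrow> 'n cfun \<Rightarrow> complex"

definition cdot :: "complex ^ 'n::finite \<Rightarrow> complex ^ 'n \<Rightarrow> complex" where
  "cdot u v = (\<Sum>i\<in>UNIV. u $ i * cnj (v $ i))"

definition Gform :: "('n::finite \<Rightarrow> real) \<Rightarrow> complex ^ 'n \<Rightarrow> complex ^ 'n \<Rightarrow> complex" where
  "Gform \<epsilon> u v = (\<Sum>j\<in>UNIV. complex_of_real (\<epsilon> j) * u $ j * cnj (v $ j))"

definition cmv :: "real ^ 'n ^ 'n::finite \<Rightarrow> complex ^ 'n \<Rightarrow> complex ^ 'n" where
  "cmv M v = (\<chi> i. \<Sum>j\<in>UNIV. complex_of_real (M $ i $ j) * v $ j)"

definition G_symmetric :: "('n::finite \<Rightarrow> real) \<Rightarrow> real ^ 'n ^ 'n \<Rightarrow> bool" where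
  "G_symmetric \<epsilon> M \<longleftrightarrow> (\<forall>u v. Gform \<epsilon> (cmv M u) v = Gform \<epsilon> u (cmv M v))"

definition G_antisymmetric :: "('n::finite \<Rightarrow> real) \<Rightarrow> real ^ 'n ^ 'n \<Rightarrow> bool" where
  "G_antisymmetric \<epsilon> M \<longleftrightarrow> (\<forall>u v. Gform \<epsilon> (cmv M u) v = - Gform \<epsilon> u (cmv M v))"

definition smooth_mat :: "(real \<Rightarrow> real ^ 'n ^ 'm) \<Rightarrow> bool" where
  "smooth_mat f \<longleftrightarrow> (\<forall>i j k t. ((deriv ^^ k) (\<lambda>s. f s $ i $ j)) differentiable (at t))"

definition is_H1_deriv :: "'n::finite cfun \<Rightarrow> 'n cfun \<Rightarrow> bool" where
  "is_H1_deriv V V' \<longleftrightarrow>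
     set_borel_measurable lborel {0..1} V' \<and>
     set_integrable lborel {0..1} (\<lambda>s. (norm (V' s))\<^sup>2) \<and>
     (\<forall>t\<in>{0..1}. V t = V 0 + (LINT s:{0..t}|lborel. V' s))"

text \<open>Elements of H^1 are represented by their continuous representative on [0,1],
  extended by 0 outside [0,1] (so that each element is a unique function).\<close>
definition H1 :: "'n::finite cfun set" where
  "H1 = {V. (\<exists>V'. is_H1_deriv V V') \<and> (\<forall>t. t \<notin> {0..1} \<longrightarrow> V t = 0)}"

definition hder :: "'n::finite cfun \<Rightarrow> 'n cfun" where
  "hder V = (SOME V'. is_H1_deriv V V')"

definition H1_inner :: "'n::finite cform" where
  "H1_inner V W = cdot (V 0) (W 0) + (LINT r:{0..1}|lborel. cdot (hder V r) (hder W r))"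

definition Hz :: "complex \<Rightarrow> 'n::finite cfun set" where
  "Hz z = {V \<in> H1. V 1 = z *s V 0}"

definition Bform :: "('n::finite \<Rightarrow> real) \<Rightarrow> (real \<Rightarrow> real ^ 'n ^ 'n) \<Rightarrow> (real \<Rightarrow> real ^ 'n ^ 'n)
    \<Rightarrow> real \<Rightarrow> 'n cform" where
  "Bform \<epsilon> \<Gamma> R t V W = (LINT r:{0..1}|lborel.
      Gform \<epsilon> (hder V r) (hder W r)
    + of_real t * Gform \<epsilon> (cmv (\<Gamma> (t * r)) (V r)) (hder W r)
    + of_real t * Gform \<epsilon> (hder V r) (cmv (\<Gamma> (t * r)) (W r))
    + of_real (t\<^sup>2) * Gform \<epsilon> (cmv (\<Gamma> (t * r)) (V r)) (cmv (\<Gamma> (t * r)) (W r))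
    + of_real (t\<^sup>2) * Gform \<epsilon> (cmv (R (t * r)) (V r)) (W r))"

definition cscale :: "complex \<Rightarrow> 'n::finite cfun \<Rightarrow> 'n cfun" where
  "cscale c V = (\<lambda>t. c *s V t)"

definition cdim :: "'n::finite cfun set \<Rightarrow> nat" where
  "cdim E = vector_space.dim cscale E"

definition cfin_dim :: "'n::finite cfun set \<Rightarrow> bool" where
  "cfin_dim E \<longleftrightarrow> (\<exists>B. finite B \<and> module.span cscale B = module.span cscale E)"

text \<open>Spectrum (real part) of the self-adjoint operator A on X representing the
  form b w.r.t. ip: lambda is in the spectrum iff A - lambda is not bijective on X,
  i.e. the equation b(V,.) - lambda ip(V,.) = ip(U,.) is not uniquely solvable in X
  for every U in X.\<close>
definition rep_spec :: "'n::finite cfun set \<Rightarrow> 'n cform \<Rightarrow> 'n cform \<Rightarrow> real set" where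
  "rep_spec X ip b = {mu. \<not> (\<forall>U\<in>X. \<exists>!V. V \<in> X \<and>
        (\<forall>W\<in>X. b V W - complex_of_real mu * ip V W = ip U W))}"

definition rep_eig :: "'n::finite cfun set \<Rightarrow> 'n cform \<Rightarrow> 'n cform \<Rightarrow> real \<Rightarrow> 'n cfun set" where
  "rep_eig X ip b mu = {V \<in> X. \<forall>W\<in>X. b V W = complex_of_real mu * ip V W}"

text \<open>a is admissible for A: a > 0, +-a not in the spectrum and the spectral projection
  onto [-a,a] has finite rank (finitely many spectral points there, each an
  eigenvalue of finite multiplicity).\<close>
definition sf_admissible :: "'n::finite cfun set \<Rightarrow> 'n cform \<Rightarrow> 'n cform \<Rightarrow> real \<Rightarrow> bool" where
  "sf_admissible X ip b a \<longleftrightarrow> 0 < a \<and> a \<notin> rep_spec X ip b \<and> - a \<notin> rep_spec X ip b \<and>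
     finite (rep_spec X ip b \<inter> {-a..a}) \<and>
     (\<forall>mu\<in>rep_spec X ip b \<inter> {-a..a}. cfin_dim (rep_eig X ip b mu))"

text \<open>rank of the spectral projection chi_[0,a)(A)\<close>
definition spec_count :: "'n::finite cfun set \<Rightarrow> 'n cform \<Rightarrow> 'n cform \<Rightarrow> real \<Rightarrow> nat" where
  "spec_count X ip b a = (\<Sum>mu\<in>rep_spec X ip b \<inter> {0..<a}. cdim (rep_eig X ip b mu))"

text \<open>Phillips' definition of the spectral flow of t in [0,1] -> b t.\<close>
definition spectral_flow :: "'n::finite cfun set \<Rightarrow> 'n cform \<Rightarrow> (real \<Rightarrow> 'n cform) \<Rightarrow> int" where
  "spectral_flow X ip b = (THE s. \<exists>(m::nat) (tp::nat \<Rightarrow> real) (a::nat \<Rightarrow> real).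
      tp 0 = 0 \<and> tp m = 1 \<and> (\<forall>i<m. tp i < tp (Suc i)) \<and>
      (\<forall>i<m. \<forall>t\<in>{tp i..tp (Suc i)}. sf_admissible X ip (b t) (a i)) \<and>
      s = (\<Sum>i<m. int (spec_count X ip (b (tp (Suc i))) (a i))
                 - int (spec_count X ip (b (tp i)) (a i))))"

end

theory Submission imports Defs begin

text \<open>The forms \<open>B\<^bsub>Nt\<^esub>\<close> split over the \<open>N\<close>-fold cover only at \<open>t = 0\<close> and \<open>t = 1\<close>, so the spectral
  flow is first written as a difference of indices at the endpoints. Let \<open>W\<^sub>m\<^sup>\<plusminus>\<close> be the space of
  functions with values in the \<open>\<plusminus>1\<close>-eigenspace of \<open>G\<close> that vanish at all the points \<open>j/m\<close>. For
  large \<open>m\<close>, uniformly in \<open>t\<close>, the form \<open>B\<^sub>t\<close> is close to \<open>\<plusminus>\<close> the inner product on \<open>W\<^sub>m\<^sup>\<plusminus>\<close>, and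
  \<open>W\<^sub>m\<^sup>+ + W\<^sub>m\<^sup>-\<close> has finite codimension. Hence there is a finite index counting the dimensions by
  which a maximal nonnegative space of \<open>B\<^sub>t\<close> exceeds \<open>W\<^sub>m\<^sup>+\<close>; its jumps are the spectral counts in the
  definition of spectral flow. The index depends only on the signs of the form, so it is additive along
  the discrete Fourier decomposition of the periodic functions into the spaces \<open>\<H>\<^sub>z\<close>, \<open>z\<^sup>N = 1\<close>,
  which at the endpoints is orthogonal for the forms.\<close>

subsection \<open>Hermitian forms\<close>

text \<open>No spectral projection is formed. Spectral counts are sums of kernel dimensions of
  \<open>b - s * ip\<close>, and the index of \<open>b - s * ip\<close>, as a function of
  \<open>s\<close>, is left-continuous and drops by exactly that dimension. A count over [0,a) is
  therefore a difference of two indices.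

  The obstacle is that \<open>spectral_flow\<close> is a definite description over all partitions
  with arbitrary thresholds. Each sign occurring in \<epsilon> belongs to the essential spectrum of
  every B_t, which forces every admissible threshold below 1. Given a partition, pick c between its
  largest threshold and 1, and refine the grid until B_t is bounded by c times the squared norm on
  the grid spaces. This is why B_t has to be close to plus or minus the inner product and not just
  definite there. The required fineness depends on the partition, so no single grid serves all of
  them: two partitions are compared on a grid fine enough for both.

  On the cover, the grid with N times m cells restricts on each sheet to the grid with m cells, so
  matching grid spaces are available on both sides of the identity.\<close>

locale complex_vs = vector_space scale
  for scale :: "complex \<Rightarrow> 'v::ab_group_add \<Rightarrow> 'v" (infixr "*C" 75)
begin

text \<open>Relative to a set because the forms of interest are Hermitian only on H1 or its
  subspaces. Conjugate linearity in the second argument follows from the symmetry clause.\<close>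

definition herm_on :: "'v set \<Rightarrow> ('v \<Rightarrow> 'v \<Rightarrow> complex) \<Rightarrow> bool" where
  "herm_on X b \<longleftrightarrow>
     (\<forall>u\<in>X. \<forall>v\<in>X. \<forall>w\<in>X. b (u + v) w = b u w + b v w) \<and>
     (\<forall>c. \<forall>u\<in>X. \<forall>w\<in>X. b (c *C u) w = c * b u w) \<and>
     (\<forall>u\<in>X. \<forall>v\<in>X. b v u = cnj (b u v))"

lemma herm_on_subset: "herm_on X b \<Longrightarrow> Y \<subseteq> X \<Longrightarrow> herm_on Y b"
  unfolding herm_on_def by (meson subsetD)

lemma herm_on_shift:
  assumes "herm_on X b" "herm_on X h"
  shows "herm_on X (\<lambda>v w. b v w - of_real s * h v w)"
proof -
  have "b v u - of_real s * h v u = cnj (b u v - of_real s * h u v)" if "u \<in> X" "v \<in> X" for u v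
  proof -
    have "b v u = cnj (b u v)" "h v u = cnj (h u v)"
      using assms that unfolding herm_on_def by blast+
    then show ?thesis by (simp only: complex_cnj_diff complex_cnj_mult complex_cnj_complex_of_real)
  qed
  moreover have "b (u + v) w = b u w + b v w" "h (u + v) w = h u w + h v w"
    if "u \<in> X" "v \<in> X" "w \<in> X" for u v w
    using assms that unfolding herm_on_def by blast+
  moreover have "b (c *C u) w = c * b u w" "h (c *C u) w = c * h u w"
    if "u \<in> X" "w \<in> X" for c u w
    using assms that unfolding herm_on_def by blast+
  ultimately show ?thesis
    unfolding herm_on_def by (auto simp: algebra_simps)
qed

context
  fixes X b
  assumes X: "subspace X" and h: "herm_on X b"
begin

lemma herm_add_left: "u \<in> X \<Longrightarrow> v \<in> X \<Longrightarrow> w \<in> X \<Longrightarrow> b (u + v) w = b u w + b v w"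
  and herm_scale_left: "u \<in> X \<Longrightarrow> w \<in> X \<Longrightarrow> b (c *C u) w = c * b u w"
  and herm_cnj: "u \<in> X \<Longrightarrow> v \<in> X \<Longrightarrow> b v u = cnj (b u v)"
  using h unfolding herm_on_def by blast+

lemma herm_add_right: "u \<in> X \<Longrightarrow> v \<in> X \<Longrightarrow> w \<in> X \<Longrightarrow> b w (u + v) = b w u + b w v"
  using herm_cnj[of "u + v" w] herm_cnj[of u w] herm_cnj[of v w] herm_add_left[of u v w]
    subspace_add[OF X] by simp

lemma herm_scale_right: "u \<in> X \<Longrightarrow> w \<in> X \<Longrightarrow> b w (c *C u) = cnj c * b w u"
  using herm_cnj[of "c *C u" w] herm_cnj[of u w] herm_scale_left[of u w c] subspace_scale[OF X]
  by simp

lemma herm_zero_left: "w \<in> X \<Longrightarrow> b 0 w = 0"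
  using herm_scale_left[of 0 w 0] subspace_0[OF X] by simp

lemma herm_zero_right: "w \<in> X \<Longrightarrow> b w 0 = 0"
  using herm_scale_right[of 0 w 0] subspace_0[OF X] by simp

lemma herm_minus_left: "u \<in> X \<Longrightarrow> w \<in> X \<Longrightarrow> b (- u) w = - b u w"
  using herm_scale_left[of u w "-1"] by simp

lemma herm_minus_right: "u \<in> X \<Longrightarrow> w \<in> X \<Longrightarrow> b w (- u) = - b w u"
  using herm_scale_right[of u w "-1"] by simp

lemma herm_diff_left: "u \<in> X \<Longrightarrow> v \<in> X \<Longrightarrow> w \<in> X \<Longrightarrow> b (u - v) w = b u w - b v w"
  using herm_add_left[of u "- v" w] herm_minus_left[of v w] subspace_neg[OF X] by simp

lemma herm_diff_right: "u \<in> X \<Longrightarrow> v \<in> X \<Longrightarrow> w \<in> X \<Longrightarrow> b w (u - v) = b w u - b w v"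
  using herm_add_right[of u "- v" w] herm_minus_right[of v w] subspace_neg[OF X] by simp

lemma herm_Im: "u \<in> X \<Longrightarrow> Im (b u u) = 0"
  using herm_cnj[of u u] by (metis Reals_cnj_iff complex_is_Real_iff)

lemma herm_of_real: "u \<in> X \<Longrightarrow> b u u = of_real (Re (b u u))"
  by (simp add: complex_eq_iff herm_Im)

lemma herm_sum_left:
  assumes "finite S" "\<And>s. s \<in> S \<Longrightarrow> f s \<in> X" "w \<in> X"
  shows "b (\<Sum>s\<in>S. f s) w = (\<Sum>s\<in>S. b (f s) w)"
  using assms(1,2)
  by (induction S rule: finite_induct)
     (simp_all add: herm_zero_left herm_add_left assms(3) subspace_sum[OF X])

lemma herm_sum_right:
  assumes "finite S" "\<And>s. s \<in> S \<Longrightarrow> f s \<in> X" "w \<in> X"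
  shows "b w (\<Sum>s\<in>S. f s) = (\<Sum>s\<in>S. b w (f s))"
  using assms(1,2)
  by (induction S rule: finite_induct)
     (simp_all add: herm_zero_right herm_add_right assms(3) subspace_sum[OF X])

lemma herm_quad_add:
  assumes "u \<in> X" "v \<in> X"
  shows "Re (b (u + v) (u + v)) = Re (b u u) + 2 * Re (b u v) + Re (b v v)"
proof -
  have "b (u + v) (u + v) = b u u + b u v + cnj (b u v) + b v v"
    using assms subspace_add[OF X] herm_cnj[of u v] by (simp add: herm_add_left herm_add_right)
  then show ?thesis by simp
qed

lemma herm_quad_scale: "u \<in> X \<Longrightarrow> Re (b (c *C u) (c *C u)) = (cmod c)\<^sup>2 * Re (b u u)"
proof -
  assume u: "u \<in> X"
  have "b (c *C u) (c *C u) = (c * cnj c) * b u u"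
    using u subspace_scale[OF X] by (simp add: herm_scale_left herm_scale_right)
  then show ?thesis
    using herm_of_real[OF u] by (metis Re_complex_of_real complex_norm_square of_real_mult)
qed

lemma herm_quad_diff:
  assumes "u \<in> X" "v \<in> X"
  shows "Re (b (u - v) (u - v)) = Re (b u u) - 2 * Re (b u v) + Re (b v v)"
  using herm_quad_add[of u "- v"] assms subspace_neg[OF X]
  by (simp add: herm_minus_right herm_minus_left)

text \<open>Semidefinite forms occur twice: \<open><Av,Aw> - q^2 <v,w>\<close> in the spectral gap
  argument, and the L2 pairing of functions that are not identified almost everywhere.\<close>

lemma herm_cauchy_schwarz:
  assumes nn: "\<And>v. v \<in> X \<Longrightarrow> 0 \<le> Re (b v v)" and u: "u \<in> X" and v: "v \<in> X"
  shows "(cmod (b u v))\<^sup>2 \<le> Re (b u u) * Re (b v v)"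
proof -
  define z where "z = b u v"
  define p q where "p = Re (b u u)" and "q = Re (b v v)"
  have pq: "0 \<le> p" "0 \<le> q" using nn u v by (auto simp: p_def q_def)
  \<comment> \<open>Scaling \<open>v\<close> by \<open>s * b u v\<close> removes the phase, so the
    form at \<open>u - c *C v\<close> becomes a real polynomial in \<open>s\<close>.\<close>
  have key: "0 \<le> p - 2 * s * (cmod z)\<^sup>2 + s\<^sup>2 * (cmod z)\<^sup>2 * q" for s :: real
  proof -
    define c where "c = of_real s * z"
    have cv: "c *C v \<in> X" using v X subspace_scale by blast
    have "0 \<le> Re (b (u - c *C v) (u - c *C v))"
      using nn subspace_diff[OF X u cv] by blast
    also have "\<dots> = p - 2 * Re (b u (c *C v)) + (cmod c)\<^sup>2 * q"
      using herm_quad_diff[OF u cv] herm_quad_scale[OF v] by (simp add: p_def q_def)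
    also have "b u (c *C v) = of_real s * (cnj z * z)"
      using herm_scale_right[OF v u] by (simp add: c_def z_def)
    also have "cnj z * z = of_real ((cmod z)\<^sup>2)" by (metis complex_norm_square mult.commute)
    finally show ?thesis by (simp add: c_def norm_mult power_mult_distrib)
  qed
  show ?thesis
  proof (cases "q = 0")
    case True
    have "(cmod z)\<^sup>2 \<le> 0"
    proof (rule ccontr)
      assume a: "\<not> (cmod z)\<^sup>2 \<le> 0"
      \<comment> \<open>For \<open>q = 0\<close> the polynomial is affine in \<open>s\<close>; this
        choice of \<open>s\<close> gives it the value \<open>- p - 2\<close>.\<close>
      have "0 \<le> p - 2 * ((p + 1) / (cmod z)\<^sup>2) * (cmod z)\<^sup>2"
        using key[of "(p + 1) / (cmod z)\<^sup>2"] True by simp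
      then show False using a pq by simp
    qed
    then show ?thesis using True by (simp add: z_def q_def)
  next
    case False
    then have q: "q > 0" using pq by simp
    have "0 \<le> q * (p - 2 * (1 / q) * (cmod z)\<^sup>2 + (1 / q)\<^sup>2 * (cmod z)\<^sup>2 * q)"
      using key[of "1 / q"] q by simp
    also have "\<dots> = p * q - (cmod z)\<^sup>2" using q by (simp add: field_simps power2_eq_square)
    finally show ?thesis by (simp add: z_def p_def q_def)
  qed
qed

end

end

subsection \<open>Bounded Hermitian forms on a Hilbert space\<close>

text \<open>The Hilbert space is a carrier inside an ambient vector space, with the inner product as
  a parameter. The same vectors can thus carry a second inner product, and closed subspaces such as
  the closure of a range can be interpreted as Hilbert spaces too.\<close>

locale hspace = complex_vs scale
  for scale :: "complex \<Rightarrow> 'v::ab_group_add \<Rightarrow> 'v" (infixr "*C" 75) +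
  fixes X :: "'v set" and ip :: "'v \<Rightarrow> 'v \<Rightarrow> complex"
  assumes sub: "subspace X" and ip: "herm_on X ip"
    and ip_pos: "\<And>v. v \<in> X \<Longrightarrow> v \<noteq> 0 \<Longrightarrow> 0 < Re (ip v v)"
    and compl: "\<And>f. (\<And>n::nat. f n \<in> X) \<Longrightarrow>
      (\<forall>e>0. \<exists>M. \<forall>m\<ge>M. \<forall>n\<ge>M. sqrt (Re (ip (f m - f n) (f m - f n))) < e) \<Longrightarrow>
      \<exists>l\<in>X. (\<lambda>n. sqrt (Re (ip (f n - l) (f n - l)))) \<longlonglongrightarrow> 0"
begin

definition nrm :: "'v \<Rightarrow> real" where "nrm v = sqrt (Re (ip v v))"

lemmas ip_simps = herm_add_left[OF sub ip] herm_add_right[OF sub ip] herm_diff_left[OF sub ip]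
  herm_diff_right[OF sub ip] herm_scale_left[OF sub ip] herm_scale_right[OF sub ip]
  herm_minus_left[OF sub ip] herm_minus_right[OF sub ip] herm_zero_left[OF sub ip]
  herm_zero_right[OF sub ip]
lemmas ip_cnj = herm_cnj[OF sub ip]
lemmas cl [simp, intro] = subspace_add[OF sub] subspace_diff[OF sub] subspace_scale[OF sub]
  subspace_neg[OF sub] subspace_0[OF sub]

lemma ip_nonneg: "v \<in> X \<Longrightarrow> 0 \<le> Re (ip v v)"
  using ip_pos[of v] herm_zero_left[OF sub ip, of 0] by (cases "v = 0") auto

lemma nrm_nonneg [simp]: "v \<in> X \<Longrightarrow> 0 \<le> nrm v"
  by (simp add: nrm_def ip_nonneg)

lemma nrm_sq: "v \<in> X \<Longrightarrow> (nrm v)\<^sup>2 = Re (ip v v)"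
  by (simp add: nrm_def ip_nonneg)

lemma ip_self: "v \<in> X \<Longrightarrow> ip v v = of_real ((nrm v)\<^sup>2)"
  using herm_of_real[OF sub ip] nrm_sq by metis

lemma nrm_zero [simp]: "nrm 0 = 0"
  using ip_simps(9)[of 0] by (simp add: nrm_def cl)

lemma nrm_pos: "v \<in> X \<Longrightarrow> v \<noteq> 0 \<Longrightarrow> 0 < nrm v"
  by (simp add: nrm_def ip_pos)

lemma ip_zero_imp: "u \<in> X \<Longrightarrow> (\<And>w. w \<in> X \<Longrightarrow> ip u w = 0) \<Longrightarrow> u = 0"
  using ip_pos[of u] by force

lemma CS: "u \<in> X \<Longrightarrow> v \<in> X \<Longrightarrow> cmod (ip u v) \<le> nrm u * nrm v"
proof -
  assume uv: "u \<in> X" "v \<in> X"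
  have "(cmod (ip u v))\<^sup>2 \<le> (nrm u * nrm v)\<^sup>2"
    using herm_cauchy_schwarz[OF sub ip ip_nonneg uv] by (simp add: power_mult_distrib nrm_sq uv)
  then show ?thesis by (rule power2_le_imp_le) (simp add: uv)
qed

lemma nrm_triangle: "u \<in> X \<Longrightarrow> v \<in> X \<Longrightarrow> nrm (u + v) \<le> nrm u + nrm v"
proof -
  assume uv: "u \<in> X" "v \<in> X"
  have "Re (ip u v) \<le> nrm u * nrm v" using CS[OF uv] complex_Re_le_cmod order_trans by blast
  then have "(nrm (u + v))\<^sup>2 \<le> (nrm u + nrm v)\<^sup>2"
    using herm_quad_add[OF sub ip uv] uv cl by (simp add: nrm_sq power2_sum)
  then show ?thesis by (rule power2_le_imp_le) (simp add: uv)
qed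

lemma nrm_scale: "u \<in> X \<Longrightarrow> nrm (c *C u) = cmod c * nrm u"
  by (simp add: nrm_def herm_quad_scale[OF sub ip] real_sqrt_mult)

lemma nrm_minus: "u \<in> X \<Longrightarrow> nrm (- u) = nrm u"
  using nrm_scale[of u "-1"] by simp

lemma nrm_minus_commute: "u \<in> X \<Longrightarrow> v \<in> X \<Longrightarrow> nrm (u - v) = nrm (v - u)"
  using nrm_minus[of "u - v"] cl by simp

lemma nrm_triangle_diff: "u \<in> X \<Longrightarrow> v \<in> X \<Longrightarrow> nrm (u - v) \<le> nrm u + nrm v"
  using nrm_triangle[of u "- v"] nrm_minus[of v] cl by simp

lemma nrm_triangle_ineq2: "u \<in> X \<Longrightarrow> v \<in> X \<Longrightarrow> nrm u - nrm v \<le> nrm (u - v)"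
  using nrm_triangle[of "u - v" v] cl by simp

lemma nrm_triangle_ineq3: "u \<in> X \<Longrightarrow> v \<in> X \<Longrightarrow> \<bar>nrm u - nrm v\<bar> \<le> nrm (u - v)"
  using nrm_triangle_ineq2[of u v] nrm_triangle_ineq2[of v u] nrm_minus_commute[of u v] by simp

lemma complete:
  assumes "\<And>n::nat. f n \<in> X" "\<And>e. e > 0 \<Longrightarrow> \<exists>M. \<forall>m\<ge>M. \<forall>n\<ge>M. nrm (f m - f n) < e"
  obtains l where "l \<in> X" "(\<lambda>n. nrm (f n - l)) \<longlonglongrightarrow> 0"
  using compl[of f] assms unfolding nrm_def by blast

lemma tendsto_nrm:
  assumes "\<And>n::nat. f n \<in> X" "l \<in> X" "(\<lambda>n. nrm (f n - l)) \<longlonglongrightarrow> 0"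
  shows "(\<lambda>n. nrm (f n)) \<longlonglongrightarrow> nrm l"
proof -
  have "(\<lambda>n. nrm (f n) - nrm l) \<longlonglongrightarrow> 0"
    by (rule Lim_null_comparison[OF _ assms(3)])
       (use nrm_triangle_ineq3 assms in \<open>auto intro!: always_eventually\<close>)
  then show ?thesis by (simp add: LIM_zero_iff)
qed

text \<open>The representing vector minimises \<open>J v = |v|^2 - 2 Re (f v)\<close>: the
  parallelogram law makes a minimising sequence Cauchy, and the first variation at the limit is the
  desired identity.\<close>

lemma riesz:
  assumes add: "\<And>u v. u \<in> X \<Longrightarrow> v \<in> X \<Longrightarrow> f (u + v) = f u + f v"
    and sc: "\<And>c u. u \<in> X \<Longrightarrow> f (c *C u) = c * f u"
    and bd: "\<And>u. u \<in> X \<Longrightarrow> cmod (f u) \<le> K * nrm u"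
  obtains u where "u \<in> X" "\<And>w. w \<in> X \<Longrightarrow> f w = ip w u"
proof -
  define J where "J v = (nrm v)\<^sup>2 - 2 * Re (f v)" for v
  have Jlb: "- K\<^sup>2 \<le> J v" if "v \<in> X" for v
  proof -
    have "Re (f v) \<le> K * nrm v" using bd[OF that] complex_Re_le_cmod order_trans by blast
    then show ?thesis using zero_le_power2[of "nrm v - K"] by (simp add: J_def power2_diff mult.commute)
  qed
  define m where "m = Inf (J ` X)"
  have bb: "bdd_below (J ` X)" using Jlb by (auto intro!: bdd_belowI)
  have mle: "m \<le> J v" if "v \<in> X" for v
    unfolding m_def using bb that by (intro cInf_lower) auto
  have "\<exists>v\<in>X. J v < m + 1 / Suc n" for n :: nat
  proof -
    have "Inf (J ` X) < m + 1 / Suc n" by (simp add: m_def)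
    then show ?thesis using cInf_lessD[of "J ` X"] subspace_0[OF sub] by blast
  qed
  then obtain v where v: "\<And>n. v n \<in> X" "\<And>n. J (v n) < m + 1 / Suc n" by metis
  \<comment> \<open>Midpoint convexity of \<open>J\<close> with the exact defect; two
    near-minimisers must be close, since their midpoint cannot fall below \<open>m\<close>.\<close>
  have half: "J ((1/2) *C (x + y)) = (J x + J y) / 2 - (nrm (x - y))\<^sup>2 / 4" if "x \<in> X" "y \<in> X" for x y
  proof -
    have "(nrm ((1/2) *C (x + y)))\<^sup>2 = (nrm (x + y))\<^sup>2 / 4"
      using that by (simp only: nrm_scale cl) (simp add: power_divide)
    moreover have "Re (f ((1/2) *C (x + y))) = (Re (f x) + Re (f y)) / 2"
      using that by (simp add: add sc)
    moreover have "(nrm (x + y))\<^sup>2 + (nrm (x - y))\<^sup>2 = 2 * (nrm x)\<^sup>2 + 2 * (nrm y)\<^sup>2"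
      using that cl by (simp add: nrm_sq herm_quad_add[OF sub ip] herm_quad_diff[OF sub ip])
    ultimately show ?thesis unfolding J_def by argo
  qed
  have dist: "(nrm (v i - v j))\<^sup>2 \<le> 2 * (1 / Suc i) + 2 * (1 / Suc j)" for i j
  proof -
    have "m \<le> J ((1/2) *C (v i + v j))" using mle v cl by blast
    then show ?thesis using half[OF v(1) v(1), of i j] v(2)[of i] v(2)[of j] by argo
  qed
  have cauchy: "\<exists>M. \<forall>i\<ge>M. \<forall>j\<ge>M. nrm (v i - v j) < e" if e: "e > 0" for e
  proof -
    obtain M where M: "4 / Suc M < e\<^sup>2"
      using reals_Archimedean[of "e\<^sup>2 / 4"] e by (auto simp: field_simps)
    have "nrm (v i - v j) < e" if "i \<ge> M" "j \<ge> M" for i j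
    proof (rule power2_less_imp_less)
      have "1 / real (Suc i) \<le> 1 / Suc M" "1 / real (Suc j) \<le> 1 / Suc M"
        using that by (auto intro!: divide_left_mono)
      then show "(nrm (v i - v j))\<^sup>2 < e\<^sup>2" using dist[of i j] M by argo
    qed (use e in simp)
    then show ?thesis by blast
  qed
  obtain l where l: "l \<in> X" "(\<lambda>n. nrm (v n - l)) \<longlonglongrightarrow> 0"
    using complete[OF v(1) cauchy] by blast
  have flim: "(\<lambda>n. f (v n)) \<longlonglongrightarrow> f l"
  proof -
    have fd: "f (v n) - f l = f (v n - l)" for n
      using add[of "v n - l" l] v l cl by simp
    have "(\<lambda>n. f (v n) - f l) \<longlonglongrightarrow> 0"
    proof (rule Lim_null_comparison)
      show "\<forall>\<^sub>F n in sequentially. norm (f (v n) - f l) \<le> K * nrm (v n - l)"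
        using bd v l cl by (intro always_eventually allI) (simp add: fd)
      show "(\<lambda>n. K * nrm (v n - l)) \<longlonglongrightarrow> 0" using tendsto_mult_left[OF l(2)] by simp
    qed
    then show ?thesis by (simp add: LIM_zero_iff)
  qed
  have "(\<lambda>n. J (v n)) \<longlonglongrightarrow> J l"
    unfolding J_def by (intro tendsto_intros tendsto_nrm v l flim)
  moreover have "(\<lambda>n. m + 1 / Suc n) \<longlonglongrightarrow> m + 0"
    by (intro tendsto_intros lim_const_over_n[THEN LIMSEQ_Suc])
  ultimately have "J l \<le> m + 0"
    by (rule LIMSEQ_le) (use v(2) in \<open>blast intro: less_imp_le\<close>)
  then have Jl: "J l \<le> m" by simp
  have re: "Re (ip l w) = Re (f w)" if w: "w \<in> X" for w
  proof -
    define d where "d = Re (ip l w) - Re (f w)"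
    \<comment> \<open>Minimality along the real line through \<open>l\<close> in direction
      \<open>w\<close>: a nonnegative quadratic without constant term has vanishing linear
      coefficient.\<close>
    have q: "0 \<le> 2 * s * d + s\<^sup>2 * (nrm w)\<^sup>2" for s :: real
    proof -
      have sw: "of_real s *C w \<in> X" using w cl by blast
      have "J l \<le> J (l + of_real s *C w)" using Jl mle l sw cl by (meson order_trans)
      also have "\<dots> = (nrm l)\<^sup>2 + 2 * Re (ip l (of_real s *C w)) + (nrm (of_real s *C w))\<^sup>2
          - 2 * Re (f l + f (of_real s *C w))"
        using herm_quad_add[OF sub ip l(1) sw] l sw cl add by (simp add: J_def nrm_sq)
      also have "\<dots> = J l + (2 * s * d + s\<^sup>2 * (nrm w)\<^sup>2)"
        using w l sc nrm_scale[OF w]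
        by (simp add: J_def ip_simps d_def algebra_simps power_mult_distrib)
      finally show ?thesis by simp
    qed
    have "d = 0"
    proof (rule ccontr)
      assume "d \<noteq> 0"
      \<comment> \<open>The added 1 keeps \<open>s = - d / N\<close> meaningful for
        \<open>w = 0\<close>.\<close>
      define N where "N = (nrm w)\<^sup>2 + 1"
      have N: "N > 0" by (simp add: N_def add_nonneg_pos)
      have "0 \<le> 2 * (- d / N) * d + (- d / N)\<^sup>2 * (nrm w)\<^sup>2" by (rule q)
      also have "\<dots> \<le> 2 * (- d / N) * d + (- d / N)\<^sup>2 * N"
        by (intro add_left_mono mult_left_mono) (auto simp: N_def)
      also have "\<dots> = - (d\<^sup>2 / N)" using N by (simp add: field_simps power2_eq_square)
      also have "\<dots> < 0" using N \<open>d \<noteq> 0\<close> by simp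
      finally show False by simp
    qed
    then show ?thesis by (simp add: d_def)
  qed
  have "f w = ip w l" if w: "w \<in> X" for w
  proof -
    have 1: "Re (ip w l) = Re (f w)" using re[OF w] ip_cnj[OF l(1) w] by simp
    \<comment> \<open>Real parts are known for every argument; inserting \<open>\<i> *C w\<close>
      turns that into the imaginary part.\<close>
    have iw: "\<i> *C w \<in> X" using w cl by blast
    have "Re (ip (\<i> *C w) l) = Re (f (\<i> *C w))"
      using re[OF iw] ip_cnj[OF l(1) iw] by simp
    then have "Im (ip w l) = Im (f w)" using w l by (simp add: ip_simps sc)
    with 1 show ?thesis by (simp add: complex_eq_iff)
  qed
  with l show ?thesis using that by blast
qed

section \<open>Bounded forms and the self-adjoint operators representing them\<close>

definition bform :: "('v \<Rightarrow> 'v \<Rightarrow> complex) \<Rightarrow> real \<Rightarrow> bool" where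
  "bform b K \<longleftrightarrow> herm_on X b \<and> 0 \<le> K \<and> (\<forall>u\<in>X. \<forall>v\<in>X. cmod (b u v) \<le> K * nrm u * nrm v)"

text \<open>The self-adjoint operator A with \<open><Av,w> = b v w\<close>. Being a choice, it has
  this property only for forms satisfying \<open>bform\<close>.\<close>

definition rep :: "('v \<Rightarrow> 'v \<Rightarrow> complex) \<Rightarrow> 'v \<Rightarrow> 'v" where
  "rep b v = (SOME u. u \<in> X \<and> (\<forall>w\<in>X. b v w = ip u w))"

text \<open>Phrased as unique solvability of a form equation so that
  \<open>bij_form (shift b s)\<close> is literally the negation of membership of \<open>s\<close> in
  \<open>rep_spec\<close>.\<close>

definition bij_form :: "('v \<Rightarrow> 'v \<Rightarrow> complex) \<Rightarrow> bool" where
  "bij_form b \<longleftrightarrow> (\<forall>U\<in>X. \<exists>!V. V \<in> X \<and> (\<forall>W\<in>X. b V W = ip U W))"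

definition shift :: "('v \<Rightarrow> 'v \<Rightarrow> complex) \<Rightarrow> real \<Rightarrow> 'v \<Rightarrow> 'v \<Rightarrow> complex" where
  "shift b s = (\<lambda>v w. b v w - complex_of_real s * ip v w)"

lemma shift_shift: "shift (shift b s) t = shift b (s + t)"
  by (simp add: shift_def fun_eq_iff algebra_simps)

lemma shift_0 [simp]: "shift b 0 = b"
  by (simp add: shift_def)

lemma bform_herm: "bform b K \<Longrightarrow> herm_on X b"
  and bform_bound: "bform b K \<Longrightarrow> u \<in> X \<Longrightarrow> v \<in> X \<Longrightarrow> cmod (b u v) \<le> K * nrm u * nrm v"
  and bform_nonneg: "bform b K \<Longrightarrow> 0 \<le> K"
  by (auto simp: bform_def)

lemma bform_shift:
  assumes "bform b K" shows "bform (shift b s) (K + \<bar>s\<bar>)"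
  unfolding bform_def
proof (intro conjI ballI)
  show "herm_on X (shift b s)"
    unfolding shift_def using herm_on_shift[OF bform_herm[OF assms] ip] .
  show "0 \<le> K + \<bar>s\<bar>" using bform_nonneg[OF assms] by simp
  fix u v assume uv: "u \<in> X" "v \<in> X"
  have "cmod (shift b s u v) \<le> cmod (b u v) + \<bar>s\<bar> * cmod (ip u v)"
    unfolding shift_def by (metis norm_mult norm_of_real norm_triangle_ineq4)
  also have "\<dots> \<le> K * nrm u * nrm v + \<bar>s\<bar> * (nrm u * nrm v)"
    by (intro add_mono mult_left_mono CS bform_bound[OF assms] uv) simp
  finally show "cmod (shift b s u v) \<le> (K + \<bar>s\<bar>) * nrm u * nrm v" by (simp add: algebra_simps)
qed

context
  fixes b K
  assumes bf: "bform b K"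
begin

lemmas b_simps = herm_add_left[OF sub bform_herm[OF bf]] herm_add_right[OF sub bform_herm[OF bf]]
  herm_diff_left[OF sub bform_herm[OF bf]] herm_diff_right[OF sub bform_herm[OF bf]]
  herm_scale_left[OF sub bform_herm[OF bf]] herm_scale_right[OF sub bform_herm[OF bf]]
  herm_zero_left[OF sub bform_herm[OF bf]] herm_zero_right[OF sub bform_herm[OF bf]]
lemmas b_cnj = herm_cnj[OF sub bform_herm[OF bf]]

lemma rep_ex: "v \<in> X \<Longrightarrow> \<exists>u. u \<in> X \<and> (\<forall>w\<in>X. b v w = ip u w)"
proof -
  assume v: "v \<in> X"
  obtain u where u: "u \<in> X" "\<And>w. w \<in> X \<Longrightarrow> b w v = ip w u"
  proof (rule riesz[of "\<lambda>w. b w v" "K * nrm v"])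
    fix w assume "w \<in> X"
    then show "cmod (b w v) \<le> K * nrm v * nrm w"
      using bform_bound[OF bf _ v, of w] by (simp add: ac_simps)
  qed (use v in \<open>auto simp: b_simps\<close>)
  then have "b v w = ip u w" if "w \<in> X" for w
    using b_cnj[OF that v] ip_cnj[OF that u(1)] that by simp
  with u show ?thesis by blast
qed

lemma rep_in [simp]: "v \<in> X \<Longrightarrow> rep b v \<in> X"
  and rep_ip: "v \<in> X \<Longrightarrow> w \<in> X \<Longrightarrow> ip (rep b v) w = b v w"
  using someI_ex[OF rep_ex, of v] by (auto simp: rep_def)

lemma rep_ip_right: "v \<in> X \<Longrightarrow> w \<in> X \<Longrightarrow> ip w (rep b v) = b w v"
  using rep_ip[of v w] ip_cnj[of "rep b v" w] b_cnj[of v w] by simp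

lemma rep_sym: "v \<in> X \<Longrightarrow> w \<in> X \<Longrightarrow> ip (rep b v) w = ip v (rep b w)"
  by (simp add: rep_ip rep_ip_right)

lemma rep_eqI:
  assumes "v \<in> X" "u \<in> X" "\<And>w. w \<in> X \<Longrightarrow> ip u w = b v w" shows "rep b v = u"
proof -
  have "ip (rep b v - u) w = 0" if "w \<in> X" for w
    using assms that by (simp add: ip_simps rep_ip)
  then have "rep b v - u = 0" using assms by (intro ip_zero_imp) auto
  then show ?thesis by simp
qed

lemma rep_add: "u \<in> X \<Longrightarrow> v \<in> X \<Longrightarrow> rep b (u + v) = rep b u + rep b v"
  by (rule rep_eqI) (auto simp: ip_simps rep_ip b_simps)

lemma rep_diff: "u \<in> X \<Longrightarrow> v \<in> X \<Longrightarrow> rep b (u - v) = rep b u - rep b v"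
  by (rule rep_eqI) (auto simp: ip_simps rep_ip b_simps)

lemma rep_scale: "u \<in> X \<Longrightarrow> rep b (c *C u) = c *C rep b u"
  by (rule rep_eqI) (auto simp: ip_simps rep_ip b_simps)

lemma rep_shift: "u \<in> X \<Longrightarrow> rep (shift b s) u = rep b u - of_real s *C u"
proof -
  assume u: "u \<in> X"
  have "ip (rep (shift b s) u - (rep b u - of_real s *C u)) w = 0" if w: "w \<in> X" for w
  proof -
    have r: "rep (shift b s) u \<in> X \<and> (\<forall>w\<in>X. shift b s u w = ip (rep (shift b s) u) w)"
      unfolding rep_def
    proof (rule someI)
      show "rep b u - of_real s *C u \<in> X \<and> (\<forall>w\<in>X. shift b s u w = ip (rep b u - of_real s *C u) w)"
        using u by (auto simp: ip_simps rep_ip shift_def)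
    qed
    then show ?thesis using u w by (simp add: ip_simps rep_ip) (metis rep_ip shift_def)
  qed
  moreover have "rep (shift b s) u \<in> X"
    unfolding rep_def
  proof (rule someI2)
    show "rep b u - of_real s *C u \<in> X \<and> (\<forall>w\<in>X. shift b s u w = ip (rep b u - of_real s *C u) w)"
      using u by (auto simp: ip_simps rep_ip shift_def)
  qed simp
  ultimately have "rep (shift b s) u - (rep b u - of_real s *C u) = 0"
    using u by (intro ip_zero_imp) auto
  then show ?thesis by simp
qed

lemma nrm_rep_le: "v \<in> X \<Longrightarrow> nrm (rep b v) \<le> K * nrm v"
proof (cases "rep b v = 0")
  case False
  assume v: "v \<in> X"
  have "(nrm (rep b v))\<^sup>2 \<le> K * nrm v * nrm (rep b v)"
    using bform_bound[OF bf v rep_in[OF v]] rep_ip[OF v rep_in[OF v]] ip_self[OF rep_in[OF v]]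
    by (metis abs_of_nonneg norm_of_real zero_le_power2)
  then show ?thesis using nrm_pos[OF rep_in[OF v] False] by (simp add: power2_eq_square)
qed (simp add: bform_nonneg[OF bf])

text \<open>The lower bound makes \<open><Av,Aw>\<close> a second complete inner product on the same
  space. Riesz for it yields \<open>v\<close> with \<open><Aw, u - Av> = 0\<close> for all
  \<open>w\<close>; by symmetry \<open>A (u - Av) = 0\<close>, and the lower bound gives
  \<open>u = Av\<close>. No orthogonal complement of the range is needed.\<close>

lemma bounded_below_imp_bij:
  assumes d: "0 < d" and bb: "\<And>v. v \<in> X \<Longrightarrow> d * nrm v \<le> nrm (rep b v)"
  shows "bij_form b"
proof -
  have n2: "sqrt (Re (ip (rep b v) (rep b v))) = nrm (rep b v)" for v by (simp add: nrm_def)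
  interpret h2: hspace scale X "\<lambda>v w. ip (rep b v) (rep b w)"
  proof
    show "subspace X" by (rule sub)
    show "herm_on X (\<lambda>v w. ip (rep b v) (rep b w))"
      unfolding herm_on_def
      by (intro conjI ballI allI) (simp_all add: rep_add rep_scale ip_simps ip_cnj[symmetric])
    show "0 < Re (ip (rep b v) (rep b v))" if "v \<in> X" "v \<noteq> 0" for v
    proof (rule ip_pos)
      show "rep b v \<noteq> 0" using bb[OF that(1)] d nrm_pos[OF that] by (auto simp: mult_le_0_iff)
    qed (use that in simp)
    fix f :: "nat \<Rightarrow> 'v" assume f: "\<And>n. f n \<in> X"
      and c: "\<forall>e>0. \<exists>M. \<forall>m\<ge>M. \<forall>n\<ge>M. sqrt (Re (ip (rep b (f m - f n)) (rep b (f m - f n)))) < e"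
    have "\<exists>M. \<forall>m\<ge>M. \<forall>n\<ge>M. nrm (f m - f n) < e" if "e > 0" for e
    proof -
      obtain M where M: "\<And>m n. m \<ge> M \<Longrightarrow> n \<ge> M \<Longrightarrow> nrm (rep b (f m - f n)) < d * e"
        using c[rule_format, of "d * e"] d \<open>e > 0\<close> unfolding n2 by auto
      have "nrm (f m - f n) < e" if "m \<ge> M" "n \<ge> M" for m n
      proof -
        have "d * nrm (f m - f n) < d * e" using bb[of "f m - f n"] M[OF that] f by fastforce
        then show ?thesis using d by simp
      qed
      then show ?thesis by blast
    qed
    from complete[OF f this] obtain l where l: "l \<in> X" "(\<lambda>n. nrm (f n - l)) \<longlonglongrightarrow> 0" by blast
    have "(\<lambda>n. nrm (rep b (f n - l))) \<longlonglongrightarrow> 0"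
    proof (rule Lim_null_comparison)
      show "\<forall>\<^sub>F n in sequentially. norm (nrm (rep b (f n - l))) \<le> K * nrm (f n - l)"
        using f l nrm_rep_le by (intro always_eventually) auto
      show "(\<lambda>n. K * nrm (f n - l)) \<longlonglongrightarrow> 0" using tendsto_mult_left[OF l(2)] by simp
    qed
    then show "\<exists>l\<in>X. (\<lambda>n. sqrt (Re (ip (rep b (f n - l)) (rep b (f n - l))))) \<longlonglongrightarrow> 0"
      unfolding n2 using l by blast
  qed
  have h2n: "h2.nrm v = nrm (rep b v)" for v unfolding h2.nrm_def n2 ..
  show ?thesis unfolding bij_form_def
  proof
    fix u assume u: "u \<in> X"
    obtain v where v: "v \<in> X" "\<And>w. w \<in> X \<Longrightarrow> ip (rep b w) u = ip (rep b w) (rep b v)"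
    proof (rule h2.riesz[of "\<lambda>w. ip (rep b w) u" "nrm u"])
      fix w assume "w \<in> X"
      then show "cmod (ip (rep b w) u) \<le> nrm u * h2.nrm w"
        using CS[of "rep b w" u] u by (simp add: h2n mult.commute)
    qed (use u in \<open>auto simp: rep_add rep_scale ip_simps\<close>)
    have "rep b (u - rep b v) = 0"
    proof (rule ip_zero_imp)
      fix w assume w: "w \<in> X"
      have "ip (rep b w) (u - rep b v) = 0" using v u w by (simp add: ip_simps)
      then show "ip (rep b (u - rep b v)) w = 0"
        using rep_sym[of w "u - rep b v"] ip_cnj[of w "rep b (u - rep b v)"] u v w by simp
    qed (use u v in simp)
    then have "nrm (u - rep b v) \<le> 0" using bb[of "u - rep b v"] u v d by (simp add: mult_le_0_iff)
    then have eq: "u = rep b v" using nrm_pos[of "u - rep b v"] u v by force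
    show "\<exists>!V. V \<in> X \<and> (\<forall>W\<in>X. b V W = ip u W)"
    proof (rule ex1I[of _ v])
      show "v \<in> X \<and> (\<forall>W\<in>X. b v W = ip u W)" using v eq rep_ip by simp
      fix v' assume v': "v' \<in> X \<and> (\<forall>W\<in>X. b v' W = ip u W)"
      then have "rep b v' = u" using u by (intro rep_eqI) auto
      then have "rep b (v' - v) = 0" using eq v v' by (simp add: rep_diff)
      then have "nrm (v' - v) \<le> 0" using bb[of "v' - v"] v v' d by (simp add: mult_le_0_iff)
      then show "v' = v" using nrm_pos[of "v' - v"] v v' by force
    qed
  qed
qed

text \<open>A gliding hump argument in place of the open mapping theorem. If A shrinks unit vectors
  \<open>v n\<close> below 4^-n, a series of terms of size 3^-n along the \<open>v n\<close>
  converges to some \<open>l\<close> with \<open>|<l, v n>|\<close> at least 3^-n / 2. Writing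
  \<open>l = A y\<close> gives \<open>|<l, v n>| = |<y, A (v n)>|\<close>, at most
  \<open>|y|\<close> 4^-n, which fails for large \<open>n\<close>.\<close>

lemma bij_imp_bounded_below:
  assumes bij: "bij_form b"
  obtains d where "0 < d" "\<And>v. v \<in> X \<Longrightarrow> d * nrm v \<le> nrm (rep b v)"
proof (rule ccontr)
  assume "\<not> thesis"
  then have no: "\<exists>v\<in>X. nrm (rep b v) < d * nrm v" if "d > 0" for d
    using that \<open>\<And>d. \<lbrakk>0 < d; \<And>v. v \<in> X \<Longrightarrow> d * nrm v \<le> nrm (rep b v)\<rbrakk> \<Longrightarrow> thesis\<close> by force
  have "\<exists>v\<in>X. nrm v = 1 \<and> nrm (rep b v) < (1/4)^n" for n :: nat
  proof -
    obtain v where v: "v \<in> X" "nrm (rep b v) < (1/4)^n * nrm v" using no[of "(1/4)^n"] by auto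
    have nv: "nrm v > 0"
    proof (rule ccontr)
      assume "\<not> nrm v > 0"
      then have "nrm v = 0" using nrm_nonneg[OF v(1)] by linarith
      then show False using v nrm_nonneg[OF rep_in[OF v(1)]] by simp
    qed
    define u where "u = of_real (1 / nrm v) *C v"
    have cu: "cmod (of_real (1 / nrm v)) = 1 / nrm v" using nv by (simp only: norm_of_real) simp
    have "u \<in> X" "nrm u = 1" unfolding u_def using v nv by (simp_all only: nrm_scale cu cl) simp
    moreover have "nrm (rep b u) = nrm (rep b v) / nrm v"
      unfolding u_def using v nv by (simp only: rep_scale nrm_scale cu cl rep_in) simp
    then have "nrm (rep b u) < (1/4)^n" using v nv by (simp add: divide_less_eq)
    ultimately show ?thesis by blast
  qed
  then obtain v where v: "\<And>n. v n \<in> X" "\<And>n. nrm (v n) = 1" "\<And>n. nrm (rep b (v n)) < (1/4)^n"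
    by metis
  define t :: "nat \<Rightarrow> complex" where "t n = of_real ((1/3)^n)" for n
  \<comment> \<open>The sign of each term is chosen so that the partial sum keeps a large component
    along \<open>v n\<close>: the two candidate components differ by \<open>2 * t n\<close>, so one
    of them has modulus at least 3^-n.\<close>
  define x where "x = rec_nat 0 (\<lambda>n y. if (1/3)^n \<le> cmod (ip (y + t n *C v n) (v n))
      then y + t n *C v n else y - t n *C v n)"
  have x0: "x 0 = 0" and xS: "x (Suc n) = (if (1/3)^n \<le> cmod (ip (x n + t n *C v n) (v n))
      then x n + t n *C v n else x n - t n *C v n)" for n by (simp_all add: x_def)
  have xX [simp]: "x n \<in> X" for n by (induction n) (auto simp: x0 xS v)
  have ct: "cmod (t n) = (1/3)^n" for n by (simp add: t_def norm_power)
  have xl: "(1/3)^n \<le> cmod (ip (x (Suc n)) (v n))" for n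
  proof (cases "(1/3)^n \<le> cmod (ip (x n + t n *C v n) (v n))")
    case False
    have iv: "ip (v n) (v n) = 1" using ip_self[OF v(1)] v(2) by simp
    have "2 * t n = ip (x n + t n *C v n) (v n) - ip (x n - t n *C v n) (v n)"
      using v by (simp add: ip_simps iv)
    then have "2 * (1/3)^n \<le> cmod (ip (x n + t n *C v n) (v n)) + cmod (ip (x n - t n *C v n) (v n))"
      using ct[of n] by (metis norm_mult norm_numeral norm_triangle_ineq4)
    then show ?thesis using False by (simp add: xS)
  qed (simp add: xS)
  have step: "nrm (x (Suc n) - x n) = (1/3)^n" for n
    using v ct[of n] nrm_minus[of "t n *C v n"] by (auto simp: xS nrm_scale)
  have far: "nrm (x (n + k) - x n) \<le> 3/2 * ((1/3)^n - (1/3)^(n + k))" for n k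
  proof (induction k)
    case (Suc k)
    have "nrm (x (n + Suc k) - x n) \<le> nrm (x (Suc (n + k)) - x (n + k)) + nrm (x (n + k) - x n)"
      using nrm_triangle[of "x (Suc (n + k)) - x (n + k)" "x (n + k) - x n"] by simp
    also have "\<dots> \<le> (1/3)^(n + k) + 3/2 * ((1/3)^n - (1/3)^(n + k))" using Suc step by simp
    also have "\<dots> = 3/2 * ((1/3)^n - (1/3)^(n + Suc k))" by (simp add: algebra_simps)
    finally show ?case .
  qed simp
  have far': "nrm (x m - x n) \<le> 3/2 * (1/3)^n" if "m \<ge> n" for m n
  proof -
    have "nrm (x m - x n) \<le> 3/2 * ((1/3)^n - (1/3)^m)" using far[of n "m - n"] that by simp
    also have "\<dots> \<le> 3/2 * (1/3)^n" by simp
    finally show ?thesis .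
  qed
  have "\<exists>M. \<forall>m\<ge>M. \<forall>n\<ge>M. nrm (x m - x n) < e" if e: "e > 0" for e
  proof -
    obtain M where M: "(1/3::real)^M < e/3" using real_arch_pow_inv[of "e/3" "1/3"] e by auto
    have "nrm (x m - x n) < e" if "m \<ge> M" "n \<ge> M" for m n
    proof -
      have "nrm (x m - x n) \<le> nrm (x m - x M) + nrm (x n - x M)"
        using nrm_triangle_diff[of "x m - x M" "x n - x M"] by simp
      also have "\<dots> \<le> 3/2 * (1/3)^M + 3/2 * (1/3)^M" by (intro add_mono far' that)
      finally show ?thesis using M by simp
    qed
    then show ?thesis by blast
  qed
  from complete[OF xX this] obtain l where l: "l \<in> X" "(\<lambda>n. nrm (x n - l)) \<longlonglongrightarrow> 0" by blast
  \<comment> \<open>The constant 3/2 sums the geometric series. After step \<open>n\<close> the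
    remaining terms total at most half of 3^-n, so they cannot destroy the component secured by
    \<open>xl\<close>.\<close>
  have tail: "nrm (l - x n) \<le> 3/2 * (1/3)^n" for n
  proof (rule field_le_epsilon)
    fix e :: real assume "e > 0"
    then have "eventually (\<lambda>m. nrm (x m - l) < e) sequentially"
      using order_tendstoD(2)[OF l(2)] by blast
    then obtain M where M: "\<And>m. m \<ge> M \<Longrightarrow> nrm (x m - l) < e" by (auto simp: eventually_sequentially)
    define m where "m = max M n"
    have "nrm (l - x n) \<le> nrm (l - x m) + nrm (x m - x n)"
      using nrm_triangle[of "l - x m" "x m - x n"] l by simp
    then show "nrm (l - x n) \<le> 3/2 * (1/3)^n + e"
      using M[of m] far'[of n m] nrm_minus_commute[of l "x m"] l by (simp add: m_def)
  qed
  have low: "1/2 * (1/3)^n \<le> cmod (ip l (v n))" for n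
  proof -
    have "cmod (ip (x (Suc n)) (v n)) - cmod (ip (l - x (Suc n)) (v n)) \<le> cmod (ip l (v n))"
      using norm_triangle_ineq4[of "ip l (v n)" "ip (l - x (Suc n)) (v n)"] l v by (simp add: ip_simps)
    moreover have "cmod (ip (l - x (Suc n)) (v n)) \<le> 1/2 * (1/3)^n"
      using CS[of "l - x (Suc n)" "v n"] l v tail[of "Suc n"] by simp
    ultimately show ?thesis using xl[of n] by simp
  qed
  obtain y where y: "y \<in> X" "\<And>w. w \<in> X \<Longrightarrow> b y w = ip l w"
    using ex1_implies_ex[OF bij[unfolded bij_form_def, rule_format, OF l(1)]] by blast
  have "(4/3)^n \<le> 2 * nrm y" for n
  proof -
    have "ip l (v n) = ip y (rep b (v n))" using y v by (simp add: rep_ip_right)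
    then have "1/2 * (1/3)^n \<le> nrm y * nrm (rep b (v n))"
      using low[of n] CS[of y "rep b (v n)"] y v by simp
    also have "\<dots> \<le> nrm y * (1/4)^n" using v y by (intro mult_left_mono) (auto intro: less_imp_le)
    finally show ?thesis by (simp add: power_divide field_simps)
  qed
  moreover obtain n where "2 * nrm y < (4/3::real)^n" using real_arch_pow[of "4/3"] by auto
  ultimately show False using not_le by blast
qed

end

section \<open>Lower bounds for operators from gaps in their spectra\<close>

text \<open>Let \<open>q\<close> be the infimum of \<open>|Av|\<close> over unit vectors and suppose
  \<open>q < r\<close>. Then \<open>A - q\<close> and \<open>A + q\<close> are bounded below, hence
  so is \<open>A^2 - q^2\<close>. But the form of \<open>A^2 - q^2\<close> is semidefinite, and a
  semidefinite bounded form whose operator is bounded below is strictly positive. That pushes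
  \<open>|Av|\<close> uniformly above \<open>q\<close>. The argument replaces the functional
  calculus.\<close>

lemma spectral_gap:
  assumes bf: "bform b K" and r: "0 < r"
    and bij: "\<And>s. \<bar>s\<bar> < r \<Longrightarrow> bij_form (shift b s)" and v0: "v0 \<in> X"
  shows "r * nrm v0 \<le> nrm (rep b v0)"
proof (rule ccontr)
  assume neg: "\<not> r * nrm v0 \<le> nrm (rep b v0)"
  note rs [simp] = rep_in[OF bf]
  have nv0: "nrm v0 > 0"
    using neg nrm_nonneg[OF rs[OF v0]] nrm_nonneg[OF v0] by (cases "nrm v0 = 0") auto
  have unit: "\<exists>u\<in>X. nrm u = 1 \<and> nrm (rep b u) = nrm (rep b v) / nrm v" if "v \<in> X" "nrm v > 0" for v
  proof (intro bexI conjI)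
    have cu: "cmod (of_real (1 / nrm v)) = 1 / nrm v" using that by (simp only: norm_of_real) simp
    show "of_real (1 / nrm v) *C v \<in> X" using that by blast
    show "nrm (of_real (1 / nrm v) *C v) = 1" using that by (simp only: nrm_scale cu) simp
    show "nrm (rep b (of_real (1 / nrm v) *C v)) = nrm (rep b v) / nrm v"
      using that by (simp only: rep_scale[OF bf] nrm_scale cu rs) simp
  qed
  define q where "q = Inf {nrm (rep b v) |v. v \<in> X \<and> nrm v = 1}"
  have bdd: "bdd_below {nrm (rep b v) |v. v \<in> X \<and> nrm v = 1}"
    by (rule bdd_belowI[of _ 0]) auto
  have ne: "{nrm (rep b v) |v. v \<in> X \<and> nrm v = 1} \<noteq> {}" using unit[OF v0 nv0] by blast
  have qle: "q \<le> nrm (rep b v)" if "v \<in> X" "nrm v = 1" for v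
    unfolding q_def by (rule cInf_lower[OF _ bdd]) (use that in blast)
  have q0: "0 \<le> q" unfolding q_def by (rule cInf_greatest[OF ne]) auto
  have qr: "q < r"
  proof -
    obtain u where u: "u \<in> X" "nrm u = 1" "nrm (rep b u) = nrm (rep b v0) / nrm v0"
      using unit[OF v0 nv0] by blast
    have "nrm (rep b u) < r" unfolding u(3) using neg nv0 by (simp add: divide_less_eq)
    then show ?thesis using qle[OF u(1,2)] by simp
  qed
  have qn: "q * nrm v \<le> nrm (rep b v)" if v: "v \<in> X" for v
  proof (cases "nrm v = 0")
    case False
    then have "nrm v > 0" using nrm_nonneg[OF v] by linarith
    with unit[OF v this] qle have "q \<le> nrm (rep b v) / nrm v" by force
    with \<open>nrm v > 0\<close> show ?thesis by (simp add: pos_le_divide_eq)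
  qed (use v in simp)
  obtain d1 where d1: "0 < d1" "\<And>v. v \<in> X \<Longrightarrow> d1 * nrm v \<le> nrm (rep (shift b q) v)"
    using bij_imp_bounded_below[OF bform_shift[OF bf] bij, of q] q0 qr by auto
  obtain d2 where d2: "0 < d2" "\<And>v. v \<in> X \<Longrightarrow> d2 * nrm v \<le> nrm (rep (shift b (- q)) v)"
    using bij_imp_bounded_below[OF bform_shift[OF bf] bij, of "- q"] q0 qr by auto
  define h where "h v w = ip (rep b v) (rep b w) - of_real (q\<^sup>2) * ip v w" for v w
  have "herm_on X (\<lambda>v w. ip (rep b v) (rep b w))"
    unfolding herm_on_def
    by (intro conjI ballI allI)
       (simp_all add: rep_add[OF bf] rep_scale[OF bf] ip_simps ip_cnj[symmetric])
  then have hh: "herm_on X h" unfolding h_def using herm_on_shift[OF _ ip] by blast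
  have hq: "Re (h v v) = (nrm (rep b v))\<^sup>2 - q\<^sup>2 * (nrm v)\<^sup>2" if "v \<in> X" for v
    using that by (simp add: h_def ip_self power2_eq_square)
  have hn: "0 \<le> Re (h v v)" if "v \<in> X" for v
    using power_mono[OF qn[OF that], of 2] q0 that by (simp add: hq power_mult_distrib)
  define S where "S v = rep b (rep b v) - of_real (q\<^sup>2) *C v" for v
  have SX [simp]: "S v \<in> X" if "v \<in> X" for v using that by (simp add: S_def)
  have hS: "h v w = ip (S v) w" if "v \<in> X" "w \<in> X" for v w
    using that rep_sym[OF bf, of "rep b v" w] by (simp add: h_def S_def ip_simps)
  have Sl: "d1 * d2 * nrm v \<le> nrm (S v)" if v: "v \<in> X" for v
  proof -
    define w where "w = rep (shift b (- q)) v"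
    have w: "w = rep b v + of_real q *C v" using rep_shift[OF bf v, of "- q"] by (simp add: w_def)
    then have wX: "w \<in> X" using v by simp
    have "rep (shift b q) w = S v"
      using v wX by (simp add: rep_shift[OF bf] S_def) (simp add: w rep_add[OF bf] rep_scale[OF bf] scale_right_distrib power2_eq_square)
    then have "d1 * nrm w \<le> nrm (S v)" using d1(2)[OF wX] by simp
    moreover have "d1 * (d2 * nrm v) \<le> d1 * nrm w" using d2(2)[OF v] d1 by (simp add: w_def)
    ultimately show ?thesis by simp
  qed
  \<comment> \<open>Cauchy-Schwarz for \<open>h\<close> at the pair \<open>v\<close>,
    \<open>S v\<close>: the left side is \<open>|Sv|^4\<close>, while \<open>h (S v) (S v)\<close>
    is at most \<open>K^2 |Sv|^2\<close>. Cancelling \<open>|Sv|^2\<close> bounds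
    \<open>h v v\<close> from below.\<close>
  have key: "(d1 * d2)\<^sup>2 \<le> K\<^sup>2 * ((nrm (rep b v))\<^sup>2 - q\<^sup>2)" if v: "v \<in> X" "nrm v = 1" for v
  proof -
    define y where "y = nrm (S v)"
    have y: "d1 * d2 \<le> y" using Sl[OF v(1)] v by (simp add: y_def)
    then have y0: "0 < y" using d1 d2 by (meson less_le_trans mult_pos_pos)
    have "(cmod (h v (S v)))\<^sup>2 \<le> Re (h v v) * Re (h (S v) (S v))"
      by (rule herm_cauchy_schwarz[OF sub hh hn]) (use v in auto)
    moreover have "cmod (h v (S v)) = y\<^sup>2"
      using v by (simp add: hS ip_self y_def norm_power)
    moreover have "Re (h (S v) (S v)) \<le> K\<^sup>2 * y\<^sup>2"
    proof -
      have "(nrm (rep b (S v)))\<^sup>2 \<le> (K * y)\<^sup>2"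
        unfolding y_def using v by (intro power_mono nrm_rep_le[OF bf]) auto
      then show ?thesis using v by (simp add: hq power_mult_distrib)
          (smt (verit) mult_nonneg_nonneg zero_le_power2)
    qed
    ultimately have "(y\<^sup>2)\<^sup>2 \<le> Re (h v v) * (K\<^sup>2 * y\<^sup>2)"
      using hn[OF v(1)] by (smt (verit) mult_left_mono)
    then have "y\<^sup>2 \<le> K\<^sup>2 * Re (h v v)" using y0 by (simp add: power2_eq_square ac_simps)
    moreover have "(d1 * d2)\<^sup>2 \<le> y\<^sup>2" using y d1 d2 by (intro power_mono) auto
    ultimately show ?thesis using v by (simp add: hq)
  qed
  \<comment> \<open>The denominator is \<open>K^2 + 1\<close> so that the division is safe when
    \<open>K = 0\<close>.\<close>
  define D where "D = (d1 * d2)\<^sup>2 / (K\<^sup>2 + 1)"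
  have K1: "K\<^sup>2 + 1 > 0" by (simp add: add_nonneg_pos)
  have D: "D > 0" using d1 d2 K1 by (simp add: D_def)
  have "sqrt (q\<^sup>2 + D) \<le> nrm (rep b v)" if v: "v \<in> X" "nrm v = 1" for v
  proof -
    have p: "0 \<le> (nrm (rep b v))\<^sup>2 - q\<^sup>2" using hn[OF v(1)] v by (simp add: hq)
    have "(d1 * d2)\<^sup>2 \<le> (K\<^sup>2 + 1) * ((nrm (rep b v))\<^sup>2 - q\<^sup>2)"
      using key[OF v] p by (simp add: algebra_simps)
    then have "D \<le> (nrm (rep b v))\<^sup>2 - q\<^sup>2"
      unfolding D_def using K1 by (simp add: pos_divide_le_eq mult.commute)
    then show ?thesis using v by (intro real_le_lsqrt) auto
  qed
  then have "sqrt (q\<^sup>2 + D) \<le> q" unfolding q_def by (intro cInf_greatest[OF ne]) auto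
  moreover have "q < sqrt (q\<^sup>2 + D)" using D by (intro real_less_rsqrt) simp
  ultimately show False by simp
qed

text \<open>The two half-gaps at 0 give \<open>\<bar>\<langle>Cv,v\<rangle>\<bar> \<le> \<parallel>Cv\<parallel>\<^sup>2 / d\<close>; polarising and testing against
  \<open>w = Cv / d\<close> shows that C is bounded below by d on its range, hence on the orthogonal
  complement of its kernel.\<close>
lemma isolated_spectrum_bounded_below:
  assumes bf: "bform b K" and d: "0 < d"
    and bij: "\<And>s. 0 < \<bar>s\<bar> \<Longrightarrow> \<bar>s\<bar> < d \<Longrightarrow> bij_form (shift b s)" and e: "e \<in> X"
    and orth: "\<And>u. u \<in> X \<Longrightarrow> (\<And>w. w \<in> X \<Longrightarrow> b u w = 0) \<Longrightarrow> ip e u = 0"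
  shows "d * nrm e \<le> nrm (rep b e)"
proof -
  note rs [simp] = rep_in[OF bf]
  have half: "d * \<bar>Re (b v v)\<bar> \<le> (nrm (rep b v))\<^sup>2" if v: "v \<in> X" for v
  proof -
    \<comment> \<open>The points d/2 and -d/2 are the midpoints of the two gaps adjacent to 0; each
      has distance d/2 from the spectrum, so \<open>spectral_gap\<close> applies to the shifted
      form.\<close>
    have *: "(d/2) * nrm v \<le> nrm (rep b v - of_real c *C v)" if c: "\<bar>c\<bar> = d/2" for c
    proof -
      have "(d/2) * nrm v \<le> nrm (rep (shift b c) v)"
      proof (rule spectral_gap[OF bform_shift[OF bf] _ _ v])
        fix s :: real assume s: "\<bar>s\<bar> < d / 2"
        show "bij_form (shift (shift b c) s)"
          unfolding shift_shift by (rule bij) (use s c d in \<open>auto simp: abs_if split: if_splits\<close>)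
      qed (use d in simp)
      then show ?thesis using rep_shift[OF bf v] by simp
    qed
    \<comment> \<open>Squaring the gap estimate cancels the term \<open>c^2 |v|^2\<close> on both
      sides.\<close>
    have sq: "0 \<le> (nrm (rep b v))\<^sup>2 - 2 * c * Re (b v v)" if c: "\<bar>c\<bar> = d/2" for c
    proof -
      have "((d/2) * nrm v)\<^sup>2 \<le> (nrm (rep b v - of_real c *C v))\<^sup>2"
        using *[OF c] d v by (intro power_mono) auto
      also have "\<dots> = (nrm (rep b v))\<^sup>2 - 2 * c * Re (b v v) + c\<^sup>2 * (nrm v)\<^sup>2"
        using v rep_ip[OF bf v v] herm_quad_diff[OF sub ip rs[OF v] cl(3)[OF v], of "of_real c"]
          herm_quad_scale[OF sub ip v, of "of_real c"] ip_simps(6)[OF v rs[OF v], of "of_real c"]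
        by (simp add: nrm_sq)
      also have "c\<^sup>2 = (d/2)\<^sup>2" using c by (metis power2_abs)
      finally show ?thesis unfolding power_mult_distrib by linarith
    qed
    show ?thesis using sq[of "d/2"] sq[of "- (d/2)"] d by (auto simp: abs_if)
  qed
  have sqb: "d * nrm (rep b v) \<le> nrm (rep b (rep b v))" if v: "v \<in> X" for v
  proof -
    define w where "w = of_real (1/d) *C rep b v"
    have wX: "w \<in> X" using v by (simp add: w_def)
    have "d * (4 * Re (b v w)) = d * Re (b (v + w) (v + w)) - d * Re (b (v - w) (v - w))"
      using v wX by (simp add: herm_quad_add[OF sub bform_herm[OF bf]]
          herm_quad_diff[OF sub bform_herm[OF bf]] algebra_simps)
    also have "\<dots> \<le> (nrm (rep b (v + w)))\<^sup>2 + (nrm (rep b (v - w)))\<^sup>2"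
      using half[of "v + w"] half[of "v - w"] v wX d
      by (smt (verit) cl(1) cl(2) mult_left_mono abs_ge_self abs_ge_minus_self mult_minus_right)
    also have "\<dots> = 2 * (nrm (rep b v))\<^sup>2 + 2 * (nrm (rep b w))\<^sup>2"
      using v wX by (simp add: rep_add[OF bf] rep_diff[OF bf] nrm_sq herm_quad_add[OF sub ip]
          herm_quad_diff[OF sub ip])
    finally have 1: "d * (4 * Re (b v w)) \<le> 2 * (nrm (rep b v))\<^sup>2 + 2 * (nrm (rep b w))\<^sup>2" .
    have "b v w = of_real (1/d) * ip (rep b v) (rep b v)"
      using v herm_scale_right[OF sub bform_herm[OF bf], of "rep b v" v "of_real (1/d)"]
        rep_ip[OF bf v, of "rep b v"] by (simp add: w_def)
    then have "d * Re (b v w) = (nrm (rep b v))\<^sup>2" using d v by (simp add: ip_self)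
    moreover have "nrm (rep b w) = nrm (rep b (rep b v)) / d"
    proof -
      have cu: "cmod (of_real (1 / d)) = 1 / d" using d by (simp only: norm_of_real) simp
      show ?thesis unfolding w_def using v by (simp only: rep_scale[OF bf] nrm_scale cu rs) simp
    qed
    ultimately have "(nrm (rep b v))\<^sup>2 \<le> (nrm (rep b (rep b v)) / d)\<^sup>2" using 1 by simp
    then have "nrm (rep b v) \<le> nrm (rep b (rep b v)) / d"
      by (rule power2_le_imp_le) (use v d in simp)
    then show ?thesis using d by (simp add: field_simps)
  qed
  \<comment> \<open>The closure of the range of A. It is complete, and on it the estimate
    \<open>sqb\<close> for vectors \<open>Av\<close> extends by continuity.\<close>
  define R where "R = {r \<in> X. \<forall>\<epsilon>>0. \<exists>v\<in>X. nrm (r - rep b v) < \<epsilon>}"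
  have RX: "R \<subseteq> X" by (auto simp: R_def)
  have RD: "\<exists>v\<in>X. nrm (r - rep b v) < \<epsilon>" if "r \<in> R" "\<epsilon> > 0" for r \<epsilon>
    using that by (simp add: R_def)
  have Rsub: "subspace R"
  proof (rule subspaceI)
    show "0 \<in> R" unfolding R_def
    proof (intro CollectI conjI allI impI)
      fix \<epsilon> :: real assume "\<epsilon> > 0"
      have "rep b 0 = 0" using rep_scale[OF bf, of 0 0] by simp
      then show "\<exists>v\<in>X. nrm (0 - rep b v) < \<epsilon>" using \<open>\<epsilon> > 0\<close> by (intro bexI[of _ 0]) auto
    qed simp
    fix x y assume x: "x \<in> R" and y: "y \<in> R"
    show "x + y \<in> R" unfolding R_def
    proof (intro CollectI conjI allI impI)
      show "x + y \<in> X" using x y RX by auto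
      fix \<epsilon> :: real assume "\<epsilon> > 0"
      then obtain v w where vw: "v \<in> X" "nrm (x - rep b v) < \<epsilon>/2" "w \<in> X" "nrm (y - rep b w) < \<epsilon>/2"
        using RD[OF x half_gt_zero] RD[OF y half_gt_zero] by blast
      have "nrm ((x - rep b v) + (y - rep b w)) \<le> nrm (x - rep b v) + nrm (y - rep b w)"
        using x y vw RX by (intro nrm_triangle) auto
      moreover have "(x - rep b v) + (y - rep b w) = x + y - rep b (v + w)"
        using vw by (simp add: rep_add[OF bf])
      ultimately show "\<exists>v\<in>X. nrm (x + y - rep b v) < \<epsilon>" using vw by (intro bexI[of _ "v + w"]) auto
    qed
    fix c
    show "c *C x \<in> R" unfolding R_def
    proof (intro CollectI conjI allI impI)
      show "c *C x \<in> X" using x RX by auto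
      fix \<epsilon> :: real assume \<epsilon>: "\<epsilon> > 0"
      have c1: "cmod c + 1 > 0" by (simp add: add_nonneg_pos)
      then obtain v where v: "v \<in> X" "nrm (x - rep b v) < \<epsilon> / (cmod c + 1)"
        using RD[OF x divide_pos_pos[OF \<epsilon>]] by blast
      have "nrm (c *C x - rep b (c *C v)) = cmod c * nrm (x - rep b v)"
        using v x RX by (simp add: rep_scale[OF bf] scale_right_diff_distrib[symmetric] nrm_scale subset_iff)
      also have "\<dots> \<le> (cmod c + 1) * nrm (x - rep b v)"
        using v x RX by (intro mult_right_mono) auto
      also have "\<dots> < \<epsilon>" using v c1 by (simp add: field_simps)
      finally show "\<exists>v\<in>X. nrm (c *C x - rep b v) < \<epsilon>" using v by blast
    qed
  qed
  interpret R: hspace scale R ip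
  proof
    show "subspace R" by (rule Rsub)
    show "herm_on R ip" using herm_on_subset[OF ip RX] .
    show "0 < Re (ip v v)" if "v \<in> R" "v \<noteq> 0" for v using that RX ip_pos by blast
    fix f :: "nat \<Rightarrow> 'v" assume f: "\<And>n. f n \<in> R"
      and c: "\<forall>e>0. \<exists>M. \<forall>m\<ge>M. \<forall>n\<ge>M. sqrt (Re (ip (f m - f n) (f m - f n))) < e"
    obtain l where l: "l \<in> X" "(\<lambda>n. nrm (f n - l)) \<longlonglongrightarrow> 0"
      using compl[of f] f RX c unfolding nrm_def by blast
    have "l \<in> R" unfolding R_def
    proof (intro CollectI conjI allI impI l)
      fix \<epsilon> :: real assume "\<epsilon> > 0"
      then have "eventually (\<lambda>n. nrm (f n - l) < \<epsilon>/2) sequentially"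
        using order_tendstoD(2)[OF l(2), of "\<epsilon>/2"] by simp
      then obtain n where n: "nrm (f n - l) < \<epsilon>/2" by (auto simp: eventually_sequentially)
      obtain v where v: "v \<in> X" "nrm (f n - rep b v) < \<epsilon>/2"
        using RD[OF f[of n] half_gt_zero[OF \<open>\<epsilon> > 0\<close>]] by blast
      have "nrm ((f n - rep b v) - (f n - l)) \<le> nrm (f n - rep b v) + nrm (f n - l)"
        using f[of n] RX v l by (intro nrm_triangle_diff) auto
      then show "\<exists>v\<in>X. nrm (l - rep b v) < \<epsilon>" using v n by (intro bexI[of _ v]) auto
    qed
    then show "\<exists>l\<in>R. (\<lambda>n. sqrt (Re (ip (f n - l) (f n - l)))) \<longlonglongrightarrow> 0"
      using l unfolding nrm_def by blast
  qed
  \<comment> \<open>Let \<open>r\<close> be the orthogonal projection of \<open>e\<close> to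
    \<open>R\<close>. Then \<open>e - r\<close> is orthogonal to the range, hence in the kernel,
    hence orthogonal to \<open>e\<close> by assumption; it is also orthogonal to \<open>r\<close>,
    so it vanishes.\<close>
  have eR: "e \<in> R"
  proof -
    obtain r where r: "r \<in> R" "\<And>w. w \<in> R \<Longrightarrow> ip w e = ip w r"
    proof (rule R.riesz[of "\<lambda>w. ip w e" "nrm e"])
      fix w assume "w \<in> R"
      then show "cmod (ip w e) \<le> nrm e * R.nrm w" using CS[of w e] RX e by (auto simp: mult.commute)
    qed (use e RX in \<open>auto simp: ip_simps subset_iff\<close>)
    have rX: "r \<in> X" using r RX by blast
    have "b (e - r) w = 0" if w: "w \<in> X" for w
    proof -
      have "rep b w \<in> R"
        unfolding R_def using w by (auto intro!: bexI[of _ w])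
      then have "ip (rep b w) (e - r) = 0" using r e rX w by (simp add: ip_simps)
      then show ?thesis
        using rep_ip[OF bf w, of "e - r"] herm_cnj[OF sub bform_herm[OF bf], of w "e - r"] e rX w by simp
    qed
    then have "ip e (e - r) = 0" using orth[of "e - r"] e rX by simp
    moreover have "ip r (e - r) = 0" using r(2)[OF r(1)] e rX by (simp add: ip_simps)
    ultimately have "ip (e - r) (e - r) = 0" using e rX ip_simps(3)[of e r "e - r"] by simp
    then have "e - r = 0" using ip_pos[of "e - r"] e rX by force
    then show ?thesis using r by simp
  qed
  show ?thesis
  proof (rule field_le_epsilon)
    fix \<epsilon> :: real assume "\<epsilon> > 0"
    have dK: "d + K > 0" using d bform_nonneg[OF bf] by simp
    then obtain v where v: "v \<in> X" "nrm (e - rep b v) < \<epsilon> / (d + K)"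
      using RD[OF eR divide_pos_pos[OF \<open>\<epsilon> > 0\<close>]] by blast
    then have small: "(d + K) * nrm (e - rep b v) < \<epsilon>" using dK by (simp add: field_simps)
    have "d * nrm e \<le> d * (nrm (rep b v) + nrm (e - rep b v))"
      using nrm_triangle_ineq2[of e "rep b v"] e v d by (intro mult_left_mono) auto
    also have "\<dots> \<le> nrm (rep b (rep b v)) + d * nrm (e - rep b v)"
      using sqb[OF v(1)] by (simp add: distrib_left)
    also have "nrm (rep b (rep b v)) \<le> nrm (rep b e) + nrm (rep b (e - rep b v))"
      using nrm_triangle_diff[of "rep b e" "rep b (e - rep b v)"] e v by (simp add: rep_diff[OF bf])
    also have "nrm (rep b (e - rep b v)) \<le> K * nrm (e - rep b v)"
      using nrm_rep_le[OF bf] e v by simp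
    finally show "d * nrm e \<le> nrm (rep b e) + \<epsilon>" using small by (simp add: distrib_right)
  qed
qed

end

subsection \<open>The relative index\<close>

context complex_vs begin

definition ssum :: "'v set \<Rightarrow> 'v set \<Rightarrow> 'v set" where
  "ssum A B = {x + y |x y. x \<in> A \<and> y \<in> B}"

lemma ssum_subspace: "subspace A \<Longrightarrow> subspace B \<Longrightarrow> subspace (ssum A B)"
  unfolding ssum_def by (rule subspace_sums)

lemma ssumI: "x \<in> A \<Longrightarrow> y \<in> B \<Longrightarrow> x + y \<in> ssum A B"
  unfolding ssum_def by blast

lemma ssumE: "z \<in> ssum A B \<Longrightarrow> (\<And>x y. x \<in> A \<Longrightarrow> y \<in> B \<Longrightarrow> z = x + y \<Longrightarrow> thesis) \<Longrightarrow> thesis"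
  unfolding ssum_def by blast

lemma ssum_left: "subspace B \<Longrightarrow> x \<in> A \<Longrightarrow> x \<in> ssum A B"
  using ssumI[of x A 0 B] subspace_0 by simp

lemma ssum_right: "subspace A \<Longrightarrow> x \<in> B \<Longrightarrow> x \<in> ssum A B"
  using ssumI[of 0 A x B] subspace_0 by simp

lemma herm_orth_span:
  assumes X: "subspace X" and h: "herm_on X b" and Z: "Z \<subseteq> X" and z: "z \<in> X"
    and orth: "\<And>x. x \<in> Z \<Longrightarrow> b z x = 0" and s: "s \<in> span Z"
  shows "b z s = 0"
proof -
  have "subspace {s \<in> X. b z s = 0}"
    using X z by (auto intro!: subspaceI simp: subspace_0 subspace_add subspace_scale
        herm_add_right[OF X h] herm_scale_right[OF X h] herm_zero_right[OF X h])
  then have "span Z \<subseteq> {s \<in> X. b z s = 0}" using Z orth by (intro span_minimal) auto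
  then show ?thesis using s by blast
qed

text \<open>\<open>S \<union> T\<close> is a basis of a complement of \<open>Wp + Wm\<close>, and
  \<open>card S\<close> will be the relative index. The signs are asymmetric on purpose: weak on the
  \<open>S\<close> side and strict on the \<open>T\<close> side, so the kernel is counted in
  \<open>S\<close>, in agreement with the half-open interval in \<open>spec_count\<close>.\<close>

definition pos_split ::
  "'v set \<Rightarrow> 'v set \<Rightarrow> 'v set \<Rightarrow> ('v \<Rightarrow> 'v \<Rightarrow> complex) \<Rightarrow> 'v set \<Rightarrow> 'v set \<Rightarrow> bool" where
  "pos_split X Wp Wm b S T \<longleftrightarrow> finite S \<and> finite T \<and> S \<inter> T = {} \<and> independent (S \<union> T) \<and> S \<union> T \<subseteq> X \<and>
     (\<forall>v\<in>span (S \<union> T). v \<in> ssum Wp Wm \<longrightarrow> v = 0) \<and>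
     (\<forall>x\<in>X. \<exists>w\<in>ssum Wp Wm. \<exists>v\<in>span (S \<union> T). x = w + v) \<and>
     (\<forall>p\<in>Wp. \<forall>s\<in>span S. 0 \<le> Re (b (p + s) (p + s))) \<and>
     (\<forall>q\<in>Wm. \<forall>t\<in>span T. q + t \<noteq> 0 \<longrightarrow> Re (b (q + t) (q + t)) < 0)"

lemma pos_splitD:
  assumes "pos_split X Wp Wm b S T"
  shows "finite S" "finite T" "S \<inter> T = {}" "independent (S \<union> T)" "S \<union> T \<subseteq> X"
    "\<And>v. v \<in> span (S \<union> T) \<Longrightarrow> v \<in> ssum Wp Wm \<Longrightarrow> v = 0"
    "\<And>x. x \<in> X \<Longrightarrow> \<exists>w\<in>ssum Wp Wm. \<exists>v\<in>span (S \<union> T). x = w + v"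
    "\<And>p s. p \<in> Wp \<Longrightarrow> s \<in> span S \<Longrightarrow> 0 \<le> Re (b (p + s) (p + s))"
    "\<And>q t. q \<in> Wm \<Longrightarrow> t \<in> span T \<Longrightarrow> q + t \<noteq> 0 \<Longrightarrow> Re (b (q + t) (q + t)) < 0"
  using assms unfolding pos_split_def by auto

lemma independent_Un:
  assumes "finite B" "independent A" "independent B" "\<And>v. v \<in> span A \<Longrightarrow> v \<in> span B \<Longrightarrow> v = 0"
  shows "independent (A \<union> B)"
  using assms(1,3,4)
proof (induction B rule: finite_induct)
  case (insert x B)
  have IH: "independent (A \<union> B)"
  proof (rule insert.IH)
    show "independent B" using insert.prems(1) by (rule independent_mono) auto
    show "v = 0" if "v \<in> span A" "v \<in> span B" for v
      using insert.prems(2)[OF that(1)] that(2) span_mono[of B "insert x B"] by blast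
  qed
  have "x \<notin> span (A \<union> B)"
  proof
    assume "x \<in> span (A \<union> B)"
    then obtain a c where ac: "a \<in> span A" "c \<in> span B" "x = a + c" unfolding span_Un by blast
    have "a \<in> span (insert x B)"
    proof -
      have "a = x - c" using ac by simp
      then show ?thesis using ac(2) span_mono[of B "insert x B"] span_base[of x "insert x B"]
        by (auto intro: span_diff)
    qed
    then have "a = 0" using insert.prems(2) ac by blast
    then have "x \<in> span B" using ac by simp
    then show False using insert.prems(1) insert.hyps by (simp add: independent_insert)
  qed
  then show ?case using independent_insertI[OF _ IH] by simp
qed (use assms in simp)

text \<open>Steinitz exchange modulo \<open>W\<close> without a quotient space. Representatives in
  \<open>span B\<close> of the elements of \<open>I\<close> extend to a linear map \<open>f\<close>
  with \<open>v - f v\<close> in \<open>W\<close>; its kernel on \<open>span I\<close> lies in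
  \<open>W\<close> and so is trivial, and the image is independent in \<open>span B\<close>.\<close>

lemma steinitz_mod:
  assumes W: "subspace W" and B: "finite B" and I: "finite I" "independent I"
    and triv: "\<And>v. v \<in> span I \<Longrightarrow> v \<in> W \<Longrightarrow> v = 0"
    and gen: "\<And>x. x \<in> I \<Longrightarrow> \<exists>w\<in>W. \<exists>v\<in>span B. x = w + v"
  shows "card I \<le> card B"
proof -
  interpret vector_space_pair scale scale ..
  obtain g where g: "\<And>x. x \<in> I \<Longrightarrow> g x \<in> span B" "\<And>x. x \<in> I \<Longrightarrow> x - g x \<in> W"
    using gen by (metis add_diff_cancel_right')
  obtain f where f: "Vector_Spaces.linear scale scale f" "\<And>x. x \<in> I \<Longrightarrow> f x = g x"
    using linear_independent_extend[OF I(2), of g] by blast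
  have fW: "v - f v \<in> W" if "v \<in> span I" for v
  proof (rule span_induct[OF that])
    show "subspace {v. v - f v \<in> W}"
    proof (rule subspaceI)
      show "0 \<in> {v. v - f v \<in> W}" using linear_0[OF f(1)] subspace_0[OF W] by simp
      show "x + y \<in> {v. v - f v \<in> W}" if "x \<in> {v. v - f v \<in> W}" "y \<in> {v. v - f v \<in> W}" for x y
        using subspace_add[OF W, of "x - f x" "y - f y"] that
        by (simp add: linear_add[OF f(1)] algebra_simps)
      show "c *C x \<in> {v. v - f v \<in> W}" if "x \<in> {v. v - f v \<in> W}" for c x
        using subspace_scale[OF W, of "x - f x" c] that
        by (simp add: linear_scale[OF f(1)] scale_right_diff_distrib)
    qed
    show "x - f x \<in> W" if "x \<in> I" for x using g f that by simp
  qed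
  have "inj_on f (span I)"
    unfolding linear_inj_on_iff_eq_0[OF f(1) subspace_span] using fW triv by (metis diff_zero)
  then have "independent (f ` I)" "card (f ` I) = card I"
    using linear_independent_injective_image[OF f(1) I(2)] 
    by (auto intro!: card_image inj_on_subset[of f "span I" I] span_superset)
  moreover have "f ` I \<subseteq> span B" using g f by auto
  ultimately show ?thesis using independent_span_bound[OF B, of "f ` I"] by simp
qed

text \<open>Sylvester's law of inertia relative to \<open>Wp\<close> and \<open>Wm\<close>. A
  nonnegative space \<open>Wp + span S\<close> meets a negative definite space
  \<open>Wm + span T'\<close> only in 0, so \<open>S \<union> T'\<close> is independent modulo
  \<open>Wp + Wm\<close>, while \<open>S' \<union> T'\<close> generates modulo it. Comparing
  cardinalities cancels \<open>T'\<close>.\<close>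

lemma pos_split_card_le:
  assumes Wp: "subspace Wp" and Wm: "subspace Wm"
    and 1: "pos_split X Wp Wm b S T" and 2: "pos_split X Wp Wm b S' T'"
  shows "card S \<le> card S'"
proof -
  note p1 = pos_splitD[OF 1] and p2 = pos_splitD[OF 2]
  have PQ: "x = 0" if "p \<in> Wp" "s \<in> span S" "x = p + s" "q \<in> Wm" "t \<in> span T'" "x = q + t" for x p s q t
    using p1(8)[OF that(1,2)] p2(9)[OF that(4,5)] that(3,6) by force
  have SW: "v = 0" if "v \<in> span S" "v \<in> ssum Wp Wm" for v
    using p1(6) that span_mono[of S "S \<union> T"] by blast
  have TW: "v = 0" if "v \<in> span T'" "v \<in> ssum Wp Wm" for v
    using p2(6) that span_mono[of T' "S' \<union> T'"] by blast
  have z: "0 \<in> Wp" "0 \<in> Wm" using Wp Wm subspace_0 by auto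
  have int0: "v = 0" if "v \<in> span S" "v \<in> span T'" for v
    using PQ[OF z(1) that(1) _ z(2) that(2)] by simp
  have iS: "independent S" using independent_mono[of "S \<union> T" S] p1(4) by simp
  have iT: "independent T'" using independent_mono[of "S' \<union> T'" T'] p2(4) by simp
  have fin: "finite S" "finite T'" using p1(1) p2(2) by auto
  have disj: "S \<inter> T' = {}"
  proof -
    have "0 \<notin> S" using iS dependent_zero by blast
    then show ?thesis using int0 span_base by (metis disjoint_iff)
  qed
  have "card (S \<union> T') \<le> card (S' \<union> T')"
  proof (rule steinitz_mod[of "ssum Wp Wm"])
    show "subspace (ssum Wp Wm)" using Wp Wm by (rule ssum_subspace)
    show "independent (S \<union> T')" by (rule independent_Un[OF fin(2) iS iT int0])
    show "finite (S' \<union> T')" "finite (S \<union> T')" using p1(1) p2(1,2) by auto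
    show "\<exists>w\<in>ssum Wp Wm. \<exists>v\<in>span (S' \<union> T'). x = w + v" if "x \<in> S \<union> T'" for x
      using p1(5) p2(5,7) that by blast
    fix v assume "v \<in> span (S \<union> T')" "v \<in> ssum Wp Wm"
    then obtain s t p q where a: "s \<in> span S" "t \<in> span T'" "p \<in> Wp" "q \<in> Wm" "v = s + t" "v = p + q"
      unfolding span_Un ssum_def by blast
    \<comment> \<open>From \<open>s + t = p + q\<close> one gets \<open>s - p = q - t\<close>, an
      element of both spaces of opposite sign.\<close>
    define x where "x = - p + s"
    have "x = q + - t" using a by (simp add: x_def algebra_simps)
    then have x0: "x = 0"
      using PQ[of "- p" s x q "- t"] a x_def subspace_neg[OF Wp] span_neg by blast
    then have "s = p" "t = q" using x_def \<open>x = q + - t\<close> by (simp_all add: algebra_simps)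
    then have "s = 0" "t = 0"
      using SW[OF a(1)] TW[OF a(2)] ssum_left[OF Wm, of p Wp] ssum_right[OF Wp, of q Wm] a by auto
    then show "v = 0" using a by simp
  qed
  then show ?thesis using disj fin p2(1-3) by (simp add: card_Un_disjoint)
qed

lemma pos_split_card_unique:
  assumes "subspace Wp" "subspace Wm" "pos_split X Wp Wm b S T" "pos_split X Wp Wm b S' T'"
  shows "card S = card S'"
  using pos_split_card_le[OF assms] pos_split_card_le[OF assms(1,2,4,3)] by simp

text \<open>A description of the common value of \<open>card S\<close>; meaningful only where some
  \<open>pos_split\<close> exists, which is why later statements carry existence of a splitting
  along.\<close>

definition ix :: "'v set \<Rightarrow> 'v set \<Rightarrow> 'v set \<Rightarrow> ('v \<Rightarrow> 'v \<Rightarrow> complex) \<Rightarrow> nat" where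
  "ix X Wp Wm b = (THE r. \<exists>S T. pos_split X Wp Wm b S T \<and> card S = r)"

lemma ix_eq:
  assumes "subspace Wp" "subspace Wm" "pos_split X Wp Wm b S T"
  shows "ix X Wp Wm b = card S"
  unfolding ix_def
proof (rule the_equality)
  show "\<exists>S' T'. pos_split X Wp Wm b S' T' \<and> card S' = card S" using assms by blast
  show "r = card S" if "\<exists>S T. pos_split X Wp Wm b S T \<and> card S = r" for r
    using that pos_split_card_unique[OF assms(1,2)] assms(3) by blast
qed

section \<open>Diagonalisation and extension of definite subspaces\<close>

text \<open>Induction on the dimension: a vector with \<open>b v v \<noteq> 0\<close> splits off
  with its orthogonal complement. If there is none, polarisation shows that the form vanishes
  identically and any basis is orthogonal, so degenerate forms are covered.\<close>

lemma herm_diagonal_basis: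
  assumes "subspace Z" "finite F" "Z \<subseteq> span F" "herm_on Z b"
  shows "\<exists>B. finite B \<and> independent B \<and> span B = Z \<and> (\<forall>x\<in>B. \<forall>y\<in>B. x \<noteq> y \<longrightarrow> b x y = 0)"
  using assms(1,3,4)
proof (induction "dim Z" arbitrary: Z rule: less_induct)
  case less
  note Z = less.prems(1) and h = less.prems(3)
  have basis: "\<exists>B. finite B \<and> independent B \<and> span B = Y \<and> card B = dim Y" if "subspace Y" "Y \<subseteq> Z" for Y
  proof -
    obtain B where B: "B \<subseteq> Y" "independent B" "Y \<subseteq> span B" "card B = dim Y" using basis_exists by blast
    have "finite B" using independent_span_bound[OF assms(2) B(2)] B(1) that(2) less.prems(2) by blast
    then show ?thesis using B span_subspace[OF B(1,3) that(1)] by blast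
  qed
  show ?case
  proof (cases "\<forall>v\<in>Z. b v v = 0")
    case True
    have re0: "Re (b u v) = 0" if "u \<in> Z" "v \<in> Z" for u v
      using herm_quad_add[OF Z h that] True that subspace_add[OF Z that] by simp
    have "b u v = 0" if "u \<in> Z" "v \<in> Z" for u v
    proof -
      have "Re (b (\<i> *C u) v) = 0" using re0 that subspace_scale[OF Z] by blast
      then show ?thesis using re0[OF that] that herm_scale_left[OF Z h that] by (simp add: complex_eq_iff)
    qed
    then show ?thesis using basis[OF Z] span_superset by blast
  next
    case False
    then obtain v where v: "v \<in> Z" "b v v \<noteq> 0" by blast
    define Y where "Y = {z \<in> Z. b z v = 0}"
    have Y: "subspace Y" "Y \<subseteq> Z"
      unfolding Y_def using v Z
      by (auto intro!: subspaceI simp: subspace_0 subspace_add subspace_scale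
          herm_add_left[OF Z h] herm_scale_left[OF Z h] herm_zero_left[OF Z h])
    obtain B' where B': "finite B'" "independent B'" "span B' = Y" "card B' = dim Y" using basis[OF Y] by blast
    obtain B'' where B'': "finite B''" "independent B''" "span B'' = Z" "card B'' = dim Z"
      using basis[OF Z] by blast
    have vY: "v \<notin> Y" using v by (simp add: Y_def)
    have "independent (insert v B')" using B' vY by (simp add: independent_insertI)
    moreover have "insert v B' \<subseteq> span B''" using B' B'' v Y span_superset[of B'] by blast
    ultimately have "card (insert v B') \<le> card B''" using independent_span_bound[OF B''(1)] by blast
    moreover have "v \<notin> B'" using vY B'(3) span_base by blast
    ultimately have "dim Y < dim Z" using B' B'' by simp
    moreover have "Y \<subseteq> span F" using Y less.prems(2) by blast
    ultimately obtain B where B: "finite B" "independent B" "span B = Y"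
      "\<And>x y. x \<in> B \<Longrightarrow> y \<in> B \<Longrightarrow> x \<noteq> y \<Longrightarrow> b x y = 0"
      using less.hyps[of Y] Y herm_on_subset[OF h Y(2)] by blast
    have BY: "B \<subseteq> Y" using B(3) span_superset by blast
    have "span (insert v B) = Z"
    proof
      show "span (insert v B) \<subseteq> Z" using v BY Y Z by (intro span_minimal) auto
      show "Z \<subseteq> span (insert v B)"
      proof
        fix z assume z: "z \<in> Z"
        define k where "k = b z v / b v v"
        have kv: "k *C v \<in> Z" using v Z subspace_scale by blast
        have "b (z - k *C v) v = 0"
          using herm_diff_left[OF Z h z kv v(1)] herm_scale_left[OF Z h v(1) v(1)] v(2) by (simp add: k_def)
        then have "z - k *C v \<in> span B" using B(3) subspace_diff[OF Z z kv] by (simp add: Y_def)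
        then show "z \<in> span (insert v B)" unfolding span_breakdown_eq by blast
      qed
    qed
    moreover have "independent (insert v B)" using B vY by (simp add: independent_insertI)
    moreover have "b x y = 0" if "x \<in> insert v B" "y \<in> insert v B" "x \<noteq> y" for x y
    proof -
      have "b x v = 0" if "x \<in> B" for x using that BY by (auto simp: Y_def)
      moreover have "b v x = 0" if "x \<in> B" for x
        using that BY herm_cnj[OF Z h, of x v] v by (auto simp: Y_def)
      ultimately show ?thesis using that B(4) by blast
    qed
    ultimately show ?thesis using B(1) by (intro exI[of _ "insert v B"]) auto
  qed
qed

end

context hspace begin

text \<open>Test \<open>A (x + y)\<close> against \<open>x - y\<close>: the mixed terms cancel in
  the real part, leaving \<open>b x x - b y y\<close>, which is at least
  \<open>d (|x|^2 + |y|^2)\<close>. No orthogonality between \<open>P\<close> and \<open>Q\<close>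
  is required.\<close>

lemma definite_splitting_bounded_below:
  assumes bf: "bform b K" and P: "P \<subseteq> X" "\<And>x. x \<in> P \<Longrightarrow> d * (nrm x)\<^sup>2 \<le> Re (b x x)"
    and Q: "Q \<subseteq> X" "\<And>y. y \<in> Q \<Longrightarrow> Re (b y y) \<le> - d * (nrm y)\<^sup>2" and d: "0 < d"
    and v: "v = x + y" "x \<in> P" "y \<in> Q"
  shows "d / 2 * nrm v \<le> nrm (rep b v)"
proof -
  have X: "x \<in> X" "y \<in> X" "v \<in> X" using v P Q by auto
  define s where "s = nrm x + nrm y"
  have s0: "0 \<le> s" using X by (simp add: s_def)
  have vs: "nrm v \<le> s" using nrm_triangle X v by (simp add: s_def)
  have "Re (b v (x - y)) = Re (b x x) - Re (b y y)"
    using X v herm_cnj[OF sub bform_herm[OF bf], of x y]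
    by (simp add: herm_add_left[OF sub bform_herm[OF bf]] herm_diff_right[OF sub bform_herm[OF bf]])
  then have "d * ((nrm x)\<^sup>2 + (nrm y)\<^sup>2) \<le> Re (b v (x - y))"
    using P(2)[OF v(2)] Q(2)[OF v(3)] by (simp add: distrib_left)
  also have "\<dots> \<le> cmod (ip (rep b v) (x - y))"
    using rep_ip[OF bf X(3), of "x - y"] X by (simp add: complex_Re_le_cmod)
  also have "\<dots> \<le> nrm (rep b v) * nrm (x - y)" using CS rep_in[OF bf X(3)] X by simp
  also have "\<dots> \<le> nrm (rep b v) * s"
    using nrm_triangle_diff[of x y] X rep_in[OF bf X(3)] by (intro mult_left_mono) (auto simp: s_def)
  finally have 1: "d * ((nrm x)\<^sup>2 + (nrm y)\<^sup>2) \<le> nrm (rep b v) * s" .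
  have "s\<^sup>2 \<le> 2 * ((nrm x)\<^sup>2 + (nrm y)\<^sup>2)"
    using zero_le_power2[of "nrm x - nrm y"] by (simp add: s_def power2_sum power2_diff)
  then have "d / 2 * s\<^sup>2 \<le> nrm (rep b v) * s" 
    using 1 d mult_left_mono[of "s\<^sup>2" "2 * ((nrm x)\<^sup>2 + (nrm y)\<^sup>2)" "d/2"]
    by (simp add: algebra_simps)
  then have "d / 2 * s \<le> nrm (rep b v)"
    using s0 rep_in[OF bf X(3)] by (cases "s = 0") (auto simp: power2_eq_square)
  moreover have "d / 2 * nrm v \<le> d / 2 * s" using vs d by (intro mult_left_mono) auto
  ultimately show ?thesis by linarith
qed

text \<open>Finitely many positive vectors, orthogonal for the form to \<open>P\<close> and to each
  other, are adjoined one at a time. Every step may worsen the constant, but only finitely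
  often.\<close>

lemma definite_extend:
  assumes h: "herm_on X b" and P: "subspace P" "P \<subseteq> X" "\<And>x. x \<in> P \<Longrightarrow> d * (nrm x)\<^sup>2 \<le> Re (b x x)" "0 < d"
    and Z: "finite Z" "Z \<subseteq> X" "\<And>z x. z \<in> Z \<Longrightarrow> x \<in> P \<Longrightarrow> b z x = 0"
      "\<And>z z'. z \<in> Z \<Longrightarrow> z' \<in> Z \<Longrightarrow> z \<noteq> z' \<Longrightarrow> b z z' = 0" "\<And>z. z \<in> Z \<Longrightarrow> 0 < Re (b z z)"
  shows "\<exists>d>0. \<forall>x\<in>P. \<forall>s\<in>span Z. d * (nrm (x + s))\<^sup>2 \<le> Re (b (x + s) (x + s))"
  using Z
proof (induction Z rule: finite_induct)
  case empty
  then show ?case using P by auto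
next
  case (insert z Z)
  obtain d' where d': "d' > 0" "\<And>x s. x \<in> P \<Longrightarrow> s \<in> span Z \<Longrightarrow> d' * (nrm (x + s))\<^sup>2 \<le> Re (b (x + s) (x + s))"
  proof -
    have "\<exists>d>0. \<forall>x\<in>P. \<forall>s\<in>span Z. d * (nrm (x + s))\<^sup>2 \<le> Re (b (x + s) (x + s))"
      by (rule insert.IH) (use insert.prems in auto)
    then show ?thesis using that by blast
  qed
  have z: "z \<in> X" "0 < Re (b z z)" using insert.prems by auto
  have "z \<noteq> 0" using z herm_zero_left[OF sub h, of 0] by auto
  then have nz: "nrm z > 0" using nrm_pos z by blast
  \<comment> \<open>\<open>e\<close> serves both the old space and the line through
    \<open>z\<close>; the factor 2 in \<open>|y + kz|^2 \<le> 2 |y|^2 + 2 |kz|^2\<close> is why only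
    \<open>e / 2\<close> survives.\<close>
  define e where "e = min d' (Re (b z z) / (nrm z)\<^sup>2)"
  have e: "e > 0" "e \<le> d'" "e * (nrm z)\<^sup>2 \<le> Re (b z z)"
    using d' z nz by (auto simp: e_def min_def field_simps)
  have ZX: "span Z \<subseteq> X" using insert.prems(1) sub by (intro span_minimal) auto
  have bz: "b z s = 0" if "s \<in> span Z" for s
    by (rule herm_orth_span[OF sub h _ z(1) _ that]) (use insert.prems insert.hyps in auto)
  have "e / 2 * (nrm (x + s))\<^sup>2 \<le> Re (b (x + s) (x + s))" if x: "x \<in> P" and s: "s \<in> span (insert z Z)" for x s
  proof -
    obtain k where k: "s - k *C z \<in> span Z" using s unfolding span_breakdown_eq by blast
    define y where "y = x + (s - k *C z)"
    have yX: "y \<in> X" using x k P ZX unfolding y_def by blast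
    have kz: "k *C z \<in> X" using z by simp
    have xs: "x + s = y + k *C z" by (simp add: y_def)
    have "b z y = 0" using bz[OF k] insert.prems(2)[of z x] x k P ZX z
      by (subst y_def, subst herm_add_right[OF sub h]) auto
    then have "b y z = 0" using herm_cnj[OF sub h z(1) yX] by simp
    then have "b y (k *C z) = 0" using herm_scale_right[OF sub h z(1) yX] by simp
    then have q: "Re (b (x + s) (x + s)) = Re (b y y) + (cmod k)\<^sup>2 * Re (b z z)"
      unfolding xs using herm_quad_add[OF sub h yX kz] herm_quad_scale[OF sub h z(1)] by simp
    have "(nrm (y + k *C z))\<^sup>2 \<le> (nrm y + cmod k * nrm z)\<^sup>2"
      using nrm_triangle[OF yX kz] nrm_scale[OF z(1)] yX kz by (intro power_mono) auto
    also have "\<dots> \<le> 2 * (nrm y)\<^sup>2 + 2 * ((cmod k)\<^sup>2 * (nrm z)\<^sup>2)"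
      using zero_le_power2[of "nrm y - cmod k * nrm z"]
      by (simp add: power2_sum power2_diff power_mult_distrib)
    finally have "e / 2 * (nrm (x + s))\<^sup>2 \<le> e / 2 * (2 * (nrm y)\<^sup>2 + 2 * ((cmod k)\<^sup>2 * (nrm z)\<^sup>2))"
      unfolding xs using e by (intro mult_left_mono) auto
    also have "\<dots> = e * (nrm y)\<^sup>2 + (cmod k)\<^sup>2 * (e * (nrm z)\<^sup>2)" by (simp add: algebra_simps)
    also have "\<dots> \<le> d' * (nrm y)\<^sup>2 + (cmod k)\<^sup>2 * Re (b z z)"
      using e by (intro add_mono mult_right_mono mult_left_mono) auto
    also have "\<dots> \<le> Re (b (x + s) (x + s))" unfolding q using d'(2)[OF x k] by (simp add: y_def)
    finally show ?thesis .
  qed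
  then show ?case using e by (intro exI[of _ "e/2"]) auto
qed

lemma nonneg_extend:
  assumes h: "herm_on X b" and P: "subspace P" "P \<subseteq> X" "\<And>x. x \<in> P \<Longrightarrow> 0 \<le> Re (b x x)"
    and Z: "finite Z" "Z \<subseteq> X" "\<And>z x. z \<in> Z \<Longrightarrow> x \<in> P \<Longrightarrow> b z x = 0"
      "\<And>z z'. z \<in> Z \<Longrightarrow> z' \<in> Z \<Longrightarrow> z \<noteq> z' \<Longrightarrow> b z z' = 0" "\<And>z. z \<in> Z \<Longrightarrow> 0 \<le> Re (b z z)"
    and "x \<in> P" "s \<in> span Z"
  shows "0 \<le> Re (b (x + s) (x + s))"
  using Z assms(10,11)
proof (induction Z arbitrary: s rule: finite_induct)
  case empty
  then show ?case using P by auto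
next
  case (insert z Z)
  have z: "z \<in> X" "0 \<le> Re (b z z)" using insert.prems by auto
  have ZX: "span Z \<subseteq> X" using insert.prems(1) sub by (intro span_minimal) auto
  obtain k where k: "s - k *C z \<in> span Z" using insert.prems(6) unfolding span_breakdown_eq by blast
  define y where "y = x + (s - k *C z)"
  have yX: "y \<in> X" using insert.prems(5) k P ZX unfolding y_def by blast
  have kz: "k *C z \<in> X" using z by simp
  have xs: "x + s = y + k *C z" by (simp add: y_def)
  have "b z (s - k *C z) = 0"
    by (rule herm_orth_span[OF sub h _ z(1) _ k]) (use insert.prems insert.hyps in auto)
  then have "b z y = 0" using insert.prems(2)[of z x] insert.prems(5) k P ZX z
    by (subst y_def, subst herm_add_right[OF sub h]) auto
  then have "b y z = 0" using herm_cnj[OF sub h z(1) yX] by simp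
  then have "b y (k *C z) = 0" using herm_scale_right[OF sub h z(1) yX] by simp
  then have "Re (b (x + s) (x + s)) = Re (b y y) + (cmod k)\<^sup>2 * Re (b z z)"
    unfolding xs using herm_quad_add[OF sub h yX kz] herm_quad_scale[OF sub h z(1)] by simp
  moreover have "0 \<le> Re (b y y)"
    unfolding y_def by (rule insert.IH) (use insert.prems k in auto)
  ultimately show ?case using z by simp
qed

end

section \<open>Forms that are definite up to finite dimension\<close>

text \<open>Two reference spaces on which the forms will be positive and negative. Closedness of
  \<open>Wp + Wm\<close> makes it a Hilbert space on its own, and finite codimension leaves a
  finite-dimensional remainder to be diagonalised.\<close>

locale krein_space = hspace scale X ip
  for scale :: "complex \<Rightarrow> 'v::ab_group_add \<Rightarrow> 'v" (infixr "*C" 75) and X ip +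
  fixes Wp Wm :: "'v set"
  assumes Wp: "subspace Wp" and Wm: "subspace Wm" and WpX: "Wp \<subseteq> X" and WmX: "Wm \<subseteq> X"
    and W_closed: "\<And>f l. (\<And>n::nat. f n \<in> ssum Wp Wm) \<Longrightarrow> l \<in> X \<Longrightarrow>
        (\<lambda>n. nrm (f n - l)) \<longlonglongrightarrow> 0 \<Longrightarrow> l \<in> ssum Wp Wm"
    and W_codim: "\<exists>F. finite F \<and> F \<subseteq> X \<and> (\<forall>x\<in>X. \<exists>w\<in>ssum Wp Wm. \<exists>v\<in>span F. x = w + v)"
begin

abbreviation "W \<equiv> ssum Wp Wm"

text \<open>\<open>c\<close> is the half-width of a window around 0: subtracting
  \<open>s * ip\<close> with \<open>\<bar>s\<bar> < c\<close> preserves the structure, so inside the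
  window the spectrum consists of isolated eigenvalues of finite multiplicity.\<close>

definition kform :: "('v \<Rightarrow> 'v \<Rightarrow> complex) \<Rightarrow> real \<Rightarrow> real \<Rightarrow> bool" where
  "kform b K c \<longleftrightarrow> bform b K \<and> 0 < c \<and> (\<forall>p\<in>Wp. c * (nrm p)\<^sup>2 \<le> Re (b p p)) \<and>
     (\<forall>q\<in>Wm. Re (b q q) \<le> - c * (nrm q)\<^sup>2)"

lemma W: "subspace W" and WX: "W \<subseteq> X"
  using Wp Wm WpX WmX by (auto intro!: ssum_subspace elim!: ssumE)

lemma hspace_W: "hspace scale W ip"
proof
  show "subspace W" by (rule W)
  show "herm_on W ip" using herm_on_subset[OF ip WX] .
  show "0 < Re (ip v v)" if "v \<in> W" "v \<noteq> 0" for v using that WX ip_pos by blast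
  fix f :: "nat \<Rightarrow> 'v" assume f: "\<And>n. f n \<in> W"
    and c: "\<forall>e>0. \<exists>M. \<forall>m\<ge>M. \<forall>n\<ge>M. sqrt (Re (ip (f m - f n) (f m - f n))) < e"
  obtain l where l: "l \<in> X" "(\<lambda>n. nrm (f n - l)) \<longlonglongrightarrow> 0"
    using compl[of f] f WX c unfolding nrm_def by blast
  then show "\<exists>l\<in>W. (\<lambda>n. sqrt (Re (ip (f n - l) (f n - l)))) \<longlonglongrightarrow> 0"
    using W_closed[OF f l] unfolding nrm_def by blast
qed

text \<open>Definiteness on \<open>Wp\<close> and \<open>Wm\<close> makes the form invertible on
  \<open>W\<close>. Riesz on \<open>W\<close> followed by this inverse gives a projection to
  \<open>W\<close> along its complement with respect to \<open>b\<close>, although \<open>b\<close>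
  is indefinite.\<close>

lemma kform_orth_decomp:
  assumes k: "kform b K c"
  shows "x \<in> X \<Longrightarrow> \<exists>w\<in>W. \<exists>z\<in>X. (\<forall>w\<in>W. b z w = 0) \<and> x = w + z"
    and "v \<in> W \<Longrightarrow> (\<And>w. w \<in> W \<Longrightarrow> b v w = 0) \<Longrightarrow> v = 0"
proof -
  have bf: "bform b K" and c: "0 < c" and p: "\<And>p. p \<in> Wp \<Longrightarrow> c * (nrm p)\<^sup>2 \<le> Re (b p p)"
    and q: "\<And>q. q \<in> Wm \<Longrightarrow> Re (b q q) \<le> - c * (nrm q)\<^sup>2"
    using k by (auto simp: kform_def)
  interpret HW: hspace scale W ip by (rule hspace_W)
  have bfW: "HW.bform b K"
    unfolding HW.bform_def using bform_herm[OF bf] bform_nonneg[OF bf] bform_bound[OF bf] WX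
    by (auto intro: herm_on_subset)
  have "HW.bij_form b"
  proof (rule HW.bounded_below_imp_bij[OF bfW, of "c/2"])
    fix v assume "v \<in> W"
    then obtain x y where xy: "x \<in> Wp" "y \<in> Wm" "v = x + y" by (rule ssumE)
    show "c / 2 * nrm v \<le> nrm (HW.rep b v)"
      by (rule HW.definite_splitting_bounded_below[OF bfW _ p _ q c xy(3,1,2)])
         (auto intro: ssum_left[OF Wm] ssum_right[OF Wp])
  qed (use c in simp)
  then have bij: "\<exists>!v. v \<in> W \<and> (\<forall>w\<in>W. b v w = ip u w)" if "u \<in> W" for u
    using that by (simp add: HW.bij_form_def)
  show "\<exists>w\<in>W. \<exists>z\<in>X. (\<forall>w\<in>W. b z w = 0) \<and> x = w + z" if x: "x \<in> X"
  proof -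
    obtain u where u: "u \<in> W" "\<And>w. w \<in> W \<Longrightarrow> b w x = ip w u"
    proof (rule HW.riesz[of "\<lambda>w. b w x" "K * nrm x"])
      fix w assume "w \<in> W"
      then show "cmod (b w x) \<le> K * nrm x * nrm w"
        using bform_bound[OF bf _ x, of w] WX by (auto simp: ac_simps)
    qed (use x WX in \<open>auto simp: herm_add_left[OF sub bform_herm[OF bf]]
            herm_scale_left[OF sub bform_herm[OF bf]] subset_iff\<close>)
    obtain y where y: "y \<in> W" "\<And>w. w \<in> W \<Longrightarrow> b y w = ip u w" using bij[OF u(1)] by blast
    have "b (x - y) w = 0" if w: "w \<in> W" for w
    proof -
      have X': "w \<in> X" "u \<in> X" "y \<in> X" using w u y WX by auto
      have "b x w = ip u w" using u(2)[OF w] herm_cnj[OF sub bform_herm[OF bf] X'(1) x] ip_cnj[OF X'(1,2)] by simp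
      then show ?thesis using y(2)[OF w] herm_diff_left[OF sub bform_herm[OF bf] x X'(3,1)] by simp
    qed
    then show ?thesis using y x WX by (intro bexI[of _ y] bexI[of _ "x - y"]) auto
  qed
  show "v = 0" if v: "v \<in> W" "\<And>w. w \<in> W \<Longrightarrow> b v w = 0"
  proof -
    have z: "0 \<in> W" using W subspace_0 by blast
    have "b 0 w = ip 0 w" if "w \<in> W" for w
      using that WX by (auto simp: ip_simps herm_zero_left[OF sub bform_herm[OF bf]])
    moreover have "b v w = ip 0 w" if "w \<in> W" for w
      using v that WX by (auto simp: ip_simps)
    ultimately show ?thesis using bij[OF z] v z by blast
  qed
qed

definition ker :: "('v \<Rightarrow> 'v \<Rightarrow> complex) \<Rightarrow> 'v set" where
  "ker b = {v \<in> X. \<forall>w\<in>X. b v w = 0}"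

lemma herm_on_uminus:
  assumes "herm_on Y b" shows "herm_on Y (\<lambda>v w. - b v w)"
proof -
  have c1: "- b v u = cnj (- b u v)" if "u \<in> Y" "v \<in> Y" for u v
    using assms that unfolding herm_on_def by (metis complex_cnj_minus)
  have c2: "b (u + v) w = b u w + b v w" if "u \<in> Y" "v \<in> Y" "w \<in> Y" for u v w
    using assms that unfolding herm_on_def by blast
  have c3: "b (c *C u) w = c * b u w" if "u \<in> Y" "w \<in> Y" for c u w
    using assms that unfolding herm_on_def by blast
  show ?thesis unfolding herm_on_def
    by (intro conjI ballI allI) (simp add: c2, simp add: c3, rule c1)
qed

text \<open>The \<open>b\<close>-orthogonal complement of \<open>W\<close> is finite-dimensional, so
  it has a \<open>b\<close>-orthogonal basis, sorted by sign into \<open>Zp\<close>,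
  \<open>Z0\<close>, \<open>Zm\<close>. Being orthogonal to \<open>W\<close>, the first and last
  enlarge \<open>Wp\<close> and \<open>Wm\<close> with uniform bounds, and \<open>Z0\<close> spans
  the kernel. All statements on the index are read off from this normal form.\<close>

lemma kform_diagonal:
  assumes k: "kform b K c"
  obtains Zp Z0 Zm d where "finite Zp" "finite Z0" "finite Zm" "Zp \<inter> Z0 = {}" "Zp \<inter> Zm = {}" "Z0 \<inter> Zm = {}"
    "independent (Zp \<union> Z0 \<union> Zm)" "Zp \<union> Z0 \<union> Zm \<subseteq> X"
    "\<And>v. v \<in> span (Zp \<union> Z0 \<union> Zm) \<Longrightarrow> v \<in> W \<Longrightarrow> v = 0"
    "\<And>x. x \<in> X \<Longrightarrow> \<exists>w\<in>W. \<exists>v\<in>span (Zp \<union> Z0 \<union> Zm). x = w + v"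
    "0 < d"
    "\<And>p s. p \<in> Wp \<Longrightarrow> s \<in> span Zp \<Longrightarrow> d * (nrm (p + s))\<^sup>2 \<le> Re (b (p + s) (p + s))"
    "\<And>q t. q \<in> Wm \<Longrightarrow> t \<in> span Zm \<Longrightarrow> Re (b (q + t) (q + t)) \<le> - d * (nrm (q + t))\<^sup>2"
    "\<And>p s. p \<in> Wp \<Longrightarrow> s \<in> span (Zp \<union> Z0) \<Longrightarrow> 0 \<le> Re (b (p + s) (p + s))"
    "\<And>q t. q \<in> Wm \<Longrightarrow> t \<in> span (Z0 \<union> Zm) \<Longrightarrow> Re (b (q + t) (q + t)) \<le> 0"
    "span Z0 = ker b"
proof -
  have bf: "bform b K" and c: "0 < c" and p: "\<And>p. p \<in> Wp \<Longrightarrow> c * (nrm p)\<^sup>2 \<le> Re (b p p)"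
    and q: "\<And>q. q \<in> Wm \<Longrightarrow> Re (b q q) \<le> - c * (nrm q)\<^sup>2"
    using k by (auto simp: kform_def)
  note h = bform_herm[OF bf]
  define Zs where "Zs = {z \<in> X. \<forall>w\<in>W. b z w = 0}"
  have ZsX: "Zs \<subseteq> X" by (auto simp: Zs_def)
  have Zs: "subspace Zs"
    unfolding Zs_def using WX sub
    by (intro subspaceI) (auto simp: subset_iff herm_add_left[OF sub h] herm_scale_left[OF sub h]
          herm_zero_left[OF sub h])
  have WZ: "v = 0" if "v \<in> W" "v \<in> Zs" for v
    using kform_orth_decomp(2)[OF k that(1)] that(2) by (auto simp: Zs_def)
  have dec: "\<exists>w\<in>W. \<exists>z\<in>Zs. x = w + z" if "x \<in> X" for x
    using kform_orth_decomp(1)[OF k that] by (auto simp: Zs_def)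
  obtain F where F: "finite F" "F \<subseteq> X" "\<And>x. x \<in> X \<Longrightarrow> \<exists>w\<in>W. \<exists>v\<in>span F. x = w + v"
    using W_codim by blast
  \<comment> \<open>The components in \<open>Zs\<close> of a finite generating set modulo
    \<open>W\<close> span \<open>Zs\<close>, because \<open>W\<close> and \<open>Zs\<close> meet
    only in 0.\<close>
  obtain wf zf where wz: "\<And>f. f \<in> F \<Longrightarrow> wf f \<in> W" "\<And>f. f \<in> F \<Longrightarrow> zf f \<in> Zs" "\<And>f. f \<in> F \<Longrightarrow> f = wf f + zf f"
    using dec F(2) by (metis subsetD)
  have zspan: "span (zf ` F) \<subseteq> Zs" using wz Zs by (intro span_minimal) auto
  have "Zs \<subseteq> span (zf ` F)"
  proof
    fix z assume z: "z \<in> Zs"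
    have sp: "\<exists>w\<in>W. \<exists>y\<in>span (zf ` F). v = w + y" if "v \<in> span F" for v
    proof (rule span_induct[OF that])
      have "subspace (ssum W (span (zf ` F)))" by (rule ssum_subspace[OF W subspace_span])
      moreover have "{v. \<exists>w\<in>W. \<exists>y\<in>span (zf ` F). v = w + y} = ssum W (span (zf ` F))"
        unfolding ssum_def by blast
      ultimately show "subspace {v. \<exists>w\<in>W. \<exists>y\<in>span (zf ` F). v = w + y}" by simp
      show "\<exists>w\<in>W. \<exists>y\<in>span (zf ` F). x = w + y" if "x \<in> F" for x
        using wz[OF that] that span_base by blast
    qed
    obtain w v where wv: "w \<in> W" "v \<in> span F" "z = w + v" using F(3) z ZsX by blast
    obtain w' y where wy: "w' \<in> W" "y \<in> span (zf ` F)" "v = w' + y" using sp[OF wv(2)] by blast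
    have "w + w' = z - y" using wv wy by (simp add: algebra_simps)
    moreover have "z - y \<in> Zs" using z wy zspan Zs subspace_diff by blast
    moreover have "w + w' \<in> W" using wv wy W subspace_add by blast
    ultimately have "w + w' = 0" using WZ by metis
    then have "z = y" using \<open>w + w' = z - y\<close> by simp
    then show "z \<in> span (zf ` F)" using wy by simp
  qed
  then obtain B where B: "finite B" "independent B" "span B = Zs"
      "\<And>x y. x \<in> B \<Longrightarrow> y \<in> B \<Longrightarrow> x \<noteq> y \<Longrightarrow> b x y = 0"
    using herm_diagonal_basis[OF Zs, of "zf ` F" b] F(1) herm_on_subset[OF h ZsX] by blast
  have BZ: "B \<subseteq> Zs" using B(3) span_superset by blast
  then have BX: "B \<subseteq> X" using ZsX by blast
  have BW: "b z w = 0" if "z \<in> B" "w \<in> W" for z w using that BZ by (auto simp: Zs_def)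
  define Zp Z0 Zm where "Zp = {z \<in> B. Re (b z z) > 0}" and "Z0 = {z \<in> B. Re (b z z) = 0}"
    and "Zm = {z \<in> B. Re (b z z) < 0}"
  have un: "Zp \<union> Z0 \<union> Zm = B" by (auto simp: Zp_def Z0_def Zm_def)
  have pW: "x \<in> W" if "x \<in> Wp" for x using that ssum_left[OF Wm] by blast
  have mW: "x \<in> W" if "x \<in> Wm" for x using that ssum_right[OF Wp] by blast
  obtain d1 where d1: "d1 > 0" "\<And>x s. x \<in> Wp \<Longrightarrow> s \<in> span Zp \<Longrightarrow> d1 * (nrm (x + s))\<^sup>2 \<le> Re (b (x + s) (x + s))"
  proof -
    have "\<exists>d>0. \<forall>x\<in>Wp. \<forall>s\<in>span Zp. d * (nrm (x + s))\<^sup>2 \<le> Re (b (x + s) (x + s))"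
      by (rule definite_extend[OF h Wp WpX p c])
         (use B BX BW pW in \<open>auto simp: Zp_def\<close>)
    then show ?thesis using that by blast
  qed
  obtain d2 where d2: "d2 > 0" "\<And>x s. x \<in> Wm \<Longrightarrow> s \<in> span Zm \<Longrightarrow> d2 * (nrm (x + s))\<^sup>2 \<le> Re (- b (x + s) (x + s))"
  proof -
    have "\<exists>d>0. \<forall>x\<in>Wm. \<forall>s\<in>span Zm. d * (nrm (x + s))\<^sup>2 \<le> Re (- b (x + s) (x + s))"
      by (rule definite_extend[OF herm_on_uminus[OF h] Wm WmX _ c])
         (use B BX BW mW q in \<open>fastforce simp: Zm_def\<close>)+
    then show ?thesis using that by blast
  qed
  define d where "d = min d1 d2"
  show thesis
  proof (rule that[of Zp Z0 Zm d])
    show "finite Zp" "finite Z0" "finite Zm" using B by (auto simp: Zp_def Z0_def Zm_def)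
    show "Zp \<inter> Z0 = {}" "Zp \<inter> Zm = {}" "Z0 \<inter> Zm = {}" by (auto simp: Zp_def Z0_def Zm_def)
    show "independent (Zp \<union> Z0 \<union> Zm)" "Zp \<union> Z0 \<union> Zm \<subseteq> X" using B BX un by auto
    show "v = 0" if "v \<in> span (Zp \<union> Z0 \<union> Zm)" "v \<in> W" for v using that WZ B(3) un by auto
    show "\<exists>w\<in>W. \<exists>v\<in>span (Zp \<union> Z0 \<union> Zm). x = w + v" if "x \<in> X" for x using dec[OF that] B(3) un by auto
    show "0 < d" using d1 d2 by (simp add: d_def)
    show "d * (nrm (p + s))\<^sup>2 \<le> Re (b (p + s) (p + s))" if "p \<in> Wp" "s \<in> span Zp" for p s
      using d1(2)[OF that] mult_right_mono[of d d1 "(nrm (p + s))\<^sup>2"] by (simp add: d_def)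
    show "Re (b (q + t) (q + t)) \<le> - d * (nrm (q + t))\<^sup>2" if "q \<in> Wm" "t \<in> span Zm" for q t
      using d2(2)[OF that] mult_right_mono[of d d2 "(nrm (q + t))\<^sup>2"] by (simp add: d_def)
    show "0 \<le> Re (b (p + s) (p + s))" if "p \<in> Wp" "s \<in> span (Zp \<union> Z0)" for p s
    proof (rule nonneg_extend[OF h Wp WpX _ _ _ _ _ _ that])
      show "0 \<le> Re (b x x)" if "x \<in> Wp" for x
        using p[OF that] c by (meson less_imp_le mult_nonneg_nonneg order_trans zero_le_power2)
    qed (use B BX BW pW in \<open>auto simp: Zp_def Z0_def\<close>)
    show "Re (b (q + t) (q + t)) \<le> 0" if "q \<in> Wm" "t \<in> span (Z0 \<union> Zm)" for q t
    proof -
      have "0 \<le> Re (- b (q + t) (q + t))"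
      proof (rule nonneg_extend[OF herm_on_uminus[OF h] Wm WmX _ _ _ _ _ _ that])
        show "0 \<le> Re (- b x x)" if "x \<in> Wm" for x
        proof -
          have "0 \<le> c * (nrm x)\<^sup>2" using c by simp
          then show ?thesis using q[OF that] by simp
        qed
      qed (use B BX BW mW in \<open>auto simp: Zm_def Z0_def\<close>)
      then show ?thesis by simp
    qed
    show "span Z0 = ker b"
    proof
      have zz: "b z v = 0" if z: "z \<in> Z0" and v: "v \<in> X" for z v
      proof -
        have zX: "z \<in> X" "z \<in> B" using z BX by (auto simp: Z0_def)
        obtain w y where wy: "w \<in> W" "y \<in> span B" "v = w + y" using dec[OF v] B(3) by blast
        have "b z x = 0" if "x \<in> B" for x
          using B(4)[OF zX(2) that] z herm_Im[OF sub h zX(1)]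
          by (cases "z = x") (auto simp: Z0_def complex_eq_iff)
        then have "b z y = 0" by (intro herm_orth_span[OF sub h BX zX(1) _ wy(2)])
        moreover have "y \<in> X" using wy B(3) ZsX by blast
        ultimately show ?thesis using BW[OF zX(2) wy(1)] herm_add_right[OF sub h _ _ zX(1), of w y] wy WX by auto
      qed
      have "subspace (ker b)"
        unfolding ker_def using sub
        by (intro subspaceI) (auto simp: herm_add_left[OF sub h] herm_scale_left[OF sub h] herm_zero_left[OF sub h])
      moreover have "Z0 \<subseteq> ker b" using zz BX by (auto simp: ker_def Z0_def)
      ultimately show "span Z0 \<subseteq> ker b" by (intro span_minimal)
      show "ker b \<subseteq> span Z0"
      proof
        fix v assume v: "v \<in> ker b"
        then have vX: "v \<in> X" and v0: "\<And>w. w \<in> X \<Longrightarrow> b v w = 0" by (auto simp: ker_def)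
        obtain w y where wy: "w \<in> W" "y \<in> Zs" "v = w + y" using dec[OF vX] by blast
        have X': "w \<in> X" "y \<in> X" using wy WX ZsX by auto
        have "w = 0"
        proof (rule kform_orth_decomp(2)[OF k wy(1)])
          fix u assume u: "u \<in> W"
          have "b v u = b w u + b y u" using herm_add_left[OF sub h X', of u] u WX wy by auto
          moreover have "b y u = 0" using wy u by (auto simp: Zs_def)
          ultimately show "b w u = 0" using v0[of u] u WX by auto
        qed
        then have "v \<in> span B" using wy B(3) by simp
        then obtain \<alpha> where \<alpha>: "v = (\<Sum>z\<in>B. \<alpha> z *C z)" unfolding span_finite[OF B(1)] by blast
        \<comment> \<open>Pairing a kernel element with a basis vector \<open>z\<close> isolates its
          coordinate, multiplied by \<open>b z z\<close>, which is nonzero outside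
          \<open>Z0\<close>.\<close>
        have "\<alpha> z = 0" if z: "z \<in> B" "z \<notin> Z0" for z
        proof -
          have zX: "z \<in> X" using z BX by blast
          have "0 = b v z" using v0[OF zX] by simp
          also have "\<dots> = (\<Sum>x\<in>B. b (\<alpha> x *C x) z)"
            unfolding \<alpha> using BX zX B(1) by (intro herm_sum_left[OF sub h]) auto
          also have "\<dots> = (\<Sum>x\<in>B. if x = z then \<alpha> z * b z z else 0)"
            using B(4) z BX zX by (intro sum.cong) (auto simp: herm_scale_left[OF sub h] subset_iff)
          also have "\<dots> = \<alpha> z * b z z" using B(1) z by simp
          finally show ?thesis using z by (auto simp: Z0_def)
        qed
        then have "v = (\<Sum>z\<in>Z0. \<alpha> z *C z)"
          unfolding \<alpha> using B(1) by (intro sum.mono_neutral_right) (auto simp: Z0_def)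
        then show "v \<in> span Z0" by (auto intro: span_sum span_scale span_base)
      qed
    qed
  qed
qed

abbreviation ixW :: "('v \<Rightarrow> 'v \<Rightarrow> complex) \<Rightarrow> nat" where "ixW b \<equiv> ix X Wp Wm b"

lemma shift_quad: "v \<in> X \<Longrightarrow> Re (shift b s v v) = Re (b v v) - s * (nrm v)\<^sup>2"
  by (simp add: shift_def ip_self power2_eq_square)

lemma kform_shift:
  assumes "kform b K c" "\<bar>s\<bar> < c" shows "kform (shift b s) (K + \<bar>s\<bar>) (c - \<bar>s\<bar>)"
  unfolding kform_def
proof (intro conjI ballI)
  show "bform (shift b s) (K + \<bar>s\<bar>)" using assms by (auto simp: kform_def bform_shift)
  show "0 < c - \<bar>s\<bar>" using assms by simp
  fix p assume p: "p \<in> Wp"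
  have "c * (nrm p)\<^sup>2 \<le> Re (b p p)" using assms p by (auto simp: kform_def)
  moreover have "s * (nrm p)\<^sup>2 \<le> \<bar>s\<bar> * (nrm p)\<^sup>2" by (intro mult_right_mono) auto
  ultimately show "(c - \<bar>s\<bar>) * (nrm p)\<^sup>2 \<le> Re (shift b s p p)"
    using p WpX by (auto simp: shift_quad left_diff_distrib)
next
  fix q assume q: "q \<in> Wm"
  have "Re (b q q) \<le> - c * (nrm q)\<^sup>2" using assms q by (auto simp: kform_def)
  moreover have "- s * (nrm q)\<^sup>2 \<le> \<bar>s\<bar> * (nrm q)\<^sup>2" by (intro mult_right_mono) auto
  ultimately show "Re (shift b s q q) \<le> - (c - \<bar>s\<bar>) * (nrm q)\<^sup>2"
    using q WmX by (auto simp: shift_quad left_diff_distrib)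
qed

lemma span_X: "S \<subseteq> X \<Longrightarrow> v \<in> span S \<Longrightarrow> v \<in> X"
  using span_minimal[OF _ sub] by blast

text \<open>Subtracting a small positive multiple of the inner product makes the kernel directions
  negative, so \<open>Z0\<close> changes sides; for a small nonpositive shift they stay nonnegative.
  The strictly signed directions have a margin \<open>d\<close> and do not move.\<close>

lemma ix_shift_near:
  assumes k: "kform b K c"
  obtains d where "0 < d" "\<And>s. 0 < s \<Longrightarrow> s < d \<Longrightarrow> ixW (shift b s) + dim (ker b) = ixW b"
    "\<And>s. - d < s \<Longrightarrow> s \<le> 0 \<Longrightarrow> ixW (shift b s) = ixW b"
proof -
  obtain Zp Z0 Zm d where Z: "finite Zp" "finite Z0" "finite Zm" "Zp \<inter> Z0 = {}" "Zp \<inter> Zm = {}" "Z0 \<inter> Zm = {}"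
    "independent (Zp \<union> Z0 \<union> Zm)" "Zp \<union> Z0 \<union> Zm \<subseteq> X"
    and ZW: "\<And>v. v \<in> span (Zp \<union> Z0 \<union> Zm) \<Longrightarrow> v \<in> W \<Longrightarrow> v = 0"
    and gen: "\<And>x. x \<in> X \<Longrightarrow> \<exists>w\<in>W. \<exists>v\<in>span (Zp \<union> Z0 \<union> Zm). x = w + v"
    and d: "0 < d"
    and dp: "\<And>p s. p \<in> Wp \<Longrightarrow> s \<in> span Zp \<Longrightarrow> d * (nrm (p + s))\<^sup>2 \<le> Re (b (p + s) (p + s))"
    and dm: "\<And>q t. q \<in> Wm \<Longrightarrow> t \<in> span Zm \<Longrightarrow> Re (b (q + t) (q + t)) \<le> - d * (nrm (q + t))\<^sup>2"
    and np: "\<And>p s. p \<in> Wp \<Longrightarrow> s \<in> span (Zp \<union> Z0) \<Longrightarrow> 0 \<le> Re (b (p + s) (p + s))"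
    and nm: "\<And>q t. q \<in> Wm \<Longrightarrow> t \<in> span (Z0 \<union> Zm) \<Longrightarrow> Re (b (q + t) (q + t)) \<le> 0"
    and ker: "span Z0 = ker b"
    by (fact kform_diagonal[OF k])
  have iZ0: "independent Z0" by (rule independent_mono[OF Z(7)]) auto
  have dimk: "dim (ker b) = card Z0" using dim_span_eq_card_independent[OF iZ0] ker by simp
  have pX: "p + s \<in> X" if "p \<in> Wp" "s \<in> span S" "S \<subseteq> Zp \<union> Z0 \<union> Zm" for p s S
    using that WpX span_X[of S s] Z(8) by blast
  have mX: "p + s \<in> X" if "p \<in> Wm" "s \<in> span S" "S \<subseteq> Zp \<union> Z0 \<union> Zm" for p s S
    using that WmX span_X[of S s] Z(8) by blast
  have right: "pos_split X Wp Wm (shift b s) Zp (Z0 \<union> Zm)" if s: "0 < s" "s < d" for s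
    unfolding pos_split_def
  proof (intro conjI ballI impI)
    have un: "Zp \<union> (Z0 \<union> Zm) = Zp \<union> Z0 \<union> Zm" by blast
    show "finite Zp" "finite (Z0 \<union> Zm)" "Zp \<inter> (Z0 \<union> Zm) = {}" "independent (Zp \<union> (Z0 \<union> Zm))"
      "Zp \<union> (Z0 \<union> Zm) \<subseteq> X" using Z unfolding un by auto
    show "v = 0" if "v \<in> span (Zp \<union> (Z0 \<union> Zm))" "v \<in> W" for v using that ZW unfolding un by blast
    show "\<exists>w\<in>W. \<exists>v\<in>span (Zp \<union> (Z0 \<union> Zm)). x = w + v" if "x \<in> X" for x using that gen unfolding un by blast
    show "0 \<le> Re (shift b s (p + v) (p + v))" if "p \<in> Wp" "v \<in> span Zp" for p v
    proof -
      have "s * (nrm (p + v))\<^sup>2 \<le> d * (nrm (p + v))\<^sup>2" using s by (intro mult_right_mono) auto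
      then show ?thesis using dp[OF that] shift_quad[of "p + v"] pX[OF that] by force
    qed
    show "Re (shift b s (q + t) (q + t)) < 0" if "q \<in> Wm" "t \<in> span (Z0 \<union> Zm)" "q + t \<noteq> 0" for q t
    proof -
      have x: "q + t \<in> X" using mX[OF that(1,2)] by blast
      have "0 < s * (nrm (q + t))\<^sup>2" using s nrm_pos[OF x that(3)] by simp
      then show ?thesis using nm[OF that(1,2)] shift_quad[OF x] by simp
    qed
  qed
  have left: "pos_split X Wp Wm (shift b s) (Zp \<union> Z0) Zm" if s: "- d < s" "s \<le> 0" for s
    unfolding pos_split_def
  proof (intro conjI ballI impI)
    show "finite (Zp \<union> Z0)" "finite Zm" "(Zp \<union> Z0) \<inter> Zm = {}" "independent (Zp \<union> Z0 \<union> Zm)"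
      "Zp \<union> Z0 \<union> Zm \<subseteq> X" using Z by auto
    show "v = 0" if "v \<in> span (Zp \<union> Z0 \<union> Zm)" "v \<in> W" for v using that ZW by blast
    show "\<exists>w\<in>W. \<exists>v\<in>span (Zp \<union> Z0 \<union> Zm). x = w + v" if "x \<in> X" for x using that gen by blast
    show "0 \<le> Re (shift b s (p + v) (p + v))" if "p \<in> Wp" "v \<in> span (Zp \<union> Z0)" for p v
    proof -
      have "s * (nrm (p + v))\<^sup>2 \<le> 0" using s by (intro mult_nonpos_nonneg) auto
      then show ?thesis using np[OF that] shift_quad[of "p + v"] pX[OF that] by force
    qed
    show "Re (shift b s (q + t) (q + t)) < 0" if "q \<in> Wm" "t \<in> span Zm" "q + t \<noteq> 0" for q t
    proof -
      have x: "q + t \<in> X" using mX[OF that(1,2)] by blast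
      have "- s * (nrm (q + t))\<^sup>2 < d * (nrm (q + t))\<^sup>2"
        using s nrm_pos[OF x that(3)] by (intro mult_strict_right_mono) auto
      then show ?thesis using dm[OF that(1,2)] shift_quad[OF x] by simp
    qed
  qed
  have ix0: "ixW b = card Zp + card Z0"
    using ix_eq[OF Wp Wm left[of 0]] d Z by (simp add: card_Un_disjoint)
  show thesis
  proof (rule that[OF d])
    show "ixW (shift b s) + dim (ker b) = ixW b" if "0 < s" "s < d" for s
      using ix_eq[OF Wp Wm right[OF that]] ix0 dimk by simp
    show "ixW (shift b s) = ixW b" if "- d < s" "s \<le> 0" for s
      using ix_eq[OF Wp Wm left[OF that]] ix0 Z by (simp add: card_Un_disjoint)
  qed
qed

lemma kform_ker_basis:
  assumes k: "kform b K c"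
  obtains B where "finite B" "independent B" "span B = ker b"
proof -
  obtain Zp Z0 Zm where Z: "finite Z0" "independent (Zp \<union> Z0 \<union> Zm)" "span Z0 = ker b"
    by (rule kform_diagonal[OF k]) blast
  have "independent Z0" by (rule independent_mono[OF Z(2)]) auto
  then show thesis using that Z by blast
qed

lemma dim_ker_eq_0:
  assumes k: "kform b K c" shows "dim (ker b) = 0 \<longleftrightarrow> ker b = {0}"
proof -
  obtain B where B: "finite B" "independent B" "span B = ker b" by (rule kform_ker_basis[OF k])
  have "dim (ker b) = card B" using dim_span_eq_card_independent[OF B(2)] B(3) by simp
  moreover have "ker b = {0} \<Longrightarrow> B = {}"
    using B span_superset[of B] dependent_zero[of B] by auto
  ultimately show ?thesis using B by (auto simp: card_eq_0_iff)
qed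

text \<open>Without kernel both halves of the normal form have a margin \<open>d\<close>, so the
  same \<open>Zp\<close>, \<open>Zm\<close> split every form whose quadratic form differs by at most
  \<open>d/2\<close> times the squared norm. The perturbed form then has uniformly definite halves
  as well, which gives invertibility.\<close>

lemma nondegenerate_stable:
  assumes k: "kform b K c" and nd: "ker b = {0}"
  obtains d where "0 < d"
    "\<And>b'. (\<And>v. v \<in> X \<Longrightarrow> \<bar>Re (b' v v) - Re (b v v)\<bar> \<le> d * (nrm v)\<^sup>2) \<Longrightarrow> ixW b' = ixW b"
    "\<And>b' K'. bform b' K' \<Longrightarrow> (\<And>v. v \<in> X \<Longrightarrow> \<bar>Re (b' v v) - Re (b v v)\<bar> \<le> d * (nrm v)\<^sup>2) \<Longrightarrow> bij_form b'"
proof -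
  obtain Zp Z0 Zm d where Z: "finite Zp" "finite Z0" "finite Zm" "Zp \<inter> Z0 = {}" "Zp \<inter> Zm = {}" "Z0 \<inter> Zm = {}"
    "independent (Zp \<union> Z0 \<union> Zm)" "Zp \<union> Z0 \<union> Zm \<subseteq> X"
    and ZW: "\<And>v. v \<in> span (Zp \<union> Z0 \<union> Zm) \<Longrightarrow> v \<in> W \<Longrightarrow> v = 0"
    and gen: "\<And>x. x \<in> X \<Longrightarrow> \<exists>w\<in>W. \<exists>v\<in>span (Zp \<union> Z0 \<union> Zm). x = w + v"
    and d: "0 < d"
    and dp: "\<And>p s. p \<in> Wp \<Longrightarrow> s \<in> span Zp \<Longrightarrow> d * (nrm (p + s))\<^sup>2 \<le> Re (b (p + s) (p + s))"
    and dm: "\<And>q t. q \<in> Wm \<Longrightarrow> t \<in> span Zm \<Longrightarrow> Re (b (q + t) (q + t)) \<le> - d * (nrm (q + t))\<^sup>2"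
    and "\<And>p s. p \<in> Wp \<Longrightarrow> s \<in> span (Zp \<union> Z0) \<Longrightarrow> 0 \<le> Re (b (p + s) (p + s))"
    and "\<And>q t. q \<in> Wm \<Longrightarrow> t \<in> span (Z0 \<union> Zm) \<Longrightarrow> Re (b (q + t) (q + t)) \<le> 0"
    and ker: "span Z0 = ker b"
    by (fact kform_diagonal[OF k])
  have iZ0: "independent Z0" by (rule independent_mono[OF Z(7)]) auto
  have Z0: "Z0 = {}" using ker nd span_superset[of Z0] iZ0 dependent_zero[of Z0] by auto
  have un: "Zp \<union> Z0 \<union> Zm = Zp \<union> Zm" using Z0 by simp
  have pX: "p + s \<in> X" if "p \<in> Wp" "s \<in> span Zp" for p s
    using that WpX span_X[of Zp s] Z(8) by blast
  have mX: "p + s \<in> X" if "p \<in> Wm" "s \<in> span Zm" for p s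
    using that WmX span_X[of Zm s] Z(8) by blast
  have lower: "d / 2 * (nrm (p + s))\<^sup>2 \<le> Re (b' (p + s) (p + s))"
    if cl: "\<And>v. v \<in> X \<Longrightarrow> \<bar>Re (b' v v) - Re (b v v)\<bar> \<le> d / 2 * (nrm v)\<^sup>2" and "p \<in> Wp" "s \<in> span Zp" for b' p s
    using cl[OF pX[OF that(2,3)]] dp[OF that(2,3)] by linarith
  have upper: "Re (b' (q + t) (q + t)) \<le> - (d / 2) * (nrm (q + t))\<^sup>2"
    if cl: "\<And>v. v \<in> X \<Longrightarrow> \<bar>Re (b' v v) - Re (b v v)\<bar> \<le> d / 2 * (nrm v)\<^sup>2" and "q \<in> Wm" "t \<in> span Zm" for b' q t
    using cl[OF mX[OF that(2,3)]] dm[OF that(2,3)] by linarith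
  have split: "pos_split X Wp Wm b' Zp Zm"
    if cl: "\<And>v. v \<in> X \<Longrightarrow> \<bar>Re (b' v v) - Re (b v v)\<bar> \<le> d / 2 * (nrm v)\<^sup>2" for b'
    unfolding pos_split_def
  proof (intro conjI ballI impI)
    show "finite Zp" "finite Zm" "Zp \<inter> Zm = {}" "independent (Zp \<union> Zm)" "Zp \<union> Zm \<subseteq> X"
      using Z unfolding un by auto
    show "v = 0" if "v \<in> span (Zp \<union> Zm)" "v \<in> W" for v using that ZW unfolding un by blast
    show "\<exists>w\<in>W. \<exists>v\<in>span (Zp \<union> Zm). x = w + v" if "x \<in> X" for x using that gen unfolding un by blast
    show "0 \<le> Re (b' (p + s) (p + s))" if "p \<in> Wp" "s \<in> span Zp" for p s
    proof -
      have "0 \<le> d / 2 * (nrm (p + s))\<^sup>2" using d by simp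
      also have "\<dots> \<le> Re (b' (p + s) (p + s))" using lower[of b', OF cl that] by blast
      finally show ?thesis .
    qed
    show "Re (b' (q + t) (q + t)) < 0" if "q \<in> Wm" "t \<in> span Zm" "q + t \<noteq> 0" for q t
    proof -
      have "0 < d / 2 * (nrm (q + t))\<^sup>2" using d nrm_pos[OF mX[OF that(1,2)] that(3)] by simp
      moreover have "Re (b' (q + t) (q + t)) \<le> - (d / 2) * (nrm (q + t))\<^sup>2"
        using upper[of b', OF cl that(1,2)] by blast
      ultimately show ?thesis by simp
    qed
  qed
  show thesis
  proof (rule that[of "d/2"])
    show "0 < d / 2" using d by simp
    show "ixW b' = ixW b" if "\<And>v. v \<in> X \<Longrightarrow> \<bar>Re (b' v v) - Re (b v v)\<bar> \<le> d / 2 * (nrm v)\<^sup>2" for b'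
    proof -
      have sb: "pos_split X Wp Wm b Zp Zm" by (rule split) (use d in simp)
      show ?thesis using ix_eq[OF Wp Wm sb] ix_eq[OF Wp Wm split[of b', OF that]] by simp
    qed
    show "bij_form b'" if bf: "bform b' K'"
      and cl: "\<And>v. v \<in> X \<Longrightarrow> \<bar>Re (b' v v) - Re (b v v)\<bar> \<le> d / 2 * (nrm v)\<^sup>2" for b' K'
    proof (rule bounded_below_imp_bij[OF bf, of "d/2/2"])
      show "0 < d / 2 / 2" using d by simp
      fix v assume "v \<in> X"
      then obtain p q s t where v: "v = (p + q) + (s + t)" "p \<in> Wp" "q \<in> Wm" "s \<in> span Zp" "t \<in> span Zm"
        using gen[of v] unfolding un span_Un by (auto elim!: ssumE)
      have v': "v = (p + s) + (q + t)" using v(1) by (simp add: algebra_simps)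
      show "d / 2 / 2 * nrm v \<le> nrm (rep b' v)"
      proof (rule definite_splitting_bounded_below[OF bf _ _ _ _ _ v'])
        show "ssum Wp (span Zp) \<subseteq> X" "ssum Wm (span Zm) \<subseteq> X" using pX mX by (auto elim!: ssumE)
        show "p + s \<in> ssum Wp (span Zp)" "q + t \<in> ssum Wm (span Zm)" using v by (auto intro: ssumI)
        show "d / 2 * (nrm x)\<^sup>2 \<le> Re (b' x x)" if "x \<in> ssum Wp (span Zp)" for x
          using that lower[of b', OF cl] by (auto elim!: ssumE)
        show "Re (b' x x) \<le> - (d / 2) * (nrm x)\<^sup>2" if "x \<in> ssum Wm (span Zm)" for x
          using that upper[of b', OF cl] by (auto elim!: ssumE)
      qed (use d in simp)
    qed
  qed
qed

text \<open>The Fredholm alternative inside the window: the nontrivial direction is stability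
  applied to the unperturbed form itself.\<close>

lemma bij_iff_ker:
  assumes k: "kform b K c" shows "bij_form b \<longleftrightarrow> ker b = {0}"
proof
  assume bij: "bij_form b"
  have bf: "bform b K" using k by (simp add: kform_def)
  have z: "0 \<in> X \<and> (\<forall>w\<in>X. b 0 w = ip 0 w)"
    using ip_simps(9) herm_zero_left[OF sub bform_herm[OF bf]] by simp
  have "v = 0" if "v \<in> ker b" for v
  proof -
    have "v \<in> X \<and> (\<forall>w\<in>X. b v w = ip 0 w)" using that ip_simps(9) by (simp add: ker_def)
    then show ?thesis using bij[unfolded bij_form_def, rule_format, of 0] z by auto
  qed
  moreover have "0 \<in> ker b" using herm_zero_left[OF sub bform_herm[OF bf]] by (simp add: ker_def)
  ultimately show "ker b = {0}" by blast
next
  assume nd: "ker b = {0}"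
  obtain d where d: "0 < d" "\<And>b' K'. bform b' K' \<Longrightarrow>
      (\<And>v. v \<in> X \<Longrightarrow> \<bar>Re (b' v v) - Re (b v v)\<bar> \<le> d * (nrm v)\<^sup>2) \<Longrightarrow> bij_form b'"
    by (rule nondegenerate_stable[OF k nd]) blast
  show "bij_form b" using d(2)[of b K] k d(1) by (simp add: kform_def)
qed

section \<open>Spectrum in the window and jumps of the index\<close>

definition spc :: "('v \<Rightarrow> 'v \<Rightarrow> complex) \<Rightarrow> real set" where
  "spc b = {s. \<not> bij_form (shift b s)}"

lemma spc_iff:
  assumes "kform b K c" "\<bar>s\<bar> < c"
  shows "s \<in> spc b \<longleftrightarrow> dim (ker (shift b s)) \<noteq> 0"
  unfolding spc_def using bij_iff_ker[OF kform_shift[OF assms]] dim_ker_eq_0[OF kform_shift[OF assms]] by simp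

lemma ix_shift_local:
  assumes k: "kform b K c" and s: "\<bar>s\<bar> < c"
  obtains d where "0 < d" "\<And>s'. s < s' \<Longrightarrow> s' < s + d \<Longrightarrow> ixW (shift b s') + dim (ker (shift b s)) = ixW (shift b s)"
    "\<And>s'. s - d < s' \<Longrightarrow> s' \<le> s \<Longrightarrow> ixW (shift b s') = ixW (shift b s)"
proof -
  obtain d where d: "0 < d" "\<And>t. 0 < t \<Longrightarrow> t < d \<Longrightarrow> ixW (shift (shift b s) t) + dim (ker (shift b s)) = ixW (shift b s)"
    "\<And>t. - d < t \<Longrightarrow> t \<le> 0 \<Longrightarrow> ixW (shift (shift b s) t) = ixW (shift b s)"
    by (fact ix_shift_near[OF kform_shift[OF k s]])
  show thesis
  proof (rule that[OF d(1)])
    show "ixW (shift b s') + dim (ker (shift b s)) = ixW (shift b s)" if "s < s'" "s' < s + d" for s'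
      using d(2)[of "s' - s"] that by (simp add: shift_shift)
    show "ixW (shift b s') = ixW (shift b s)" if "s - d < s'" "s' \<le> s" for s'
      using d(3)[of "s' - s"] that by (simp add: shift_shift)
  qed
qed

text \<open>On each side of \<open>s\<close> the index is locally constant in the shift parameter. A
  spectral point there would have a nontrivial kernel and hence force a jump of the index.\<close>

lemma spc_isolated:
  assumes k: "kform b K c" and s: "\<bar>s\<bar> < c"
  obtains d where "0 < d" "\<And>s'. s' \<noteq> s \<Longrightarrow> \<bar>s' - s\<bar> < d \<Longrightarrow> s' \<notin> spc b"
proof -
  obtain d where d: "0 < d" "\<And>s'. s < s' \<Longrightarrow> s' < s + d \<Longrightarrow> ixW (shift b s') + dim (ker (shift b s)) = ixW (shift b s)"
    "\<And>s'. s - d < s' \<Longrightarrow> s' \<le> s \<Longrightarrow> ixW (shift b s') = ixW (shift b s)"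
    by (fact ix_shift_local[OF k s])
  define e where "e = min d (c - \<bar>s\<bar>)"
  have e: "s' \<notin> spc b" if s': "s' \<noteq> s" "\<bar>s' - s\<bar> < e" for s'
  proof -
    have a: "\<bar>s'\<bar> < c" using s' by (auto simp: e_def)
    obtain d' where d': "0 < d'"
      "\<And>s''. s' < s'' \<Longrightarrow> s'' < s' + d' \<Longrightarrow> ixW (shift b s'') + dim (ker (shift b s')) = ixW (shift b s')"
      by (rule ix_shift_local[OF k a]) blast
    \<comment> \<open>\<open>m\<close> stays on the same side of \<open>s\<close> as
      \<open>s'\<close>, so that the midpoint \<open>s''\<close> is controlled both by the constancy
      around \<open>s\<close> and by the jump formula at \<open>s'\<close>.\<close>
    define m where "m = min (s' + d') (if s' < s then s else s + d)"
    define s'' where "s'' = (s' + m) / 2"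
    have m: "s' < m" "m \<le> s' + d'" "s' < s \<Longrightarrow> m \<le> s" "\<not> s' < s \<Longrightarrow> m \<le> s + d"
      using d' s' by (auto simp: m_def e_def)
    have s'': "s' < s''" "s'' < m" using m(1) by (auto simp: s''_def)
    have "ixW (shift b s'') + dim (ker (shift b s')) = ixW (shift b s')"
      by (rule d'(2)) (use m s'' in auto)
    moreover have "ixW (shift b s'') = ixW (shift b s')"
    proof (cases "s' < s")
      case True
      have l: "s - d < s'" using True s' by (auto simp: e_def)
      have "ixW (shift b s'') = ixW (shift b s)" by (rule d(3)) (use True l m(3) s'' in auto)
      moreover have "ixW (shift b s') = ixW (shift b s)" by (rule d(3)) (use True l in auto)
      ultimately show ?thesis by simp
    next
      case False
      then have l: "s < s'" "s' < s + d" using s' by (auto simp: e_def)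
      have "ixW (shift b s'') + dim (ker (shift b s)) = ixW (shift b s)"
        by (rule d(2)) (use False l m(4) s'' in auto)
      moreover have "ixW (shift b s') + dim (ker (shift b s)) = ixW (shift b s)" by (rule d(2)[OF l])
      ultimately show ?thesis by simp
    qed
    ultimately show ?thesis using spc_iff[OF k a] by simp
  qed
  have "0 < e" using d(1) s by (simp add: e_def)
  then show thesis using e by (rule that)
qed

lemma finite_spc:
  assumes k: "kform b K c" and a: "a < c"
  shows "finite (spc b \<inter> {-a..a})"
proof -
  have "finite ({-a..a} \<inter> spc b)"
  proof (rule finite_not_islimpt_in_compact)
    show "compact {-a..a}" by simp
    fix s assume "s \<in> {-a..a}"
    then have "\<bar>s\<bar> < c" using a by auto
    from spc_isolated[OF k this] obtain d where "0 < d" "\<And>s'. s' \<noteq> s \<Longrightarrow> \<bar>s' - s\<bar> < d \<Longrightarrow> s' \<notin> spc b" by blast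
    then show "\<not> s islimpt spc b" unfolding islimpt_approachable dist_real_def by blast
  qed
  then show ?thesis by (simp add: Int_commute)
qed

text \<open>The function \<open>g\<close>, the count over \<open>[0, x)\<close> plus the index of
  the form shifted by \<open>x\<close>, is locally constant: passing a spectral point adds to the
  count precisely what the index loses. Comparing the ends of \<open>[0, a]\<close> expresses the
  spectral count as an index difference.\<close>

lemma sum_dim_ker_eq_ix_diff:
  assumes k: "kform b K c" and a: "0 \<le> a" "a < c"
  shows "(\<Sum>s\<in>spc b \<inter> {0..<a}. dim (ker (shift b s))) + ixW (shift b a) = ixW b"
proof -
  define E where "E s = dim (ker (shift b s))" for s
  define g where "g x = (\<Sum>s\<in>spc b \<inter> {0..<x}. E s) + ixW (shift b x)" for x
  have fin: "finite (spc b \<inter> {0..<x})" if "x \<le> a" for x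
    by (rule finite_subset[OF _ finite_spc[OF k a(2)]]) (use that in auto)
  have "g 0 = g a"
  proof (rule connected_local_const[of "{0..a}"])
    show "connected {0..a}" by simp
    show "0 \<in> {0..a}" "a \<in> {0..a}" using a by auto
    show "\<forall>x\<in>{0..a}. eventually (\<lambda>y. g x = g y) (at x within {0..a})"
    proof
      fix x assume x: "x \<in> {0..a}"
      then have xc: "\<bar>x\<bar> < c" using a by auto
      obtain d1 where d1: "0 < d1" "\<And>s'. x < s' \<Longrightarrow> s' < x + d1 \<Longrightarrow> ixW (shift b s') + E x = ixW (shift b x)"
        "\<And>s'. x - d1 < s' \<Longrightarrow> s' \<le> x \<Longrightarrow> ixW (shift b s') = ixW (shift b x)"
        unfolding E_def by (fact ix_shift_local[OF k xc])
      obtain d2 where d2: "0 < d2" "\<And>s'. s' \<noteq> x \<Longrightarrow> \<bar>s' - x\<bar> < d2 \<Longrightarrow> s' \<notin> spc b"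
        by (fact spc_isolated[OF k xc])
      have "g x = g y" if y: "y \<in> {0..a}" "y \<noteq> x" "dist y x < min d1 d2" for y
      proof (cases "x < y")
        case True
        have "ixW (shift b y) + E x = ixW (shift b x)" using d1(2)[OF True] y by (auto simp: dist_real_def)
        moreover have "(\<Sum>s\<in>spc b \<inter> {0..<y}. E s) = (\<Sum>s\<in>spc b \<inter> {0..<x}. E s) + E x"
        proof (cases "x \<in> spc b")
          case xs: True
          have "spc b \<inter> {0..<y} = insert x (spc b \<inter> {0..<x})"
          proof -
            have f: "s = x \<or> s < x" if "s \<in> spc b" "s < y" for s
              using d2(2)[of s] that y by (cases s x rule: linorder_cases) (auto simp: dist_real_def)
            show ?thesis using xs x True by (auto dest: f)
          qed
          then show ?thesis using fin[of x] x by simp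
        next
          case xs: False
          have "spc b \<inter> {0..<y} = spc b \<inter> {0..<x}"
          proof -
            have f: "s < x" if "s \<in> spc b" "s < y" for s
              using d2(2)[of s] that y xs by (cases s x rule: linorder_cases) (auto simp: dist_real_def)
            show ?thesis using True by (auto dest: f)
          qed
          moreover have "E x = 0" using xs spc_iff[OF k xc] by (simp add: E_def)
          ultimately show ?thesis by simp
        qed
        ultimately show ?thesis by (simp add: g_def)
      next
        case False
        then have "y < x" using y by simp
        have "ixW (shift b y) = ixW (shift b x)" using d1(3)[of y] y False by (auto simp: dist_real_def)
        moreover have "spc b \<inter> {0..<y} = spc b \<inter> {0..<x}"
        proof -
          have f: "s < y" if "s \<in> spc b" "s < x" for s
            using d2(2)[of s] that y \<open>y < x\<close> by (cases s y rule: linorder_cases) (auto simp: dist_real_def)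
          show ?thesis using \<open>y < x\<close> by (auto dest: f)
        qed
        ultimately show ?thesis by (simp add: g_def)
      qed
      then show "eventually (\<lambda>y. g x = g y) (at x within {0..a})"
        unfolding eventually_at using d1(1) d2(1) by (intro exI[of _ "min d1 d2"]) auto
    qed
  qed
  then show ?thesis by (simp add: g_def E_def)
qed

text \<open>While the threshold \<open>a\<close> avoids the spectrum the shifted form has no kernel,
  so stability makes its index locally constant along a connected parameter interval.\<close>

lemma ix_const_on_path:
  fixes b :: "real \<Rightarrow> 'v \<Rightarrow> 'v \<Rightarrow> complex"
  assumes k: "\<And>t. t \<in> {u..v} \<Longrightarrow> kform (b t) K c" and a: "\<bar>a\<bar> < c" and uv: "u \<le> v"
    and cont: "\<And>t e. t \<in> {u..v} \<Longrightarrow> 0 < e \<Longrightarrow> \<exists>d>0. \<forall>t'\<in>{u..v}. \<bar>t' - t\<bar> < d \<longrightarrow>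
        (\<forall>x\<in>X. \<bar>Re (b t' x x) - Re (b t x x)\<bar> \<le> e * (nrm x)\<^sup>2)"
    and nsp: "\<And>t. t \<in> {u..v} \<Longrightarrow> a \<notin> spc (b t)"
  shows "ixW (shift (b u) a) = ixW (shift (b v) a)"
proof (rule connected_local_const[of "{u..v}" u v "\<lambda>t. ixW (shift (b t) a)"])
  show "connected {u..v}" by simp
  show "u \<in> {u..v}" "v \<in> {u..v}" using uv by auto
  show "\<forall>t\<in>{u..v}. eventually (\<lambda>t'. ixW (shift (b t) a) = ixW (shift (b t') a)) (at t within {u..v})"
  proof
    fix t assume t: "t \<in> {u..v}"
    note ks = kform_shift[OF k[OF t] a]
    have "ker (shift (b t) a) = {0}" using nsp[OF t] bij_iff_ker[OF ks] by (simp add: spc_def)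
    then obtain d where d: "0 < d"
      "\<And>b'. (\<And>v. v \<in> X \<Longrightarrow> \<bar>Re (b' v v) - Re (shift (b t) a v v)\<bar> \<le> d * (nrm v)\<^sup>2) \<Longrightarrow> ixW b' = ixW (shift (b t) a)"
      by (rule nondegenerate_stable[OF ks]) blast
    obtain e where e: "e > 0" "\<And>t' x. t' \<in> {u..v} \<Longrightarrow> \<bar>t' - t\<bar> < e \<Longrightarrow> x \<in> X \<Longrightarrow>
        \<bar>Re (b t' x x) - Re (b t x x)\<bar> \<le> d * (nrm x)\<^sup>2"
      using cont[OF t d(1)] by blast
    show "eventually (\<lambda>t'. ixW (shift (b t) a) = ixW (shift (b t') a)) (at t within {u..v})"
      unfolding eventually_at
    proof (intro exI[of _ e] conjI ballI impI)
      fix t' assume t': "t' \<in> {u..v}" "t' \<noteq> t \<and> dist t' t < e"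
      have "ixW (shift (b t') a) = ixW (shift (b t) a)"
        by (rule d(2)) (use e(2)[OF t'(1)] t'(2) in \<open>auto simp: shift_quad dist_real_def\<close>)
      then show "ixW (shift (b t) a) = ixW (shift (b t') a)" by simp
    qed (rule e)
  qed
qed

lemma local_admissible:
  fixes b :: "real \<Rightarrow> 'v \<Rightarrow> 'v \<Rightarrow> complex"
  assumes k: "\<And>t. t \<in> I \<Longrightarrow> kform (b t) K c" and t: "t \<in> I"
    and cont: "\<And>t e. t \<in> I \<Longrightarrow> 0 < e \<Longrightarrow> \<exists>d>0. \<forall>t'\<in>I. \<bar>t' - t\<bar> < d \<longrightarrow>
        (\<forall>x\<in>X. \<bar>Re (b t' x x) - Re (b t x x)\<bar> \<le> e * (nrm x)\<^sup>2)"
  shows "\<exists>a d. 0 < a \<and> a < c \<and> 0 < d \<and> (\<forall>t'\<in>I. \<bar>t' - t\<bar> < d \<longrightarrow> a \<notin> spc (b t') \<and> - a \<notin> spc (b t'))"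
proof -
  have c: "c > 0" using k[OF t] by (simp add: kform_def)
  have "\<bar>0\<bar> < c" using c by simp
  from spc_isolated[OF k[OF t] this] obtain d0 where d0: "0 < d0"
    "\<And>s'. s' \<noteq> 0 \<Longrightarrow> \<bar>s' - 0\<bar> < d0 \<Longrightarrow> s' \<notin> spc (b t)" by blast
  \<comment> \<open>0 itself may be spectral; the two points of absolute value \<open>a\<close> only
    have to lie within its isolation radius and inside the window.\<close>
  define a where "a = min d0 c / 2"
  have a: "0 < a" "a < c" "a < d0" using c d0 by (auto simp: a_def min_def)
  have st: "\<exists>d>0. \<forall>t'\<in>I. \<bar>t' - t\<bar> < d \<longrightarrow> r \<notin> spc (b t')" if r: "\<bar>r\<bar> = a" for r
  proof -
    have rc: "\<bar>r\<bar> < c" "r \<noteq> 0" "\<bar>r\<bar> < d0" using r a by auto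
    note ks = kform_shift[OF k[OF t] rc(1)]
    have "r \<notin> spc (b t)" using d0(2)[of r] rc by simp
    then have "ker (shift (b t) r) = {0}" using bij_iff_ker[OF ks] by (simp add: spc_def)
    then obtain d where d: "0 < d"
      "\<And>b' K'. bform b' K' \<Longrightarrow> (\<And>v. v \<in> X \<Longrightarrow> \<bar>Re (b' v v) - Re (shift (b t) r v v)\<bar> \<le> d * (nrm v)\<^sup>2) \<Longrightarrow> bij_form b'"
      by (rule nondegenerate_stable[OF ks]) blast
    obtain e where e: "e > 0" "\<And>t' x. t' \<in> I \<Longrightarrow> \<bar>t' - t\<bar> < e \<Longrightarrow> x \<in> X \<Longrightarrow>
        \<bar>Re (b t' x x) - Re (b t x x)\<bar> \<le> d * (nrm x)\<^sup>2"
      using cont[OF t d(1)] by blast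
    have "r \<notin> spc (b t')" if t': "t' \<in> I" "\<bar>t' - t\<bar> < e" for t'
    proof -
      have "bform (shift (b t') r) (K + \<bar>r\<bar>)" using k[OF t'(1)] by (simp add: kform_def bform_shift)
      then have "bij_form (shift (b t') r)"
        by (rule d(2)) (use e(2)[OF t'] in \<open>auto simp: shift_quad\<close>)
      then show ?thesis by (simp add: spc_def)
    qed
    then show ?thesis using e by blast
  qed
  obtain e1 where e1: "e1 > 0" "\<forall>t'\<in>I. \<bar>t' - t\<bar> < e1 \<longrightarrow> a \<notin> spc (b t')" using st[of a] a by auto
  obtain e2 where e2: "e2 > 0" "\<forall>t'\<in>I. \<bar>t' - t\<bar> < e2 \<longrightarrow> - a \<notin> spc (b t')" using st[of "- a"] a by auto
  show ?thesis using a e1 e2 by (intro exI[of _ a] exI[of _ "min e1 e2"]) auto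
qed

end

section \<open>The index of a direct sum\<close>

context complex_vs begin

text \<open>Linearity on a subspace only: the gluing maps used later come from a choice that is
  controlled just on the quasi-periodic functions.\<close>

definition lin_on :: "'v set \<Rightarrow> ('v \<Rightarrow> 'v) \<Rightarrow> bool" where
  "lin_on H f \<longleftrightarrow> (\<forall>x\<in>H. \<forall>y\<in>H. f (x + y) = f x + f y) \<and> (\<forall>c. \<forall>x\<in>H. f (c *C x) = c *C f x)"

lemma lin_on_preimage:
  assumes "subspace H" "lin_on H f" "subspace Y"
  shows "subspace {x \<in> H. f x \<in> Y}"
proof (rule subspaceI)
  have "f 0 = 0" using assms(1,2) subspace_0[of H] unfolding lin_on_def by (metis scale_zero_left)
  then show "0 \<in> {x \<in> H. f x \<in> Y}" using assms subspace_0 by simp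
qed (use assms in \<open>auto simp: lin_on_def subspace_add subspace_scale\<close>)

lemma lin_on_0: "subspace H \<Longrightarrow> lin_on H f \<Longrightarrow> f 0 = 0"
  using subspace_0[of H] unfolding lin_on_def by (metis scale_zero_left)

lemma lin_on_span:
  assumes "subspace H" "lin_on H f" "A \<subseteq> H" "\<And>a. a \<in> A \<Longrightarrow> f a \<in> span B" "x \<in> span A"
  shows "x \<in> H" "f x \<in> span B"
proof -
  have "span A \<subseteq> {x \<in> H. f x \<in> span B}"
    using lin_on_preimage[OF assms(1,2) subspace_span] assms(3,4) by (intro span_minimal) auto
  then show "x \<in> H" "f x \<in> span B" using assms(5) by auto
qed

lemma pos_split_direct_sum:
  fixes \<Phi> \<Psi> :: "nat \<Rightarrow> 'v \<Rightarrow> 'v"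
  assumes X: "subspace X" and H: "\<And>k. k < N \<Longrightarrow> subspace (H k)"
    and \<Phi>: "\<And>k. k < N \<Longrightarrow> lin_on (H k) (\<Phi> k)" "\<And>k v. k < N \<Longrightarrow> v \<in> H k \<Longrightarrow> \<Phi> k v \<in> X"
    and \<Psi>: "\<And>k. k < N \<Longrightarrow> lin_on X (\<Psi> k)" "\<And>k x. k < N \<Longrightarrow> x \<in> X \<Longrightarrow> \<Psi> k x \<in> H k"
    and \<Psi>\<Phi>: "\<And>j k v. j < N \<Longrightarrow> k < N \<Longrightarrow> v \<in> H k \<Longrightarrow> \<Psi> j (\<Phi> k v) = (if j = k then v else 0)"
    and sum: "\<And>x. x \<in> X \<Longrightarrow> x = (\<Sum>k<N. \<Phi> k (\<Psi> k x))"
    and W: "subspace Wp" "subspace Wm" "Wp \<subseteq> X" "Wm \<subseteq> X" "\<And>k. k < N \<Longrightarrow> Vp \<subseteq> H k" "\<And>k. k < N \<Longrightarrow> Vm \<subseteq> H k"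
    and \<Phi>W: "\<And>k v. k < N \<Longrightarrow> v \<in> Vp \<Longrightarrow> \<Phi> k v \<in> Wp" "\<And>k v. k < N \<Longrightarrow> v \<in> Vm \<Longrightarrow> \<Phi> k v \<in> Wm"
    and \<Psi>W: "\<And>k x. k < N \<Longrightarrow> x \<in> Wp \<Longrightarrow> \<Psi> k x \<in> Vp" "\<And>k x. k < N \<Longrightarrow> x \<in> Wm \<Longrightarrow> \<Psi> k x \<in> Vm"
    and b0: "b 0 0 = 0"
    and b: "\<And>x. x \<in> X \<Longrightarrow> Re (B x x) = c * (\<Sum>k<N. Re (b (\<Psi> k x) (\<Psi> k x)))" and c: "0 < c"
    and split: "\<And>k. k < N \<Longrightarrow> pos_split (H k) Vp Vm b (S k) (T k)"
  shows "pos_split X Wp Wm B (\<Union>k<N. \<Phi> k ` S k) (\<Union>k<N. \<Phi> k ` T k)"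
    and "card (\<Union>k<N. \<Phi> k ` S k) = (\<Sum>k<N. card (S k))"
proof -
  define U where "U k = S k \<union> T k" for k
  define SS TT UU where "SS = (\<Union>k<N. \<Phi> k ` S k)" and "TT = (\<Union>k<N. \<Phi> k ` T k)" and "UU = (\<Union>k<N. \<Phi> k ` U k)"
  have UU: "SS \<union> TT = UU" by (auto simp: SS_def TT_def UU_def U_def)
  have UH: "U k \<subseteq> H k" and Ui: "independent (U k)" if "k < N" for k
    using pos_splitD(4,5)[OF split[OF that]] by (auto simp: U_def)
  have U0: "u \<noteq> 0" if "k < N" "u \<in> U k" for k u using Ui[OF that(1)] that(2) dependent_zero by blast
  have UUX: "UU \<subseteq> X" using UH \<Phi>(2) by (auto simp: UU_def)
  have \<Phi>inj: "j = k \<and> u = v" if "j < N" "k < N" "u \<in> U j" "v \<in> U k" "\<Phi> j u = \<Phi> k v" for j k u v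
  proof -
    have HH: "u \<in> H j" "v \<in> H k" using that UH by blast+
    have "u = \<Psi> j (\<Phi> k v)" using \<Psi>\<Phi>[OF that(1,1) HH(1)] that(5) by simp
    also have "\<dots> = (if j = k then v else 0)" by (rule \<Psi>\<Phi>[OF that(1,2) HH(2)])
    finally show ?thesis using U0[OF that(1,3)] by (auto split: if_splits)
  qed
  have \<Psi>span: "x \<in> X \<and> \<Psi> k x \<in> span (A k)" if "x \<in> span (\<Union>k<N. \<Phi> k ` A k)" "k < N" "\<And>k. k < N \<Longrightarrow> A k \<subseteq> U k" for x k A
  proof
    have AX: "(\<Union>k<N. \<Phi> k ` A k) \<subseteq> X" using that(3) UUX by (fastforce simp: UU_def)
    have "\<Psi> k a \<in> span (A k)" if a: "a \<in> (\<Union>k<N. \<Phi> k ` A k)" for a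
    proof -
      obtain j v where jv: "j < N" "v \<in> A j" "a = \<Phi> j v" using a by auto
      have "v \<in> H j" using jv UH \<open>\<And>k. k < N \<Longrightarrow> A k \<subseteq> U k\<close> by blast
      then show ?thesis using \<Psi>\<Phi>[OF \<open>k < N\<close> jv(1)] jv by (auto simp: span_base span_zero)
    qed
    then show "x \<in> X" "\<Psi> k x \<in> span (A k)" using lin_on_span[OF X \<Psi>(1)[OF that(2)] AX _ that(1)] by auto
  qed
  have \<Phi>span: "\<Phi> k v \<in> span UU" if "v \<in> span (U k)" "k < N" for k v
    by (rule lin_on_span(2)[OF H[OF that(2)] \<Phi>(1)[OF that(2)] UH[OF that(2)] _ that(1)])
       (use that(2) in \<open>auto simp: UU_def intro!: span_base\<close>)
  have indep: "independent UU"
  proof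
    assume "dependent UU"
    then obtain u where u: "u \<in> UU" "u \<in> span (UU - {u})" unfolding dependent_def by blast
    obtain k s where ks: "k < N" "s \<in> U k" "u = \<Phi> k s" using u(1) by (auto simp: UU_def)
    define A where "A j = (if j = k then U k - {s} else U j)" for j
    \<comment> \<open>Removing \<open>u\<close> removes only \<open>s\<close> from the k-th block,
      so applying \<open>\<Psi> k\<close> to a dependence of \<open>u\<close> yields one of
      \<open>s\<close> inside \<open>U k\<close>.\<close>
    have "UU - {u} \<subseteq> (\<Union>j<N. \<Phi> j ` A j)" using ks \<Phi>inj by (fastforce simp: UU_def A_def)
    then have "u \<in> span (\<Union>j<N. \<Phi> j ` A j)" using u(2) span_mono by blast
    then have "\<Psi> k u \<in> span (A k)" using \<Psi>span[of u A k] ks by (auto simp: A_def)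
    moreover have "s \<in> H k" using ks UH by blast
    then have "\<Psi> k u = s" using ks \<Psi>\<Phi>[of k k s] by simp
    ultimately have "s \<in> span (U k - {s})" by (simp add: A_def)
    then show False using Ui[OF ks(1)] ks(2) unfolding dependent_def by blast
  qed
  have \<Psi>zero: "x = 0" if "x \<in> X" "\<And>k. k < N \<Longrightarrow> \<Psi> k x = 0" for x
  proof -
    have "(\<Sum>k<N. \<Phi> k (\<Psi> k x)) = 0"
      using that(2) lin_on_0[OF H \<Phi>(1)] by (intro sum.neutral) auto
    then show ?thesis using sum[OF that(1)] by simp
  qed
  have \<Psi>add: "\<Psi> k (x + y) = \<Psi> k x + \<Psi> k y" if "k < N" "x \<in> X" "y \<in> X" for k x y
    using \<Psi>(1)[OF that(1)] that by (simp add: lin_on_def)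
  have Psub: "span A \<subseteq> X" if "A \<subseteq> UU" for A using that UUX X by (intro span_minimal) auto
  show "pos_split X Wp Wm B (\<Union>k<N. \<Phi> k ` S k) (\<Union>k<N. \<Phi> k ` T k)"
    unfolding SS_def[symmetric] TT_def[symmetric] pos_split_def UU
  proof (intro conjI ballI impI)
    show "finite SS" "finite TT" using pos_splitD(1,2)[OF split] by (auto simp: SS_def TT_def)
    show "SS \<inter> TT = {}"
    proof -
      have False if "j < N" "k < N" "u \<in> S j" "v \<in> T k" "\<Phi> j u = \<Phi> k v" for j k u v
        using \<Phi>inj[OF that(1,2) _ _ that(5)] that(3,4) pos_splitD(3)[OF split[OF that(1)]] by (auto simp: U_def)
      then show ?thesis by (auto simp: SS_def TT_def)
    qed
    show "independent UU" "UU \<subseteq> X" by fact+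
    show "v = 0" if v: "v \<in> span UU" "v \<in> ssum Wp Wm" for v
    proof (rule \<Psi>zero)
      show "v \<in> X" using Psub[of UU] v by blast
      fix k assume k: "k < N"
      obtain p q where pq: "p \<in> Wp" "q \<in> Wm" "v = p + q" using v(2) by (rule ssumE)
      have "\<Psi> k v = \<Psi> k p + \<Psi> k q" using \<Psi>add[OF k, of p q] pq W(3,4) by (simp add: subset_iff)
      then have "\<Psi> k v \<in> ssum Vp Vm" using \<Psi>W k pq by (auto intro: ssumI)
      moreover have "\<Psi> k v \<in> span (U k)" using \<Psi>span[of v U k] v(1) k by (simp add: UU_def)
      ultimately show "\<Psi> k v = 0" using pos_splitD(6)[OF split[OF k]] by (simp add: U_def)
    qed
    show "\<exists>w\<in>ssum Wp Wm. \<exists>v\<in>span UU. x = w + v" if x: "x \<in> X" for x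
    proof -
      have "\<exists>p q v. p \<in> Vp \<and> q \<in> Vm \<and> v \<in> span (U k) \<and> \<Psi> k x = p + q + v" if k: "k < N" for k
        using pos_splitD(7)[OF split[OF k] \<Psi>(2)[OF k x]] by (auto simp: U_def elim!: ssumE)
      then obtain p q v where pqv: "\<And>k. k < N \<Longrightarrow> p k \<in> Vp" "\<And>k. k < N \<Longrightarrow> q k \<in> Vm"
        "\<And>k. k < N \<Longrightarrow> v k \<in> span (U k)" "\<And>k. k < N \<Longrightarrow> \<Psi> k x = p k + q k + v k" by metis
      have "\<Phi> k (\<Psi> k x) = \<Phi> k (p k) + \<Phi> k (q k) + \<Phi> k (v k)" if k: "k < N" for k
      proof -
        have "p k \<in> H k" "q k \<in> H k" "v k \<in> H k"
          using pqv W k span_minimal[OF UH[OF k] H[OF k]] by blast+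
        then show ?thesis using \<Phi>(1)[OF k] pqv(4)[OF k] subspace_add[OF H[OF k]] by (simp add: lin_on_def)
      qed
      then have "x = (\<Sum>k<N. \<Phi> k (p k) + \<Phi> k (q k) + \<Phi> k (v k))" using sum[OF x] by simp
      then have "x = ((\<Sum>k<N. \<Phi> k (p k)) + (\<Sum>k<N. \<Phi> k (q k))) + (\<Sum>k<N. \<Phi> k (v k))"
        by (simp add: sum.distrib)
      moreover have "(\<Sum>k<N. \<Phi> k (p k)) \<in> Wp" "(\<Sum>k<N. \<Phi> k (q k)) \<in> Wm"
        using \<Phi>W pqv W by (auto intro!: subspace_sum)
      moreover have "(\<Sum>k<N. \<Phi> k (v k)) \<in> span UU" using \<Phi>span pqv by (auto intro!: span_sum)
      ultimately show ?thesis using ssumI by blast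
    qed
    show "0 \<le> Re (B (p + s) (p + s))" if ps: "p \<in> Wp" "s \<in> span SS" for p s
    proof -
      have X': "p \<in> X" "s \<in> X" using ps W Psub[of SS] UU by auto
      have "0 \<le> Re (b (\<Psi> k (p + s)) (\<Psi> k (p + s)))" if k: "k < N" for k
      proof -
        have "\<Psi> k s \<in> span (S k)" using \<Psi>span[of s S k] ps(2) k by (auto simp: SS_def U_def)
        then show ?thesis using pos_splitD(8)[OF split[OF k] \<Psi>W(1)[OF k ps(1)]] \<Psi>add[OF k X'] by simp
      qed
      then show ?thesis using b[of "p + s"] subspace_add[OF X X'] c by (auto intro!: mult_nonneg_nonneg sum_nonneg)
    qed
    show "Re (B (q + t) (q + t)) < 0" if qt: "q \<in> Wm" "t \<in> span TT" "q + t \<noteq> 0" for q t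
    proof -
      have X': "q \<in> X" "t \<in> X" using qt W Psub[of TT] UU by auto
      have X'': "q + t \<in> X" using X' X subspace_add by blast
      have neg: "\<Psi> k (q + t) \<noteq> 0 \<Longrightarrow> Re (b (\<Psi> k (q + t)) (\<Psi> k (q + t))) < 0" if k: "k < N" for k
      proof -
        have "\<Psi> k t \<in> span (T k)" using \<Psi>span[of t T k] qt(2) k by (auto simp: TT_def U_def)
        then show "\<Psi> k (q + t) \<noteq> 0 \<Longrightarrow> Re (b (\<Psi> k (q + t)) (\<Psi> k (q + t))) < 0"
          using pos_splitD(9)[OF split[OF k] \<Psi>W(2)[OF k qt(1)]] \<Psi>add[OF k X'] by simp
      qed
      have np: "Re (b (\<Psi> k (q + t)) (\<Psi> k (q + t))) \<le> 0" if k: "k < N" for k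
      proof (cases "\<Psi> k (q + t) = 0")
        case True
        then show ?thesis using b0 by simp
      qed (use neg[OF k] in simp)
      \<comment> \<open>Strictness needs a single nonzero coordinate; it exists because the
        coordinates reconstruct the vector.\<close>
      obtain k where k: "k < N" "\<Psi> k (q + t) \<noteq> 0" using \<Psi>zero[OF X''] qt(3) by blast
      have "(\<Sum>k<N. Re (b (\<Psi> k (q + t)) (\<Psi> k (q + t)))) < 0"
        using sum_strict_mono_ex1[of "{..<N}" "\<lambda>k. Re (b (\<Psi> k (q + t)) (\<Psi> k (q + t)))" "\<lambda>_. 0"] np neg[OF k(1) k(2)] k
        by auto
      then show ?thesis using b[OF X''] c by (simp add: mult_pos_neg)
    qed
  qed
  show "card (\<Union>k<N. \<Phi> k ` S k) = (\<Sum>k<N. card (S k))"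
  proof -
    have "card (\<Union>k<N. \<Phi> k ` S k) = (\<Sum>k<N. card (\<Phi> k ` S k))"
    proof (rule card_UN_disjoint)
      show "\<forall>i\<in>{..<N}. finite (\<Phi> i ` S i)" using pos_splitD(1)[OF split] by auto
      show "\<forall>i\<in>{..<N}. \<forall>j\<in>{..<N}. i \<noteq> j \<longrightarrow> \<Phi> i ` S i \<inter> \<Phi> j ` S j = {}"
        using \<Phi>inj by (fastforce simp: U_def)
    qed simp
    also have "\<dots> = (\<Sum>k<N. card (S k))"
    proof (rule sum.cong)
      fix k assume "k \<in> {..<N}"
      then have "inj_on (\<Phi> k) (S k)" using \<Phi>inj[of k k] by (auto simp: inj_on_def U_def)
      then show "card (\<Phi> k ` S k) = card (S k)" by (rule card_image)
    qed simp
    finally show ?thesis .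
  qed
qed

end

subsection \<open>Square-integrable functions on the unit interval\<close>

text \<open>A finite measure space that turns the set integrals over \<open>{0..1}\<close> in the
  definitions into plain integrals.\<close>

definition UI :: "real measure" where "UI = restrict_space lborel {0..1}"

lemma space_UI [simp]: "space UI = {0..1}"
  by (simp add: UI_def)

lemma finite_UI: "finite_measure UI"
  by (rule finite_measureI) (simp add: UI_def emeasure_restrict_space)

lemma measure_UI [simp]: "measure UI {0..1} = 1"
  by (simp add: UI_def measure_restrict_space)

lemma borel_measurable_UI:
  fixes f :: "real \<Rightarrow> 'b::real_normed_vector"
  shows "set_borel_measurable lborel {0..1} f \<longleftrightarrow> f \<in> borel_measurable UI"
  unfolding UI_def set_borel_measurable_def by (subst borel_measurable_restrict_space_iff) auto

lemma integrable_UI: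
  fixes f :: "real \<Rightarrow> 'b::{banach, second_countable_topology}"
  shows "set_integrable lborel {0..1} f \<longleftrightarrow> integrable UI f"
  unfolding UI_def set_integrable_def by (subst integrable_restrict_space) auto

lemma integral_UI:
  fixes f :: "real \<Rightarrow> 'b::{banach, second_countable_topology}"
  shows "(LINT s:{0..1}|lborel. f s) = integral\<^sup>L UI f"
  unfolding UI_def set_lebesgue_integral_def by (subst integral_restrict_space) auto

lemma integral_UI_upto:
  fixes f :: "real \<Rightarrow> 'b::{banach, second_countable_topology}"
  assumes "t \<in> {0..1}"
  shows "(LINT s:{0..t}|lborel. f s) = (\<integral>s. indicator {0..t} s *\<^sub>R f s \<partial>UI)"
  unfolding UI_def set_lebesgue_integral_def
  by (subst integral_restrict_space) (use assms in \<open>auto intro!: Bochner_Integration.integral_cong split: split_indicator\<close>)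

lemma borel_measurable_UI_continuous: "continuous_on {0..1} f \<Longrightarrow> f \<in> borel_measurable UI"
  unfolding UI_def using borel_measurable_continuous_on_restrict measurable_cong_sets sets_restrict_space_cong
  by (metis sets_lborel)

lemma borel_measurable_indicator_UI [measurable]: "A \<in> sets borel \<Longrightarrow> indicator A \<in> borel_measurable UI"
  unfolding UI_def by (rule measurable_restrict_space1) simp

text \<open>Vanishing over initial segments passes to all Borel sets, since half-lines form an
  intersection-stable generator; a density whose integrals all vanish is zero almost everywhere.
  This gives uniqueness of weak derivatives.\<close>

lemma AE_UI_zero:
  fixes f :: "real \<Rightarrow> 'b::{banach, second_countable_topology}"
  assumes f: "integrable UI f" and z: "\<And>t. t \<in> {0..1} \<Longrightarrow> (\<integral>s. indicator {0..t} s *\<^sub>R f s \<partial>UI) = 0"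
  shows "AE s in UI. f s = 0"
proof -
  define g where "g s = indicator {0..1} s *\<^sub>R f s" for s :: real
  have g: "integrable lborel g"
    using f unfolding g_def integrable_UI[symmetric] set_integrable_def by simp
  have atm: "set_lebesgue_integral lborel {..t} g = 0" for t
  proof -
    have eq: "set_lebesgue_integral lborel {..t} g = (LINT s:{0..u}|lborel. f s)" if "u = min t 1" for u
      unfolding set_lebesgue_integral_def g_def
      by (intro Bochner_Integration.integral_cong) (auto simp: that split: split_indicator)
    show ?thesis
    proof (cases "t < 0")
      case True
      then show ?thesis using eq[of t] by (simp add: set_lebesgue_integral_def)
    next
      case False
      then show ?thesis using eq[of "min t 1"] integral_UI_upto[of "min t 1" f] z[of "min t 1"] by simp
    qed
  qed
  have tot: "integral\<^sup>L lborel g = 0"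
  proof -
    have "set_lebesgue_integral lborel {..1} g = integral\<^sup>L lborel g"
      unfolding set_lebesgue_integral_def g_def
      by (intro Bochner_Integration.integral_cong) (auto split: split_indicator)
    then show ?thesis using atm by simp
  qed
  have all: "set_lebesgue_integral lborel A g = 0" if "A \<in> sets borel" for A
  proof -
    have gi: "set_integrable lborel A g" if "A \<in> sets borel" for A
      using integrable_mult_indicator[OF _ g, of A] that unfolding set_integrable_def by simp
    have "Int_stable (range (\<lambda>a::real. {..a}))" "range (\<lambda>a::real. {..a}) \<subseteq> Pow UNIV"
      by (auto simp: Int_stable_def)
    moreover have "A \<in> sigma_sets UNIV (range (\<lambda>a::real. {..a}))"
      using that by (simp add: borel_eq_atMost)
    ultimately show ?thesis
    proof (induction rule: sigma_sets_induct_disjoint)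
      case (compl A)
      then have A: "A \<in> sets borel" by (simp add: borel_eq_atMost)
      have "set_lebesgue_integral lborel (A \<union> (UNIV - A)) g
          = set_lebesgue_integral lborel A g + set_lebesgue_integral lborel (UNIV - A) g"
        using A by (intro set_integral_Un gi) auto
      moreover have "set_lebesgue_integral lborel (A \<union> (UNIV - A)) g = integral\<^sup>L lborel g"
        by (simp add: set_lebesgue_integral_def)
      ultimately show ?case using compl tot by simp
    next
      case (union A)
      then have A: "\<And>i. A i \<in> sets borel" by (auto simp: borel_eq_atMost)
      have "set_lebesgue_integral lborel (\<Union>i. A i) g = (\<Sum>i. set_lebesgue_integral lborel (A i) g)"
        using A union(1) by (intro lebesgue_integral_countable_add gi) (auto simp: disjoint_family_on_def)
      then show ?case using union by simp
    qed (use atm in \<open>auto simp: set_lebesgue_integral_def\<close>)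
  qed
  have "AE s in lborel. g s = 0"
    by (rule sigma_finite_measure.density_zero[OF sigma_finite_lborel g]) (simp add: all)
  then show ?thesis unfolding UI_def g_def
    by (subst AE_restrict_space_iff) (auto split: split_indicator_asm)
qed

section \<open>Vector-valued functions and the L2 pairing\<close>

lemma complex_vs_cscale: "complex_vs (cscale :: complex \<Rightarrow> 'n::finite cfun \<Rightarrow> 'n cfun)"
  by unfold_locales (auto simp: cscale_def fun_eq_iff vec_eq_iff algebra_simps)

interpretation cfun: complex_vs "cscale :: complex \<Rightarrow> 'n::finite cfun \<Rightarrow> 'n cfun"
  by (rule complex_vs_cscale)

lemma cdot_add_left: "cdot (u + v) w = cdot u w + cdot v w"
  and cdot_add_right: "cdot w (u + v) = cdot w u + cdot w v"
  and cdot_scale_left: "cdot (c *s u) w = c * cdot u w"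
  and cdot_scale_right: "cdot w (c *s u) = cnj c * cdot w u"
  and cdot_scaleR_left: "cdot (r *\<^sub>R u) w = of_real r * cdot u w"
  and cdot_scaleR_right: "cdot w (r *\<^sub>R u) = of_real r * cdot w u"
  and cdot_cnj: "cnj (cdot u v) = cdot v u"
  and cdot_0 [simp]: "cdot 0 w = 0" "cdot w 0 = 0"
  by (simp_all add: cdot_def algebra_simps sum.distrib sum_subtractf sum_distrib_left scaleR_conv_of_real[where 'a=complex] mult.left_commute)

lemma cdot_self: "cdot u u = of_real ((norm u)\<^sup>2)"
  by (simp add: cdot_def norm_vec_def L2_set_def sum_nonneg complex_norm_square[symmetric] del: of_real_power)

lemma norm_cdot_le: "cmod (cdot u v) \<le> norm u * norm v"
proof -
  have "cmod (cdot u v) \<le> (\<Sum>i\<in>UNIV. \<bar>norm (u $ i)\<bar> * \<bar>norm (v $ i)\<bar>)"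
    unfolding cdot_def by (rule order_trans[OF norm_sum]) (simp add: norm_mult)
  also have "\<dots> \<le> norm u * norm v" unfolding norm_vec_def by (rule L2_set_mult_ineq)
  finally show ?thesis .
qed

lemma norm_vec_scale: "norm (c *s (v :: complex ^ 'n::finite)) = cmod c * norm v"
  by (simp add: norm_vec_def L2_set_def norm_mult power_mult_distrib sum_distrib_left[symmetric] real_sqrt_mult)

lemma borel_measurable_vec_nth:
  fixes f :: "'a \<Rightarrow> complex ^ 'n::finite"
  assumes "f \<in> borel_measurable M" shows "(\<lambda>x. f x $ i) \<in> borel_measurable M"
  by (rule borel_measurable_continuous_on[OF _ assms]) (intro continuous_intros)

lemma borel_measurable_vec:
  fixes f :: "'a \<Rightarrow> complex ^ 'n::finite"
  assumes "\<And>i. (\<lambda>x. f x $ i) \<in> borel_measurable M" shows "f \<in> borel_measurable M"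
proof -
  have "(\<lambda>x. \<Sum>i\<in>UNIV. f x $ i *s axis i 1) \<in> borel_measurable M"
  proof (intro borel_measurable_sum)
    fix i :: 'n
    show "(\<lambda>x. f x $ i *s axis i 1) \<in> borel_measurable M"
    proof (rule borel_measurable_continuous_on[OF _ assms])
      have "linear (\<lambda>c::complex. c *s (axis i 1 :: complex ^ 'n))"
        by (rule linearI) (simp_all add: vec_eq_iff algebra_simps scaleR_conv_of_real[where 'a=complex])
      then show "continuous_on UNIV (\<lambda>c::complex. c *s (axis i 1 :: complex ^ 'n))"
        by (rule linear_continuous_on[OF linear_conv_bounded_linear[THEN iffD1]])
    qed
  qed
  then show ?thesis by (simp add: basis_expansion)
qed

lemma borel_measurable_vec_scale:
  fixes f :: "'a \<Rightarrow> complex ^ 'n::finite"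
  assumes "f \<in> borel_measurable M" shows "(\<lambda>x. c *s f x) \<in> borel_measurable M"
proof (rule borel_measurable_vec)
  have [measurable]: "(\<lambda>x. f x $ i) \<in> borel_measurable M" for i by (rule borel_measurable_vec_nth[OF assms])
  show "(\<lambda>x. (c *s f x) $ i) \<in> borel_measurable M" for i by simp
qed

lemma borel_measurable_cdot:
  fixes f g :: "'a \<Rightarrow> complex ^ 'n::finite"
  assumes "f \<in> borel_measurable M" "g \<in> borel_measurable M"
  shows "(\<lambda>x. cdot (f x) (g x)) \<in> borel_measurable M"
proof -
  have "(\<lambda>x. cnj (g x $ i)) \<in> borel_measurable M" for i
    by (rule borel_measurable_continuous_on[OF _ borel_measurable_vec_nth[OF assms(2)]]) (intro continuous_intros)
  then show ?thesis
    unfolding cdot_def using borel_measurable_vec_nth[OF assms(1)] by measurable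
qed

text \<open>Functions, not classes modulo null sets. The pairing is therefore only semidefinite here
  and \<open>hspace\<close> is not interpreted for it; statements up to null sets go through
  \<open>ipL2_cong\<close>.\<close>

definition L2 :: "'n::finite cfun set" where
  "L2 = {f \<in> borel_measurable UI. integrable UI (\<lambda>s. (norm (f s))\<^sup>2)}"

lemma L2_D: "f \<in> L2 \<Longrightarrow> f \<in> borel_measurable UI" "f \<in> L2 \<Longrightarrow> integrable UI (\<lambda>s. (norm (f s))\<^sup>2)"
  by (auto simp: L2_def)

lemma L2_norm_integrable: "f \<in> L2 \<Longrightarrow> integrable UI (\<lambda>s. norm (f s))"
proof (rule Bochner_Integration.integrable_bound)
  interpret finite_measure UI by (rule finite_UI)
  assume f: "f \<in> L2"
  show "integrable UI (\<lambda>s. 1 + (norm (f s))\<^sup>2)" using L2_D[OF f] by simp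
  show "(\<lambda>s. norm (f s)) \<in> borel_measurable UI" using L2_D[OF f] by simp
  have "x \<le> 1 + x\<^sup>2" for x :: real 
  proof -
    have "2 * x \<le> 1 + x\<^sup>2" using zero_le_power2[of "x - 1"] by (simp add: power2_diff)
    then show ?thesis using zero_le_power2[of x] by (cases "x \<le> 0") linarith+
  qed
  then show "AE s in UI. norm (norm (f s)) \<le> norm (1 + (norm (f s))\<^sup>2)" by simp
qed

lemma L2_integrable: "f \<in> L2 \<Longrightarrow> integrable UI f"
  using L2_norm_integrable L2_D(1) integrable_norm_iff by blast

lemma L2_cdot_integrable:
  assumes "f \<in> L2" "g \<in> L2" shows "integrable UI (\<lambda>s. cdot (f s) (g s))"
proof (rule Bochner_Integration.integrable_bound)
  show "integrable UI (\<lambda>s. (norm (f s))\<^sup>2 + (norm (g s))\<^sup>2)"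
    by (intro Bochner_Integration.integrable_add L2_D(2) assms)
  show "(\<lambda>s. cdot (f s) (g s)) \<in> borel_measurable UI" using assms L2_D borel_measurable_cdot by blast
  have "norm u * norm v \<le> (norm u)\<^sup>2 + (norm v)\<^sup>2" for u v :: "complex ^ 'a"
  proof -
    have "2 * (norm u * norm v) \<le> (norm u)\<^sup>2 + (norm v)\<^sup>2"
      using zero_le_power2[of "norm u - norm v"] by (simp add: power2_diff)
    moreover have "0 \<le> norm u * norm v" by simp
    ultimately show ?thesis by linarith
  qed
  then show "AE s in UI. norm (cdot (f s) (g s)) \<le> norm ((norm (f s))\<^sup>2 + (norm (g s))\<^sup>2)"
    using norm_cdot_le order_trans by (intro AE_I2) fastforce
qed

lemma L2_add: assumes "f \<in> L2" "g \<in> L2" shows "(\<lambda>s. f s + g s) \<in> L2"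
  unfolding L2_def
proof (intro CollectI conjI)
  show m: "(\<lambda>s. f s + g s) \<in> borel_measurable UI"
    by (intro borel_measurable_add L2_D(1) assms)
  show "integrable UI (\<lambda>s. (norm (f s + g s))\<^sup>2)"
  proof (rule Bochner_Integration.integrable_bound)
    show "integrable UI (\<lambda>s. 2 * (norm (f s))\<^sup>2 + 2 * (norm (g s))\<^sup>2)"
      by (intro Bochner_Integration.integrable_add integrable_mult_right L2_D(2) assms)
    show "(\<lambda>s. (norm (f s + g s))\<^sup>2) \<in> borel_measurable UI" using m by simp
    have "(norm (u + v))\<^sup>2 \<le> 2 * (norm u)\<^sup>2 + 2 * (norm v)\<^sup>2" for u v :: "complex ^ 'a"
    proof -
      have "(norm (u + v))\<^sup>2 \<le> (norm u + norm v)\<^sup>2" by (intro power_mono norm_triangle_ineq) auto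
      then show ?thesis using zero_le_power2[of "norm u - norm v"] by (simp add: power2_diff power2_sum)
    qed
    then show "AE s in UI. norm ((norm (f s + g s))\<^sup>2) \<le> norm (2 * (norm (f s))\<^sup>2 + 2 * (norm (g s))\<^sup>2)" by simp
  qed
qed

lemma L2_scale: assumes "f \<in> L2" shows "(\<lambda>s. c *s f s) \<in> L2"
  using assms by (auto simp: L2_def norm_vec_scale power_mult_distrib borel_measurable_vec_scale)

lemma L2_subspace: "cfun.subspace (L2 :: 'n::finite cfun set)"
  by (rule cfun.subspaceI)
     (auto simp: plus_fun_def cscale_def zero_fun_def L2_add L2_scale, simp add: L2_def)

definition ipL2 :: "'n::finite cform" where "ipL2 f g = (\<integral>s. cdot (f s) (g s) \<partial>UI)"

lemma ipL2_herm: "cfun.herm_on L2 ipL2"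
  unfolding cfun.herm_on_def
proof (intro conjI ballI allI)
  fix f g h :: "'a cfun" and c assume L: "f \<in> L2" "g \<in> L2" 
  show "ipL2 g f = cnj (ipL2 f g)"
    unfolding ipL2_def by (subst cdot_cnj[symmetric]) (rule Bochner_Integration.integral_cnj)
  show "ipL2 (cscale c f) g = c * ipL2 f g"
    by (simp add: ipL2_def cscale_def cdot_scale_left)
  assume h: "h \<in> L2"
  show "ipL2 (f + g) h = ipL2 f h + ipL2 g h"
    unfolding ipL2_def using L h
    by (simp add: cdot_add_left Bochner_Integration.integral_add L2_cdot_integrable)
qed

definition nL2 :: "'n::finite cfun \<Rightarrow> real" where "nL2 f = sqrt (\<integral>s. (norm (f s))\<^sup>2 \<partial>UI)"

lemma nL2_nonneg [simp]: "0 \<le> nL2 f"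
  by (simp add: nL2_def)

lemma nL2_sq: "(nL2 f)\<^sup>2 = (\<integral>s. (norm (f s))\<^sup>2 \<partial>UI)"
  by (simp add: nL2_def)

lemma ipL2_self: "ipL2 f f = of_real ((nL2 f)\<^sup>2)"
  by (simp add: ipL2_def cdot_self nL2_sq flip: integral_complex_of_real of_real_power)

lemma ipL2_le:
  assumes "f \<in> L2" "g \<in> L2" shows "cmod (ipL2 f g) \<le> nL2 f * nL2 g"
proof -
  have "(cmod (ipL2 f g))\<^sup>2 \<le> Re (ipL2 f f) * Re (ipL2 g g)"
    by (rule cfun.herm_cauchy_schwarz[OF L2_subspace ipL2_herm _ assms]) (simp add: ipL2_self)
  then have "(cmod (ipL2 f g))\<^sup>2 \<le> (nL2 f * nL2 g)\<^sup>2" by (simp add: ipL2_self power_mult_distrib)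
  then show ?thesis by (rule power2_le_imp_le) simp
qed

text \<open>Integrate the nonnegative function equal to \<open>(|f| - c)^2\<close> on
  \<open>[s, t]\<close> and to \<open>|f|^2\<close> elsewhere, then take
  \<open>c = m / (t - s)\<close>. For \<open>t = s\<close> the resulting inequality is linear in
  \<open>c\<close> and forces \<open>m = 0\<close>.\<close>

lemma norm_integral_L2_le:
  fixes f :: "'n::finite cfun"
  assumes f: "f \<in> L2" and st: "0 \<le> s" "s \<le> t" "t \<le> 1"
  shows "(\<integral>r. indicator {s..t} r * norm (f r) \<partial>UI) \<le> sqrt (t - s) * nL2 f"
proof -
  interpret finite_measure UI by (rule finite_UI)
  define m where "m = (\<integral>r. indicator {s..t} r * norm (f r) \<partial>UI)"
  have i1: "integrable UI (\<lambda>r. indicator {s..t} r * norm (f r))"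
    by (rule Bochner_Integration.integrable_bound[OF L2_norm_integrable[OF f]])
       (use L2_D(1)[OF f] in \<open>auto split: split_indicator\<close>)
  have ind: "integrable UI (indicator {s..t} :: real \<Rightarrow> real)"
    by (rule integrable_const_bound[where B = 1]) (auto split: split_indicator)
  have ival: "(\<integral>r. indicator {s..t} r \<partial>UI) = t - s"
    unfolding UI_def using st
    by (subst integral_restrict_space) (auto simp: indicator_inter_arith[symmetric] Int_absorb1)
  have key: "2 * c * m \<le> (nL2 f)\<^sup>2 + c\<^sup>2 * (t - s)" for c
  proof -
    have "0 \<le> (\<integral>r. (norm (f r))\<^sup>2 - 2 * c * (indicator {s..t} r * norm (f r)) + c\<^sup>2 * indicator {s..t} r \<partial>UI)"
    proof (rule Bochner_Integration.integral_nonneg)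
      fix r
      have "0 \<le> (norm (f r) - c)\<^sup>2" by simp
      then show "0 \<le> (norm (f r))\<^sup>2 - 2 * c * (indicator {s..t} r * norm (f r)) + c\<^sup>2 * indicator {s..t} r"
        by (auto simp: power2_diff algebra_simps split: split_indicator)
    qed
    also have "\<dots> = (nL2 f)\<^sup>2 - 2 * c * m + c\<^sup>2 * (t - s)"
      using L2_D(2)[OF f] i1 ind by (simp add: nL2_sq m_def ival[symmetric])
    finally show ?thesis by simp
  qed
  have m0: "0 \<le> m" unfolding m_def by (rule Bochner_Integration.integral_nonneg) simp
  have "m\<^sup>2 \<le> (sqrt (t - s) * nL2 f)\<^sup>2"
  proof (cases "t = s")
    case True
    have "m \<le> 0"
    proof (rule ccontr)
      assume "\<not> m \<le> 0"
      then have "2 * (((nL2 f)\<^sup>2 + 1) / m) * m = 2 * (nL2 f)\<^sup>2 + 2" by simp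
      then show False using key[of "((nL2 f)\<^sup>2 + 1) / m"] True zero_le_power2[of "nL2 f"] by simp
    qed
    then show ?thesis using m0 True by simp
  next
    case False
    then have d: "t - s > 0" using st by simp
    have "(t - s) * (2 * (m / (t - s)) * m) \<le> (t - s) * ((nL2 f)\<^sup>2 + (m / (t - s))\<^sup>2 * (t - s))"
      using key[of "m / (t - s)"] d by (intro mult_left_mono) auto
    also have "\<dots> = (t - s) * (nL2 f)\<^sup>2 + m\<^sup>2"
    proof -
      have "D * ((m / D)\<^sup>2 * D) = m\<^sup>2" if "D > 0" for D :: real
        using that by (simp add: field_simps power2_eq_square)
      then show ?thesis using d by (simp only: distrib_left)
    qed
    also have "(t - s) * (2 * (m / (t - s)) * m) = 2 * m\<^sup>2" using d by (simp add: power2_eq_square)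
    finally show ?thesis using d by (simp add: power_mult_distrib)
  qed
  then show ?thesis unfolding m_def[symmetric] by (rule power2_le_imp_le) (use st in simp)
qed

lemma L2_diff: assumes "f \<in> L2" "g \<in> L2" shows "(\<lambda>s. f s - g s) \<in> L2"
  using L2_add[OF assms(1) L2_scale[OF assms(2), of "-1"]] by (simp add: vec_eq_iff fun_eq_iff)

lemma L2_cong:
  assumes "f \<in> L2" "AE s in UI. f s = g s" "g \<in> borel_measurable UI" shows "g \<in> L2" "nL2 g = nL2 f"
proof -
  have "integrable UI (\<lambda>s. (norm (g s))\<^sup>2) \<longleftrightarrow> integrable UI (\<lambda>s. (norm (f s))\<^sup>2)"
    by (rule integrable_cong_AE) (use assms L2_D(1)[OF assms(1)] in auto)
  then show "g \<in> L2" using assms by (simp add: L2_def)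
  have "(\<integral>s. (norm (g s))\<^sup>2 \<partial>UI) = (\<integral>s. (norm (f s))\<^sup>2 \<partial>UI)"
    by (rule integral_cong_AE) (use assms L2_D(1)[OF assms(1)] in auto)
  then show "nL2 g = nL2 f" by (simp add: nL2_def)
qed

lemma ipL2_cong:
  assumes "f \<in> L2" "f' \<in> L2" "g \<in> L2" "g' \<in> L2" "AE s in UI. f s = f' s" "AE s in UI. g s = g' s"
  shows "ipL2 f g = ipL2 f' g'"
  unfolding ipL2_def
proof (rule integral_cong_AE)
  show "(\<lambda>s. cdot (f s) (g s)) \<in> borel_measurable UI" "(\<lambda>s. cdot (f' s) (g' s)) \<in> borel_measurable UI"
    using assms L2_D(1) borel_measurable_cdot by blast+
  show "AE s in UI. cdot (f s) (g s) = cdot (f' s) (g' s)" using assms(5,6) by eventually_elim simp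
qed

lemma L1_le_L2: "f \<in> L2 \<Longrightarrow> (\<integral>r. norm (f r) \<partial>UI) \<le> nL2 f"
proof -
  assume f: "f \<in> L2"
  have "(\<integral>r. norm (f r) \<partial>UI) = (\<integral>r. indicator {0..1} r * norm (f r) \<partial>UI)"
    by (rule Bochner_Integration.integral_cong) auto
  also have "\<dots> \<le> nL2 f" using norm_integral_L2_le[OF f, of 0 1] by simp
  finally show ?thesis .
qed

text \<open>Riesz-Fischer: along a subsequence with increments below 2^-k in L2, hence in L1, the
  increments are absolutely summable almost everywhere. Fatou's lemma then bounds the L2 distance
  from the whole sequence to the pointwise limit.\<close>

lemma L2_complete:
  fixes f :: "nat \<Rightarrow> 'n::finite cfun"
  assumes f: "\<And>n. f n \<in> L2" and c: "\<And>e. e > 0 \<Longrightarrow> \<exists>M. \<forall>m\<ge>M. \<forall>n\<ge>M. nL2 (\<lambda>s. f m s - f n s) < e"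
  obtains F where "F \<in> L2" "(\<lambda>n. nL2 (\<lambda>s. f n s - F s)) \<longlonglongrightarrow> 0"
proof -
  interpret finite_measure UI by (rule finite_UI)
  have "\<forall>k. \<exists>M. \<forall>m\<ge>M. \<forall>n\<ge>M. nL2 (\<lambda>s. f m s - f n s) < (1/2)^k" using c by simp
  then obtain M where M: "\<And>k m n. m \<ge> M k \<Longrightarrow> n \<ge> M k \<Longrightarrow> nL2 (\<lambda>s. f m s - f n s) < (1/2)^k" by metis
  \<comment> \<open>The summand \<open>k\<close> makes the index cofinal; the sum of all earlier
    \<open>M i\<close> makes it monotone and at least \<open>M k\<close>.\<close>
  define r where "r k = k + (\<Sum>i\<le>k. M i)" for k
  have rM: "M k \<le> r k" for k
    unfolding r_def using member_le_sum[of k "{..k}" M] by simp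
  have rS: "r k \<le> r (Suc k)" for k by (simp add: r_def)
  have rk: "k \<le> r k" for k by (simp add: r_def)
  define g where "g k = f (r k)" for k
  define d where "d k s = norm (g (Suc k) s - g k s)" for k s
  have gm [measurable]: "g k \<in> borel_measurable UI" for k unfolding g_def by (rule L2_D(1)[OF f])
  have fm [measurable]: "f k \<in> borel_measurable UI" for k by (rule L2_D(1)[OF f])
  have dm [measurable]: "d k \<in> borel_measurable UI" for k unfolding d_def by measurable
  have dL: "(\<lambda>s. g (Suc k) s - g k s) \<in> L2" for k unfolding g_def by (rule L2_diff[OF f f])
  have dint: "integrable UI (d k)" for k unfolding d_def by (rule L2_norm_integrable[OF dL])
  have dle: "(\<integral>s. d k s \<partial>UI) \<le> (1/2)^k" for k
  proof -
    have "(\<integral>s. d k s \<partial>UI) \<le> nL2 (\<lambda>s. g (Suc k) s - g k s)" unfolding d_def by (rule L1_le_L2[OF dL])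
    also have "\<dots> \<le> (1/2)^k" unfolding g_def using M[of k "r (Suc k)" "r k"] rM rS order_trans by (metis less_imp_le)
    finally show ?thesis .
  qed
  have "(\<integral>\<^sup>+s. (\<Sum>k. ennreal (d k s)) \<partial>UI) = (\<Sum>k. \<integral>\<^sup>+s. ennreal (d k s) \<partial>UI)"
    by (rule nn_integral_suminf) simp
  also have "\<dots> \<le> (\<Sum>k. ennreal ((1/2)^k))"
  proof (rule suminf_le)
    fix k
    have "(\<integral>\<^sup>+s. ennreal (d k s) \<partial>UI) = ennreal (\<integral>s. d k s \<partial>UI)"
      by (rule nn_integral_eq_integral[OF dint]) (simp add: d_def)
    then show "(\<integral>\<^sup>+s. ennreal (d k s) \<partial>UI) \<le> ennreal ((1/2)^k)" using dle by (simp add: ennreal_leI)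
  qed auto
  also have "\<dots> = ennreal (\<Sum>k. (1/2)^k)" by (rule suminf_ennreal2) (auto simp: summable_geometric)
  also have "\<dots> < \<infinity>" by simp
  finally have "(\<integral>\<^sup>+s. (\<Sum>k. ennreal (d k s)) \<partial>UI) \<noteq> \<infinity>" by simp
  then have "AE s in UI. (\<Sum>k. ennreal (d k s)) \<noteq> \<infinity>" by (intro nn_integral_PInf_AE) auto
  then have conv: "AE s in UI. convergent (\<lambda>k. g k s)"
  proof eventually_elim
    case (elim s)
    then have "summable (\<lambda>k. d k s)" by (intro summable_suminf_not_top) (auto simp: d_def)
    then have "summable (\<lambda>k. g (Suc k) s - g k s)" unfolding d_def by (rule summable_norm_cancel)
    then have "convergent (\<lambda>n. \<Sum>k<n. g (Suc k) s - g k s)" by (simp add: summable_iff_convergent)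
    then have "convergent (\<lambda>n. g n s - g 0 s)" by (simp add: sum_lessThan_telescope[of "\<lambda>k. g k s"])
    then have "convergent (\<lambda>n. (g n s - g 0 s) + g 0 s)" by (intro convergent_add convergent_const)
    then show ?case by simp
  qed
  define F where "F s = lim (\<lambda>k. g k s)" for s
  have Fm [measurable]: "F \<in> borel_measurable UI" unfolding F_def by (rule borel_measurable_lim_metric) simp
  have Flim: "AE s in UI. (\<lambda>k. g k s) \<longlonglongrightarrow> F s"
    using conv by eventually_elim (simp add: F_def convergent_LIMSEQ_iff)
  have key: "(\<lambda>s. f n s - F s) \<in> L2 \<and> nL2 (\<lambda>s. f n s - F s) \<le> e"
    if e: "e > 0" and N: "\<And>m n. m \<ge> N \<Longrightarrow> n \<ge> N \<Longrightarrow> nL2 (\<lambda>s. f m s - f n s) < e" and n: "n \<ge> N" for e N n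
  proof -
    have "(\<integral>\<^sup>+s. ennreal ((norm (f n s - F s))\<^sup>2) \<partial>UI)
        \<le> (\<integral>\<^sup>+s. liminf (\<lambda>k. ennreal ((norm (f n s - g k s))\<^sup>2)) \<partial>UI)"
    proof (rule nn_integral_mono_AE)
      show "AE s in UI. ennreal ((norm (f n s - F s))\<^sup>2) \<le> liminf (\<lambda>k. ennreal ((norm (f n s - g k s))\<^sup>2))"
        using Flim
      proof eventually_elim
        case (elim s)
        then have "(\<lambda>k. ennreal ((norm (f n s - g k s))\<^sup>2)) \<longlonglongrightarrow> ennreal ((norm (f n s - F s))\<^sup>2)"
          by (intro tendsto_intros tendsto_ennrealI)
        then show ?case using lim_imp_Liminf[OF sequentially_bot] by fastforce
      qed
    qed
    also have "\<dots> \<le> liminf (\<lambda>k. \<integral>\<^sup>+s. ennreal ((norm (f n s - g k s))\<^sup>2) \<partial>UI)"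
      by (rule nn_integral_liminf) simp
    also have "\<dots> \<le> ennreal (e\<^sup>2)"
    proof (rule Liminf_le)
      show "\<forall>\<^sub>F k in sequentially. (\<integral>\<^sup>+s. ennreal ((norm (f n s - g k s))\<^sup>2) \<partial>UI) \<le> ennreal (e\<^sup>2)"
        unfolding eventually_sequentially
      proof (intro exI allI impI)
        fix k assume k: "N \<le> k"
        then have rk': "N \<le> r k" using rk[of k] by simp
        have L: "(\<lambda>s. f n s - g k s) \<in> L2" unfolding g_def by (rule L2_diff[OF f f])
        have "(\<integral>\<^sup>+s. ennreal ((norm (f n s - g k s))\<^sup>2) \<partial>UI) = ennreal ((nL2 (\<lambda>s. f n s - g k s))\<^sup>2)"
          unfolding nL2_sq by (rule nn_integral_eq_integral[OF L2_D(2)[OF L]]) simp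
        also have "\<dots> \<le> ennreal (e\<^sup>2)"
          using N[OF n rk'] by (intro ennreal_leI power_mono) (auto simp: g_def)
        finally show "(\<integral>\<^sup>+s. ennreal ((norm (f n s - g k s))\<^sup>2) \<partial>UI) \<le> ennreal (e\<^sup>2)" .
      qed
    qed simp
    finally have fat: "(\<integral>\<^sup>+s. ennreal ((norm (f n s - F s))\<^sup>2) \<partial>UI) \<le> ennreal (e\<^sup>2)" .
    have int: "integrable UI (\<lambda>s. (norm (f n s - F s))\<^sup>2)"
    proof (rule integrableI_bounded)
      show "(\<integral>\<^sup>+s. ennreal (norm ((norm (f n s - F s))\<^sup>2)) \<partial>UI) < \<infinity>"
        using order.strict_trans1[OF fat] by simp
    qed simp
    then have L: "(\<lambda>s. f n s - F s) \<in> L2" by (simp add: L2_def)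
    have "ennreal ((nL2 (\<lambda>s. f n s - F s))\<^sup>2) \<le> ennreal (e\<^sup>2)"
      using fat unfolding nL2_sq by (subst (asm) nn_integral_eq_integral[OF int]) auto
    then have "(nL2 (\<lambda>s. f n s - F s))\<^sup>2 \<le> e\<^sup>2" by (simp add: ennreal_le_iff)
    then have "nL2 (\<lambda>s. f n s - F s) \<le> e" by (rule power2_le_imp_le) (use e in simp)
    with L show ?thesis by blast
  qed
  have FL: "F \<in> L2"
  proof -
    obtain N where N: "\<And>m n. m \<ge> N \<Longrightarrow> n \<ge> N \<Longrightarrow> nL2 (\<lambda>s. f m s - f n s) < 1" using c[of 1] by auto
    have "(\<lambda>s. f N s - F s) \<in> L2" using key[OF _ N, of N] by simp
    from L2_diff[OF f[of N] this] show ?thesis by simp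
  qed
  have "(\<lambda>n. nL2 (\<lambda>s. f n s - F s)) \<longlonglongrightarrow> 0"
  proof (rule LIMSEQ_I)
    fix e :: real assume e: "e > 0"
    obtain N where N: "\<And>m n. m \<ge> N \<Longrightarrow> n \<ge> N \<Longrightarrow> nL2 (\<lambda>s. f m s - f n s) < e/2" using c[of "e/2"] e by auto
    have "norm (nL2 (\<lambda>s. f n s - F s) - 0) < e" if "n \<ge> N" for n
    proof -
      have "nL2 (\<lambda>s. f n s - F s) \<le> e/2" using key[OF _ N that] e by simp
      then show ?thesis using e by simp
    qed
    then show "\<exists>no. \<forall>n\<ge>no. norm (nL2 (\<lambda>s. f n s - F s) - 0) < e" by blast
  qed
  with FL show thesis by (rule that)
qed

subsection \<open>The Sobolev space\<close>

lemma is_H1_deriv_iff: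
  "is_H1_deriv V D \<longleftrightarrow> D \<in> L2 \<and> (\<forall>t\<in>{0..1}. V t = V 0 + (\<integral>s. indicator {0..t} s *\<^sub>R D s \<partial>UI))"
  unfolding is_H1_deriv_def L2_def borel_measurable_UI integrable_UI by (auto simp: integral_UI_upto)

lemma integrable_indicator_L2: "f \<in> L2 \<Longrightarrow> A \<in> sets borel \<Longrightarrow> integrable UI (\<lambda>s. indicator A s *\<^sub>R f s)"
proof (rule Bochner_Integration.integrable_bound)
  assume f: "f \<in> L2" and A: "A \<in> sets borel"
  show "integrable UI f" by (rule L2_integrable[OF f])
  show "(\<lambda>s. indicator A s *\<^sub>R f s) \<in> borel_measurable UI"
    by (intro borel_measurable_scaleR borel_measurable_indicator_UI A L2_D(1)[OF f])
  show "AE s in UI. norm (indicat_real A s *\<^sub>R f s) \<le> norm (f s)"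
    by (auto split: split_indicator)
qed

lemma H1_hder:
  assumes "V \<in> H1"
  shows "hder V \<in> L2" and "t \<in> {0..1} \<Longrightarrow> V t = V 0 + (\<integral>s. indicator {0..t} s *\<^sub>R hder V s \<partial>UI)"
proof -
  have "\<exists>D. is_H1_deriv V D" using assms unfolding H1_def by blast
  then have d: "is_H1_deriv V (hder V)" unfolding hder_def by (rule someI_ex)
  show "hder V \<in> L2" using d unfolding is_H1_deriv_iff by blast
  show "V t = V 0 + (\<integral>s. indicator {0..t} s *\<^sub>R hder V s \<partial>UI)" if "t \<in> {0..1}"
    using d that unfolding is_H1_deriv_iff by blast
qed

lemma H1_outside: "V \<in> H1 \<Longrightarrow> t \<notin> {0..1} \<Longrightarrow> V t = 0"
  by (simp add: H1_def)

text \<open>\<open>hder\<close> is a choice of weak derivative. Uniqueness almost everywhere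
  identifies it with any explicitly given derivative, which is how all derivatives are computed
  below.\<close>

lemma H1I:
  assumes "D \<in> L2" "\<And>t. t \<in> {0..1} \<Longrightarrow> V t = V 0 + (\<integral>s. indicator {0..t} s *\<^sub>R D s \<partial>UI)"
    "\<And>t. t \<notin> {0..1} \<Longrightarrow> V t = 0"
  shows "V \<in> H1" "AE s in UI. hder V s = D s"
proof -
  have d: "is_H1_deriv V D" unfolding is_H1_deriv_iff using assms(1,2) by blast
  then show V: "V \<in> H1" unfolding H1_def using assms(3) by blast
  have "AE s in UI. hder V s - D s = 0"
  proof (rule AE_UI_zero)
    show "integrable UI (\<lambda>s. hder V s - D s)" using L2_integrable H1_hder(1)[OF V] assms(1) by auto
    fix t :: real assume t: "t \<in> {0..1}"
    have "(\<integral>s. indicator {0..t} s *\<^sub>R (hder V s - D s) \<partial>UI)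
        = (\<integral>s. indicator {0..t} s *\<^sub>R hder V s \<partial>UI) - (\<integral>s. indicator {0..t} s *\<^sub>R D s \<partial>UI)"
      unfolding scaleR_diff_right
      by (intro Bochner_Integration.integral_diff integrable_indicator_L2 H1_hder(1)[OF V] assms(1)) auto
    moreover have "(\<integral>s. indicator {0..t} s *\<^sub>R hder V s \<partial>UI) = (\<integral>s. indicator {0..t} s *\<^sub>R D s \<partial>UI)"
      by (rule add_left_imp_eq[OF trans[OF sym[OF H1_hder(2)[OF V t]] assms(2)[OF t]]])
    ultimately show "(\<integral>s. indicator {0..t} s *\<^sub>R (hder V s - D s) \<partial>UI) = 0" by simp
  qed
  then show "AE s in UI. hder V s = D s" by simp
qed

lemma bounded_linear_vec_scale: "bounded_linear (\<lambda>v::complex ^ 'n::finite. c *s v)"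
  by (rule linear_conv_bounded_linear[THEN iffD1], rule linearI)
     (simp_all add: vec_eq_iff algebra_simps scaleR_conv_of_real[where 'a=complex])

lemma vec_scale_integral:
  fixes f :: "real \<Rightarrow> complex ^ 'n::finite"
  shows "integrable M f \<Longrightarrow> (\<integral>s. c *s f s \<partial>M) = c *s (\<integral>s. f s \<partial>M)"
  by (rule integral_bounded_linear[OF bounded_linear_vec_scale])

lemma vec_scale_scaleR: "c *s (r *\<^sub>R (v::complex ^ 'n::finite)) = r *\<^sub>R (c *s v)"
  by (simp add: vec_eq_iff)

lemma H1_add: assumes V: "V \<in> H1" and W: "W \<in> H1"
  shows "V + W \<in> H1" "AE s in UI. hder (V + W) s = hder V s + hder W s"
proof -
  have D: "(\<lambda>s. hder V s + hder W s) \<in> L2" by (intro L2_add H1_hder(1) V W)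
  have E: "(V + W) t = (V + W) 0 + (\<integral>s. indicator {0..t} s *\<^sub>R (hder V s + hder W s) \<partial>UI)" if t: "t \<in> {0..1}" for t
  proof -
    have "(\<integral>s. indicator {0..t} s *\<^sub>R (hder V s + hder W s) \<partial>UI)
        = (\<integral>s. indicator {0..t} s *\<^sub>R hder V s \<partial>UI) + (\<integral>s. indicator {0..t} s *\<^sub>R hder W s \<partial>UI)"
      unfolding scaleR_add_right
      by (intro Bochner_Integration.integral_add integrable_indicator_L2 H1_hder(1) V W) auto
    then show ?thesis using H1_hder(2)[OF V t] H1_hder(2)[OF W t] by simp
  qed
  have O: "(V + W) t = 0" if "t \<notin> {0..1}" for t using H1_outside[OF V that] H1_outside[OF W that] by simp
  show "V + W \<in> H1" "AE s in UI. hder (V + W) s = hder V s + hder W s"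
    by (rule H1I[of _ "V + W", OF D E O]; assumption)+
qed

lemma H1_scale: assumes V: "V \<in> H1"
  shows "cscale c V \<in> H1" "AE s in UI. hder (cscale c V) s = c *s hder V s"
proof -
  have D: "(\<lambda>s. c *s hder V s) \<in> L2" by (intro L2_scale H1_hder(1) V)
  have E: "cscale c V t = cscale c V 0 + (\<integral>s. indicator {0..t} s *\<^sub>R (c *s hder V s) \<partial>UI)" if t: "t \<in> {0..1}" for t
  proof -
    have "(\<integral>s. indicator {0..t} s *\<^sub>R (c *s hder V s) \<partial>UI) = c *s (\<integral>s. indicator {0..t} s *\<^sub>R hder V s \<partial>UI)"
      unfolding vec_scale_scaleR[symmetric]
      by (intro vec_scale_integral integrable_indicator_L2 H1_hder(1) V) auto
    then show ?thesis using H1_hder(2)[OF V t] by (simp add: cscale_def vec_eq_iff algebra_simps)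
  qed
  have O: "cscale c V t = 0" if "t \<notin> {0..1}" for t using H1_outside[OF V that] by (simp add: cscale_def vec_eq_iff)
  show "cscale c V \<in> H1" "AE s in UI. hder (cscale c V) s = c *s hder V s"
    by (rule H1I[of _ "cscale c V", OF D E O]; assumption)+
qed

lemma H1_zero: "0 \<in> H1"
  by (rule H1I(1)[of "\<lambda>_. 0"]) (auto simp: L2_def)

lemma H1_subspace: "cfun.subspace H1"
  by (rule cfun.subspaceI) (auto intro: H1_zero H1_add(1) H1_scale(1))

lemma H1_diff: assumes V: "V \<in> H1" and W: "W \<in> H1"
  shows "V - W \<in> H1" "AE s in UI. hder (V - W) s = hder V s - hder W s"
proof -
  have eq: "V - W = V + cscale (-1) W" by (simp add: fun_eq_iff cscale_def vec_eq_iff)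
  show "V - W \<in> H1" unfolding eq by (intro H1_add H1_scale V W)
  show "AE s in UI. hder (V - W) s = hder V s - hder W s"
    unfolding eq using H1_add(2)[OF V H1_scale(1)[OF W], of "-1"] H1_scale(2)[OF W, of "-1"]
    by eventually_elim (simp add: vec_eq_iff)
qed

lemma H1_inner_alt: "H1_inner V W = cdot (V 0) (W 0) + ipL2 (hder V) (hder W)"
  unfolding H1_inner_def ipL2_def integral_UI ..

lemma H1_inner_herm: "cfun.herm_on H1 H1_inner"
  unfolding cfun.herm_on_def
proof (intro conjI ballI allI)
  fix V W :: "'n::finite cfun" assume V: "V \<in> H1" and W: "W \<in> H1"
  note D = H1_hder(1)[OF V] H1_hder(1)[OF W]
  show "H1_inner W V = cnj (H1_inner V W)"
    using cfun.herm_cnj[OF L2_subspace ipL2_herm D] by (simp add: H1_inner_alt cdot_cnj)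
  show "H1_inner (cscale c V) W = c * H1_inner V W" for c
  proof -
    have "ipL2 (hder (cscale c V)) (hder W) = ipL2 (cscale c (hder V)) (hder W)"
      by (rule ipL2_cong) (use D H1_hder(1)[OF H1_scale(1)[OF V]] H1_scale(2)[OF V] L2_scale in \<open>auto simp: cscale_def\<close>)
    also have "\<dots> = c * ipL2 (hder V) (hder W)" by (rule cfun.herm_scale_left[OF L2_subspace ipL2_herm D])
    finally show ?thesis by (simp add: H1_inner_alt cscale_def cdot_scale_left algebra_simps)
  qed
  fix Z :: "'n::finite cfun" assume Z: "Z \<in> H1"
  note DZ = H1_hder(1)[OF Z]
  show "H1_inner (V + W) Z = H1_inner V Z + H1_inner W Z"
  proof -
    have "ipL2 (hder (V + W)) (hder Z) = ipL2 (hder V + hder W) (hder Z)"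
      by (rule ipL2_cong) (use D DZ H1_hder(1)[OF H1_add(1)[OF V W]] H1_add(2)[OF V W] L2_add in \<open>auto simp: plus_fun_def\<close>)
    also have "\<dots> = ipL2 (hder V) (hder Z) + ipL2 (hder W) (hder Z)"
      by (rule cfun.herm_add_left[OF L2_subspace ipL2_herm D DZ])
    finally show ?thesis by (simp add: H1_inner_alt cdot_add_left algebra_simps)
  qed
qed

definition H1n :: "'n::finite cfun \<Rightarrow> real" where "H1n V = sqrt (Re (H1_inner V V))"

lemma Re_H1_inner: "Re (H1_inner V V) = (norm (V 0))\<^sup>2 + (nL2 (hder V))\<^sup>2"
  by (simp add: H1_inner_alt cdot_self ipL2_self)

lemma H1n_sq: "(H1n V)\<^sup>2 = (norm (V 0))\<^sup>2 + (nL2 (hder V))\<^sup>2"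
  by (simp add: H1n_def Re_H1_inner)

lemma H1n_nonneg [simp]: "0 \<le> H1n V"
  by (simp add: H1n_def Re_H1_inner)

lemma norm_0_le_H1n: "norm (V 0) \<le> H1n V" and nL2_le_H1n: "nL2 (hder V) \<le> H1n V"
  by (rule power2_le_imp_le; simp add: H1n_sq)+

text \<open>The Hoelder-1/2 bound is the source of all smallness later: on a grid of mesh 1/m it
  produces the factor \<open>sqrt (1 / m)\<close>.\<close>

lemma H1_holder:
  assumes V: "V \<in> H1" and st: "0 \<le> s" "s \<le> t" "t \<le> 1"
  shows "norm (V t - V s) \<le> sqrt (t - s) * nL2 (hder V)"
proof -
  note D = H1_hder(1)[OF V]
  have "V t - V s = (\<integral>r. indicator {0..t} r *\<^sub>R hder V r \<partial>UI) - (\<integral>r. indicator {0..s} r *\<^sub>R hder V r \<partial>UI)"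
    using H1_hder(2)[OF V, of t] H1_hder(2)[OF V, of s] st by simp
  also have "\<dots> = (\<integral>r. indicator {0..t} r *\<^sub>R hder V r - indicator {0..s} r *\<^sub>R hder V r \<partial>UI)"
    by (intro Bochner_Integration.integral_diff[symmetric] integrable_indicator_L2 D) auto
  also have "norm \<dots> \<le> (\<integral>r. indicator {s..t} r * norm (hder V r) \<partial>UI)"
  proof (rule Bochner_Integration.integral_norm_bound_integral)
    show "integrable UI (\<lambda>r. indicator {0..t} r *\<^sub>R hder V r - indicator {0..s} r *\<^sub>R hder V r)"
      by (intro Bochner_Integration.integrable_diff integrable_indicator_L2 D) auto
    show "integrable UI (\<lambda>r. indicator {s..t} r * norm (hder V r))"
      by (rule Bochner_Integration.integrable_bound[OF L2_norm_integrable[OF D]])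
         (use L2_D(1)[OF D] in \<open>auto split: split_indicator\<close>)
    show "norm (indicator {0..t} r *\<^sub>R hder V r - indicator {0..s} r *\<^sub>R hder V r) \<le> indicator {s..t} r * norm (hder V r)" for r
      using st by (auto split: split_indicator)
  qed
  also have "\<dots> \<le> sqrt (t - s) * nL2 (hder V)" by (rule norm_integral_L2_le[OF D st])
  finally show ?thesis .
qed

text \<open>The factor 2 is crude: \<open>norm (V 0)\<close> and the L2 norm of the derivative are
  each bounded by \<open>H1n V\<close>.\<close>

lemma H1_sup_le: assumes V: "V \<in> H1" shows "norm (V r) \<le> 2 * H1n V"
proof (cases "r \<in> {0..1}")
  case True
  have "norm (V r - V 0) \<le> sqrt (r - 0) * nL2 (hder V)" using H1_holder[OF V, of 0 r] True by simp
  also have "\<dots> \<le> 1 * nL2 (hder V)" using True by (intro mult_right_mono) auto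
  finally have "norm (V r) \<le> norm (V 0) + nL2 (hder V)" using norm_triangle_sub[of "V r" "V 0"] by simp
  then show ?thesis using norm_0_le_H1n[of V] nL2_le_H1n[of V] by simp
qed (simp add: H1_outside[OF V])

lemma H1_continuous: assumes V: "V \<in> H1" shows "continuous_on {0..1} V"
  unfolding continuous_on_iff
proof (intro ballI allI impI)
  fix x e :: real assume x: "x \<in> {0..1}" and e: "0 < e"
  define K where "K = nL2 (hder V) + 1"
  have K: "K > 0" by (simp add: K_def add_nonneg_pos)
  have "dist (V y) (V x) < e" if y: "y \<in> {0..1}" "dist y x < (e / K)\<^sup>2" for y
  proof -
    have "norm (V y - V x) \<le> sqrt \<bar>y - x\<bar> * nL2 (hder V)"
    proof (cases "x \<le> y")
      case True
      then show ?thesis using H1_holder[OF V, of x y] x y by simp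
    next
      case False
      then show ?thesis using H1_holder[OF V, of y x] x y by (simp add: norm_minus_commute)
    qed
    also have "\<dots> \<le> sqrt \<bar>y - x\<bar> * K" by (intro mult_left_mono) (auto simp: K_def)
    also have "\<dots> < e / K * K"
      using y e K by (intro mult_strict_right_mono real_less_lsqrt) (auto simp: dist_real_def)
    finally show ?thesis using K by (simp add: dist_norm)
  qed
  then show "\<exists>d>0. \<forall>y\<in>{0..1}. dist y x < d \<longrightarrow> dist (V y) (V x) < e"
    using e K by (intro exI[of _ "(e / K)\<^sup>2"]) auto
qed

lemma H1n_eq_0: assumes V: "V \<in> H1" and z: "H1n V = 0" shows "V = 0"
  using H1_sup_le[OF V] z by (simp add: fun_eq_iff)

text \<open>The norm splits into the value at 0 and the L2 norm of the derivative; both converge,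
  and the limit is the primitive of the limiting derivative with the limiting initial value.\<close>

lemma H1_complete:
  fixes f :: "nat \<Rightarrow> 'n::finite cfun"
  assumes f: "\<And>n. f n \<in> H1" and c: "\<And>e. e > 0 \<Longrightarrow> \<exists>M. \<forall>m\<ge>M. \<forall>n\<ge>M. H1n (f m - f n) < e"
  obtains V where "V \<in> H1" "(\<lambda>n. H1n (f n - V)) \<longlonglongrightarrow> 0"
proof -
  have nd: "nL2 (\<lambda>s. hder (f m) s - hder (f n) s) \<le> H1n (f m - f n)" for m n
  proof -
    have "nL2 (\<lambda>s. hder (f m) s - hder (f n) s) = nL2 (hder (f m - f n))"
      by (rule L2_cong(2)[OF H1_hder(1)[OF H1_diff(1)[OF f f]] H1_diff(2)[OF f f]])
         (intro L2_D(1) L2_diff H1_hder(1) f)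
    then show ?thesis using nL2_le_H1n[of "f m - f n"] by simp
  qed
  have "\<exists>M. \<forall>m\<ge>M. \<forall>n\<ge>M. nL2 (\<lambda>s. hder (f m) s - hder (f n) s) < e" if "e > 0" for e
    using c[OF that] nd by (meson le_less_trans)
  then obtain F where F: "F \<in> L2" "(\<lambda>n. nL2 (\<lambda>s. hder (f n) s - F s)) \<longlonglongrightarrow> 0"
    using L2_complete[of "\<lambda>n. hder (f n)"] H1_hder(1)[OF f] by blast
  have "Cauchy (\<lambda>n. f n 0)"
  proof (rule metric_CauchyI)
    fix e :: real assume "e > 0"
    then obtain M where M: "\<And>m n. m \<ge> M \<Longrightarrow> n \<ge> M \<Longrightarrow> H1n (f m - f n) < e" using c by blast
    have "dist (f m 0) (f n 0) < e" if "m \<ge> M" "n \<ge> M" for m n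
      using norm_0_le_H1n[of "f m - f n"] M[OF that] by (simp add: dist_norm)
    then show "\<exists>M. \<forall>m\<ge>M. \<forall>n\<ge>M. dist (f m 0) (f n 0) < e" by blast
  qed
  then obtain v where v: "(\<lambda>n. f n 0) \<longlonglongrightarrow> v" using Cauchy_convergent convergent_def by blast
  define V where "V t = (if t \<in> {0..1} then v + (\<integral>s. indicator {0..t} s *\<^sub>R F s \<partial>UI) else 0)" for t
  have "AE s in lborel. s \<noteq> (0::real)" by (rule AE_lborel_singleton)
  then have "AE s in UI. s \<noteq> 0" unfolding UI_def by (subst AE_restrict_space_iff) (auto elim: eventually_mono)
  then have "AE s in UI. indicat_real {0..0} s *\<^sub>R F s = 0" by eventually_elim simp
  \<comment> \<open>At \<open>t = 0\<close> the defining formula integrates over the single point 0,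
    a null set, so the initial value is indeed \<open>v\<close>.\<close>
  then have "(\<integral>s. indicator {0..0::real} s *\<^sub>R F s \<partial>UI) = 0" by (rule integral_eq_zero_AE)
  then have V0: "V 0 = v" by (simp add: V_def)
  have Vt: "V t = V 0 + (\<integral>s. indicator {0..t} s *\<^sub>R F s \<partial>UI)" if "t \<in> {0..1}" for t
    unfolding V0 using that by (simp add: V_def)
  have Vo: "V t = 0" if "t \<notin> {0..1}" for t unfolding V_def using that by (rule if_not_P)
  have V: "V \<in> H1" "AE s in UI. hder V s = F s"
    by (rule H1I[of _ V, OF F(1) Vt Vo]; assumption)+
  have "(\<lambda>n. (H1n (f n - V))\<^sup>2) \<longlonglongrightarrow> 0"
  proof -
    have "nL2 (hder (f n - V)) = nL2 (\<lambda>s. hder (f n) s - F s)" for n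
    proof (rule L2_cong(2))
      show "(\<lambda>s. hder (f n) s - F s) \<in> L2" by (intro L2_diff H1_hder(1) f F)
      show "AE s in UI. hder (f n) s - F s = hder (f n - V) s"
        using H1_diff(2)[OF f[of n] V(1)] V(2) by eventually_elim simp
      show "hder (f n - V) \<in> borel_measurable UI" by (intro L2_D(1) H1_hder(1) H1_diff(1) f V)
    qed
    then have eq: "(H1n (f n - V))\<^sup>2 = (norm (f n 0 - v))\<^sup>2 + (nL2 (\<lambda>s. hder (f n) s - F s))\<^sup>2" for n
      by (simp add: H1n_sq V0)
    have "(\<lambda>n. (norm (f n 0 - v))\<^sup>2 + (nL2 (\<lambda>s. hder (f n) s - F s))\<^sup>2) \<longlonglongrightarrow> (norm (v - v))\<^sup>2 + 0\<^sup>2"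
      by (intro tendsto_intros v F)
    then show ?thesis unfolding eq by simp
  qed
  then have "(\<lambda>n. sqrt ((H1n (f n - V))\<^sup>2)) \<longlonglongrightarrow> sqrt 0" by (rule tendsto_real_sqrt)
  then have "(\<lambda>n. H1n (f n - V)) \<longlonglongrightarrow> 0" by simp
  with V(1) show thesis by (rule that)
qed

lemma H1_eval_tendsto:
  assumes "\<And>n::nat. f n \<in> H1" "V \<in> H1" "(\<lambda>n. H1n (f n - V)) \<longlonglongrightarrow> 0"
  shows "(\<lambda>n. f n r) \<longlonglongrightarrow> V r"
proof -
  have "(\<lambda>n. f n r - V r) \<longlonglongrightarrow> 0"
  proof (rule Lim_null_comparison)
    show "\<forall>\<^sub>F n in sequentially. norm (f n r - V r) \<le> 2 * H1n (f n - V)"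
      using H1_sup_le[OF H1_diff(1)[OF assms(1,2)]] by (intro always_eventually allI) simp
    show "(\<lambda>n. 2 * H1n (f n - V)) \<longlonglongrightarrow> 0" using tendsto_mult_left[OF assms(3), of 2] by simp
  qed
  then show ?thesis by (simp add: LIM_zero_iff)
qed

lemma Hz_subset: "Hz z \<subseteq> H1"
  by (auto simp: Hz_def)

lemma Hz_subspace: "cfun.subspace (Hz z)"
  using H1_subspace by (auto simp: Hz_def cfun.subspace_def cscale_def vec_eq_iff algebra_simps)

text \<open>Evaluation at a point is continuous in the H1 norm, so the boundary condition survives
  limits and the subspace is closed.\<close>

lemma hspace_Hz: "hspace cscale (Hz z) H1_inner"
proof
  show "cfun.subspace (Hz z)" by (rule Hz_subspace)
  show "cfun.herm_on (Hz z) H1_inner" by (rule cfun.herm_on_subset[OF H1_inner_herm Hz_subset])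
  show "0 < Re (H1_inner V V)" if "V \<in> Hz z" "V \<noteq> 0" for V
  proof -
    have "H1n V \<noteq> 0" using that Hz_subset H1n_eq_0 by blast
    then have "0 < (H1n V)\<^sup>2" by simp
    then show ?thesis by (simp add: H1n_def Re_H1_inner)
  qed
  fix f :: "nat \<Rightarrow> 'a cfun" assume f: "\<And>n. f n \<in> Hz z"
    and c: "\<forall>e>0. \<exists>M. \<forall>m\<ge>M. \<forall>n\<ge>M. sqrt (Re (H1_inner (f m - f n) (f m - f n))) < e"
  have fH: "f n \<in> H1" for n using f Hz_subset by blast
  obtain V where V: "V \<in> H1" "(\<lambda>n. H1n (f n - V)) \<longlonglongrightarrow> 0"
    using H1_complete[of f] fH c unfolding H1n_def by blast
  have "(\<lambda>n. z *s f n 0) \<longlonglongrightarrow> z *s V 0"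
    by (rule bounded_linear.tendsto[OF bounded_linear_vec_scale H1_eval_tendsto[OF fH V]])
  moreover have "(\<lambda>n. z *s f n 0) \<longlonglongrightarrow> V 1"
    using H1_eval_tendsto[OF fH V, of 1] f by (simp add: Hz_def)
  ultimately have "V 1 = z *s V 0" using LIMSEQ_unique by blast
  then show "\<exists>l\<in>Hz z. (\<lambda>n. sqrt (Re (H1_inner (f n - l) (f n - l)))) \<longlonglongrightarrow> 0"
    using V unfolding H1n_def Hz_def by blast
qed

subsection \<open>The index forms\<close>

definition Gm :: "('n::finite \<Rightarrow> real) \<Rightarrow> complex ^ 'n \<Rightarrow> complex ^ 'n" where
  "Gm \<epsilon> u = (\<chi> i. complex_of_real (\<epsilon> i) * u $ i)"

text \<open>The sum of absolute entries, convenient for bounding the action of a real matrix on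
  complex vectors; \<open>mnorm_le_norm\<close> compares it with the ambient norm.\<close>

definition mnorm :: "real ^ 'n ^ 'n::finite \<Rightarrow> real" where
  "mnorm M = (\<Sum>i\<in>UNIV. \<Sum>j\<in>UNIV. \<bar>M $ i $ j\<bar>)"

lemma Gform_Gm: "Gform \<epsilon> u v = cdot (Gm \<epsilon> u) v"
  by (simp add: Gform_def cdot_def Gm_def)

lemma Gm_add: "Gm \<epsilon> (u + v) = Gm \<epsilon> u + Gm \<epsilon> v"
  and Gm_diff: "Gm \<epsilon> (u - v) = Gm \<epsilon> u - Gm \<epsilon> v"
  and Gm_scale: "Gm \<epsilon> (c *s u) = c *s Gm \<epsilon> u"
  and Gm_scaleR: "Gm \<epsilon> (r *\<^sub>R u) = r *\<^sub>R Gm \<epsilon> u"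
  by (simp_all add: Gm_def vec_eq_iff algebra_simps)

lemma Gm_zero [simp]: "Gm \<epsilon> 0 = 0"
  by (simp add: Gm_def vec_eq_iff)

lemma cdot_Gm_swap: "cdot (Gm \<epsilon> u) v = cdot u (Gm \<epsilon> v)"
  by (simp add: cdot_def Gm_def mult.assoc mult.left_commute)

lemma norm_Gm: "\<forall>i. \<epsilon> i = 1 \<or> \<epsilon> i = -1 \<Longrightarrow> norm (Gm \<epsilon> u) = norm u"
proof -
  assume "\<forall>i. \<epsilon> i = 1 \<or> \<epsilon> i = -1"
  then have "norm (complex_of_real (\<epsilon> i) * u $ i) = norm (u $ i)" for i
    by (cases "\<epsilon> i = 1") (auto simp: norm_mult)
  then show ?thesis by (simp add: norm_vec_def Gm_def L2_set_def)
qed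

lemma bounded_linear_Gm: "bounded_linear (Gm \<epsilon>)"
  by (rule linear_conv_bounded_linear[THEN iffD1], rule linearI) (simp_all add: Gm_add Gm_scaleR)

lemma cmv_add: "cmv M (u + v) = cmv M u + cmv M v"
  and cmv_diff: "cmv M (u - v) = cmv M u - cmv M v"
  and cmv_scale: "cmv M (c *s u) = c *s cmv M u"
  and cmv_mat_diff: "cmv (M - M') u = cmv M u - cmv M' u"
  and cmv_scaleR: "cmv (r *\<^sub>R M) u = of_real r *s cmv M u"
  by (simp_all add: cmv_def vec_eq_iff algebra_simps sum.distrib sum_subtractf sum_distrib_left)

lemma mnorm_nonneg [simp]: "0 \<le> mnorm M"
  by (simp add: mnorm_def sum_nonneg)

lemma norm_cmv_le: "norm (cmv M v) \<le> mnorm M * norm v"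
proof -
  have "norm (cmv M v) \<le> (\<Sum>i\<in>UNIV. norm (cmv M v $ i))"
    unfolding norm_vec_def by (rule L2_set_le_sum) simp
  also have "\<dots> \<le> (\<Sum>i\<in>UNIV. \<Sum>j\<in>UNIV. \<bar>M $ i $ j\<bar> * norm v)"
  proof (intro sum_mono)
    fix i
    have "norm (cmv M v $ i) \<le> (\<Sum>j\<in>UNIV. norm (complex_of_real (M $ i $ j) * v $ j))"
      unfolding cmv_def by (simp add: norm_sum)
    also have "\<dots> \<le> (\<Sum>j\<in>UNIV. \<bar>M $ i $ j\<bar> * norm v)"
      by (intro sum_mono) (auto simp: norm_mult intro!: mult_left_mono component_le_norm_cart Finite_Cartesian_Product.norm_nth_le)
    finally show "norm (cmv M v $ i) \<le> (\<Sum>j\<in>UNIV. \<bar>M $ i $ j\<bar> * norm v)" .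
  qed
  also have "\<dots> = mnorm M * norm v" by (simp add: mnorm_def sum_distrib_right)
  finally show ?thesis .
qed

lemma continuous_on_mnorm: "continuous_on A f \<Longrightarrow> continuous_on A (\<lambda>x. mnorm (f x))"
  unfolding mnorm_def by (intro continuous_intros)

lemma continuous_on_cmv:
  assumes "continuous_on A M" "continuous_on A v" shows "continuous_on A (\<lambda>x. cmv (M x) (v x))"
  unfolding cmv_def using assms by (intro continuous_intros)

lemma L2_bounded:
  fixes f :: "'n::finite cfun"
  assumes "f \<in> borel_measurable UI" "0 \<le> B" "AE s in UI. norm (f s) \<le> B" shows "f \<in> L2" "nL2 f \<le> B"
proof -
  interpret finite_measure UI by (rule finite_UI)
  have ae: "AE s in UI. (norm (f s))\<^sup>2 \<le> B\<^sup>2" using assms(3) by eventually_elim (simp add: power_mono)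
  have i: "integrable UI (\<lambda>s. (norm (f s))\<^sup>2)"
    by (rule integrable_const_bound[where B = "B\<^sup>2"]) (use assms ae in auto)
  then show "f \<in> L2" using assms by (simp add: L2_def)
  have "(\<integral>s. (norm (f s))\<^sup>2 \<partial>UI) \<le> (\<integral>s. B\<^sup>2 \<partial>UI)"
    by (rule integral_mono_AE[OF i _ ae]) simp
  then have "(nL2 f)\<^sup>2 \<le> B\<^sup>2" by (simp add: nL2_sq)
  then show "nL2 f \<le> B" by (rule power2_le_imp_le) fact
qed

lemma L2_Gm:
  assumes "\<forall>i. \<epsilon> i = 1 \<or> \<epsilon> i = -1" "f \<in> L2" shows "(\<lambda>s. Gm \<epsilon> (f s)) \<in> L2" "nL2 (\<lambda>s. Gm \<epsilon> (f s)) = nL2 f"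
proof -
  have "(\<lambda>s. Gm \<epsilon> (f s)) \<in> borel_measurable UI"
    by (rule borel_measurable_continuous_on[OF _ L2_D(1)[OF assms(2)]])
       (rule linear_continuous_on[OF bounded_linear_Gm])
  then show "(\<lambda>s. Gm \<epsilon> (f s)) \<in> L2" using assms by (simp add: L2_def norm_Gm)
  show "nL2 (\<lambda>s. Gm \<epsilon> (f s)) = nL2 f" using assms by (simp add: nL2_def norm_Gm)
qed

lemma nL2_triangle: assumes "f \<in> L2" "g \<in> L2" shows "nL2 (\<lambda>s. f s + g s) \<le> nL2 f + nL2 g"
proof -
  have "(nL2 (f + g))\<^sup>2 = (nL2 f)\<^sup>2 + 2 * Re (ipL2 f g) + (nL2 g)\<^sup>2"
    using cfun.herm_quad_add[OF L2_subspace ipL2_herm assms] by (simp add: ipL2_self)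
  also have "\<dots> \<le> (nL2 f + nL2 g)\<^sup>2"
    using ipL2_le[OF assms] complex_Re_le_cmod[of "ipL2 f g"] by (simp add: power2_sum)
  finally show ?thesis unfolding plus_fun_def by (rule power2_le_imp_le) simp
qed

lemma H1_L2: "V \<in> H1 \<Longrightarrow> V \<in> L2" and nL2_le_2H1n: "V \<in> H1 \<Longrightarrow> nL2 V \<le> 2 * H1n V"
  by (rule L2_bounded[of _ "2 * H1n V"]; simp add: borel_measurable_UI_continuous H1_continuous H1_sup_le)+

text \<open>The form \<open>Bform\<close> in the shape \<open>\<integral> G(DV, DW) + G(EV, W)\<close> with \<open>DV = V' + AV\<close>.\<close>

definition DA :: "(real \<Rightarrow> real ^ 'n ^ 'n::finite) \<Rightarrow> 'n cfun \<Rightarrow> 'n cfun" where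
  "DA A V = (\<lambda>r. hder V r + cmv (A r) (V r))"

definition EA :: "(real \<Rightarrow> real ^ 'n ^ 'n::finite) \<Rightarrow> 'n cfun \<Rightarrow> 'n cfun" where
  "EA E V = (\<lambda>r. cmv (E r) (V r))"

definition GA :: "('n::finite \<Rightarrow> real) \<Rightarrow> 'n cfun \<Rightarrow> 'n cfun" where
  "GA \<epsilon> f = (\<lambda>r. Gm \<epsilon> (f r))"

definition Bgen :: "('n::finite \<Rightarrow> real) \<Rightarrow> (real \<Rightarrow> real ^ 'n ^ 'n) \<Rightarrow> (real \<Rightarrow> real ^ 'n ^ 'n) \<Rightarrow> 'n cform" where
  "Bgen \<epsilon> A E V W = ipL2 (GA \<epsilon> (DA A V)) (DA A W) + ipL2 (GA \<epsilon> (EA E V)) W"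

lemma EA_L2:
  assumes "continuous_on {0..1} E" "V \<in> H1" "0 \<le> S" "\<And>r. r \<in> {0..1} \<Longrightarrow> norm (V r) \<le> S"
    "0 \<le> K" "\<And>r. r \<in> {0..1} \<Longrightarrow> mnorm (E r) \<le> K"
  shows "EA E V \<in> L2" "nL2 (EA E V) \<le> K * S"
proof -
  have m: "EA E V \<in> borel_measurable UI" unfolding EA_def
    by (intro borel_measurable_UI_continuous continuous_on_cmv assms(1) H1_continuous assms(2))
  have "norm (EA E V r) \<le> K * S" if "r \<in> {0..1}" for r
    unfolding EA_def using norm_cmv_le[of "E r" "V r"] mult_mono[OF assms(6)[OF that] assms(4)[OF that] assms(5)]
    by simp
  then have ae: "AE s in UI. norm (EA E V s) \<le> K * S" by (intro AE_I2) simp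
  show "EA E V \<in> L2" "nL2 (EA E V) \<le> K * S" using L2_bounded[OF m _ ae] assms by auto
qed

lemma EA_L2':
  assumes "continuous_on {0..1} E" "V \<in> H1" shows "EA E V \<in> L2"
proof -
  obtain K where K: "\<And>r. r \<in> {0..1} \<Longrightarrow> mnorm (E r) \<le> K"
    using compact_imp_bounded[OF compact_continuous_image[OF continuous_on_mnorm[OF assms(1)] compact_Icc]]
    unfolding bounded_iff by auto (metis abs_le_D1 atLeastAtMost_iff)
  have "0 \<le> K" using order_trans[OF mnorm_nonneg K[of 0]] by simp
  then show ?thesis using EA_L2(1)[OF assms(1,2), of "2 * H1n V" K] H1_sup_le[OF assms(2)] K by simp
qed

lemma DA_alt: "DA A V = hder V + EA A V"
  by (simp add: DA_def EA_def fun_eq_iff)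

lemma DA_L2: "continuous_on {0..1} A \<Longrightarrow> V \<in> H1 \<Longrightarrow> DA A V \<in> L2"
  unfolding DA_alt plus_fun_def by (intro L2_add H1_hder(1) EA_L2')

lemma nL2_DA_le:
  assumes A: "continuous_on {0..1} A" and V: "V \<in> H1" and K: "0 \<le> K" "\<And>r. r \<in> {0..1} \<Longrightarrow> mnorm (A r) \<le> K"
  shows "nL2 (DA A V) \<le> (1 + 2 * K) * H1n V"
proof -
  note E = EA_L2[OF A V _ H1_sup_le[OF V] K]
  have "nL2 (DA A V) \<le> nL2 (hder V) + nL2 (EA A V)"
    unfolding DA_alt plus_fun_def by (rule nL2_triangle[OF H1_hder(1)[OF V] EA_L2'[OF A V]])
  also have "\<dots> \<le> H1n V + K * (2 * H1n V)" by (intro add_mono nL2_le_H1n E) simp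
  finally show ?thesis by (simp add: algebra_simps)
qed

text \<open>With \<open>A r = t \<Gamma>(t r)\<close>, the first four terms of \<open>Bform\<close>
  are the expansion of \<open>G(V' + AV, W' + AW)\<close>; the curvature term is the remaining
  zeroth-order part with \<open>E r = t^2 R(t r)\<close>.\<close>

lemma Bform_eq_Bgen:
  assumes eps: "\<forall>i. \<epsilon> i = 1 \<or> \<epsilon> i = -1" and c: "continuous_on UNIV \<Gamma>" "continuous_on UNIV R" and V: "V \<in> H1" and W: "W \<in> H1"
  shows "Bform \<epsilon> \<Gamma> R t V W = Bgen \<epsilon> (\<lambda>r. t *\<^sub>R \<Gamma> (t * r)) (\<lambda>r. t\<^sup>2 *\<^sub>R R (t * r)) V W"
proof -
  define A E where "A r = t *\<^sub>R \<Gamma> (t * r)" and "E r = t\<^sup>2 *\<^sub>R R (t * r)" for r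
  have cA: "continuous_on {0..1} A" "continuous_on {0..1} E"
    unfolding A_def E_def by (intro continuous_intros continuous_on_compose2[OF c(1)] continuous_on_compose2[OF c(2)]; simp)+
  have L: "GA \<epsilon> (DA A V) \<in> L2" "DA A W \<in> L2" "GA \<epsilon> (EA E V) \<in> L2" "W \<in> L2"
    unfolding GA_def by (intro L2_Gm eps DA_L2 EA_L2' cA V W H1_L2)+
  have "Bform \<epsilon> \<Gamma> R t V W = (\<integral>r. cdot (GA \<epsilon> (DA A V) r) (DA A W r) + cdot (GA \<epsilon> (EA E V) r) (W r) \<partial>UI)"
    unfolding Bform_def integral_UI
    by (rule Bochner_Integration.integral_cong)
       (simp_all add: Gform_Gm GA_def DA_def EA_def A_def E_def cmv_scaleR Gm_add Gm_scale cdot_add_left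
          cdot_add_right cdot_scale_left cdot_scale_right power2_eq_square algebra_simps)
  also have "\<dots> = Bgen \<epsilon> A E V W"
    unfolding Bgen_def ipL2_def by (intro Bochner_Integration.integral_add L2_cdot_integrable L)
  finally show ?thesis unfolding A_def E_def .
qed

lemma GA_add: "GA \<epsilon> (f + g) = GA \<epsilon> f + GA \<epsilon> g" and GA_diff: "GA \<epsilon> (f - g) = GA \<epsilon> f - GA \<epsilon> g"
  by (simp_all add: GA_def fun_eq_iff Gm_add Gm_diff)

lemma L2_plus: "f \<in> L2 \<Longrightarrow> g \<in> L2 \<Longrightarrow> f + g \<in> L2" and L2_minus: "f \<in> L2 \<Longrightarrow> g \<in> L2 \<Longrightarrow> f - g \<in> L2"
  using L2_subspace cfun.subspace_add cfun.subspace_diff by blast+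

lemmas ipL2_simps = cfun.herm_add_left[OF L2_subspace ipL2_herm] cfun.herm_add_right[OF L2_subspace ipL2_herm]
  cfun.herm_diff_left[OF L2_subspace ipL2_herm] cfun.herm_diff_right[OF L2_subspace ipL2_herm]

lemma DA_diff: "DA A V - DA A' V = EA (\<lambda>r. A r - A' r) V"
  and EA_diff: "EA E V - EA E' V = EA (\<lambda>r. E r - E' r) V"
  by (simp_all add: DA_def EA_def fun_eq_iff cmv_mat_diff)

section \<open>Grid spaces, where the form is close to plus or minus the inner product\<close>

definition gridW :: "nat \<Rightarrow> 'n::finite cfun set" where
  "gridW m = {V \<in> H1. \<forall>j\<le>m. V (real j / real m) = 0}"

definition Wsp :: "('n::finite \<Rightarrow> real) \<Rightarrow> nat \<Rightarrow> real \<Rightarrow> 'n cfun set" where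
  "Wsp \<epsilon> m \<sigma> = {V \<in> gridW m. \<forall>r. Gm \<epsilon> (V r) = of_real \<sigma> *s V r}"

text \<open>Every point of the interval has a grid point at most 1/m to its left, where the function
  vanishes; the Hoelder bound does the rest.\<close>

lemma gridW_sup:
  assumes V: "V \<in> gridW m" and m: "0 < m"
  shows "norm (V r) \<le> sqrt (1 / m) * H1n V"
proof (cases "r \<in> {0..1}")
  case True
  have VH: "V \<in> H1" and g: "\<And>j. j \<le> m \<Longrightarrow> V (real j / real m) = 0" using V by (auto simp: gridW_def)
  define j where "j = nat \<lfloor>real m * r\<rfloor>"
  have mr: "0 \<le> real m * r" "real m * r \<le> real m" using True m by (auto intro: mult_left_le)
  have j: "real j \<le> real m * r" "real m * r < real j + 1"
    unfolding j_def using mr by (simp_all add: of_nat_nat)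
  have jm: "j \<le> m" using j(1) mr(2) by simp
  have jr1: "real j / m \<le> r" using j(1) m by (simp add: pos_divide_le_eq mult.commute)
  have "r \<le> (real j + 1) / m" using j(2) m by (simp add: pos_le_divide_eq mult.commute)
  then have jr: "real j / m \<le> r" "r - real j / m \<le> 1 / m" using jr1 by (simp_all add: add_divide_distrib)
  have "norm (V r - V (real j / m)) \<le> sqrt (r - real j / m) * nL2 (hder V)"
    by (rule H1_holder[OF VH]) (use jr True m in auto)
  also have "\<dots> \<le> sqrt (1 / m) * H1n V" using jr by (intro mult_mono nL2_le_H1n) auto
  finally show ?thesis using g[OF jm] by simp
next
  case False
  then show ?thesis using V by (simp add: gridW_def H1_outside)
qed

text \<open>If \<open>V\<close> takes values in an eigenspace of G, then
  \<open>\<sigma> G V'\<close> is also a weak derivative of \<open>V\<close>, so it agrees with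
  \<open>V'\<close> almost everywhere.\<close>

lemma hder_Gm:
  assumes V: "V \<in> H1" and G: "\<And>r. Gm \<epsilon> (V r) = of_real \<sigma> *s V r" and \<sigma>: "\<sigma> * \<sigma> = 1"
    and eps: "\<forall>i. \<epsilon> i = 1 \<or> \<epsilon> i = -1"
  shows "AE r in UI. Gm \<epsilon> (hder V r) = of_real \<sigma> *s hder V r"
proof -
  define T where "T v = of_real \<sigma> *s Gm \<epsilon> v" for v
  have T: "bounded_linear T"
    unfolding T_def by (rule bounded_linear_compose[OF bounded_linear_vec_scale bounded_linear_Gm])
  have s1: "of_real \<sigma> *s (of_real \<sigma> *s v) = v" for v :: "complex ^ 'a"
  proof -
    have "of_real \<sigma> * of_real \<sigma> = (1::complex)" using \<sigma> by (metis of_real_1 of_real_mult)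
    then show ?thesis by (simp add: vec_eq_iff mult.assoc[symmetric])
  qed
  have TV: "T (V r) = V r" for r unfolding T_def G s1 ..
  have D: "(\<lambda>r. T (hder V r)) \<in> L2" unfolding T_def by (intro L2_scale L2_Gm eps H1_hder(1) V)
  have E: "V t = V 0 + (\<integral>s. indicator {0..t} s *\<^sub>R T (hder V s) \<partial>UI)" if t: "t \<in> {0..1}" for t
  proof -
    have "V t = T (V t)" by (simp add: TV)
    also have "\<dots> = T (V 0 + (\<integral>s. indicator {0..t} s *\<^sub>R hder V s \<partial>UI))"
      using H1_hder(2)[OF V t] by (rule arg_cong)
    also have "\<dots> = V 0 + T (\<integral>s. indicator {0..t} s *\<^sub>R hder V s \<partial>UI)"
      by (simp add: bounded_linear.linear[OF T, THEN linear_add] TV)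
    also have "T (\<integral>s. indicator {0..t} s *\<^sub>R hder V s \<partial>UI) = (\<integral>s. T (indicator {0..t} s *\<^sub>R hder V s) \<partial>UI)"
      by (rule integral_bounded_linear[OF T, symmetric]) (intro integrable_indicator_L2 H1_hder(1) V, simp)
    also have "\<dots> = (\<integral>s. indicator {0..t} s *\<^sub>R T (hder V s) \<partial>UI)"
      by (simp add: bounded_linear.linear[OF T, THEN linear_scale])
    finally show ?thesis .
  qed
  have "AE s in UI. hder V s = T (hder V s)"
    by (rule H1I(2)[OF D E]) (use H1_outside[OF V] in auto)
  then show ?thesis
  proof eventually_elim
    case (elim r)
    have "of_real \<sigma> *s hder V r = of_real \<sigma> *s T (hder V r)" using elim by (rule arg_cong)
    then show ?case unfolding T_def s1 by simp
  qed
qed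

text \<open>Half-open intervals are used because they tile the interval without overlap, both for
  the grid and for the sheets of the cover.\<close>

lemma integral_hder_Ioc:
  assumes V: "V \<in> H1" and ab: "0 \<le> a" "a \<le> b" "b \<le> 1"
  shows "(\<integral>r. indicator {a<..b} r *\<^sub>R hder V r \<partial>UI) = V b - V a"
proof -
  note D = H1_hder(1)[OF V]
  have "V b - V a = (\<integral>r. indicator {0..b} r *\<^sub>R hder V r \<partial>UI) - (\<integral>r. indicator {0..a} r *\<^sub>R hder V r \<partial>UI)"
    using H1_hder(2)[OF V, of a] H1_hder(2)[OF V, of b] ab by simp
  also have "\<dots> = (\<integral>r. indicator {0..b} r *\<^sub>R hder V r - indicator {0..a} r *\<^sub>R hder V r \<partial>UI)"
    by (intro Bochner_Integration.integral_diff[symmetric] integrable_indicator_L2 D) auto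
  also have "\<dots> = (\<integral>r. indicator {a<..b} r *\<^sub>R hder V r \<partial>UI)"
    using ab by (intro Bochner_Integration.integral_cong) (auto split: split_indicator)
  finally show ?thesis by simp
qed

lemma AE_UI_nonzero: "AE s in UI. s \<noteq> 0"
proof -
  have "AE s in lborel. s \<noteq> (0::real)" by (rule AE_lborel_singleton)
  then show ?thesis unfolding UI_def by (subst AE_restrict_space_iff) (auto elim: eventually_mono)
qed

lemma H1_mod:
  assumes W: "W \<in> H1" and ab: "a \<in> {0..1}" "b \<in> {0..1}" "\<bar>b - a\<bar> \<le> d"
  shows "norm (W b - W a) \<le> sqrt d * H1n W"
proof -
  have "norm (W b - W a) \<le> sqrt \<bar>b - a\<bar> * nL2 (hder W)"
  proof (cases "a \<le> b")
    case True
    then show ?thesis using H1_holder[OF W, of a b] ab by simp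
  next
    case False
    then show ?thesis using H1_holder[OF W, of b a] ab by (simp add: norm_minus_commute)
  qed
  also have "\<dots> \<le> sqrt d * H1n W" using ab by (intro mult_mono nL2_le_H1n) auto
  finally show ?thesis .
qed

text \<open>V' has mean 0 on each grid cell, so A W may be replaced by its deviation from a step
  function; this is what makes the first-order cross term small.\<close>
lemma cross_term_small:
  assumes eps: "\<forall>i. \<epsilon> i = 1 \<or> \<epsilon> i = -1" and A: "continuous_on {0..1} A"
    and K: "0 \<le> K" "\<And>r. r \<in> {0..1} \<Longrightarrow> mnorm (A r) \<le> K"
    and \<omega>: "0 \<le> \<omega>" "\<And>r r'. r \<in> {0..1} \<Longrightarrow> r' \<in> {0..1} \<Longrightarrow> \<bar>r - r'\<bar> \<le> 1 / m \<Longrightarrow> mnorm (A r - A r') \<le> \<omega>"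
    and m: "0 < m" and V: "V \<in> gridW m" and W: "W \<in> H1"
  shows "cmod (ipL2 (GA \<epsilon> (hder V)) (EA A W)) \<le> (2 * \<omega> + K * sqrt (1 / m)) * H1n V * H1n W"
proof -
  have VH: "V \<in> H1" and g: "\<And>j. j \<le> m \<Longrightarrow> V (real j / real m) = 0" using V by (auto simp: gridW_def)
  define c where "c j = cmv (A (real j / m)) (W (real j / m))" for j :: nat
  define q where "q r = (\<Sum>j<m. indicator {real j / m<..real (Suc j) / m} r *\<^sub>R c j)" for r
  note GV = L2_Gm[OF eps H1_hder(1)[OF VH], folded GA_def]
  have qm: "q \<in> borel_measurable UI"
    unfolding q_def by (intro borel_measurable_sum borel_measurable_scaleR borel_measurable_indicator_UI) auto
  have qval: "q r = c j" if "j < m" "real j / m < r" "r \<le> real (Suc j) / m" for r j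
  proof -
    have "q r = (\<Sum>i<m. if i = j then c j else 0)"
      unfolding q_def
    proof (intro sum.cong refl)
      fix i
      have ij: "i = j" if "real i / m < r" "r \<le> real (Suc i) / m"
      proof -
        have "real i / m < real (Suc j) / m" "real j / m < real (Suc i) / m"
          using that \<open>real j / m < r\<close> \<open>r \<le> real (Suc j) / m\<close> by linarith+
        then have "real i < real (Suc j)" "real j < real (Suc i)" using m by (simp_all only: divide_less_cancel)
        then show ?thesis by linarith
      qed
      show "indicator {real i / m<..real (Suc i) / m} r *\<^sub>R c i = (if i = j then c j else 0)"
      proof (cases "i = j")
        case True
        have "r \<in> {real j / m<..real (Suc j) / m}" using that(2,3) by simp
        then show ?thesis using True by (simp only: indicator_simps) simp
      next
        case False
        then have "r \<notin> {real i / m<..real (Suc i) / m}" using ij by (meson greaterThanAtMost_iff)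
        then show ?thesis using False by (simp only: indicator_simps) simp
      qed
    qed
    also have "\<dots> = c j" using that by simp
    finally show ?thesis .
  qed
  define \<eta> where "\<eta> = (2 * \<omega> + K * sqrt (1 / m)) * H1n W"
  have \<eta>0: "0 \<le> \<eta>" using \<omega>(1) K(1) by (simp add: \<eta>_def)
  have close: "norm (EA A W r - q r) \<le> \<eta>" if r: "0 < r" "r \<le> 1" for r
  proof -
    \<comment> \<open>Ceiling minus one selects the left-open, right-closed cell containing
      \<open>r\<close>; the point 0 belongs to no cell and is discarded as a null set.\<close>
    define j where "j = nat (\<lceil>real m * r\<rceil> - 1)"
    have mr: "0 < real m * r" "real m * r \<le> real m" using r m by (auto intro: mult_left_le)
    have c1: "1 \<le> \<lceil>real m * r\<rceil>" using mr by (simp add: Suc_leI int_one_le_iff_zero_less)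
    have rj: "real j = of_int \<lceil>real m * r\<rceil> - 1" unfolding j_def using c1 by (simp add: of_nat_nat)
    have j: "real j < real m * r" "real m * r \<le> real j + 1" unfolding rj by linarith+
    have jm: "j < m" using j(1) mr(2) by simp
    have b1: "real j / m < r" using j(1) m by (simp add: pos_divide_less_eq mult.commute)
    have b2: "r \<le> real (Suc j) / m" using j(2) m by (simp add: pos_le_divide_eq mult.commute add.commute)
    note b = b1 b2
    have "real (Suc j) / m = real j / m + 1 / m" by (simp add: add_divide_distrib add.commute)
    then have in01: "r \<in> {0..1}" "real j / m \<in> {0..1}" "\<bar>r - real j / m\<bar> \<le> 1 / m"
      using r jm b by auto
    have "EA A W r - q r = cmv (A r - A (real j / m)) (W r) + cmv (A (real j / m)) (W r - W (real j / m))"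
      unfolding qval[OF jm b] EA_def c_def by (simp add: cmv_mat_diff cmv_diff)
    also have "norm \<dots> \<le> mnorm (A r - A (real j / m)) * norm (W r) + mnorm (A (real j / m)) * norm (W r - W (real j / m))"
      by (rule norm_triangle_le) (intro add_mono norm_cmv_le)
    also have "\<dots> \<le> \<omega> * (2 * H1n W) + K * (sqrt (1 / m) * H1n W)"
      using \<omega> K in01 by (intro add_mono mult_mono H1_sup_le[OF W] H1_mod[OF W]) auto
    also have "\<dots> = \<eta>" by (simp add: \<eta>_def algebra_simps)
    finally show ?thesis .
  qed
  have EL: "EA A W \<in> L2" by (rule EA_L2'[OF A W])
  have dm: "(EA A W - q) \<in> borel_measurable UI" unfolding fun_diff_def by (intro borel_measurable_diff L2_D(1) EL qm)
  have "AE s in UI. s \<in> space UI" by (rule AE_space)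
  then have ae: "AE s in UI. norm ((EA A W - q) s) \<le> \<eta>"
    using AE_UI_nonzero by eventually_elim (use close in auto)
  have dL: "EA A W - q \<in> L2" "nL2 (EA A W - q) \<le> \<eta>" by (rule L2_bounded[OF dm \<eta>0 ae])+
  have "EA A W - (EA A W - q) = q" by (simp add: fun_eq_iff)
  with L2_minus[OF EL dL(1)] have qL: "q \<in> L2" by simp
  \<comment> \<open>Moving each indicator from the step function to \<open>hder V\<close> leaves the
    integral of \<open>hder V\<close> over a cell, a difference of two vanishing grid
    values.\<close>
  have "ipL2 (GA \<epsilon> (hder V)) q = 0"
  proof -
    have bl: "bounded_linear (\<lambda>v. cdot (Gm \<epsilon> v) (c j))" for j
      by (rule linear_conv_bounded_linear[THEN iffD1], rule linearI)
         (simp_all add: Gm_add Gm_scaleR cdot_add_left cdot_scaleR_left scaleR_conv_of_real[where 'a=complex])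
    have int: "integrable UI (\<lambda>r. indicat_real {real j / m<..real (Suc j) / m} r *\<^sub>R hder V r)" for j
      by (intro integrable_indicator_L2 H1_hder(1) VH) simp
    have "ipL2 (GA \<epsilon> (hder V)) q
        = (\<integral>r. (\<Sum>j<m. cdot (Gm \<epsilon> (indicator {real j / m<..real (Suc j) / m} r *\<^sub>R hder V r)) (c j)) \<partial>UI)"
      unfolding ipL2_def GA_def q_def
    proof (rule Bochner_Integration.integral_cong[OF refl])
      fix r
      have cs: "cdot u (\<Sum>j<m. f j) = (\<Sum>j<m. cdot u (f j))" for u :: "complex ^ 'a" and f
        by (induction m) (simp_all add: cdot_add_right)
      show "cdot (Gm \<epsilon> (hder V r)) (\<Sum>j<m. indicat_real {real j / m<..real (Suc j) / m} r *\<^sub>R c j) =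
          (\<Sum>j<m. cdot (Gm \<epsilon> (indicat_real {real j / m<..real (Suc j) / m} r *\<^sub>R hder V r)) (c j))"
        by (simp only: cs Gm_scaleR cdot_scaleR_left cdot_scaleR_right)
    qed
    also have "\<dots> = (\<Sum>j<m. \<integral>r. cdot (Gm \<epsilon> (indicator {real j / m<..real (Suc j) / m} r *\<^sub>R hder V r)) (c j) \<partial>UI)"
      by (rule Bochner_Integration.integral_sum) (rule integrable_bounded_linear[OF bl int])
    also have "\<dots> = (\<Sum>j<m. cdot (Gm \<epsilon> (\<integral>r. indicator {real j / m<..real (Suc j) / m} r *\<^sub>R hder V r \<partial>UI)) (c j))"
      by (intro sum.cong refl integral_bounded_linear[OF bl int])
    also have "\<dots> = 0"
    proof (intro sum.neutral ballI)
      fix j assume "j \<in> {..<m}"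
      then have "(\<integral>r. indicator {real j / m<..real (Suc j) / m} r *\<^sub>R hder V r \<partial>UI) = 0"
        using integral_hder_Ioc[OF VH, of "real j / m" "real (Suc j) / m"] g[of j] g[of "Suc j"] m
        by (auto simp: divide_right_mono)
      then show "cdot (Gm \<epsilon> (\<integral>r. indicator {real j / m<..real (Suc j) / m} r *\<^sub>R hder V r \<partial>UI)) (c j) = 0" by simp
    qed
    finally show ?thesis .
  qed
  then have "ipL2 (GA \<epsilon> (hder V)) (EA A W) = ipL2 (GA \<epsilon> (hder V)) (EA A W - q)"
    using ipL2_simps(4)[OF EL qL GV(1)] by simp
  also have "cmod \<dots> \<le> nL2 (hder V) * \<eta>"
    using ipL2_le[OF GV(1) dL(1)] mult_left_mono[OF dL(2), of "nL2 (hder V)"] GV(2) by simp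
  also have "\<dots> \<le> H1n V * \<eta>" using nL2_le_H1n \<eta>0 by (rule mult_right_mono)
  finally show ?thesis by (simp add: \<eta>_def algebra_simps)
qed

text \<open>On functions with \<open>G V = \<sigma> V\<close> and \<open>V 0 = 0\<close> the
  principal term is exactly \<open>\<sigma>\<close> times the inner product. The cross term is small
  by mean zero on cells, and the others contain undifferentiated \<open>V\<close>, which is
  \<open>sqrt (1 / m)\<close> times smaller. \<open>W\<close> ranges over all of H1: this controls
  the operator on \<open>V\<close>, as needed for approximate eigenvectors, and not only the
  quadratic form.\<close>

lemma Bgen_near_pm:
  assumes eps: "\<forall>i. \<epsilon> i = 1 \<or> \<epsilon> i = -1" and A: "continuous_on {0..1} A" and E: "continuous_on {0..1} E"
    and K: "0 \<le> K" "\<And>r. r \<in> {0..1} \<Longrightarrow> mnorm (A r) \<le> K" "\<And>r. r \<in> {0..1} \<Longrightarrow> mnorm (E r) \<le> K"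
    and \<omega>: "0 \<le> \<omega>" "\<And>r r'. r \<in> {0..1} \<Longrightarrow> r' \<in> {0..1} \<Longrightarrow> \<bar>r - r'\<bar> \<le> 1 / m \<Longrightarrow> mnorm (A r - A r') \<le> \<omega>"
    and m: "0 < m" and \<sigma>: "\<sigma> * \<sigma> = 1" and V: "V \<in> Wsp \<epsilon> m \<sigma>" and W: "W \<in> H1"
  shows "cmod (Bgen \<epsilon> A E V W - of_real \<sigma> * H1_inner V W)
      \<le> (2 * \<omega> + (4 * K + 2 * K * K) * sqrt (1 / m)) * H1n V * H1n W"
proof -
  have Vg: "V \<in> gridW m" and VG: "\<And>r. Gm \<epsilon> (V r) = of_real \<sigma> *s V r" using V by (auto simp: Wsp_def)
  have VH: "V \<in> H1" and V0: "V 0 = 0" using Vg by (auto simp: gridW_def dest: spec[of _ 0])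
  define h where "h = sqrt (1 / m)"
  have h0: "0 \<le> h" by (simp add: h_def)
  note LV = H1_hder(1)[OF VH] and LW = H1_hder(1)[OF W]
  note Gh = L2_Gm[OF eps LV, folded GA_def]
  have EA': "EA A V \<in> L2" "nL2 (EA A V) \<le> K * (h * H1n V)"
    using EA_L2[OF A VH _ _ K(1,2), of "h * H1n V"] gridW_sup[OF Vg m] h0 by (auto simp: h_def)
  have EE: "EA E V \<in> L2" "nL2 (EA E V) \<le> K * (h * H1n V)"
    using EA_L2[OF E VH _ _ K(1,3), of "h * H1n V"] gridW_sup[OF Vg m] h0 by (auto simp: h_def)
  note GE = L2_Gm[OF eps EE(1), folded GA_def] and GA' = L2_Gm[OF eps EA'(1), folded GA_def]
  note DW = DA_L2[OF A W] and EW = EA_L2'[OF A W]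
  have "ipL2 (GA \<epsilon> (hder V)) (hder W) = ipL2 (cscale (of_real \<sigma>) (hder V)) (hder W)"
    by (rule ipL2_cong[OF Gh(1) _ LW LW])
       (use hder_Gm[OF VH VG \<sigma> eps] L2_scale[OF LV] in \<open>auto simp: GA_def cscale_def\<close>)
  also have "\<dots> = of_real \<sigma> * ipL2 (hder V) (hder W)"
    by (rule cfun.herm_scale_left[OF L2_subspace ipL2_herm LV LW])
  finally have main: "ipL2 (GA \<epsilon> (hder V)) (hder W) = of_real \<sigma> * H1_inner V W"
    by (simp add: H1_inner_alt V0)
  have "Bgen \<epsilon> A E V W = ipL2 (GA \<epsilon> (hder V)) (hder W) + ipL2 (GA \<epsilon> (hder V)) (EA A W)
      + ipL2 (GA \<epsilon> (EA A V)) (DA A W) + ipL2 (GA \<epsilon> (EA E V)) W"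
    unfolding Bgen_def DA_alt[of A V] GA_add ipL2_simps(1)[OF Gh(1) GA'(1) DW]
    using ipL2_simps(2)[OF LW EW Gh(1)] by (simp add: DA_alt)
  then have eq: "Bgen \<epsilon> A E V W - of_real \<sigma> * H1_inner V W = ipL2 (GA \<epsilon> (hder V)) (EA A W)
      + ipL2 (GA \<epsilon> (EA A V)) (DA A W) + ipL2 (GA \<epsilon> (EA E V)) W" by (simp add: main)
  have "cmod (Bgen \<epsilon> A E V W - of_real \<sigma> * H1_inner V W) \<le> cmod (ipL2 (GA \<epsilon> (hder V)) (EA A W)) + cmod (ipL2 (GA \<epsilon> (EA A V)) (DA A W))
      + cmod (ipL2 (GA \<epsilon> (EA E V)) W)"
    unfolding eq by (rule order_trans[OF norm_triangle_ineq add_right_mono[OF norm_triangle_ineq]])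
  also have "\<dots> \<le> (2 * \<omega> + K * h) * H1n V * H1n W + (K * (h * H1n V)) * ((1 + 2 * K) * H1n W)
      + (K * (h * H1n V)) * (2 * H1n W)"
  proof (intro add_mono)
    show "cmod (ipL2 (GA \<epsilon> (hder V)) (EA A W)) \<le> (2 * \<omega> + K * h) * H1n V * H1n W"
      unfolding h_def
    proof (rule cross_term_small[of \<epsilon> A K \<omega> m V W])
      show "mnorm (A r) \<le> K" if "r \<in> {0..1}" for r using K(2)[OF that] .
      show "mnorm (A r - A r') \<le> \<omega>" if "r \<in> {0..1}" "r' \<in> {0..1}" "\<bar>r - r'\<bar> \<le> 1 / m" for r r'
        using \<omega>(2)[OF that] .
    qed fact+
    have "cmod (ipL2 (GA \<epsilon> (EA A V)) (DA A W)) \<le> nL2 (EA A V) * nL2 (DA A W)"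
      using ipL2_le[OF GA'(1) DW] GA'(2) by simp
    also have "\<dots> \<le> (K * (h * H1n V)) * ((1 + 2 * K) * H1n W)"
      using K(1) h0 by (intro mult_mono EA' nL2_DA_le[OF A W K(1,2)]) auto
    finally show "cmod (ipL2 (GA \<epsilon> (EA A V)) (DA A W)) \<le> (K * (h * H1n V)) * ((1 + 2 * K) * H1n W)" .
    have "cmod (ipL2 (GA \<epsilon> (EA E V)) W) \<le> nL2 (EA E V) * nL2 W"
      using ipL2_le[OF GE(1) H1_L2[OF W]] GE(2) by simp
    also have "\<dots> \<le> (K * (h * H1n V)) * (2 * H1n W)"
      using K(1) h0 by (intro mult_mono EE nL2_le_2H1n[OF W]) auto
    finally show "cmod (ipL2 (GA \<epsilon> (EA E V)) W) \<le> (K * (h * H1n V)) * (2 * H1n W)" .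
  qed
  also have "\<dots> = (2 * \<omega> + (4 * K + 2 * K * K) * h) * H1n V * H1n W" by (simp add: algebra_simps)
  finally show ?thesis by (simp add: h_def)
qed

lemma Bgen_bound:
  assumes eps: "\<forall>i. \<epsilon> i = 1 \<or> \<epsilon> i = -1" and A: "continuous_on {0..1} A" and E: "continuous_on {0..1} E"
    and K: "0 \<le> K" "\<And>r. r \<in> {0..1} \<Longrightarrow> mnorm (A r) \<le> K" "\<And>r. r \<in> {0..1} \<Longrightarrow> mnorm (E r) \<le> K"
    and V: "V \<in> H1" and W: "W \<in> H1"
  shows "cmod (Bgen \<epsilon> A E V W) \<le> ((1 + 2 * K) * (1 + 2 * K) + 4 * K) * H1n V * H1n W"
proof -
  note EE = EA_L2[OF E V _ H1_sup_le[OF V] K(1,3)]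
  have EL: "EA E V \<in> L2" by (rule EA_L2'[OF E V])
  note D = DA_L2[OF A V] DA_L2[OF A W]
  have "cmod (Bgen \<epsilon> A E V W) \<le> cmod (ipL2 (GA \<epsilon> (DA A V)) (DA A W)) + cmod (ipL2 (GA \<epsilon> (EA E V)) W)"
    unfolding Bgen_def by (rule norm_triangle_ineq)
  also have "\<dots> \<le> ((1 + 2 * K) * H1n V) * ((1 + 2 * K) * H1n W) + (K * (2 * H1n V)) * (2 * H1n W)"
  proof (rule add_mono)
    have "cmod (ipL2 (GA \<epsilon> (DA A V)) (DA A W)) \<le> nL2 (DA A V) * nL2 (DA A W)"
      using ipL2_le[OF L2_Gm(1)[OF eps D(1)] D(2)] L2_Gm(2)[OF eps D(1)] by (simp add: GA_def)
    also have "\<dots> \<le> ((1 + 2 * K) * H1n V) * ((1 + 2 * K) * H1n W)"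
      using K(1) by (intro mult_mono nL2_DA_le[OF A V K(1,2)] nL2_DA_le[OF A W K(1,2)]) auto
    finally show "cmod (ipL2 (GA \<epsilon> (DA A V)) (DA A W)) \<le> ((1 + 2 * K) * H1n V) * ((1 + 2 * K) * H1n W)" .
    have "cmod (ipL2 (GA \<epsilon> (EA E V)) W) \<le> nL2 (EA E V) * nL2 W"
      using ipL2_le[OF L2_Gm(1)[OF eps EL] H1_L2[OF W]] L2_Gm(2)[OF eps EL] by (simp add: GA_def)
    also have "\<dots> \<le> (K * (2 * H1n V)) * (2 * H1n W)"
      using K(1) by (intro mult_mono EE nL2_le_2H1n[OF W]) auto
    finally show "cmod (ipL2 (GA \<epsilon> (EA E V)) W) \<le> (K * (2 * H1n V)) * (2 * H1n W)" .
  qed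
  finally show ?thesis by (simp add: algebra_simps)
qed

text \<open>The difference expands into three pairings, each containing one factor EA of a
  coefficient difference; this yields norm continuity of the path in the form used by the index
  lemmas.\<close>

lemma Bgen_diff_bound:
  assumes eps: "\<forall>i. \<epsilon> i = 1 \<or> \<epsilon> i = -1"
    and c: "continuous_on {0..1} A" "continuous_on {0..1} E" "continuous_on {0..1} A'" "continuous_on {0..1} E'"
    and K: "0 \<le> K" "\<And>r. r \<in> {0..1} \<Longrightarrow> mnorm (A r) \<le> K" "\<And>r. r \<in> {0..1} \<Longrightarrow> mnorm (A' r) \<le> K"
    and d: "0 \<le> d" "\<And>r. r \<in> {0..1} \<Longrightarrow> mnorm (A r - A' r) \<le> d" "\<And>r. r \<in> {0..1} \<Longrightarrow> mnorm (E r - E' r) \<le> d"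
    and V: "V \<in> H1"
  shows "cmod (Bgen \<epsilon> A E V V - Bgen \<epsilon> A' E' V V) \<le> d * (8 + 8 * K) * (H1n V)\<^sup>2"
proof -
  have cd: "continuous_on {0..1} (\<lambda>r. A r - A' r)" "continuous_on {0..1} (\<lambda>r. E r - E' r)"
    by (intro continuous_intros c)+
  note DD = EA_L2[OF cd(1) V _ H1_sup_le[OF V] d(1,2)] and DE = EA_L2[OF cd(2) V _ H1_sup_le[OF V] d(1,3)]
  have L: "DA A V \<in> L2" "DA A' V \<in> L2" "EA E V \<in> L2" "EA E' V \<in> L2" "V \<in> L2"
    by (intro DA_L2 EA_L2' H1_L2 c V)+
  have G: "GA \<epsilon> f \<in> L2" "nL2 (GA \<epsilon> f) = nL2 f" if "f \<in> L2" for f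
    unfolding GA_def using L2_Gm[OF eps that] by auto
  define X Y where "X = EA (\<lambda>r. A r - A' r) V" and "Y = EA (\<lambda>r. E r - E' r) V"
  have X: "X \<in> L2" "nL2 X \<le> d * (2 * H1n V)" and Y: "Y \<in> L2" "nL2 Y \<le> d * (2 * H1n V)"
    unfolding X_def Y_def using DD DE by (simp_all add: EA_L2'[OF cd(1) V] EA_L2'[OF cd(2) V])
  have e1: "DA A V = DA A' V + X" using DA_diff[of A V A'] by (simp add: X_def algebra_simps)
  have e2: "EA E V = EA E' V + Y" using EA_diff[of E V E'] by (simp add: Y_def algebra_simps)
  have "ipL2 (GA \<epsilon> (DA A V)) (DA A V) = ipL2 (GA \<epsilon> (DA A' V)) (DA A V) + ipL2 (GA \<epsilon> X) (DA A V)"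
    using ipL2_simps(1)[OF G(1)[OF L(2)] G(1)[OF X(1)] L(1)] by (simp add: e1 GA_add)
  moreover have "ipL2 (GA \<epsilon> (DA A' V)) (DA A V) = ipL2 (GA \<epsilon> (DA A' V)) (DA A' V) + ipL2 (GA \<epsilon> (DA A' V)) X"
    using ipL2_simps(2)[OF L(2) X(1) G(1)[OF L(2)]] by (simp add: e1)
  moreover have "ipL2 (GA \<epsilon> (EA E V)) V = ipL2 (GA \<epsilon> (EA E' V)) V + ipL2 (GA \<epsilon> Y) V"
    using ipL2_simps(1)[OF G(1)[OF L(4)] G(1)[OF Y(1)] L(5)] by (simp add: e2 GA_add)
  ultimately have eq: "Bgen \<epsilon> A E V V - Bgen \<epsilon> A' E' V V
      = ipL2 (GA \<epsilon> X) (DA A V) + ipL2 (GA \<epsilon> (DA A' V)) X + ipL2 (GA \<epsilon> Y) V"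
    by (simp add: Bgen_def)
  have "cmod (Bgen \<epsilon> A E V V - Bgen \<epsilon> A' E' V V) \<le> cmod (ipL2 (GA \<epsilon> X) (DA A V)) + cmod (ipL2 (GA \<epsilon> (DA A' V)) X) + cmod (ipL2 (GA \<epsilon> Y) V)"
    unfolding eq by (rule order_trans[OF norm_triangle_ineq add_right_mono[OF norm_triangle_ineq]])
  also have "\<dots> \<le> (d * (2 * H1n V)) * ((1 + 2 * K) * H1n V) + ((1 + 2 * K) * H1n V) * (d * (2 * H1n V))
      + (d * (2 * H1n V)) * (2 * H1n V)"
  proof (intro add_mono)
    have "cmod (ipL2 (GA \<epsilon> X) (DA A V)) \<le> nL2 X * nL2 (DA A V)" using ipL2_le[OF G(1)[OF X(1)] L(1)] G(2)[OF X(1)] by simp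
    also have "\<dots> \<le> (d * (2 * H1n V)) * ((1 + 2 * K) * H1n V)"
      using K(1) d(1) by (intro mult_mono X nL2_DA_le[OF c(1) V K(1,2)]) auto
    finally show "cmod (ipL2 (GA \<epsilon> X) (DA A V)) \<le> (d * (2 * H1n V)) * ((1 + 2 * K) * H1n V)" .
    have "cmod (ipL2 (GA \<epsilon> (DA A' V)) X) \<le> nL2 (DA A' V) * nL2 X" using ipL2_le[OF G(1)[OF L(2)] X(1)] G(2)[OF L(2)] by simp
    also have "\<dots> \<le> ((1 + 2 * K) * H1n V) * (d * (2 * H1n V))"
      using K(1) d(1) by (intro mult_mono X nL2_DA_le[OF c(3) V K(1,3)]) auto
    finally show "cmod (ipL2 (GA \<epsilon> (DA A' V)) X) \<le> ((1 + 2 * K) * H1n V) * (d * (2 * H1n V))" .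
    have "cmod (ipL2 (GA \<epsilon> Y) V) \<le> nL2 Y * nL2 V" using ipL2_le[OF G(1)[OF Y(1)] L(5)] G(2)[OF Y(1)] by simp
    also have "\<dots> \<le> (d * (2 * H1n V)) * (2 * H1n V)"
      using d(1) by (intro mult_mono Y nL2_le_2H1n[OF V]) auto
    finally show "cmod (ipL2 (GA \<epsilon> Y) V) \<le> (d * (2 * H1n V)) * (2 * H1n V)" .
  qed
  also have "\<dots> = d * (8 + 8 * K) * (H1n V)\<^sup>2" by (simp add: algebra_simps power2_eq_square)
  finally show ?thesis .
qed

text \<open>The first summand is G paired with one and the same first-order expression on both
  sides, hence Hermitian; the second is Hermitian by the G-symmetry of \<open>E\<close>.\<close>

lemma Bgen_herm:
  assumes eps: "\<forall>i. \<epsilon> i = 1 \<or> \<epsilon> i = -1" and A: "continuous_on {0..1} A" and E: "continuous_on {0..1} E"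
    and sym: "\<And>r. G_symmetric \<epsilon> (E r)"
  shows "cfun.herm_on H1 (Bgen \<epsilon> A E)"
  unfolding cfun.herm_on_def
proof (intro conjI ballI allI)
  fix V W :: "'a cfun" assume V: "V \<in> H1" and W: "W \<in> H1"
  have G: "GA \<epsilon> f \<in> L2" if "f \<in> L2" for f unfolding GA_def using L2_Gm[OF eps that] by auto
  note L = DA_L2[OF A] EA_L2'[OF E] H1_L2
  show "Bgen \<epsilon> A E W V = cnj (Bgen \<epsilon> A E V W)"
  proof -
    have c1: "ipL2 (GA \<epsilon> f) g = cnj (ipL2 (GA \<epsilon> g) f)" if "f \<in> L2" "g \<in> L2" for f g
    proof -
      have "ipL2 (GA \<epsilon> f) g = ipL2 f (GA \<epsilon> g)" by (simp add: ipL2_def GA_def cdot_Gm_swap)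
      then show ?thesis using cfun.herm_cnj[OF L2_subspace ipL2_herm G[OF that(2)] that(1)] by simp
    qed
    have c2: "ipL2 (GA \<epsilon> (EA E W)) V = cnj (ipL2 (GA \<epsilon> (EA E V)) W)"
    proof -
      have "cdot (Gm \<epsilon> (cmv (E r) (W r))) (V r) = cnj (cdot (Gm \<epsilon> (cmv (E r) (V r))) (W r))" for r
        using sym[of r] unfolding G_symmetric_def Gform_Gm by (simp add: cdot_cnj cdot_Gm_swap)
      then show ?thesis unfolding ipL2_def GA_def EA_def by simp
    qed
    show ?thesis unfolding Bgen_def c1[OF L(1)[OF W] L(1)[OF V]] c2 by (rule complex_cnj_add[symmetric])
  qed
  show "Bgen \<epsilon> A E (cscale c V) W = c * Bgen \<epsilon> A E V W" for c
  proof -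
    have cV: "cscale c V \<in> H1" by (rule H1_scale(1)[OF V])
    have "ipL2 (GA \<epsilon> (DA A (cscale c V))) (DA A W) = ipL2 (cscale c (GA \<epsilon> (DA A V))) (DA A W)"
    proof (rule ipL2_cong)
      show "AE s in UI. GA \<epsilon> (DA A (cscale c V)) s = cscale c (GA \<epsilon> (DA A V)) s"
        using H1_scale(2)[OF V, of c]
        by eventually_elim (simp add: GA_def DA_def cscale_def cmv_scale Gm_add Gm_scale vector_add_ldistrib)
      show "cscale c (GA \<epsilon> (DA A V)) \<in> L2" using cfun.subspace_scale[OF L2_subspace] G L(1)[OF V] by blast
    qed (use G L(1) cV W in auto)
    also have "\<dots> = c * ipL2 (GA \<epsilon> (DA A V)) (DA A W)"
      by (rule cfun.herm_scale_left[OF L2_subspace ipL2_herm G[OF L(1)[OF V]] L(1)[OF W]])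
    moreover have "ipL2 (GA \<epsilon> (EA E (cscale c V))) W = c * ipL2 (GA \<epsilon> (EA E V)) W"
    proof -
      have "GA \<epsilon> (EA E (cscale c V)) = cscale c (GA \<epsilon> (EA E V))"
        by (simp add: GA_def EA_def cscale_def cmv_scale Gm_scale fun_eq_iff)
      then show ?thesis using cfun.herm_scale_left[OF L2_subspace ipL2_herm G[OF L(2)[OF V]] L(3)[OF W]] by simp
    qed
    ultimately show ?thesis unfolding Bgen_def by (simp add: distrib_left)
  qed
  fix Z :: "'a cfun" assume Z: "Z \<in> H1"
  show "Bgen \<epsilon> A E (V + W) Z = Bgen \<epsilon> A E V Z + Bgen \<epsilon> A E W Z"
  proof -
    have VW: "V + W \<in> H1" by (rule H1_add(1)[OF V W])
    have "ipL2 (GA \<epsilon> (DA A (V + W))) (DA A Z) = ipL2 (GA \<epsilon> (DA A V) + GA \<epsilon> (DA A W)) (DA A Z)"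
    proof (rule ipL2_cong)
      show "AE s in UI. GA \<epsilon> (DA A (V + W)) s = (GA \<epsilon> (DA A V) + GA \<epsilon> (DA A W)) s"
        using H1_add(2)[OF V W] by eventually_elim (simp add: GA_def DA_def cmv_add Gm_add)
      show "GA \<epsilon> (DA A V) + GA \<epsilon> (DA A W) \<in> L2" by (intro L2_plus G L(1) V W)
    qed (use G L(1) VW Z in auto)
    also have "\<dots> = ipL2 (GA \<epsilon> (DA A V)) (DA A Z) + ipL2 (GA \<epsilon> (DA A W)) (DA A Z)"
      by (rule ipL2_simps(1)[OF G[OF L(1)[OF V]] G[OF L(1)[OF W]] L(1)[OF Z]])
    moreover have "ipL2 (GA \<epsilon> (EA E (V + W))) Z = ipL2 (GA \<epsilon> (EA E V)) Z + ipL2 (GA \<epsilon> (EA E W)) Z"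
    proof -
      have "GA \<epsilon> (EA E (V + W)) = GA \<epsilon> (EA E V) + GA \<epsilon> (EA E W)"
        by (simp add: GA_def EA_def cmv_add Gm_add fun_eq_iff)
      then show ?thesis using ipL2_simps(1)[OF G[OF L(2)[OF V]] G[OF L(2)[OF W]] L(3)[OF Z]] by simp
    qed
    ultimately show ?thesis unfolding Bgen_def by simp
  qed
qed

text \<open>One functional at a time: either it already vanishes on the common kernel of the
  previous ones, or one vector of that kernel on which it is nonzero suffices to correct its
  value.\<close>

lemma (in complex_vs) finite_codim_functionals:
  assumes X: "subspace X" and L: "finite L"
    and lin: "\<And>l x y. l \<in> L \<Longrightarrow> x \<in> X \<Longrightarrow> y \<in> X \<Longrightarrow> l (x + y) = l x + l y"
      "\<And>l c x. l \<in> L \<Longrightarrow> x \<in> X \<Longrightarrow> l (c *C x) = c * (l x :: complex)"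
  shows "\<exists>F. finite F \<and> F \<subseteq> X \<and> (\<forall>x\<in>X. \<exists>w\<in>X. (\<forall>l\<in>L. l w = 0) \<and> (\<exists>v\<in>span F. x = w + v))"
  using L lin
proof (induction L rule: finite_induct)
  case empty
  have "\<exists>w\<in>X. \<exists>v\<in>span {}. x = w + v" if "x \<in> X" for x using that by auto
  then show ?case by (intro exI[of _ "{}"]) auto
next
  case (insert l L)
  obtain F where F: "finite F" "F \<subseteq> X" "\<And>x. x \<in> X \<Longrightarrow> \<exists>w\<in>X. (\<forall>l\<in>L. l w = 0) \<and> (\<exists>v\<in>span F. x = w + v)"
  proof -
    have "\<exists>F. finite F \<and> F \<subseteq> X \<and> (\<forall>x\<in>X. \<exists>w\<in>X. (\<forall>l\<in>L. l w = 0) \<and> (\<exists>v\<in>span F. x = w + v))"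
      by (rule insert.IH) (use insert.prems in auto)
    then show ?thesis using that by blast
  qed
  show ?case
  proof (cases "\<exists>f\<in>X. (\<forall>l\<in>L. l f = 0) \<and> l f \<noteq> 0")
    case False
    have "\<exists>w\<in>X. (\<forall>l\<in>insert l L. l w = 0) \<and> (\<exists>v\<in>span F. x = w + v)" if "x \<in> X" for x
      using F(3)[OF that] False by blast
    then show ?thesis using F(1,2) by blast
  next
    case True
    then obtain f where f: "f \<in> X" "\<And>l. l \<in> L \<Longrightarrow> l f = 0" "l f \<noteq> 0" by blast
    have "\<exists>w\<in>X. (\<forall>l\<in>insert l L. l w = 0) \<and> (\<exists>v\<in>span (insert f F). x = w + v)" if x: "x \<in> X" for x
    proof -
      obtain w v where w: "w \<in> X" "\<And>l. l \<in> L \<Longrightarrow> l w = 0" "v \<in> span F" "x = w + v" using F(3)[OF x] by blast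
      define k where "k = - (l w / l f)"
      have kf: "k *C f \<in> X" using f X subspace_scale by blast
      have lk: "l' (w + k *C f) = l' w + k * l' f" if "l' \<in> insert l L" for l'
        using insert.prems(1)[OF that w(1) kf] insert.prems(2)[OF that f(1)] by simp
      have "l' (w + k *C f) = 0" if "l' \<in> insert l L" for l'
      proof (cases "l' = l")
        case True
        then show ?thesis using lk[OF that] f(3) by (simp add: k_def)
      next
        case False
        then have "l' \<in> L" using that by simp
        from w(2)[OF this] f(2)[OF this] show ?thesis using lk[OF that] by simp
      qed
      moreover have "w + k *C f \<in> X" using w kf X subspace_add by blast
      moreover have "v \<in> span (insert f F)" using w(3) span_mono[of F "insert f F"] by blast
      then have "v - k *C f \<in> span (insert f F)" by (rule span_diff[OF _ span_scale[OF span_base]]) simp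
      moreover have "x = (w + k *C f) + (v - k *C f)" using w by simp
      ultimately show ?thesis by blast
    qed
    then show ?thesis using F(1,2) f(1) by (intro exI[of _ "insert f F"]) auto
  qed
qed

lemma gridW_subspace: "cfun.subspace (gridW m)"
  using H1_subspace by (auto simp: gridW_def cfun.subspace_def cscale_def vec_eq_iff)

lemma Wsp_subspace: "cfun.subspace (Wsp \<epsilon> m \<sigma>)"
proof (rule cfun.subspaceI)
  show "0 \<in> Wsp \<epsilon> m \<sigma>" using cfun.subspace_0[OF gridW_subspace] by (simp add: Wsp_def vec_eq_iff)
  show "x + y \<in> Wsp \<epsilon> m \<sigma>" if "x \<in> Wsp \<epsilon> m \<sigma>" "y \<in> Wsp \<epsilon> m \<sigma>" for x y
    using cfun.subspace_add[OF gridW_subspace] that by (auto simp: Wsp_def Gm_add vector_add_ldistrib)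
  show "cscale c x \<in> Wsp \<epsilon> m \<sigma>" if "x \<in> Wsp \<epsilon> m \<sigma>" for c x
    using cfun.subspace_scale[OF gridW_subspace, of x m c] that
    by (auto simp: Wsp_def cscale_def Gm_scale vector_smult_assoc mult.commute)
qed

text \<open>Vanishing at 0 and 1 satisfies every boundary condition \<open>V 1 = z V 0\<close>, so
  the same grid spaces serve as reference for all \<open>z\<close>.\<close>

lemma gridW_subset_Hz: "0 < m \<Longrightarrow> gridW m \<subseteq> Hz z"
proof
  fix V :: "'n::finite cfun" assume m: "0 < m" and V: "V \<in> gridW m"
  have "V (real 0 / real m) = 0" "V (real m / real m) = 0" using V unfolding gridW_def by blast+
  then show "V \<in> Hz z" using V m by (simp add: gridW_def Hz_def vec_eq_iff)
qed

lemma Wsp_subset_Hz: "0 < m \<Longrightarrow> Wsp \<epsilon> m \<sigma> \<subseteq> Hz z"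
  using gridW_subset_Hz[of m z] by (auto simp: Wsp_def)

lemma H1_GA: assumes eps: "\<forall>i. \<epsilon> i = 1 \<or> \<epsilon> i = -1" and V: "V \<in> H1" shows "GA \<epsilon> V \<in> H1"
proof (rule H1I(1))
  show "GA \<epsilon> (hder V) \<in> L2" unfolding GA_def by (intro L2_Gm eps H1_hder(1) V)
  show "GA \<epsilon> V t = GA \<epsilon> V 0 + (\<integral>s. indicator {0..t} s *\<^sub>R GA \<epsilon> (hder V) s \<partial>UI)" if t: "t \<in> {0..1}" for t
  proof -
    have "GA \<epsilon> V t = Gm \<epsilon> (V 0 + (\<integral>s. indicator {0..t} s *\<^sub>R hder V s \<partial>UI))"
      unfolding GA_def using H1_hder(2)[OF V t] by (rule arg_cong)
    also have "\<dots> = GA \<epsilon> V 0 + Gm \<epsilon> (\<integral>s. indicator {0..t} s *\<^sub>R hder V s \<partial>UI)" by (simp add: Gm_add GA_def)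
    also have "Gm \<epsilon> (\<integral>s. indicator {0..t} s *\<^sub>R hder V s \<partial>UI) = (\<integral>s. Gm \<epsilon> (indicator {0..t} s *\<^sub>R hder V s) \<partial>UI)"
      by (rule integral_bounded_linear[OF bounded_linear_Gm, symmetric]) (intro integrable_indicator_L2 H1_hder(1) V, simp)
    finally show ?thesis by (simp add: Gm_scaleR GA_def)
  qed
  show "GA \<epsilon> V t = 0" if "t \<notin> {0..1}" for t using H1_outside[OF V that] by (simp add: GA_def)
qed

text \<open>G is an involution, so the projections \<open>(V + GV)/2\<close> and
  \<open>(V - GV)/2\<close> split every grid function.\<close>

lemma ssum_Wsp:
  fixes \<epsilon> :: "'n::finite \<Rightarrow> real"
  assumes eps: "\<forall>i. \<epsilon> i = 1 \<or> \<epsilon> i = -1"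
  shows "cfun.ssum (Wsp \<epsilon> m 1) (Wsp \<epsilon> m (-1)) = gridW m"
proof
  show "cfun.ssum (Wsp \<epsilon> m 1) (Wsp \<epsilon> m (-1)) \<subseteq> gridW m"
    using cfun.subspace_add[OF gridW_subspace] by (auto simp: Wsp_def elim!: cfun.ssumE)
  show "gridW m \<subseteq> cfun.ssum (Wsp \<epsilon> m 1) (Wsp \<epsilon> m (-1))"
  proof
    fix V :: "'n cfun" assume V: "V \<in> gridW m"
    have GG: "Gm \<epsilon> (Gm \<epsilon> u) = u" for u
    proof -
      have "complex_of_real (\<epsilon> i) * complex_of_real (\<epsilon> i) = 1" for i
        using eps by (metis mult.left_neutral mult_minus_left mult_minus_right minus_minus of_real_1 of_real_minus)
      then show ?thesis by (simp add: Gm_def vec_eq_iff mult.assoc[symmetric])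
    qed
    have GV: "GA \<epsilon> V \<in> gridW m" using V H1_GA[OF eps] by (auto simp: gridW_def GA_def)
    define P Q where "P = cscale (1/2) (V + GA \<epsilon> V)" and "Q = cscale (1/2) (V - GA \<epsilon> V)"
    have "P \<in> gridW m" "Q \<in> gridW m" unfolding P_def Q_def
      using V GV gridW_subspace cfun.subspace_scale cfun.subspace_add cfun.subspace_diff by blast+
    moreover have "Gm \<epsilon> (P r) = of_real 1 *s P r" "Gm \<epsilon> (Q r) = of_real (-1) *s Q r" for r
      by (simp_all add: P_def Q_def cscale_def Gm_scale Gm_add Gm_diff GA_def GG vec_eq_iff)
    ultimately have "P \<in> Wsp \<epsilon> m 1" "Q \<in> Wsp \<epsilon> m (-1)" by (auto simp: Wsp_def)
    moreover have "V = P + Q" by (simp add: P_def Q_def fun_eq_iff cscale_def vec_eq_iff field_simps)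
    ultimately show "V \<in> cfun.ssum (Wsp \<epsilon> m 1) (Wsp \<epsilon> m (-1))" by (metis cfun.ssumI)
  qed
qed

lemma nrm_H1n: "hspace.nrm H1_inner V = H1n V"
  unfolding hspace.nrm_def[OF hspace_Hz] H1n_def ..

text \<open>The sum of the two grid spaces is the common kernel of finitely many continuous
  functionals, the components of the values at the grid points: hence closed and of finite
  codimension.\<close>

lemma krein_Hz:
  fixes \<epsilon> :: "'n::finite \<Rightarrow> real"
  assumes eps: "\<forall>i. \<epsilon> i = 1 \<or> \<epsilon> i = -1" and m: "0 < m"
  shows "krein_space cscale (Hz z) H1_inner (Wsp \<epsilon> m 1) (Wsp \<epsilon> m (-1))"
proof -
  interpret hspace cscale "Hz z" H1_inner by (rule hspace_Hz)
  show ?thesis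
  proof
    show "cfun.subspace (Wsp \<epsilon> m 1)" "cfun.subspace (Wsp \<epsilon> m (-1))" by (rule Wsp_subspace)+
    show "Wsp \<epsilon> m 1 \<subseteq> Hz z" "Wsp \<epsilon> m (-1) \<subseteq> Hz z" using Wsp_subset_Hz[OF m] by blast+
    show "l \<in> cfun.ssum (Wsp \<epsilon> m 1) (Wsp \<epsilon> m (-1))"
      if f: "\<And>n. f n \<in> cfun.ssum (Wsp \<epsilon> m 1) (Wsp \<epsilon> m (-1))" and l: "l \<in> Hz z"
        and lim: "(\<lambda>n. nrm (f n - l)) \<longlonglongrightarrow> 0" for f :: "nat \<Rightarrow> 'n cfun" and l
    proof -
      have fH: "f n \<in> H1" and f0: "j \<le> m \<Longrightarrow> f n (real j / real m) = 0" for n j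
        using f[of n] unfolding ssum_Wsp[OF eps] by (auto simp: gridW_def)
      have lH: "l \<in> H1" using l Hz_subset by blast
      have lim': "(\<lambda>n. H1n (f n - l)) \<longlonglongrightarrow> 0" using lim by (simp add: nrm_H1n)
      have "l (real j / real m) = 0" if "j \<le> m" for j
        using H1_eval_tendsto[OF fH lH lim', of "real j / real m"] f0[OF that] by (simp add: LIMSEQ_const_iff)
      then show ?thesis unfolding ssum_Wsp[OF eps] using lH by (simp add: gridW_def)
    qed
    define L where "L = (\<lambda>(j, i) (V::'n cfun). V (real j / real m) $ i) ` ({..m} \<times> (UNIV :: 'n set))"
    have "\<exists>F. finite F \<and> F \<subseteq> Hz z \<and> (\<forall>x\<in>Hz z. \<exists>w\<in>Hz z. (\<forall>l\<in>L. l w = 0) \<and> (\<exists>v\<in>cfun.span F. x = w + v))"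
      by (rule cfun.finite_codim_functionals[OF Hz_subspace]) (auto simp: L_def cscale_def)
    moreover have "w \<in> gridW m" if "w \<in> Hz z" "\<And>l. l \<in> L \<Longrightarrow> l w = 0" for w
    proof -
      have "w (real j / real m) $ i = 0" if "j \<le> m" for j i
        using \<open>\<And>l. l \<in> L \<Longrightarrow> l w = 0\<close>[of "\<lambda>V. V (real j / real m) $ i"] that by (force simp: L_def)
      then show ?thesis using that(1) Hz_subset by (auto simp: gridW_def vec_eq_iff)
    qed
    ultimately show "\<exists>F. finite F \<and> F \<subseteq> Hz z \<and>
        (\<forall>x\<in>Hz z. \<exists>w\<in>cfun.ssum (Wsp \<epsilon> m 1) (Wsp \<epsilon> m (-1)). \<exists>v\<in>cfun.span F. x = w + v)"
      unfolding ssum_Wsp[OF eps] by meson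
  qed
qed

lemma mnorm_le_norm: "mnorm (M :: real ^ 'n ^ 'n::finite) \<le> real (CARD('n) * CARD('n)) * norm M"
proof -
  have "\<bar>M $ i $ j\<bar> \<le> norm M" for i j
    using component_le_norm_cart[of "M $ i" j] Finite_Cartesian_Product.norm_nth_le[of M i] by simp
  then have "mnorm M \<le> (\<Sum>i\<in>(UNIV::'n set). \<Sum>j\<in>(UNIV::'n set). norm M)"
    unfolding mnorm_def by (intro sum_mono)
  then show ?thesis by simp
qed

section \<open>The path of index forms\<close>

locale index_form =
  fixes \<epsilon> :: "'n::finite \<Rightarrow> real" and \<Gamma> R :: "real \<Rightarrow> real ^ 'n ^ 'n"
  assumes eps: "\<forall>i. \<epsilon> i = 1 \<or> \<epsilon> i = -1" and c\<Gamma>: "continuous_on UNIV \<Gamma>" and cR: "continuous_on UNIV R"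
    and sym: "\<And>t. G_symmetric \<epsilon> (R t)"
begin

definition At :: "real \<Rightarrow> real \<Rightarrow> real ^ 'n ^ 'n" where "At t r = t *\<^sub>R \<Gamma> (t * r)"
definition Et :: "real \<Rightarrow> real \<Rightarrow> real ^ 'n ^ 'n" where "Et t r = t\<^sup>2 *\<^sub>R R (t * r)"

abbreviation B :: "real \<Rightarrow> 'n cform" where "B t \<equiv> Bform \<epsilon> \<Gamma> R t"

lemma cAt: "continuous_on A (\<lambda>p. At (fst p) (snd p))" and cEt: "continuous_on A (\<lambda>p. Et (fst p) (snd p))"
  unfolding At_def Et_def
  by (intro continuous_intros continuous_on_compose2[OF c\<Gamma>] continuous_on_compose2[OF cR]; simp)+

lemma cAt1: "continuous_on {0..1} (At t)" and cEt1: "continuous_on {0..1} (Et t)"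
  unfolding At_def Et_def
  by (intro continuous_intros continuous_on_compose2[OF c\<Gamma>] continuous_on_compose2[OF cR]; simp)+

lemma B_eq: "V \<in> H1 \<Longrightarrow> W \<in> H1 \<Longrightarrow> B t V W = Bgen \<epsilon> (At t) (Et t) V W"
  using Bform_eq_Bgen[OF eps c\<Gamma> cR] by (simp add: At_def[abs_def] Et_def[abs_def])

lemma Et_sym: "G_symmetric \<epsilon> (Et t r)"
  using sym[of "t * r"] unfolding G_symmetric_def Et_def cmv_scaleR Gform_Gm Gm_scale
  by (simp add: cdot_scale_left cdot_scale_right)

lemma B_herm: "cfun.herm_on H1 (B t)"
proof -
  have h: "cfun.herm_on H1 (Bgen \<epsilon> (At t) (Et t))" by (rule Bgen_herm[OF eps cAt1 cEt1 Et_sym])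
  note s = H1_subspace
  show ?thesis unfolding cfun.herm_on_def
  proof (intro conjI ballI allI)
    fix u v w :: "'n cfun" and c assume u: "u \<in> H1" and v: "v \<in> H1"
    show "B t v u = cnj (B t u v)"
      unfolding B_eq[OF u v] B_eq[OF v u] by (rule cfun.herm_cnj[OF s h u v])
    show "B t (cscale c u) v = c * B t u v"
      unfolding B_eq[OF u v] B_eq[OF H1_scale(1)[OF u] v] by (rule cfun.herm_scale_left[OF s h u v])
    assume w: "w \<in> H1"
    show "B t (u + v) w = B t u w + B t v w"
      unfolding B_eq[OF u w] B_eq[OF v w] B_eq[OF H1_add(1)[OF u v] w] by (rule cfun.herm_add_left[OF s h u v w])
  qed
qed

lemma At_bound:
  obtains K where "0 \<le> K" "\<And>t r. t \<in> {0..\<tau>} \<Longrightarrow> r \<in> {0..1} \<Longrightarrow> mnorm (At t r) \<le> K"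
    "\<And>t r. t \<in> {0..\<tau>} \<Longrightarrow> r \<in> {0..1} \<Longrightarrow> mnorm (Et t r) \<le> K"
proof -
  have cmp: "compact ({0..\<tau>} \<times> {0..1::real})" by (intro compact_Times compact_Icc)
  have "bounded ((\<lambda>p. mnorm (At (fst p) (snd p))) ` ({0..\<tau>} \<times> {0..1}))"
    "bounded ((\<lambda>p. mnorm (Et (fst p) (snd p))) ` ({0..\<tau>} \<times> {0..1}))"
    by (intro compact_imp_bounded compact_continuous_image continuous_on_mnorm cAt cEt cmp)+
  then obtain K1 K2 where K: "\<And>p. p \<in> {0..\<tau>} \<times> {0..1} \<Longrightarrow> norm (mnorm (At (fst p) (snd p))) \<le> K1"
    "\<And>p. p \<in> {0..\<tau>} \<times> {0..1} \<Longrightarrow> norm (mnorm (Et (fst p) (snd p))) \<le> K2"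
    unfolding bounded_iff by blast
  show thesis
  proof (rule that[of "max 0 (max K1 K2)"])
    show "mnorm (At t r) \<le> max 0 (max K1 K2)" if "t \<in> {0..\<tau>}" "r \<in> {0..1}" for t r
      using K(1)[of "(t, r)"] that by simp
    show "mnorm (Et t r) \<le> max 0 (max K1 K2)" if "t \<in> {0..\<tau>}" "r \<in> {0..1}" for t r
      using K(2)[of "(t, r)"] that by simp
  qed simp
qed

text \<open>Uniform continuity on a compact rectangle, used in both directions: in \<open>t\<close>
  for continuity of the path, in \<open>r\<close> for a modulus of continuity on grid cells that
  does not depend on \<open>t\<close>.\<close>

lemma At_uniform:
  assumes e: "0 < e"
  obtains d where "0 < d"
    "\<And>t t' r r'. t \<in> {0..\<tau>} \<Longrightarrow> t' \<in> {0..\<tau>} \<Longrightarrow> r \<in> {0..1} \<Longrightarrow> r' \<in> {0..1} \<Longrightarrow> \<bar>t - t'\<bar> < d \<Longrightarrow> \<bar>r - r'\<bar> < d \<Longrightarrow>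
       mnorm (At t r - At t' r') \<le> e \<and> mnorm (Et t r - Et t' r') \<le> e"
proof -
  define C where "C = real (CARD('n) * CARD('n)) + 1"
  have C: "C > 0" by (simp add: C_def add_nonneg_pos)
  have mC: "mnorm M \<le> C * norm M" for M :: "real ^ 'n ^ 'n"
    using mnorm_le_norm[of M] norm_ge_zero[of M] unfolding C_def distrib_right mult_1 by linarith
  have cmp: "compact ({0..\<tau>} \<times> {0..1::real})" by (intro compact_Times compact_Icc)
  have eC: "e / C > 0" using e C by simp
  obtain d1 where d1: "d1 > 0" "\<And>p p'. p \<in> {0..\<tau>} \<times> {0..1} \<Longrightarrow> p' \<in> {0..\<tau>} \<times> {0..1} \<Longrightarrow> dist p' p < d1 \<Longrightarrow>
      dist (At (fst p') (snd p')) (At (fst p) (snd p)) < e / C"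
    using compact_uniformly_continuous[OF cAt cmp] eC unfolding uniformly_continuous_on_def by metis
  obtain d2 where d2: "d2 > 0" "\<And>p p'. p \<in> {0..\<tau>} \<times> {0..1} \<Longrightarrow> p' \<in> {0..\<tau>} \<times> {0..1} \<Longrightarrow> dist p' p < d2 \<Longrightarrow>
      dist (Et (fst p') (snd p')) (Et (fst p) (snd p)) < e / C"
    using compact_uniformly_continuous[OF cEt cmp] eC unfolding uniformly_continuous_on_def by metis
  define d where "d = min d1 d2 / 2"
  have fin: "mnorm M \<le> e" if "norm M < e / C" for M :: "real ^ 'n ^ 'n"
    using mC[of M] mult_strict_left_mono[OF that C] C by simp
  show thesis
  proof (rule that[of d])
    show "0 < d" using d1 d2 by (simp add: d_def)
    fix t t' r r' assume a: "t \<in> {0..\<tau>}" "t' \<in> {0..\<tau>}" "r \<in> {0..1}" "r' \<in> {0..1}" "\<bar>t - t'\<bar> < d" "\<bar>r - r'\<bar> < d"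
    have "dist (t, r) (t', r') \<le> \<bar>t - t'\<bar> + \<bar>r - r'\<bar>"
      unfolding dist_Pair_Pair dist_real_def using sqrt_sum_squares_le_sum_abs[of "\<bar>t - t'\<bar>" "\<bar>r - r'\<bar>"] by simp
    then have "dist (t, r) (t', r') < min d1 d2" using a(5,6) unfolding d_def by linarith
    then show "mnorm (At t r - At t' r') \<le> e \<and> mnorm (Et t r - Et t' r') \<le> e"
      using d1(2)[of "(t', r')" "(t, r)"] d2(2)[of "(t', r')" "(t, r)"] a by (auto simp: dist_norm intro!: fin)
  qed
qed

lemma B_near_pm:
  assumes \<eta>: "0 < \<eta>"
  obtains m0 where "0 < m0" "\<And>m t \<sigma> V W. m0 \<le> m \<Longrightarrow> t \<in> {0..\<tau>} \<Longrightarrow> \<sigma> * \<sigma> = 1 \<Longrightarrow> V \<in> Wsp \<epsilon> m \<sigma> \<Longrightarrow> W \<in> H1 \<Longrightarrow>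
    cmod (B t V W - of_real \<sigma> * H1_inner V W) \<le> \<eta> * H1n V * H1n W"
proof -
  obtain K where K: "0 \<le> K" "\<And>t r. t \<in> {0..\<tau>} \<Longrightarrow> r \<in> {0..1} \<Longrightarrow> mnorm (At t r) \<le> K"
    "\<And>t r. t \<in> {0..\<tau>} \<Longrightarrow> r \<in> {0..1} \<Longrightarrow> mnorm (Et t r) \<le> K" by (rule At_bound) blast
  obtain d where d: "0 < d"
    "\<And>t t' r r'. t \<in> {0..\<tau>} \<Longrightarrow> t' \<in> {0..\<tau>} \<Longrightarrow> r \<in> {0..1} \<Longrightarrow> r' \<in> {0..1} \<Longrightarrow> \<bar>t - t'\<bar> < d \<Longrightarrow> \<bar>r - r'\<bar> < d \<Longrightarrow>
       mnorm (At t r - At t' r') \<le> \<eta> / 4 \<and> mnorm (Et t r - Et t' r') \<le> \<eta> / 4"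
    by (rule At_uniform[of "\<eta> / 4" \<tau>]) (use \<eta> in auto)
  define k where "k = 4 * K + 2 * K * K + 1"
  have k: "k > 0" using K(1) by (simp add: k_def add_nonneg_pos)
  \<comment> \<open>Half of \<open>\<eta>\<close> is spent on the modulus of continuity (twice
    \<open>\<eta> / 4\<close>); the second entry of the minimum makes the
    \<open>sqrt (1 / m)\<close> terms at most the other half.\<close>
  define \<delta> where "\<delta> = min d ((\<eta> / (2 * k))\<^sup>2)"
  have \<delta>: "\<delta> > 0" using d(1) \<eta> k by (simp add: \<delta>_def)
  obtain m0 :: nat where m0: "0 < m0" "1 / real m0 < \<delta>"
    using reals_Archimedean[OF \<delta>] by (auto simp: inverse_eq_divide intro: that[of "Suc _"])
  show thesis
  proof (rule that[OF m0(1)])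
    fix m t \<sigma> and V W :: "'n cfun"
    assume m: "m0 \<le> m" and t: "t \<in> {0..\<tau>}" and \<sigma>: "\<sigma> * \<sigma> = (1::real)" and V: "V \<in> Wsp \<epsilon> m \<sigma>" and W: "W \<in> H1"
    have mpos: "0 < m" using m m0 by simp
    have "1 / real m \<le> 1 / real m0" using m m0 by (intro divide_left_mono) auto
    then have m\<delta>: "1 / real m < \<delta>" using m0 by simp
    have VH: "V \<in> H1" using V by (simp add: Wsp_def gridW_def)
    have "cmod (B t V W - of_real \<sigma> * H1_inner V W)
        \<le> (2 * (\<eta> / 4) + (4 * K + 2 * K * K) * sqrt (1 / m)) * H1n V * H1n W"
      unfolding B_eq[OF VH W]
    proof (rule Bgen_near_pm[OF eps cAt1 cEt1 K(1) _ _ _ _ mpos \<sigma> V W])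
      show "mnorm (At t r - At t r') \<le> \<eta> / 4" if "r \<in> {0..1}" "r' \<in> {0..1}" "\<bar>r - r'\<bar> \<le> 1 / real m" for r r'
        using d(2)[OF t t that(1,2)] d(1) that(3) m\<delta> by (auto simp: \<delta>_def)
    qed (use K t \<eta> in auto)
    also have "\<dots> \<le> \<eta> * H1n V * H1n W"
    proof (intro mult_right_mono)
      have "sqrt (1 / m) \<le> sqrt ((\<eta> / (2 * k))\<^sup>2)" using m\<delta> by (intro real_sqrt_le_mono) (simp add: \<delta>_def)
      also have "\<dots> = \<eta> / (2 * k)" using \<eta> k by simp
      finally have s: "sqrt (1 / m) \<le> \<eta> / (2 * k)" .
      have "(4 * K + 2 * K * K) * sqrt (1 / m) \<le> k * (\<eta> / (2 * k))"
        using s K(1) by (intro mult_mono) (auto simp: k_def)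
      also have "\<dots> = \<eta> / 2" using k by simp
      finally show "2 * (\<eta> / 4) + (4 * K + 2 * K * K) * sqrt (1 / m) \<le> \<eta>" by simp
    qed auto
    finally show "cmod (B t V W - of_real \<sigma> * H1_inner V W) \<le> \<eta> * H1n V * H1n W" .
  qed
qed

lemma B_bounded:
  obtains K where "0 \<le> K" "\<And>t V W. t \<in> {0..\<tau>} \<Longrightarrow> V \<in> H1 \<Longrightarrow> W \<in> H1 \<Longrightarrow> cmod (B t V W) \<le> K * H1n V * H1n W"
proof -
  obtain K where K: "0 \<le> K" "\<And>t r. t \<in> {0..\<tau>} \<Longrightarrow> r \<in> {0..1} \<Longrightarrow> mnorm (At t r) \<le> K"
    "\<And>t r. t \<in> {0..\<tau>} \<Longrightarrow> r \<in> {0..1} \<Longrightarrow> mnorm (Et t r) \<le> K" by (rule At_bound) blast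
  show thesis
  proof (rule that)
    show "0 \<le> (1 + 2 * K) * (1 + 2 * K) + 4 * K" using K(1) by simp
    show "cmod (B t V W) \<le> ((1 + 2 * K) * (1 + 2 * K) + 4 * K) * H1n V * H1n W"
      if "t \<in> {0..\<tau>}" "V \<in> H1" "W \<in> H1" for t V W
      unfolding B_eq[OF that(2,3)] by (rule Bgen_bound[OF eps cAt1 cEt1 K(1) _ _ that(2,3)]) (use K that in auto)
  qed
qed

lemma B_continuous:
  assumes e: "0 < e"
  obtains d where "0 < d" "\<And>t t' V. t \<in> {0..\<tau>} \<Longrightarrow> t' \<in> {0..\<tau>} \<Longrightarrow> \<bar>t - t'\<bar> < d \<Longrightarrow> V \<in> H1 \<Longrightarrow>
    \<bar>Re (B t V V) - Re (B t' V V)\<bar> \<le> e * (H1n V)\<^sup>2"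
proof -
  obtain K where K: "0 \<le> K" "\<And>t r. t \<in> {0..\<tau>} \<Longrightarrow> r \<in> {0..1} \<Longrightarrow> mnorm (At t r) \<le> K"
    "\<And>t r. t \<in> {0..\<tau>} \<Longrightarrow> r \<in> {0..1} \<Longrightarrow> mnorm (Et t r) \<le> K" by (rule At_bound) blast
  define e' where "e' = e / (8 + 8 * K)"
  have e': "0 < e'" "e' * (8 + 8 * K) = e" using e K(1) by (auto simp: e'_def)
  obtain d where d: "0 < d"
    "\<And>t t' r r'. t \<in> {0..\<tau>} \<Longrightarrow> t' \<in> {0..\<tau>} \<Longrightarrow> r \<in> {0..1} \<Longrightarrow> r' \<in> {0..1} \<Longrightarrow> \<bar>t - t'\<bar> < d \<Longrightarrow> \<bar>r - r'\<bar> < d \<Longrightarrow>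
       mnorm (At t r - At t' r') \<le> e' \<and> mnorm (Et t r - Et t' r') \<le> e'"
    by (rule At_uniform[OF e'(1), of \<tau>]) auto
  show thesis
  proof (rule that[OF d(1)])
    fix t t' and V :: "'n cfun" assume t: "t \<in> {0..\<tau>}" "t' \<in> {0..\<tau>}" "\<bar>t - t'\<bar> < d" and V: "V \<in> H1"
    have "\<bar>Re (B t V V) - Re (B t' V V)\<bar> \<le> cmod (B t V V - B t' V V)"
      using abs_Re_le_cmod[of "B t V V - B t' V V"] by simp
    also have "\<dots> \<le> e' * (8 + 8 * K) * (H1n V)\<^sup>2"
      unfolding B_eq[OF V V]
      by (rule Bgen_diff_bound[OF eps cAt1 cEt1 cAt1 cEt1 K(1) _ _ _ _ _ V]) (use K d t e' in auto)
    finally show "\<bar>Re (B t V V) - Re (B t' V V)\<bar> \<le> e * (H1n V)\<^sup>2" by (simp add: e')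
  qed
qed

end

text \<open>The null directions \<open>Z0\<close> of the normal form are put on the nonnegative
  side, as the weak inequality in \<open>pos_split\<close> requires.\<close>

lemma (in krein_space) kform_pos_split:
  assumes k: "kform b K c" shows "\<exists>S T. pos_split X Wp Wm b S T"
proof -
  obtain Zp Z0 Zm d where Z: "finite Zp" "finite Z0" "finite Zm" "Zp \<inter> Z0 = {}" "Zp \<inter> Zm = {}" "Z0 \<inter> Zm = {}"
    "independent (Zp \<union> Z0 \<union> Zm)" "Zp \<union> Z0 \<union> Zm \<subseteq> X"
    and ZW: "\<And>v. v \<in> span (Zp \<union> Z0 \<union> Zm) \<Longrightarrow> v \<in> W \<Longrightarrow> v = 0"
    and gen: "\<And>x. x \<in> X \<Longrightarrow> \<exists>w\<in>W. \<exists>v\<in>span (Zp \<union> Z0 \<union> Zm). x = w + v"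
    and d: "0 < d"
    and dp: "\<And>p s. p \<in> Wp \<Longrightarrow> s \<in> span Zp \<Longrightarrow> d * (nrm (p + s))\<^sup>2 \<le> Re (b (p + s) (p + s))"
    and dm: "\<And>q t. q \<in> Wm \<Longrightarrow> t \<in> span Zm \<Longrightarrow> Re (b (q + t) (q + t)) \<le> - d * (nrm (q + t))\<^sup>2"
    and np: "\<And>p s. p \<in> Wp \<Longrightarrow> s \<in> span (Zp \<union> Z0) \<Longrightarrow> 0 \<le> Re (b (p + s) (p + s))"
    and nm: "\<And>q t. q \<in> Wm \<Longrightarrow> t \<in> span (Z0 \<union> Zm) \<Longrightarrow> Re (b (q + t) (q + t)) \<le> 0"
    and ker: "span Z0 = ker b"
    by (fact kform_diagonal[OF k])
  have "pos_split X Wp Wm b (Zp \<union> Z0) Zm"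
    unfolding pos_split_def
  proof (intro conjI ballI impI)
    show "finite (Zp \<union> Z0)" "finite Zm" "(Zp \<union> Z0) \<inter> Zm = {}" "independent (Zp \<union> Z0 \<union> Zm)"
      "Zp \<union> Z0 \<union> Zm \<subseteq> X" using Z by auto
    show "v = 0" if "v \<in> span (Zp \<union> Z0 \<union> Zm)" "v \<in> W" for v using that ZW by blast
    show "\<exists>w\<in>W. \<exists>v\<in>span (Zp \<union> Z0 \<union> Zm). x = w + v" if "x \<in> X" for x using that gen by blast
    show "0 \<le> Re (b (p + s) (p + s))" if "p \<in> Wp" "s \<in> span (Zp \<union> Z0)" for p s using np that by blast
    show "Re (b (q + t) (q + t)) < 0" if qt: "q \<in> Wm" "t \<in> span Zm" "q + t \<noteq> 0" for q t
    proof -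
      have x: "q + t \<in> X" using qt WmX span_X[of Zm t] Z(8) by blast
      have "0 < d * (nrm (q + t))\<^sup>2" using d nrm_pos[OF x qt(3)] by simp
      then show ?thesis using dm[OF qt(1,2)] by simp
    qed
  qed
  then show ?thesis by blast
qed

section \<open>Approximate eigenvectors and the bound on admissible thresholds\<close>

lemma H1_C1:
  fixes F f :: "real \<Rightarrow> complex ^ 'n::finite"
  assumes F: "\<And>x. (F has_vector_derivative f x) (at x)" and f: "continuous_on UNIV f"
  shows "(\<lambda>t. if t \<in> {0..1} then F t else 0) \<in> H1"
proof (rule H1I(1)[of f])
  have fm: "f \<in> borel_measurable UI" by (intro borel_measurable_UI_continuous continuous_on_subset[OF f]) simp
  have "bounded (f ` {0..1})" by (intro compact_imp_bounded compact_continuous_image continuous_on_subset[OF f]) auto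
  then obtain K where K: "\<And>x. x \<in> {0..1} \<Longrightarrow> norm (f x) \<le> K" unfolding bounded_iff by blast
  have "0 \<le> K" using order_trans[OF norm_ge_zero K[of 0]] by simp
  then show "f \<in> L2" by (rule L2_bounded(1)[OF fm]) (intro AE_I2, use K in simp)
  show "(if t \<in> {0..1} then F t else 0) = (if 0 \<in> {0..1::real} then F 0 else 0) + (\<integral>s. indicator {0..t} s *\<^sub>R f s \<partial>UI)"
    if t: "t \<in> {0..1}" for t :: real
  proof -
    have "(\<integral>s. indicator {0..t} s *\<^sub>R f s \<partial>UI) = (LINT s:{0..t}|lborel. f s)" by (rule integral_UI_upto[OF t, symmetric])
    also have "\<dots> = F t - F 0" unfolding set_lebesgue_integral_def
    proof (rule integral_FTC_Icc)
      show "(F has_vector_derivative f x) (at x within {0..t})" for x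
        using F[of x] by (rule has_vector_derivative_at_within)
      show "continuous_on {0..t} f" using f by (rule continuous_on_subset) simp
    qed (use t in simp)
    finally show ?thesis using t by simp
  qed
qed auto

lemma bounded_linear_axis: "bounded_linear (\<lambda>x::real. axis i (complex_of_real x) :: complex ^ 'n::finite)"
  by (rule linear_conv_bounded_linear[THEN iffD1], rule linearI)
     (auto simp: vec_eq_iff axis_def scaleR_conv_of_real[where 'a=complex])

text \<open>Unnormalised Lagrange polynomials at the distinct nodes \<open>1 / (k + 2)\<close>: each
  is nonzero at its own node and zero at the others, so evaluating a linear relation at a node
  isolates one coefficient. A single real component keeps them inside one eigenspace of G.\<close>

lemma independent_in_component:
  fixes i :: "'n::finite"
  shows "\<exists>S. finite S \<and> card S = n \<and> cfun.independent S \<and> S \<subseteq> H1 \<and>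
    (\<forall>V\<in>S. \<forall>r. \<exists>x::real. V r = axis i (complex_of_real x))"
proof -
  define x :: "nat \<Rightarrow> real" where "x k = 1 / (real k + 2)" for k
  have x01: "x k \<in> {0..1}" for k by (simp add: x_def)
  have xinj: "x j = x k \<longleftrightarrow> j = k" for j k by (auto simp: x_def frac_eq_eq)
  define p where "p j = (\<Prod>k\<in>{..<n} - {j}. [:- x k, 1:])" for j
  define V :: "nat \<Rightarrow> 'n cfun" where "V j = (\<lambda>t. if t \<in> {0..1} then axis i (complex_of_real (poly (p j) t)) else 0)" for j
  have VH: "V j \<in> H1" for j
    unfolding V_def
  proof (rule H1_C1)
    show "((\<lambda>t. axis i (complex_of_real (poly (p j) t)) :: complex ^ 'n) has_vector_derivative
        axis i (complex_of_real (poly (pderiv (p j)) t))) (at t)" for t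
      by (rule bounded_linear.has_vector_derivative[OF bounded_linear_axis])
         (simp add: has_real_derivative_iff_has_vector_derivative[symmetric])
    show "continuous_on UNIV (\<lambda>t. axis i (complex_of_real (poly (pderiv (p j)) t)) :: complex ^ 'n)"
      by (rule bounded_linear.continuous_on[OF bounded_linear_axis]) (intro continuous_intros)
  qed
  have ev: "V j (x k) $ i = 0 \<longleftrightarrow> j \<noteq> k" if "j < n" "k < n" for j k
  proof -
    have "V j (x k) $ i = complex_of_real (\<Prod>l\<in>{..<n} - {j}. x k - x l)"
      using x01[of k] by (simp add: V_def p_def poly_prod axis_def)
    then show ?thesis using that by (auto simp: xinj)
  qed
  have inj: "inj_on V {..<n}"
  proof (rule inj_onI)
    fix j k assume jk: "j \<in> {..<n}" "k \<in> {..<n}" "V j = V k"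
    show "j = k" using ev[of j k] ev[of k k] jk by auto
  qed
  have indep: "cfun.independent (V ` {..<n})"
  proof (rule cfun.independent_if_scalars_zero)
    show "finite (V ` {..<n})" by simp
    fix u v assume z: "(\<Sum>w\<in>V ` {..<n}. cscale (u w) w) = 0" and v: "v \<in> V ` {..<n}"
    obtain k where k: "k < n" "v = V k" using v by auto
    have "0 = (\<Sum>w\<in>V ` {..<n}. cscale (u w) w) (x k) $ i" by (simp add: z)
    also have "\<dots> = (\<Sum>j<n. cscale (u (V j)) (V j)) (x k) $ i" by (simp add: sum.reindex[OF inj])
    also have "\<dots> = (\<Sum>j<n. u (V j) * V j (x k) $ i)"
    proof -
      have "(\<Sum>j\<in>A. cscale (u (V j)) (V j)) (x k) $ i = (\<Sum>j\<in>A. u (V j) * V j (x k) $ i)" if "finite A" for A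
        using that by (induction A) (auto simp: cscale_def)
      then show ?thesis by simp
    qed
    also have "\<dots> = (\<Sum>j<n. if j = k then u (V k) * V k (x k) $ i else 0)"
      using ev k by (intro sum.cong) auto
    also have "\<dots> = u (V k) * V k (x k) $ i" using k by simp
    finally show "u v = 0" using ev[of k k] k by auto
  qed
  have "\<exists>y. V j r = axis i (complex_of_real y)" for j r
  proof (cases "r \<in> {0..1}")
    case False
    then have "V j r = axis i (complex_of_real 0)" by (auto simp: V_def axis_def vec_eq_iff)
    then show ?thesis by blast
  qed (auto simp: V_def)
  then show ?thesis using inj indep VH by (intro exI[of _ "V ` {..<n}"]) (auto simp: card_image)
qed

text \<open>The grid conditions and the orthogonality conditions are finitely many linear
  functionals on the infinite-dimensional space of H1 functions with values in the eigenspace of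
  \<open>\<sigma>\<close>, so they have a nonzero common zero.\<close>

lemma Wsp_nonzero_orth:
  fixes i :: "'n::finite"
  assumes m: "0 < m" and i: "\<epsilon> i = \<sigma>" and U: "finite U" "U \<subseteq> H1"
  obtains e where "e \<in> Wsp \<epsilon> m \<sigma>" "e \<noteq> 0" "\<And>u. u \<in> U \<Longrightarrow> H1_inner e u = 0"
proof -
  define Y :: "'n cfun set" where "Y = {V \<in> H1. \<forall>r. Gm \<epsilon> (V r) = of_real \<sigma> *s V r}"
  have YH: "Y \<subseteq> H1" by (auto simp: Y_def)
  have Y: "cfun.subspace Y"
    using H1_subspace unfolding Y_def cfun.subspace_def
    by (auto simp: Gm_add Gm_scale cscale_def vec_eq_iff algebra_simps)
  define L where "L = (\<lambda>(j, i) (V::'n cfun). V (real j / real m) $ i) ` ({..m} \<times> (UNIV :: 'n set)) \<union> (\<lambda>u V. H1_inner V u) ` U"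
  have "\<exists>F. finite F \<and> F \<subseteq> Y \<and> (\<forall>x\<in>Y. \<exists>w\<in>Y. (\<forall>l\<in>L. l w = 0) \<and> (\<exists>v\<in>cfun.span F. x = w + v))"
  proof (rule cfun.finite_codim_functionals[OF Y])
    show "finite L" using U by (simp add: L_def)
    show "l (x + y) = l x + l y" if "l \<in> L" "x \<in> Y" "y \<in> Y" for l x y
      using that YH U(2) by (auto simp: L_def intro!: cfun.herm_add_left[OF H1_subspace H1_inner_herm])
    show "l (cscale c x) = c * l x" if "l \<in> L" "x \<in> Y" for l c x
      using that YH U(2) by (auto simp: L_def cscale_def[of c x] intro!: cfun.herm_scale_left[OF H1_subspace H1_inner_herm, unfolded cscale_def])
  qed
  then obtain F where F: "finite F" "\<And>x. x \<in> Y \<Longrightarrow> \<exists>w\<in>Y. (\<forall>l\<in>L. l w = 0) \<and> (\<exists>v\<in>cfun.span F. x = w + v)" by blast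
  have "\<exists>w\<in>Y. (\<forall>l\<in>L. l w = 0) \<and> w \<noteq> 0"
  proof (rule ccontr)
    assume no: "\<not> ?thesis"
    have "Y \<subseteq> cfun.span F"
    proof
      fix x assume "x \<in> Y"
      then obtain w v where "w \<in> Y" "\<forall>l\<in>L. l w = 0" "v \<in> cfun.span F" "x = w + v" using F(2) by blast
      moreover from this have "w = 0" using no by blast
      ultimately show "x \<in> cfun.span F" by simp
    qed
    moreover obtain S where S: "finite S" "card S = Suc (card F)" "cfun.independent S" "S \<subseteq> H1"
      "\<And>V r. V \<in> S \<Longrightarrow> \<exists>x::real. V r = axis i (complex_of_real x)"
      using independent_in_component[of "Suc (card F)" i] by blast
    have "S \<subseteq> Y"
    proof
      fix V assume V: "V \<in> S"
      have "Gm \<epsilon> (V r) = of_real \<sigma> *s V r" for r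
        using S(5)[OF V, of r] i by (auto simp: Gm_def axis_def vec_eq_iff)
      then show "V \<in> Y" using S(4) V by (auto simp: Y_def)
    qed
    ultimately have "card S \<le> card F" using cfun.independent_span_bound[OF F(1) S(3)] by blast
    then show False using S(2) by simp
  qed
  then obtain w where w: "w \<in> Y" "\<And>l. l \<in> L \<Longrightarrow> l w = 0" "w \<noteq> 0" by blast
  have "w (real j / real m) $ k = 0" if "j \<le> m" for j k
    using w(2)[of "\<lambda>V. V (real j / real m) $ k"] that by (force simp: L_def)
  then have "w \<in> Wsp \<epsilon> m \<sigma>" using w(1) by (auto simp: Wsp_def gridW_def Y_def vec_eq_iff)
  moreover have "H1_inner w u = 0" if "u \<in> U" for u
    using w(2)[of "\<lambda>V. H1_inner V u"] that by (auto simp: L_def)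
  ultimately show thesis using w(3) that by blast
qed

context index_form begin

lemma B_bform:
  obtains K where "\<And>t. t \<in> {0..\<tau>} \<Longrightarrow> hspace.bform cscale (Hz z) H1_inner (B t) K"
proof -
  interpret hspace cscale "Hz z" H1_inner by (rule hspace_Hz)
  obtain K where K: "0 \<le> K" "\<And>t V W. t \<in> {0..\<tau>} \<Longrightarrow> V \<in> H1 \<Longrightarrow> W \<in> H1 \<Longrightarrow> cmod (B t V W) \<le> K * H1n V * H1n W"
    by (rule B_bounded) blast
  have "bform (B t) K" if "t \<in> {0..\<tau>}" for t
    unfolding bform_def nrm_H1n using K that Hz_subset cfun.herm_on_subset[OF B_herm Hz_subset] by blast
  then show thesis by (rule that)
qed

text \<open>A sign \<open>\<sigma>\<close> occurring in \<epsilon> has approximate eigenvectors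
  orthogonal to any finite set. Hence it is neither outside the spectrum nor an isolated eigenvalue
  of finite multiplicity. If \<open>a \<ge> 1\<close> were admissible, one of the two would hold:
  plus and minus \<open>a\<close> are not spectral, and the spectrum in \<open>[-a, a]\<close> is
  finite with finite-dimensional eigenspaces.\<close>

lemma admissible_lt_1:
  assumes adm: "sf_admissible (Hz z) H1_inner (B t) a" and t: "0 \<le> t"
  shows "a < 1"
proof (rule ccontr)
  assume "\<not> a < 1"
  then have a1: "1 \<le> a" by simp
  interpret hspace cscale "Hz z" H1_inner by (rule hspace_Hz)
  have tt: "t \<in> {0..t}" using t by simp
  obtain K where K: "\<And>s. s \<in> {0..t} \<Longrightarrow> bform (B s) K" by (rule B_bform[of t z]) blast
  define i :: 'n where "i = undefined"
  define \<sigma> where "\<sigma> = \<epsilon> i"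
  have \<sigma>: "\<sigma> = 1 \<or> \<sigma> = -1" using eps by (simp add: \<sigma>_def)
  then have \<sigma>2: "\<sigma> * \<sigma> = 1" by auto
  define b' where "b' = shift (B t) \<sigma>"
  have bf': "bform b' (K + \<bar>\<sigma>\<bar>)" unfolding b'_def by (rule bform_shift[OF K[OF tt]])
  \<comment> \<open>The near-eigenvalue estimate is tested against the vector
    \<open>rep b' e\<close> itself, which converts a bound on the form into a bound on the norm of
    the operator.\<close>
  have small: "\<exists>e\<in>Hz z. e \<noteq> 0 \<and> (\<forall>u\<in>U. H1_inner e u = 0) \<and> nrm (rep b' e) \<le> \<eta> * nrm e"
    if \<eta>: "0 < \<eta>" and U: "finite U" "U \<subseteq> H1" for \<eta> U
  proof -
    obtain m where m: "0 < m" and near: "\<And>s V W. s \<in> {0..t} \<Longrightarrow> V \<in> Wsp \<epsilon> m \<sigma> \<Longrightarrow> W \<in> H1 \<Longrightarrow>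
        cmod (B s V W - of_real \<sigma> * H1_inner V W) \<le> \<eta> * H1n V * H1n W"
      by (rule B_near_pm[OF \<eta>, of t]) (use \<sigma>2 in blast)
    obtain e where e: "e \<in> Wsp \<epsilon> m \<sigma>" "e \<noteq> 0" "\<And>u. u \<in> U \<Longrightarrow> H1_inner e u = 0"
      by (rule Wsp_nonzero_orth[of m \<epsilon> i \<sigma> U, OF m \<sigma>_def[symmetric] U]) blast
    have eX: "e \<in> Hz z" using e(1) Wsp_subset_Hz[OF m] by blast
    define w where "w = rep b' e"
    have wX: "w \<in> Hz z" unfolding w_def using rep_in[OF bf' eX] .
    have "(nrm w)\<^sup>2 = cmod (H1_inner w w)" using ip_self[OF wX] by (simp add: norm_power)
    also have "H1_inner w w = b' e w" unfolding w_def by (rule rep_ip[OF bf' eX wX[unfolded w_def]])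
    also have "cmod \<dots> \<le> \<eta> * nrm e * nrm w"
      unfolding b'_def shift_def nrm_H1n using near[OF tt e(1)] wX Hz_subset by blast
    finally have "nrm w * nrm w \<le> (\<eta> * nrm e) * nrm w" by (simp add: power2_eq_square)
    then have "nrm w \<le> \<eta> * nrm e"
      using nrm_nonneg[OF wX] nrm_nonneg[OF eX] \<eta> by (cases "nrm w = 0") auto
    then show ?thesis using e eX unfolding w_def by blast
  qed
  have spec: "s \<in> rep_spec (Hz z) H1_inner (B t) \<longleftrightarrow> \<not> bij_form (shift (B t) s)" for s
    by (simp add: rep_spec_def bij_form_def shift_def)
  show False
  proof (cases "\<sigma> \<in> rep_spec (Hz z) H1_inner (B t)")
    case False
    then have "bij_form b'" using spec by (simp add: b'_def)
    then obtain d where d: "0 < d" "\<And>v. v \<in> Hz z \<Longrightarrow> d * nrm v \<le> nrm (rep b' v)"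
      by (rule bij_imp_bounded_below[OF bf']) blast
    obtain e where e: "e \<in> Hz z" "e \<noteq> 0" "nrm (rep b' e) \<le> d / 2 * nrm e"
      using small[of "d/2" "{}"] d(1) by auto
    show False using d(2)[OF e(1)] e(3) mult_pos_pos[OF d(1) nrm_pos[OF e(1,2)]] by simp
  next
    case True
    then have "a \<noteq> 1" using adm \<sigma> unfolding sf_admissible_def by auto
    then have a: "1 < a" using a1 by simp
    define Sp where "Sp = rep_spec (Hz z) H1_inner (B t) \<inter> {-a..a}"
    have fin: "finite Sp" using adm by (simp add: sf_admissible_def Sp_def)
    obtain d0 where d0: "0 < d0" "\<And>s. s \<in> Sp \<Longrightarrow> s \<noteq> \<sigma> \<Longrightarrow> d0 \<le> dist \<sigma> s"
      using finite_set_avoid[OF fin, of \<sigma>] by blast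
    \<comment> \<open>Keeps \<open>\<sigma> + s\<close> away from the other spectral points and
      still within \<open>[-a, a]\<close>; \<open>a > 1\<close> because \<open>a = 1\<close> would
      place \<open>\<sigma>\<close> at one of the excluded endpoints.\<close>
    define d where "d = min d0 (a - 1)"
    have d: "0 < d" using d0 a by (simp add: d_def)
    have bij: "bij_form (shift b' s)" if s: "0 < \<bar>s\<bar>" "\<bar>s\<bar> < d" for s
    proof -
      have "\<sigma> + s \<notin> Sp" using d0(2)[of "\<sigma> + s"] s by (auto simp: d_def dist_real_def)
      moreover have "\<sigma> + s \<in> {-a..a}" using s \<sigma> a by (auto simp: d_def)
      ultimately have "bij_form (shift (B t) (\<sigma> + s))" using spec by (simp add: Sp_def)
      then show ?thesis by (simp add: b'_def shift_shift)
    qed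
    have "cfin_dim (rep_eig (Hz z) H1_inner (B t) \<sigma>)"
      using adm True \<sigma> a unfolding sf_admissible_def by auto
    then obtain U where U: "finite U" "cfun.span U = cfun.span (rep_eig (Hz z) H1_inner (B t) \<sigma>)"
      unfolding cfin_dim_def by blast
    have eigX: "cfun.span (rep_eig (Hz z) H1_inner (B t) \<sigma>) \<subseteq> Hz z"
      by (rule cfun.span_minimal[OF _ Hz_subspace]) (auto simp: rep_eig_def)
    have UX: "U \<subseteq> Hz z" using cfun.span_superset[of U] U(2) eigX by blast
    then have UH: "U \<subseteq> H1" using Hz_subset by blast
    obtain e where e: "e \<in> Hz z" "e \<noteq> 0" "\<And>u. u \<in> U \<Longrightarrow> H1_inner e u = 0" "nrm (rep b' e) \<le> d / 2 * nrm e"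
      using small[of "d/2" U] d U(1) UH by auto
    \<comment> \<open>Orthogonality of \<open>e\<close> to a finite spanning set of the eigenspace
      gives orthogonality to the whole kernel of the shifted form, so the estimate for isolated
      points of the spectrum applies.\<close>
    have "d * nrm e \<le> nrm (rep b' e)"
    proof (rule isolated_spectrum_bounded_below[OF bf' d bij e(1)])
      fix u assume u: "u \<in> Hz z" and u0: "\<And>w. w \<in> Hz z \<Longrightarrow> b' u w = 0"
      have "u \<in> rep_eig (Hz z) H1_inner (B t) \<sigma>"
        using u u0 by (auto simp: rep_eig_def b'_def shift_def)
      then have uU: "u \<in> cfun.span U" using U(2) cfun.span_base by blast
      show "H1_inner e u = 0"
        by (rule cfun.herm_orth_span[of "Hz z" H1_inner U e u, OF sub ip UX e(1) _ uU]) (rule e(3))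
    qed
    then show False using e(4) mult_pos_pos[OF d nrm_pos[OF e(1,2)]] by simp
  qed
qed

section \<open>Spectral flow as an index difference\<close>

abbreviation "kfm m z b K c \<equiv> krein_space.kform cscale (Hz z) H1_inner (Wsp \<epsilon> m 1) (Wsp \<epsilon> m (-1)) b K c"
abbreviation "ixm m z b \<equiv> cfun.ix (Hz z) (Wsp \<epsilon> m 1) (Wsp \<epsilon> m (-1)) b"

text \<open>Closeness within \<open>1 - c\<close> to plus or minus the inner product leaves a margin
  \<open>c\<close> on the grid spaces. Any \<open>c < 1\<close> is reached by a sufficiently fine
  grid, uniformly in \<open>t\<close>.\<close>

lemma B_kform:
  assumes c: "0 < c" "c < 1"
  obtains m0 K where "0 < m0" "\<And>m t. m0 \<le> m \<Longrightarrow> t \<in> {0..\<tau>} \<Longrightarrow> kfm m z (B t) K c"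
proof -
  obtain K where K: "\<And>t. t \<in> {0..\<tau>} \<Longrightarrow> hspace.bform cscale (Hz z) H1_inner (B t) K" by (rule B_bform[of \<tau> z]) blast
  have "0 < 1 - c" using c by simp
  then obtain m0 where m0: "0 < m0" and near: "\<And>m t \<sigma> V W. m0 \<le> m \<Longrightarrow> t \<in> {0..\<tau>} \<Longrightarrow> \<sigma> * \<sigma> = 1 \<Longrightarrow> V \<in> Wsp \<epsilon> m \<sigma> \<Longrightarrow> W \<in> H1 \<Longrightarrow>
    cmod (B t V W - of_real \<sigma> * H1_inner V W) \<le> (1 - c) * H1n V * H1n W"
    by (rule B_near_pm[of "1 - c" \<tau>]) blast
  show thesis
  proof (rule that[OF m0])
    fix m t assume m: "m0 \<le> m" and t: "t \<in> {0..\<tau>}"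
    have mpos: "0 < m" using m m0 by simp
    interpret krein_space cscale "Hz z" H1_inner "Wsp \<epsilon> m 1" "Wsp \<epsilon> m (-1)" by (rule krein_Hz[OF eps mpos])
    have bnd: "\<bar>Re (B t V V) - \<sigma> * (H1n V)\<^sup>2\<bar> \<le> (1 - c) * (H1n V)\<^sup>2" if s: "\<sigma> * \<sigma> = 1" and V: "V \<in> Wsp \<epsilon> m \<sigma>" for V \<sigma>
    proof -
      have VH: "V \<in> H1" using V by (simp add: Wsp_def gridW_def)
      have "Re (H1_inner V V) = (H1n V)\<^sup>2" by (simp add: H1n_sq Re_H1_inner)
      then have "\<bar>Re (B t V V) - \<sigma> * (H1n V)\<^sup>2\<bar> = \<bar>Re (B t V V - of_real \<sigma> * H1_inner V V)\<bar>" by simp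
      also have "\<dots> \<le> cmod (B t V V - of_real \<sigma> * H1_inner V V)" by (rule abs_Re_le_cmod)
      also have "\<dots> \<le> (1 - c) * H1n V * H1n V" by (rule near[OF m t s V VH])
      finally show ?thesis by (simp add: power2_eq_square mult.assoc)
    qed
    show "kfm m z (B t) K c"
      unfolding kform_def nrm_H1n
    proof (intro conjI ballI)
      show "bform (B t) K" by (rule K[OF t])
      show "0 < c" by fact
      show "c * (H1n p)\<^sup>2 \<le> Re (B t p p)" if "p \<in> Wsp \<epsilon> m 1" for p
        using bnd[of 1 p] that by (simp add: abs_le_iff left_diff_distrib)
      show "Re (B t q q) \<le> - c * (H1n q)\<^sup>2" if "q \<in> Wsp \<epsilon> m (-1)" for q
        using bnd[of "-1" q] that by (simp add: abs_le_iff left_diff_distrib)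
    qed
  qed
qed

text \<open>Each spectral count is the index of the form minus the index of the form shifted by the
  threshold. The latter is constant along a subinterval on which the threshold is admissible, so it
  cancels and the sum telescopes.\<close>

lemma flow_value:
  assumes m: "0 < m" and k: "\<And>t. t \<in> {0..\<tau>} \<Longrightarrow> kfm m z (B t) K c" and \<tau>: "0 \<le> \<tau>"
    and tp: "tp 0 = 0" "tp n = 1" "\<forall>i<n. tp i < tp (Suc i)"
    and adm: "\<forall>i<n. \<forall>t\<in>{tp i..tp (Suc i)}. sf_admissible (Hz z) H1_inner (B (\<tau> * t)) (a i)"
    and ac: "\<And>i. i < n \<Longrightarrow> a i < c"
  shows "(\<Sum>i<n. int (spec_count (Hz z) H1_inner (B (\<tau> * tp (Suc i))) (a i))
        - int (spec_count (Hz z) H1_inner (B (\<tau> * tp i)) (a i))) = int (ixm m z (B \<tau>)) - int (ixm m z (B 0))"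
proof -
  interpret krein_space cscale "Hz z" H1_inner "Wsp \<epsilon> m 1" "Wsp \<epsilon> m (-1)" by (rule krein_Hz[OF eps m])
  have spec: "rep_spec (Hz z) H1_inner b = spc b" for b
    by (simp add: rep_spec_def spc_def bij_form_def shift_def)
  have eig: "rep_eig (Hz z) H1_inner b s = ker (shift b s)" for b s
    by (auto simp: rep_eig_def ker_def shift_def)
  have cnt: "int (spec_count (Hz z) H1_inner (B t) \<alpha>) = int (ixW (B t)) - int (ixW (shift (B t) \<alpha>))"
    if "t \<in> {0..\<tau>}" "0 \<le> \<alpha>" "\<alpha> < c" for t \<alpha>
  proof -
    have "spec_count (Hz z) H1_inner (B t) \<alpha> + ixW (shift (B t) \<alpha>) = ixW (B t)"
      unfolding spec_count_def spec eig cdim_def by (rule sum_dim_ker_eq_ix_diff[OF k[OF that(1)] that(2,3)])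
    then show ?thesis by linarith
  qed
  have mono: "tp i \<le> tp j" if "i \<le> j" "j \<le> n" for i j
    using that
  proof (induction j rule: dec_induct)
    case (step j)
    then have "tp j < tp (Suc j)" using tp(3) by simp
    then show ?case using step by simp
  qed simp
  have "int (spec_count (Hz z) H1_inner (B (\<tau> * tp (Suc i))) (a i)) - int (spec_count (Hz z) H1_inner (B (\<tau> * tp i)) (a i))
      = int (ixW (B (\<tau> * tp (Suc i)))) - int (ixW (B (\<tau> * tp i)))" if i: "i < n" for i
  proof -
    have r: "0 \<le> tp i" "tp i < tp (Suc i)" "tp (Suc i) \<le> 1"
      using mono[of 0 i] mono[of "Suc i" n] tp i by auto
    have in\<tau>: "\<tau> * t \<in> {0..\<tau>}" if "t \<in> {tp i..tp (Suc i)}" for t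
      using that r \<tau> by (auto intro!: mult_left_le)
    have a0: "0 < a i" using adm i r unfolding sf_admissible_def by fastforce
    have ai: "\<bar>a i\<bar> < c" using a0 ac[OF i] by simp
    have nsp: "a i \<notin> spc (B s)" if "s \<in> {\<tau> * tp i..\<tau> * tp (Suc i)}" for s
    proof (cases "\<tau> = 0")
      case True
      then have "s = \<tau> * tp i" using that by simp
      then show ?thesis using adm i r unfolding sf_admissible_def spec[symmetric] by auto
    next
      case False
      then have "\<tau> > 0" using \<tau> by simp
      then have "s / \<tau> \<in> {tp i..tp (Suc i)}" "s = \<tau> * (s / \<tau>)" using that by (auto simp: field_simps)
      then show ?thesis using adm i unfolding sf_admissible_def spec[symmetric] by metis
    qed
    have "ixW (shift (B (\<tau> * tp i)) (a i)) = ixW (shift (B (\<tau> * tp (Suc i))) (a i))"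
    proof (rule ix_const_on_path[of _ _ B K c])
      have sub\<tau>: "s \<in> {0..\<tau>}" if "s \<in> {\<tau> * tp i..\<tau> * tp (Suc i)}" for s
        using in\<tau>[of "tp i"] in\<tau>[of "tp (Suc i)"] r that by auto
      show "kform (B s) K c" if "s \<in> {\<tau> * tp i..\<tau> * tp (Suc i)}" for s using k sub\<tau>[OF that] by blast
      show "\<bar>a i\<bar> < c" by (rule ai)
      show "\<tau> * tp i \<le> \<tau> * tp (Suc i)" using r \<tau> by (intro mult_left_mono) auto
      show "a i \<notin> spc (B s)" if "s \<in> {\<tau> * tp i..\<tau> * tp (Suc i)}" for s by (rule nsp[OF that])
      fix s e :: real assume s: "s \<in> {\<tau> * tp i..\<tau> * tp (Suc i)}" and e: "0 < e"
      obtain d where d: "0 < d" "\<And>t t' V. t \<in> {0..\<tau>} \<Longrightarrow> t' \<in> {0..\<tau>} \<Longrightarrow> \<bar>t - t'\<bar> < d \<Longrightarrow> V \<in> H1 \<Longrightarrow>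
          \<bar>Re (B t V V) - Re (B t' V V)\<bar> \<le> e * (H1n V)\<^sup>2" by (rule B_continuous[OF e, of \<tau>]) blast
      show "\<exists>d>0. \<forall>t'\<in>{\<tau> * tp i..\<tau> * tp (Suc i)}. \<bar>t' - s\<bar> < d \<longrightarrow>
          (\<forall>x\<in>Hz z. \<bar>Re (B t' x x) - Re (B s x x)\<bar> \<le> e * (nrm x)\<^sup>2)"
        unfolding nrm_H1n using d sub\<tau> s Hz_subset by blast
    qed
    then show ?thesis
      using cnt[OF in\<tau>[of "tp i"], of "a i"] cnt[OF in\<tau>[of "tp (Suc i)"], of "a i"] a0 ac[OF i] r by simp
  qed
  then have "(\<Sum>i<n. int (spec_count (Hz z) H1_inner (B (\<tau> * tp (Suc i))) (a i))
        - int (spec_count (Hz z) H1_inner (B (\<tau> * tp i)) (a i)))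
      = (\<Sum>i<n. int (ixW (B (\<tau> * tp (Suc i)))) - int (ixW (B (\<tau> * tp i))))" by simp
  also have "\<dots> = int (ixW (B (\<tau> * tp n))) - int (ixW (B (\<tau> * tp 0)))"
    by (rule sum_lessThan_telescope[of "\<lambda>i. int (ixW (B (\<tau> * tp i)))"])
  finally show ?thesis by (simp add: tp)
qed

text \<open>Every time has a threshold admissible in a neighbourhood; a Lebesgue number of this
  cover yields an equidistant partition with one threshold per subinterval.\<close>

lemma flow_partition_exists:
  assumes m: "0 < m" and k: "\<And>t. t \<in> {0..\<tau>} \<Longrightarrow> kfm m z (B t) K c" and \<tau>: "0 \<le> \<tau>"
  obtains n :: nat and tp a where "tp 0 = 0" "tp n = 1" "\<forall>i<n. tp i < tp (Suc i)"
    "\<forall>i<n. \<forall>t\<in>{tp i..tp (Suc i)}. sf_admissible (Hz z) H1_inner (B (\<tau> * t)) (a i)" "\<And>i. i < n \<Longrightarrow> a i < c"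
proof -
  interpret krein_space cscale "Hz z" H1_inner "Wsp \<epsilon> m 1" "Wsp \<epsilon> m (-1)" by (rule krein_Hz[OF eps m])
  have spec: "rep_spec (Hz z) H1_inner b = spc b" for b
    by (simp add: rep_spec_def spc_def bij_form_def shift_def)
  have eig: "rep_eig (Hz z) H1_inner b s = ker (shift b s)" for b s
    by (auto simp: rep_eig_def ker_def shift_def)
  have in\<tau>: "\<tau> * t \<in> {0..\<tau>}" if "t \<in> {0..1}" for t using that \<tau> by (auto intro!: mult_left_le)
  have kt: "kform (B (\<tau> * t)) K c" if "t \<in> {0..1}" for t using k[OF in\<tau>[OF that]] .
  have cont: "\<exists>d>0. \<forall>t'\<in>{0..1}. \<bar>t' - t\<bar> < d \<longrightarrow>
      (\<forall>x\<in>Hz z. \<bar>Re (B (\<tau> * t') x x) - Re (B (\<tau> * t) x x)\<bar> \<le> e * (nrm x)\<^sup>2)" if t: "t \<in> {0..1}" and e: "0 < e" for t e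
  proof -
    obtain d where d: "0 < d" "\<And>t t' V. t \<in> {0..\<tau>} \<Longrightarrow> t' \<in> {0..\<tau>} \<Longrightarrow> \<bar>t - t'\<bar> < d \<Longrightarrow> V \<in> H1 \<Longrightarrow>
        \<bar>Re (B t V V) - Re (B t' V V)\<bar> \<le> e * (H1n V)\<^sup>2" by (rule B_continuous[OF e, of \<tau>]) blast
    have "\<bar>Re (B (\<tau> * t') x x) - Re (B (\<tau> * t) x x)\<bar> \<le> e * (H1n x)\<^sup>2"
      if "t' \<in> {0..1}" "\<bar>t' - t\<bar> < d / (\<tau> + 1)" "x \<in> Hz z" for t' x
    proof (rule d(2)[OF in\<tau>[OF that(1)] in\<tau>[OF t]])
      have "\<bar>\<tau> * t' - \<tau> * t\<bar> = \<tau> * \<bar>t' - t\<bar>" using \<tau> by (simp add: abs_mult right_diff_distrib[symmetric])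
      also have "\<dots> \<le> (\<tau> + 1) * \<bar>t' - t\<bar>" by (simp add: mult_right_mono)
      also have "\<dots> < d" using that(2) \<tau> by (simp add: pos_less_divide_eq mult.commute)
      finally show "\<bar>\<tau> * t' - \<tau> * t\<bar> < d" .
    qed (use that(3) Hz_subset in blast)
    then show ?thesis unfolding nrm_H1n using d(1) \<tau> by (intro exI[of _ "d / (\<tau> + 1)"]) auto
  qed
  have "\<exists>a d. 0 < a \<and> a < c \<and> 0 < d \<and>
      (\<forall>t'\<in>{0..1}. \<bar>t' - t\<bar> < d \<longrightarrow> a \<notin> spc (B (\<tau> * t')) \<and> - a \<notin> spc (B (\<tau> * t')))" if "t \<in> {0..1}" for t
    by (rule local_admissible[of "{0..1}" "\<lambda>t. B (\<tau> * t)" K c t, OF kt that cont])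
  then obtain \<alpha> \<delta> where ad: "\<And>t. t \<in> {0..1} \<Longrightarrow> 0 < \<alpha> t \<and> \<alpha> t < c \<and> 0 < \<delta> t \<and>
      (\<forall>t'\<in>{0..1}. \<bar>t' - t\<bar> < \<delta> t \<longrightarrow> \<alpha> t \<notin> spc (B (\<tau> * t')) \<and> - \<alpha> t \<notin> spc (B (\<tau> * t')))" by metis
  have adm: "sf_admissible (Hz z) H1_inner (B (\<tau> * t')) (\<alpha> t)" if t: "t \<in> {0..1}" "t' \<in> {0..1}" "\<bar>t' - t\<bar> < \<delta> t" for t t'
    unfolding sf_admissible_def spec eig
  proof (intro conjI ballI)
    show "0 < \<alpha> t" "\<alpha> t \<notin> spc (B (\<tau> * t'))" "- \<alpha> t \<notin> spc (B (\<tau> * t'))" using ad[OF t(1)] t by auto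
    show "finite (spc (B (\<tau> * t')) \<inter> {- \<alpha> t..\<alpha> t})" using finite_spc[OF kt[OF t(2)]] ad[OF t(1)] by blast
    fix s assume "s \<in> spc (B (\<tau> * t')) \<inter> {- \<alpha> t..\<alpha> t}"
    then have "\<bar>s\<bar> < c" using ad[OF t(1)] by auto
    from kform_shift[OF kt[OF t(2)] this] obtain U where "finite U" "cfun.span U = ker (shift (B (\<tau> * t')) s)"
      by (rule kform_ker_basis) blast
    then show "cfin_dim (ker (shift (B (\<tau> * t')) s))"
      unfolding cfin_dim_def using cfun.span_span by metis
  qed
  obtain e where e: "0 < e" "\<And>x. x \<in> {0..1} \<Longrightarrow> \<exists>G\<in>(\<lambda>t. ball t (\<delta> t)) ` {0..1}. ball x e \<subseteq> G"
  proof (rule Heine_Borel_lemma[of "{0..1::real}" "(\<lambda>t. ball t (\<delta> t)) ` {0..1}"])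
    show "{0..1} \<subseteq> \<Union> ((\<lambda>t. ball t (\<delta> t)) ` {0..1})" using ad by fastforce
  qed auto
  then have "\<exists>t\<in>{0..1}. ball x e \<subseteq> ball t (\<delta> t)" if "x \<in> {0..1}" for x using that by fast
  then obtain T where T: "\<And>x. x \<in> {0..1} \<Longrightarrow> T x \<in> {0..1}" "\<And>x. x \<in> {0..1} \<Longrightarrow> ball x e \<subseteq> ball (T x) (\<delta> (T x))" by metis
  obtain n0 :: nat where n0: "inverse (real (Suc n0)) < e" using reals_Archimedean[OF e(1)] by blast
  define n where "n = Suc n0"
  have n: "0 < n" "1 / real n < e" using n0 by (auto simp: n_def inverse_eq_divide)
  show thesis
  proof (rule that[of "\<lambda>i. real i / real n" n "\<lambda>i. \<alpha> (T (real i / real n))"])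
    show "real 0 / real n = 0" "real n / real n = 1" using n by auto
    show "\<forall>i<n. real i / real n < real (Suc i) / real n" using n by (simp add: divide_strict_right_mono)
    have x01: "real i / real n \<in> {0..1}" if "i < n" for i using that by simp
    show "\<alpha> (T (real i / real n)) < c" if "i < n" for i using ad[OF T(1)[OF x01[OF that]]] by blast
    show "\<forall>i<n. \<forall>t\<in>{real i / real n..real (Suc i) / real n}.
        sf_admissible (Hz z) H1_inner (B (\<tau> * t)) (\<alpha> (T (real i / real n)))"
    proof (intro allI impI ballI)
      fix i t assume i: "i < n" and t: "t \<in> {real i / real n..real (Suc i) / real n}"
      have "real (Suc i) / real n = real i / real n + 1 / real n" by (simp add: add_divide_distrib add.commute)
      then have "dist (real i / real n) t < e" using t n by (auto simp: dist_real_def)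
      then have "t \<in> ball (T (real i / real n)) (\<delta> (T (real i / real n)))" using T(2)[OF x01[OF i]] by auto
      moreover have "real (Suc i) / real n \<le> 1" using i by simp
      then have "t \<in> {0..1}" using t order_trans[of 0 "real i / real n" t] by auto
      ultimately show "sf_admissible (Hz z) H1_inner (B (\<tau> * t)) (\<alpha> (T (real i / real n)))"
        using adm[OF T(1)[OF x01[OF i]]] by (auto simp: dist_real_def abs_minus_commute)
    qed
  qed
qed

text \<open>The description in \<open>spectral_flow\<close> has a witness, and any admissible
  partition sum equals the index difference on all sufficiently fine grids. Two partitions are
  compared on a common fine grid, where the right-hand side is the same number, so the value is
  unique.\<close>

lemma spectral_flow_eq_index_diff:
  assumes \<tau>: "0 \<le> \<tau>"
  obtains m0 where "0 < m0"
    "\<And>m. m0 \<le> m \<Longrightarrow> spectral_flow (Hz z) H1_inner (\<lambda>t. B (\<tau> * t)) = int (ixm m z (B \<tau>)) - int (ixm m z (B 0))"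
    "\<And>m t. m0 \<le> m \<Longrightarrow> t \<in> {0..\<tau>} \<Longrightarrow> \<exists>S T. cfun.pos_split (Hz z) (Wsp \<epsilon> m 1) (Wsp \<epsilon> m (-1)) (B t) S T"
proof -
  \<comment> \<open>The window 1/2 is an arbitrary choice for producing one witness; a given
    partition receives its own window below.\<close>
  obtain m0 K where m0: "0 < m0" and k: "\<And>m t. m0 \<le> m \<Longrightarrow> t \<in> {0..\<tau>} \<Longrightarrow> kfm m z (B t) K (1/2)"
    by (rule B_kform[of "1/2" \<tau> z]) auto
  obtain n :: nat and tp a where w: "tp 0 = 0" "tp n = 1" "\<forall>i<n. tp i < tp (Suc i)"
    "\<forall>i<n. \<forall>t\<in>{tp i..tp (Suc i)}. sf_admissible (Hz z) H1_inner (B (\<tau> * t)) (a i)" "\<And>i. i < n \<Longrightarrow> a i < 1/2"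
    by (rule flow_partition_exists[OF m0 k \<tau>]) auto
  define P where "P s \<longleftrightarrow> (\<exists>(m::nat) (tp::nat \<Rightarrow> real) (a::nat \<Rightarrow> real).
      tp 0 = 0 \<and> tp m = 1 \<and> (\<forall>i<m. tp i < tp (Suc i)) \<and>
      (\<forall>i<m. \<forall>t\<in>{tp i..tp (Suc i)}. sf_admissible (Hz z) H1_inner (B (\<tau> * t)) (a i)) \<and>
      s = (\<Sum>i<m. int (spec_count (Hz z) H1_inner (B (\<tau> * tp (Suc i))) (a i))
                 - int (spec_count (Hz z) H1_inner (B (\<tau> * tp i)) (a i))))" for s
  have all: "\<exists>m1. \<forall>m\<ge>m1. s = int (ixm m z (B \<tau>)) - int (ixm m z (B 0))" if Ps: "P s" for s
  proof -
    obtain n :: nat and tp a where w: "tp 0 = 0" "tp n = 1" "\<forall>i<n. tp i < tp (Suc i)"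
      "\<forall>i<n. \<forall>t\<in>{tp i..tp (Suc i)}. sf_admissible (Hz z) H1_inner (B (\<tau> * t)) (a i)"
      and s: "s = (\<Sum>i<n. int (spec_count (Hz z) H1_inner (B (\<tau> * tp (Suc i))) (a i))
                 - int (spec_count (Hz z) H1_inner (B (\<tau> * tp i)) (a i)))"
      using Ps[unfolded P_def] by (elim exE conjE)
    have tp0: "0 \<le> tp i" if "i \<le> n" for i using that
    proof (induction i)
      case (Suc i)
      then have "tp i < tp (Suc i)" using w(3) by simp
      then show ?case using Suc by simp
    qed (simp add: w)
    have a1: "a i < 1" if "i < n" for i
    proof (rule admissible_lt_1)
      show "sf_admissible (Hz z) H1_inner (B (\<tau> * tp i)) (a i)" using w(3,4) that by (simp add: less_imp_le)
      show "0 \<le> \<tau> * tp i" using \<tau> tp0[of i] that by simp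
    qed
    \<comment> \<open>Inserting 0 keeps the maximum defined and nonnegative; \<open>c\<close> is
      then the midpoint between \<open>\<mu>\<close> and 1, above all thresholds.\<close>
    define \<mu> where "\<mu> = Max (insert 0 (a ` {..<n}))"
    have M: "\<mu> < 1" unfolding \<mu>_def using a1 by (subst Max_less_iff) auto
    have M0: "0 \<le> \<mu>" unfolding \<mu>_def by (rule Max_ge) auto
    define c where "c = (\<mu> + 1) / 2"
    have c0: "0 < c" unfolding c_def using M0 by simp
    have c1: "c < 1" unfolding c_def using M by simp
    have ac: "a i < c" if "i < n" for i
    proof -
      have "a i \<le> \<mu>" unfolding \<mu>_def using that by (intro Max_ge) auto
      then show ?thesis using M unfolding c_def by simp
    qed
    obtain m1 K where m1: "0 < m1" and k: "\<And>m t. m1 \<le> m \<Longrightarrow> t \<in> {0..\<tau>} \<Longrightarrow> kfm m z (B t) K c"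
      by (rule B_kform[OF c0 c1, of \<tau> z]) blast
    have "s = int (ixm m z (B \<tau>)) - int (ixm m z (B 0))" if "m1 \<le> m" for m
      unfolding s by (rule flow_value[OF _ k[OF that] \<tau> w ac]) (use m1 that in auto)
    then show ?thesis by blast
  qed
  define s0 where "s0 = (\<Sum>i<n. int (spec_count (Hz z) H1_inner (B (\<tau> * tp (Suc i))) (a i))
                 - int (spec_count (Hz z) H1_inner (B (\<tau> * tp i)) (a i)))"
  have P0: "P s0" unfolding P_def s0_def using w by blast
  have uniq: "s = s0" if Ps: "P s" for s
  proof -
    obtain m1 m2 where "\<forall>m\<ge>m1. s = int (ixm m z (B \<tau>)) - int (ixm m z (B 0))"
      "\<forall>m\<ge>m2. s0 = int (ixm m z (B \<tau>)) - int (ixm m z (B 0))" using all[OF Ps] all[OF P0] by blast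
    then show ?thesis using max.cobounded1[of m1 m2] max.cobounded2[of m2 m1] by metis
  qed
  have "spectral_flow (Hz z) H1_inner (\<lambda>t. B (\<tau> * t)) = (THE s. P s)"
    unfolding spectral_flow_def P_def ..
  also have "\<dots> = s0" using P0 uniq by (rule the_equality)
  finally have sf: "spectral_flow (Hz z) H1_inner (\<lambda>t. B (\<tau> * t)) = s0" .
  show thesis
  proof (rule that[OF m0])
    show "spectral_flow (Hz z) H1_inner (\<lambda>t. B (\<tau> * t)) = int (ixm m z (B \<tau>)) - int (ixm m z (B 0))" if "m0 \<le> m" for m
      unfolding sf s0_def by (rule flow_value[OF _ k[OF that] \<tau> w]) (use m0 that in auto)
    show "\<exists>S T. cfun.pos_split (Hz z) (Wsp \<epsilon> m 1) (Wsp \<epsilon> m (-1)) (B t) S T" if "m0 \<le> m" "t \<in> {0..\<tau>}" for m t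
    proof -
      have "0 < m" using m0 that by simp
      then interpret krein_space cscale "Hz z" H1_inner "Wsp \<epsilon> m 1" "Wsp \<epsilon> m (-1)" by (rule krein_Hz[OF eps])
      show ?thesis by (rule kform_pos_split[OF k[OF that]])
    qed
  qed
qed

end

subsection \<open>Cutting and gluing along an N-fold cover\<close>

text \<open>Cells are open on the left and closed on the right, so they tile (0,1] exactly and only
  the null point 0 is left out.\<close>

lemma cell_exists:
  assumes "0 < N" "0 < r" "r \<le> (1::real)"
  obtains j where "j < N" "real j / real N < r" "r \<le> real (Suc j) / real N"
proof -
  define j where "j = nat (\<lceil>real N * r\<rceil> - 1)"
  have mr: "0 < real N * r" "real N * r \<le> real N" using assms by (auto intro: mult_left_le)
  have c1: "1 \<le> \<lceil>real N * r\<rceil>" using mr by (simp add: Suc_leI int_one_le_iff_zero_less)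
  have rj: "real j = of_int \<lceil>real N * r\<rceil> - 1" unfolding j_def using c1 by (simp add: of_nat_nat)
  have j: "real j < real N * r" "real N * r \<le> real j + 1" unfolding rj by linarith+
  show thesis
  proof (rule that[of j])
    show "j < N" using j(1) mr(2) by simp
    show "real j / real N < r" using j(1) assms by (simp add: pos_divide_less_eq mult.commute)
    show "r \<le> real (Suc j) / real N" using j(2) assms by (simp add: pos_le_divide_eq mult.commute add.commute)
  qed
qed

lemma cell_unique:
  assumes "0 < N" "real i / real N < r" "r \<le> real (Suc i) / real N" "real j / real N < r" "r \<le> real (Suc j) / real N"
  shows "i = j"
proof -
  have "real i / N < real (Suc j) / N" "real j / N < real (Suc i) / N" using assms by linarith+
  then have "real i < real (Suc j)" "real j < real (Suc i)" using assms(1) by (simp_all only: divide_less_cancel)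
  then show ?thesis by linarith
qed

lemma cell_sum:
  fixes v :: "nat \<Rightarrow> 'b::real_vector"
  assumes "0 < N" "i < N" "real i / real N < r" "r \<le> real (Suc i) / real N"
  shows "(\<Sum>j<N. indicator {real j / real N<..real (Suc j) / real N} r *\<^sub>R v j) = v i"
proof -
  have "indicator {real j / real N<..real (Suc j) / real N} r *\<^sub>R v j = (if j = i then v i else 0)" for j
  proof (cases "j = i")
    case True
    have "r \<in> {real i / N<..real (Suc i) / N}" using assms by simp
    then show ?thesis using True by (simp only: indicator_simps) simp
  next
    case False
    then have "r \<notin> {real j / N<..real (Suc j) / N}" using cell_unique[OF assms(1) _ _ assms(3,4)] by (meson greaterThanAtMost_iff)
    then show ?thesis using False by (simp only: indicator_simps) simp
  qed
  then show ?thesis using assms(2) by simp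
qed

lemma unit_cover:
  assumes "0 < N" "r \<in> {0..1::real}"
  obtains i s where "i < N" "s \<in> {0..1}" "r = (s + real i) / real N"
proof (cases "r = 0")
  case True
  then show thesis using that[of 0 0] assms by simp
next
  case False
  then obtain i where i: "i < N" "real i / real N < r" "r \<le> real (Suc i) / real N"
    using cell_exists[of N r] assms by auto
  have "real i < real N * r" "real N * r \<le> real i + 1"
    using i assms(1) by (simp_all add: pos_divide_less_eq pos_le_divide_eq mult.commute add.commute)
  then show thesis using that[of i "real N * r - real i"] i assms(1) by simp
qed

lemma cell_in_unit: "i < N \<Longrightarrow> s \<in> {0..1} \<Longrightarrow> (s + real i) / real N \<in> {0..1}"
proof -
  assume i: "i < N" and s: "s \<in> {0..1}"
  have "s + real i \<le> real N" using i s by simp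
  then show ?thesis using i s by (simp add: divide_le_eq_1)
qed

lemma AE_UI_unit: "AE s in UI. 0 < s \<and> s \<le> 1"
proof -
  have "AE s in UI. s \<in> space UI" by (rule AE_space)
  then show ?thesis using AE_UI_nonzero by eventually_elim auto
qed

text \<open>Substitution \<open>r = (s + j) / N\<close>, restricted to an initial part of the j-th
  cell; the version with variable \<open>t\<close> is needed to recover primitives, not just total
  integrals.\<close>

lemma UI_affine:
  fixes g :: "real \<Rightarrow> 'b::{banach, second_countable_topology}"
  assumes j: "j < N" and t: "t \<in> {0..1}"
  shows "(\<integral>r. indicator {real j / real N<..(t + real j) / real N} r *\<^sub>R g r \<partial>UI)
    = (1 / real N) *\<^sub>R (\<integral>s. indicator {0<..t} s *\<^sub>R g ((s + real j) / real N) \<partial>UI)"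
proof -
  have N: "0 < real N" using j by simp
  define f where "f r = indicator {real j / real N<..(t + real j) / real N} r *\<^sub>R g r" for r
  have up: "(t + real j) / real N \<le> 1" using cell_in_unit[OF j t] by simp
  have lo: "0 \<le> real j / real N" by simp
  have "(\<integral>r. f r \<partial>UI) = (\<integral>r. indicator {0..1} r *\<^sub>R f r \<partial>lborel)"
    unfolding UI_def by (subst integral_restrict_space) auto
  also have "\<dots> = (\<integral>r. f r \<partial>lborel)"
  proof (rule Bochner_Integration.integral_cong[OF refl])
    fix r show "indicator {0..1} r *\<^sub>R f r = f r"
      using up order_trans[OF lo] unfolding f_def by (auto split: split_indicator)
  qed
  also have "\<dots> = \<bar>1 / real N\<bar> *\<^sub>R (\<integral>x. f (real j / real N + (1 / real N) * x) \<partial>lborel)"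
    by (rule lborel_integral_real_affine) (use N in simp)
  also have "(\<integral>x. f (real j / real N + (1 / real N) * x) \<partial>lborel) = (\<integral>s. indicator {0..1} s *\<^sub>R (indicator {0<..t} s *\<^sub>R g ((s + real j) / real N)) \<partial>lborel)"
  proof (rule Bochner_Integration.integral_cong[OF refl])
    fix x
    have eq: "real j / real N + (1 / real N) * x = (x + real j) / real N" by (simp add: add_divide_distrib)
    have "real j / real N < (x + real j) / real N \<longleftrightarrow> 0 < x" "(x + real j) / real N \<le> (t + real j) / real N \<longleftrightarrow> x \<le> t"
      using N by (simp_all add: divide_less_cancel divide_le_cancel)
    then show "f (real j / real N + (1 / real N) * x) = indicator {0..1} x *\<^sub>R (indicator {0<..t} x *\<^sub>R g ((x + real j) / real N))"
      unfolding eq f_def using t by (auto split: split_indicator)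
  qed
  also have "\<dots> = (\<integral>s. indicator {0<..t} s *\<^sub>R g ((s + real j) / real N) \<partial>UI)"
    unfolding UI_def by (subst integral_restrict_space) auto
  finally show ?thesis unfolding f_def using N by simp
qed

lemma UI_affine_measurable:
  assumes j: "j < N" and g: "g \<in> borel_measurable UI"
  shows "(\<lambda>s. g ((s + real j) / real N)) \<in> borel_measurable UI"
proof (rule measurable_compose[OF _ g])
  have "(\<lambda>s. (s + real j) / real N) \<in> measurable UI lborel"
    unfolding UI_def by (rule measurable_restrict_space1) simp
  then have "(\<lambda>s. (s + real j) / real N) \<in> measurable UI (restrict_space lborel {0..1})"
    using cell_in_unit[OF j] by (intro measurable_restrict_space2) auto
  then show "(\<lambda>s. (s + real j) / real N) \<in> measurable UI UI" unfolding UI_def .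
qed

lemma UI_affine_integrable:
  fixes g :: "real \<Rightarrow> 'b::{banach, second_countable_topology}"
  assumes j: "j < N" and g: "integrable UI g"
  shows "integrable UI (\<lambda>s. g ((s + real j) / real N))"
proof -
  have N: "1 / real N \<noteq> 0" using j by simp
  have "integrable lborel (\<lambda>r. indicator {0..1} r *\<^sub>R g r)"
    using g unfolding integrable_UI[symmetric] set_integrable_def .
  from integrable_mult_indicator[OF _ lborel_integrable_real_affine[OF this N, of "real j / real N"], of "{0..1}"]
  have i: "integrable lborel (\<lambda>x. indicator {0..1} x *\<^sub>R (indicator {0..1} (real j / real N + 1 / real N * x) *\<^sub>R g (real j / real N + 1 / real N * x)))"
    by simp
  have "indicator {0..1} x *\<^sub>R (indicator {0..1} (real j / real N + 1 / real N * x) *\<^sub>R g (real j / real N + 1 / real N * x))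
      = indicator {0..1} x *\<^sub>R g ((x + real j) / real N)" for x
  proof -
    have "real j / real N + 1 / real N * x = (x + real j) / real N" by (simp add: add_divide_distrib)
    then show ?thesis using cell_in_unit[OF j, of x] by (cases "x \<in> {0..1}") auto
  qed
  with i show ?thesis unfolding integrable_UI[symmetric] set_integrable_def by simp
qed

lemma UI_cells:
  fixes g :: "real \<Rightarrow> 'b::{banach, second_countable_topology}"
  assumes N: "0 < N" and g: "integrable UI g"
  shows "(\<integral>r. g r \<partial>UI) = (1 / real N) *\<^sub>R (\<Sum>j<N. \<integral>s. g ((s + real j) / real N) \<partial>UI)"
proof -
  have ig: "integrable UI (\<lambda>r. indicat_real {real j / real N<..real (Suc j) / real N} r *\<^sub>R g r)" for j
  proof (rule Bochner_Integration.integrable_bound[OF g])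
    show "(\<lambda>r. indicat_real {real j / real N<..real (Suc j) / real N} r *\<^sub>R g r) \<in> borel_measurable UI"
      by (intro borel_measurable_scaleR borel_measurable_indicator_UI borel_measurable_integrable[OF g]) simp
  qed (auto split: split_indicator)
  have "(\<integral>r. g r \<partial>UI) = (\<integral>r. (\<Sum>j<N. indicator {real j / real N<..real (Suc j) / real N} r *\<^sub>R g r) \<partial>UI)"
  proof (rule integral_cong_AE)
    show "g \<in> borel_measurable UI" using g by simp
    show "(\<lambda>r. \<Sum>j<N. indicat_real {real j / real N<..real (Suc j) / real N} r *\<^sub>R g r) \<in> borel_measurable UI"
      by (intro borel_measurable_sum borel_measurable_integrable ig)
    show "AE r in UI. g r = (\<Sum>j<N. indicat_real {real j / real N<..real (Suc j) / real N} r *\<^sub>R g r)"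
      using AE_UI_unit
    proof eventually_elim
      case (elim r)
      obtain i where "i < N" "real i / real N < r" "r \<le> real (Suc i) / real N" using cell_exists[OF N] elim by blast
      then show ?case using cell_sum[OF N, of i r "\<lambda>_. g r"] by simp
    qed
  qed
  also have "\<dots> = (\<Sum>j<N. \<integral>r. indicator {real j / real N<..real (Suc j) / real N} r *\<^sub>R g r \<partial>UI)"
    by (rule Bochner_Integration.integral_sum) (rule ig)
  also have "\<dots> = (\<Sum>j<N. (1 / real N) *\<^sub>R (\<integral>s. g ((s + real j) / real N) \<partial>UI))"
  proof (rule sum.cong[OF refl])
    fix j assume "j \<in> {..<N}"
    then have j: "j < N" by simp
    have "(\<integral>r. indicator {real j / real N<..real (Suc j) / real N} r *\<^sub>R g r \<partial>UI)
        = (1 / real N) *\<^sub>R (\<integral>s. indicator {0<..1} s *\<^sub>R g ((s + real j) / real N) \<partial>UI)"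
      using UI_affine[OF j, of 1 g] by (simp add: add.commute)
    also have "(\<integral>s. indicator {0<..1} s *\<^sub>R g ((s + real j) / real N) \<partial>UI) = (\<integral>s. g ((s + real j) / real N) \<partial>UI)"
    proof (rule integral_cong_AE)
      have m: "(\<lambda>s. g ((s + real j) / real N)) \<in> borel_measurable UI"
        using UI_affine_integrable[OF j g] by simp
      then show "(\<lambda>s. g ((s + real j) / real N)) \<in> borel_measurable UI"
        "(\<lambda>s. indicat_real {0<..1} s *\<^sub>R g ((s + real j) / real N)) \<in> borel_measurable UI"
        by (auto intro!: borel_measurable_scaleR borel_measurable_indicator_UI)
      show "AE s in UI. indicat_real {0<..1} s *\<^sub>R g ((s + real j) / real N) = g ((s + real j) / real N)"
        using AE_UI_unit by eventually_elim simp
    qed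
    finally show "(\<integral>r. indicator {real j / real N<..real (Suc j) / real N} r *\<^sub>R g r \<partial>UI)
        = (1 / real N) *\<^sub>R (\<integral>s. g ((s + real j) / real N) \<partial>UI)" .
  qed
  finally show ?thesis by (simp add: scaleR_sum_right)
qed

lemma Ioc_Icc_integral:
  fixes f :: "'n::finite cfun"
  assumes "f \<in> L2" shows "(\<integral>s. indicator {0<..t} s *\<^sub>R f s \<partial>UI) = (\<integral>s. indicator {0..t} s *\<^sub>R f s \<partial>UI)"
proof (rule integral_cong_AE)
  show "(\<lambda>s. indicat_real {0<..t} s *\<^sub>R f s) \<in> borel_measurable UI" "(\<lambda>s. indicat_real {0..t} s *\<^sub>R f s) \<in> borel_measurable UI"
    by (intro borel_measurable_integrable integrable_indicator_L2 assms; simp)+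
  show "AE s in UI. indicat_real {0<..t} s *\<^sub>R f s = indicat_real {0..t} s *\<^sub>R f s"
    using AE_UI_unit by eventually_elim (auto split: split_indicator)
qed

text \<open>The j-th sheet of \<open>U\<close>, stretched to unit length and set to 0 outside to
  respect the normal form of H1 elements. Both cell endpoints are kept, so adjacent pieces share
  boundary values.\<close>

definition piece :: "nat \<Rightarrow> nat \<Rightarrow> 'n::finite cfun \<Rightarrow> 'n cfun" where
  "piece N j U = (\<lambda>s. if s \<in> {0..1} then U ((s + real j) / real N) else 0)"

lemma piece_add: "piece N j (U + V) = piece N j U + piece N j V"
  and piece_scale: "piece N j (cscale c U) = cscale c (piece N j U)"
  by (auto simp: piece_def fun_eq_iff cscale_def vec_eq_iff)

lemma piece_sum: "finite A \<Longrightarrow> piece N j (\<Sum>a\<in>A. f a) = (\<Sum>a\<in>A. piece N j (f a))"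
proof (induction A rule: finite_induct)
  case empty
  show ?case by (simp add: piece_def fun_eq_iff)
next
  case (insert x F)
  show ?case unfolding sum.insert[OF insert.hyps] piece_add insert.IH ..
qed

lemma L2_affine:
  assumes j: "j < N" and f: "f \<in> L2" shows "(\<lambda>s. f ((s + real j) / real N)) \<in> L2"
  using UI_affine_measurable[OF j L2_D(1)[OF f]] UI_affine_integrable[OF j L2_D(2)[OF f]] by (simp add: L2_def)

lemma L2_scaleR: "f \<in> L2 \<Longrightarrow> (\<lambda>s. r *\<^sub>R f s) \<in> L2"
  by (auto simp: L2_def power_mult_distrib)

lemma piece_H1:
  assumes j: "j < N" and U: "U \<in> H1"
  shows "piece N j U \<in> H1" "AE s in UI. hder (piece N j U) s = (1 / real N) *\<^sub>R hder U ((s + real j) / real N)"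
proof -
  define D where "D s = (1 / real N) *\<^sub>R hder U ((s + real j) / real N)" for s
  have D: "D \<in> L2" unfolding D_def by (intro L2_scaleR L2_affine j H1_hder(1) U)
  have E: "piece N j U t = piece N j U 0 + (\<integral>s. indicator {0..t} s *\<^sub>R D s \<partial>UI)" if t: "t \<in> {0..1}" for t
  proof -
    have "U ((t + real j) / real N) - U (real j / real N) = (\<integral>r. indicator {real j / real N<..(t + real j) / real N} r *\<^sub>R hder U r \<partial>UI)"
      by (rule integral_hder_Ioc[OF U, symmetric]) (use cell_in_unit[OF j t] t j in \<open>auto simp: divide_right_mono\<close>)
    also have "\<dots> = (1 / real N) *\<^sub>R (\<integral>s. indicator {0<..t} s *\<^sub>R hder U ((s + real j) / real N) \<partial>UI)"
      by (rule UI_affine[OF j t])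
    also have "\<dots> = (\<integral>s. indicator {0<..t} s *\<^sub>R D s \<partial>UI)"
      unfolding D_def scaleR_left_commute[of _ "1 / real N"]
      by (rule integral_scaleR_right[symmetric])
    also have "\<dots> = (\<integral>s. indicator {0..t} s *\<^sub>R D s \<partial>UI)" by (rule Ioc_Icc_integral[OF D])
    finally show ?thesis using t by (simp add: piece_def algebra_simps)
  qed
  have O: "piece N j U t = 0" if "t \<notin> {0..1}" for t unfolding piece_def using that by (rule if_not_P)
  show "piece N j U \<in> H1" "AE s in UI. hder (piece N j U) s = (1 / real N) *\<^sub>R hder U ((s + real j) / real N)"
    using H1I[OF D E O] unfolding D_def by blast+
qed

lemma pieces_eqI:
  assumes N: "0 < N" and U: "U \<in> H1" and V: "V \<in> H1" and eq: "\<And>j. j < N \<Longrightarrow> piece N j U = piece N j V"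
  shows "U = V"
proof
  fix r
  show "U r = V r"
  proof (cases "r \<in> {0..1}")
    case True
    then obtain i s where i: "i < N" "s \<in> {0..1}" "r = (s + real i) / real N" by (rule unit_cover[OF N])
    then show ?thesis using fun_cong[OF eq[OF i(1)], of s] by (simp add: piece_def)
  next
    case False
    then show ?thesis using H1_outside[OF U] H1_outside[OF V] by simp
  qed
qed

lemma H1_of_deriv:
  fixes f :: "'n::finite cfun"
  assumes f: "f \<in> L2"
  obtains U where "U \<in> H1" "U 0 = v" "\<And>a b. 0 \<le> a \<Longrightarrow> a \<le> b \<Longrightarrow> b \<le> 1 \<Longrightarrow>
    U b - U a = (\<integral>r. indicator {a<..b} r *\<^sub>R f r \<partial>UI)"
proof -
  define U where "U t = (if t \<in> {0..1} then v + (\<integral>s. indicator {0<..t} s *\<^sub>R f s \<partial>UI) else 0)" for t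
  have U0: "U 0 = v" by (simp add: U_def)
  have E: "U t = U 0 + (\<integral>s. indicator {0..t} s *\<^sub>R f s \<partial>UI)" if "t \<in> {0..1}" for t
    unfolding U0 Ioc_Icc_integral[OF f, symmetric] using that by (simp add: U_def)
  have O: "U t = 0" if "t \<notin> {0..1}" for t unfolding U_def using that by (rule if_not_P)
  have UH: "U \<in> H1" and ae: "AE s in UI. hder U s = f s"
    using H1I[OF f E O] by blast+
  show thesis
  proof (rule that[OF UH U0])
    fix a b :: real assume ab: "0 \<le> a" "a \<le> b" "b \<le> 1"
    have "U b - U a = (\<integral>r. indicator {a<..b} r *\<^sub>R hder U r \<partial>UI)" by (rule integral_hder_Ioc[OF UH ab, symmetric])
    also have "\<dots> = (\<integral>r. indicator {a<..b} r *\<^sub>R f r \<partial>UI)"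
    proof (rule integral_cong_AE)
      show "(\<lambda>r. indicat_real {a<..b} r *\<^sub>R hder U r) \<in> borel_measurable UI" "(\<lambda>r. indicat_real {a<..b} r *\<^sub>R f r) \<in> borel_measurable UI"
        by (intro borel_measurable_integrable integrable_indicator_L2 H1_hder(1) UH f; simp)+
      show "AE r in UI. indicat_real {a<..b} r *\<^sub>R hder U r = indicat_real {a<..b} r *\<^sub>R f r"
        using ae by eventually_elim simp
    qed
    finally show "U b - U a = (\<integral>r. indicator {a<..b} r *\<^sub>R f r \<partial>UI)" .
  qed
qed

text \<open>The glued function is built from its derivative: on the j-th cell take
  \<open>N \<zeta>^j V'(N r - j)\<close> and integrate from \<open>V 0\<close>. The boundary
  condition of \<open>V\<close> is precisely what makes the values at the nodes agree, so that the
  j-th piece is \<open>\<zeta>^j V\<close>.\<close>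

lemma glue_exists:
  fixes V :: "'n::finite cfun"
  assumes N: "0 < N" and V: "V \<in> Hz \<zeta>"
  shows "\<exists>U\<in>H1. \<forall>j<N. piece N j U = cscale (\<zeta> ^ j) V"
proof -
  have VH: "V \<in> H1" and V1: "V 1 = \<zeta> *s V 0" using V by (auto simp: Hz_def)
  note DV = H1_hder(1)[OF VH]
  \<comment> \<open>The weak derivative is constrained only on \<open>[0,1]\<close>; cutting it off
    gives a Borel function on the line to which affine substitutions apply.\<close>
  define H where "H x = indicat_real {0..1} x *\<^sub>R hder V x" for x
  have Hm: "H \<in> borel_measurable borel"
    using L2_D(1)[OF DV] unfolding borel_measurable_UI[symmetric] set_borel_measurable_def H_def by simp
  have Hi: "integrable lborel (\<lambda>x. (norm (H x))\<^sup>2)"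
  proof -
    have "integrable lborel (\<lambda>x. indicat_real {0..1} x *\<^sub>R (norm (hder V x))\<^sup>2)"
      using L2_D(2)[OF DV] unfolding integrable_UI[symmetric] set_integrable_def .
    then show ?thesis by (rule Bochner_Integration.integrable_cong[THEN iffD1, OF refl, rotated]) (auto simp: H_def split: split_indicator)
  qed
  define h where "h j r = indicat_real {real j / real N<..real (Suc j) / real N} r *\<^sub>R H (real N * r - real j)" for j :: nat and r
  have hL: "h j \<in> L2" for j
    unfolding L2_def
  proof (intro CollectI conjI)
    have [measurable]: "H \<in> borel_measurable borel" by (rule Hm)
    have "(\<lambda>r. indicat_real {real j / real N<..real (Suc j) / real N} r *\<^sub>R H (real N * r - real j)) \<in> borel_measurable lborel"
      by measurable
    then have hm: "h j \<in> borel_measurable lborel" unfolding h_def .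
    then show m: "h j \<in> borel_measurable UI" unfolding UI_def by (rule measurable_restrict_space1)
    have i: "integrable lborel (\<lambda>r. (norm (H (- real j + real N * r)))\<^sup>2)"
      by (rule lborel_integrable_real_affine[OF Hi]) (use N in simp)
    have "integrable lborel (\<lambda>r. indicat_real {0..1} r *\<^sub>R (norm (h j r))\<^sup>2)"
    proof (rule Bochner_Integration.integrable_bound[OF i])
      show "(\<lambda>r. indicat_real {0..1} r *\<^sub>R (norm (h j r))\<^sup>2) \<in> borel_measurable lborel" using hm by measurable
    qed (auto simp: h_def split: split_indicator)
    then show "integrable UI (\<lambda>s. (norm (h j s))\<^sup>2)" unfolding integrable_UI[symmetric] set_integrable_def .
  qed
  \<comment> \<open>The factor \<open>N\<close> compensates the 1/N of the substitution, so
    increments of the primitive are those of \<open>\<zeta>^j V\<close>.\<close>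
  define f where "f = (\<Sum>j<N. cscale (of_nat N * \<zeta> ^ j) (h j))"
  have fL: "f \<in> L2"
    unfolding f_def by (intro cfun.subspace_sum[OF L2_subspace] cfun.subspace_scale[OF L2_subspace] hL)
  have fval: "f ((x + real i) / real N) = (of_nat N * \<zeta> ^ i) *s hder V x" if i: "i < N" and x: "0 < x" "x \<le> 1" for i x
  proof -
    define r where "r = (x + real i) / real N"
    have cell: "real i / real N < r" "r \<le> real (Suc i) / real N"
      unfolding r_def using x N by (auto intro!: divide_strict_right_mono divide_right_mono)
    have Nr: "real N * r = x + real i" using N by (simp add: r_def)
    have "f r = (\<Sum>j<N. indicat_real {real j / real N<..real (Suc j) / real N} r *\<^sub>R ((of_nat N * \<zeta> ^ j) *s H (real N * r - real j)))"
    proof -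
      have "(\<Sum>j\<in>A. cscale (of_nat N * \<zeta> ^ j) (h j)) r = (\<Sum>j\<in>A. cscale (of_nat N * \<zeta> ^ j) (h j) r)" if "finite A" for A
        using that by (induction A) auto
      then show ?thesis unfolding f_def by (simp add: cscale_def h_def vec_scale_scaleR)
    qed
    also have "\<dots> = (of_nat N * \<zeta> ^ i) *s H (real N * r - real i)" by (rule cell_sum[OF N i cell])
    also have "real N * r - real i = x" using Nr by simp
    also have "H x = hder V x" using x by (simp add: H_def)
    finally show ?thesis unfolding r_def .
  qed
  obtain U where U: "U \<in> H1" "U 0 = V 0" "\<And>a b. 0 \<le> a \<Longrightarrow> a \<le> b \<Longrightarrow> b \<le> 1 \<Longrightarrow>
    U b - U a = (\<integral>r. indicator {a<..b} r *\<^sub>R f r \<partial>UI)" by (rule H1_of_deriv[OF fL, of "V 0"]) blast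
  have inc: "U ((s + real i) / real N) - U (real i / real N) = \<zeta> ^ i *s (V s - V 0)" if i: "i < N" and s: "s \<in> {0..1}" for i s
  proof -
    have "U ((s + real i) / real N) - U (real i / real N) = (\<integral>r. indicator {real i / real N<..(s + real i) / real N} r *\<^sub>R f r \<partial>UI)"
      by (rule U(3)) (use cell_in_unit[OF i s] s i in \<open>auto simp: divide_right_mono\<close>)
    also have "\<dots> = (1 / real N) *\<^sub>R (\<integral>x. indicator {0<..s} x *\<^sub>R f ((x + real i) / real N) \<partial>UI)"
      by (rule UI_affine[OF i s])
    also have "(\<integral>x. indicator {0<..s} x *\<^sub>R f ((x + real i) / real N) \<partial>UI)
        = (\<integral>x. (of_nat N * \<zeta> ^ i) *s (indicator {0<..s} x *\<^sub>R hder V x) \<partial>UI)"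
      by (rule Bochner_Integration.integral_cong[OF refl])
         (use s fval[OF i] in \<open>auto simp: vec_scale_scaleR split: split_indicator\<close>)
    also have "\<dots> = (of_nat N * \<zeta> ^ i) *s (\<integral>x. indicator {0<..s} x *\<^sub>R hder V x \<partial>UI)"
      by (rule vec_scale_integral) (intro integrable_indicator_L2 DV, simp)
    also have "(\<integral>x. indicator {0<..s} x *\<^sub>R hder V x \<partial>UI) = V s - V 0"
      using integral_hder_Ioc[OF VH, of 0 s] s by simp
    finally show ?thesis using N by (simp add: vec_eq_iff scaleR_conv_of_real[where 'a=complex] diff_divide_distrib)
  qed
  \<comment> \<open>Induction along the nodes:
    \<open>\<zeta>^i V 0 + \<zeta>^i (V 1 - V 0) = \<zeta>^i V 1\<close>, which is
    \<open>\<zeta>^(i+1) V 0\<close> by quasi-periodicity.\<close>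
  have node: "U (real i / real N) = \<zeta> ^ i *s V 0" if "i < N" for i
    using that
  proof (induction i)
    case 0
    then show ?case using U(2) by (simp add: vec_eq_iff)
  next
    case (Suc i)
    have "U ((1 + real i) / real N) - U (real i / real N) = \<zeta> ^ i *s (V 1 - V 0)" using inc[of i 1] Suc.prems by simp
    then have "U (real (Suc i) / real N) = \<zeta> ^ i *s V 0 + \<zeta> ^ i *s (V 1 - V 0)"
      using Suc by (simp add: algebra_simps)
    then show ?case unfolding V1 by (simp add: vec_eq_iff algebra_simps)
  qed
  have "piece N j U = cscale (\<zeta> ^ j) V" if j: "j < N" for j
  proof
    fix s
    show "piece N j U s = cscale (\<zeta> ^ j) V s"
    proof (cases "s \<in> {0..1}")
      case True
      have "U ((s + real j) / real N) = \<zeta> ^ j *s V 0 + \<zeta> ^ j *s (V s - V 0)"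
        using inc[OF j True] node[OF j] by (simp add: algebra_simps)
      then show ?thesis using True by (simp add: piece_def cscale_def vec_eq_iff algebra_simps)
    next
      case False
      then show ?thesis using H1_outside[OF VH False] by (auto simp: piece_def cscale_def vec_eq_iff)
    qed
  qed
  then show ?thesis using U(1) by blast
qed

subsection \<open>The decomposition over the roots of unity\<close>

text \<open>The summand is the j-th power of \<open>z = \<omega>^k cnj (\<omega>^l)\<close>, an N-th
  root of unity different from 1 unless \<open>k = l\<close>; the geometric sum then
  vanishes.\<close>

lemma root_unity_orthogonality:
  assumes N: "0 < N" and k: "k < N" and l: "l < N"
  shows "(\<Sum>j<N. (cis (2 * pi / real N) ^ k) ^ j * cnj ((cis (2 * pi / real N) ^ l) ^ j)) = (if k = l then of_nat N else 0)"
proof -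
  define \<omega> where "\<omega> = cis (2 * pi / real N)"
  have pow: "\<omega> ^ i = cis (2 * pi * real i / real N)" for i unfolding \<omega>_def Complex.DeMoivre by (rule arg_cong[where f = cis]) simp
  define z where "z = \<omega> ^ k * cnj (\<omega> ^ l)"
  have \<omega>1: "\<omega> ^ i * cnj (\<omega> ^ i) = 1" for i
    by (simp add: pow cis_cnj cis_mult)
  have eq: "(\<omega> ^ k) ^ j * cnj ((\<omega> ^ l) ^ j) = z ^ j" for j by (simp add: z_def power_mult_distrib)
  show ?thesis
  proof (cases "k = l")
    case True
    then have "z = 1" using \<omega>1 by (simp add: z_def)
    then show ?thesis using True unfolding \<omega>_def[symmetric] eq by simp
  next
    case False
    have zN: "z ^ N = 1"
    proof -
      have "\<omega> ^ N = 1" using N by (simp add: pow cis_2pi)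
      moreover have "(\<omega> ^ i) ^ N = (\<omega> ^ N) ^ i" for i by (simp only: power_mult[symmetric] mult.commute)
      ultimately show ?thesis unfolding eq[symmetric] by (simp only: power_one complex_cnj_one mult_1)
    qed
    have "z \<noteq> 1"
    proof
      assume "z = 1"
      have "\<omega> ^ k = \<omega> ^ k * (\<omega> ^ l * cnj (\<omega> ^ l))" using \<omega>1[of l] by simp
      also have "\<dots> = z * \<omega> ^ l" by (simp add: z_def)
      finally have "\<omega> ^ k = \<omega> ^ l" using \<open>z = 1\<close> by simp
      moreover have "inj_on (\<lambda>k. cis (2 * pi * real k / real N)) {..<N}"
        using Complex.bij_betw_roots_unity[OF N] by (simp add: bij_betw_def)
      ultimately show False using False k l unfolding pow by (auto dest: inj_onD)
    qed
    then have "(\<Sum>j<N. z ^ j) = 0" using zN by (simp add: geometric_sum)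
    then show ?thesis using False unfolding \<omega>_def[symmetric] eq by simp
  qed
qed

lemma cfun_sum_apply: "finite A \<Longrightarrow> (\<Sum>a\<in>A. f a :: 'n::finite cfun) s = (\<Sum>a\<in>A. f a s)"
  by (induction A rule: finite_induct) auto

lemma vec_scale_sum_divide: "(\<Sum>k\<in>A. (a k / c) *s p) = ((\<Sum>k\<in>A. a k) / c) *s (p :: complex ^ 'n)"
  unfolding sum_divide_distrib vec.scale_sum_left ..

locale iterated = index_form \<epsilon> \<Gamma> R for \<epsilon> :: "'n::finite \<Rightarrow> real" and \<Gamma> R +
  fixes N :: nat
  assumes N: "0 < N" and per\<Gamma>: "\<And>t. \<Gamma> (t + 1) = \<Gamma> t" and perR: "\<And>t. R (t + 1) = R t"
begin

definition \<zeta> :: "nat \<Rightarrow> complex" where "\<zeta> k = cis (2 * pi / real N) ^ k"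

text \<open>The k-th discrete Fourier coefficient of the sequence of sheets.\<close>

definition \<Psi> :: "nat \<Rightarrow> 'n cfun \<Rightarrow> 'n cfun" where
  "\<Psi> k U = (\<Sum>j<N. cscale (cnj (\<zeta> k ^ j) / of_nat N) (piece N j U))"

text \<open>The inverse construction: the k-th Fourier mode, spread over all sheets. The choice is
  unique, since a function in H1 is determined by its pieces, and this is how linearity is
  obtained.\<close>

definition \<Phi> :: "nat \<Rightarrow> 'n cfun \<Rightarrow> 'n cfun" where
  "\<Phi> k V = (SOME U. U \<in> H1 \<and> (\<forall>j<N. piece N j U = cscale (\<zeta> k ^ j) V))"

lemma orth: "k < N \<Longrightarrow> l < N \<Longrightarrow> (\<Sum>j<N. \<zeta> k ^ j * cnj (\<zeta> l ^ j)) = (if k = l then of_nat N else 0)"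
  unfolding \<zeta>_def by (rule root_unity_orthogonality[OF N])

text \<open>Symmetry of the character table, so that one orthogonality relation serves for sums over
  sheets and for sums over modes.\<close>

lemma \<zeta>_swap: "\<zeta> k ^ j = \<zeta> j ^ k"
  by (simp add: \<zeta>_def power_mult[symmetric] mult.commute)

lemma \<zeta>_unit: "\<zeta> k * cnj (\<zeta> k) = 1"
  by (simp add: \<zeta>_def Complex.DeMoivre cis_cnj cis_mult)

lemma \<zeta>_N: "\<zeta> k ^ N = 1"
proof -
  have "cis (2 * pi / real N) ^ N = 1" using N by (simp add: Complex.DeMoivre cis_2pi)
  moreover have "\<zeta> k ^ N = (cis (2 * pi / real N) ^ N) ^ k" by (simp only: \<zeta>_def power_mult[symmetric] mult.commute)
  ultimately show ?thesis by simp
qed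

lemma \<Phi>:
  assumes V: "V \<in> Hz (\<zeta> k)"
  shows "\<Phi> k V \<in> H1" "j < N \<Longrightarrow> piece N j (\<Phi> k V) = cscale (\<zeta> k ^ j) V"
proof -
  have "\<exists>U. U \<in> H1 \<and> (\<forall>j<N. piece N j U = cscale (\<zeta> k ^ j) V)" using glue_exists[OF N V] by blast
  from someI_ex[OF this] show "\<Phi> k V \<in> H1" "j < N \<Longrightarrow> piece N j (\<Phi> k V) = cscale (\<zeta> k ^ j) V"
    unfolding \<Phi>_def by blast+
qed

text \<open>The end of the last sheet carries \<open>\<zeta>^(N-1) V 1 = \<zeta>^N V 0\<close>, and
  \<open>\<zeta>^N = 1\<close> closes the loop.\<close>

lemma \<Phi>_Hz: assumes V: "V \<in> Hz (\<zeta> k)" shows "\<Phi> k V \<in> Hz 1"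
proof -
  have V1: "V 1 = \<zeta> k *s V 0" using V by (simp add: Hz_def)
  have Nm: "N - 1 < N" "real (N - 1) = real N - 1" using N by auto
  have "\<Phi> k V 1 = piece N (N - 1) (\<Phi> k V) 1" using N Nm(2) by (simp add: piece_def)
  also have "\<dots> = \<zeta> k ^ (N - 1) *s V 1" unfolding \<Phi>(2)[OF V Nm(1)] by (simp add: cscale_def)
  also have "\<dots> = (\<zeta> k ^ (N - 1) * \<zeta> k) *s V 0" unfolding V1 by (simp add: vec_eq_iff mult.assoc)
  also have "\<zeta> k ^ (N - 1) * \<zeta> k = 1" using \<zeta>_N[of k] N by (metis Suc_diff_1 power_Suc2)
  also have "1 *s V 0 = piece N 0 (\<Phi> k V) 0" unfolding \<Phi>(2)[OF V N] by (simp add: cscale_def)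
  also have "\<dots> = \<Phi> k V 0" by (simp add: piece_def)
  finally show ?thesis using \<Phi>(1)[OF V] by (simp add: Hz_def vec_eq_iff)
qed

lemma \<Psi>_H1: "U \<in> H1 \<Longrightarrow> \<Psi> k U \<in> H1"
  unfolding \<Psi>_def by (intro cfun.subspace_sum[OF H1_subspace] cfun.subspace_scale[OF H1_subspace] piece_H1(1)) auto

lemma \<Psi>_apply: "\<Psi> k U s = (\<Sum>j<N. (cnj (\<zeta> k ^ j) / of_nat N) *s piece N j U s)"
  unfolding \<Psi>_def by (simp add: cfun_sum_apply cscale_def)

text \<open>The endpoint of a sheet is the start of the next one, so \<open>\<Psi> k U 1\<close> is
  the sum for \<open>\<Psi> k U 0\<close> with index shifted by one, times \<open>\<zeta> k\<close>.
  The wrap-around term agrees by periodicity of \<open>U\<close> and of the powers of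
  \<open>\<zeta> k\<close>.\<close>

lemma \<Psi>_Hz: assumes U: "U \<in> Hz 1" shows "\<Psi> k U \<in> Hz (\<zeta> k)"
proof -
  have UH: "U \<in> H1" and U1: "U 1 = U 0" using U by (auto simp: Hz_def vec_eq_iff)
  define f where "f j = (cnj (\<zeta> k ^ j) / of_nat N) *s U (real j / real N)" for j
  have "\<zeta> k * cnj (\<zeta> k ^ Suc j) = cnj (\<zeta> k ^ j)" for j
    using \<zeta>_unit[of k] by (simp add: mult.assoc[symmetric])
  then have "\<Psi> k U 1 = (\<Sum>j<N. \<zeta> k *s f (Suc j))"
    unfolding \<Psi>_apply f_def
    by (intro sum.cong refl) (simp add: piece_def vec_eq_iff mult.assoc[symmetric] add.commute)
  also have "\<dots> = \<zeta> k *s (\<Sum>j<N. f (Suc j))" by (simp add: vec_eq_iff sum_distrib_left)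
  also have "(\<Sum>j<N. f (Suc j)) = (\<Sum>j<N. f j)"
  proof -
    have "f N = f 0" using \<zeta>_N[of k] N U1 by (simp add: f_def flip: complex_cnj_power)
    then show ?thesis using sum.lessThan_Suc_shift[of f N] sum.lessThan_Suc[of f N] by (simp add: add.commute)
  qed
  also have "(\<Sum>j<N. f j) = \<Psi> k U 0" unfolding \<Psi>_apply f_def by (simp add: piece_def)
  finally show ?thesis using \<Psi>_H1[OF UH] by (simp add: Hz_def)
qed

text \<open>Fourier inversion on the sheets: interchange the two sums and apply orthogonality over
  the modes.\<close>

lemma piece_expand:
  assumes i: "i < N" shows "piece N i U = (\<Sum>k<N. cscale (\<zeta> k ^ i) (\<Psi> k U))"
proof
  fix s
  have "(\<Sum>k<N. cscale (\<zeta> k ^ i) (\<Psi> k U)) s = (\<Sum>k<N. \<Sum>j<N. (\<zeta> k ^ i * cnj (\<zeta> k ^ j) / of_nat N) *s piece N j U s)"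
    by (simp add: cfun_sum_apply cscale_def \<Psi>_apply vec_eq_iff sum_distrib_left mult.assoc)
  also have "\<dots> = (\<Sum>j<N. \<Sum>k<N. (\<zeta> k ^ i * cnj (\<zeta> k ^ j) / of_nat N) *s piece N j U s)" by (rule sum.swap)
  also have "\<dots> = (\<Sum>j<N. ((\<Sum>k<N. \<zeta> i ^ k * cnj (\<zeta> j ^ k)) / of_nat N) *s piece N j U s)"
  proof (rule sum.cong[OF refl])
    fix j
    show "(\<Sum>k<N. (\<zeta> k ^ i * cnj (\<zeta> k ^ j) / of_nat N) *s piece N j U s)
        = ((\<Sum>k<N. \<zeta> i ^ k * cnj (\<zeta> j ^ k)) / of_nat N) *s piece N j U s"
      unfolding vec_scale_sum_divide \<zeta>_swap[of i] \<zeta>_swap[of j] ..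
  qed
  also have "\<dots> = (\<Sum>j<N. if j = i then piece N i U s else 0)"
    using i N by (intro sum.cong refl) (auto simp: orth vec_eq_iff simp del: complex_cnj_power)
  also have "\<dots> = piece N i U s" using i by simp
  finally show "piece N i U s = (\<Sum>k<N. cscale (\<zeta> k ^ i) (\<Psi> k U)) s" by simp
qed

lemma \<Psi>\<Phi>:
  assumes l: "l < N" and k: "k < N" and V: "V \<in> Hz (\<zeta> k)"
  shows "\<Psi> l (\<Phi> k V) = (if l = k then V else 0)"
proof
  fix s
  have "\<Psi> l (\<Phi> k V) s = (\<Sum>j<N. (cnj (\<zeta> l ^ j) / of_nat N) *s (\<zeta> k ^ j *s V s))"
    unfolding \<Psi>_apply using \<Phi>(2)[OF V] by (intro sum.cong refl) (simp add: cscale_def)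
  also have "\<dots> = ((\<Sum>j<N. \<zeta> k ^ j * cnj (\<zeta> l ^ j)) / of_nat N) *s V s"
    unfolding vec_scale_sum_divide[symmetric] by (intro sum.cong refl) (simp add: vec_eq_iff)
  also have "\<dots> = (if l = k then V else 0) s" unfolding orth[OF k l] using N by (auto simp: vec_eq_iff)
  finally show "\<Psi> l (\<Phi> k V) s = (if l = k then V else 0) s" .
qed

lemma \<Phi>\<Psi>: assumes U: "U \<in> Hz 1" shows "U = (\<Sum>k<N. \<Phi> k (\<Psi> k U))"
proof (rule pieces_eqI[OF N])
  show "U \<in> H1" using U Hz_subset by blast
  show "(\<Sum>k<N. \<Phi> k (\<Psi> k U)) \<in> H1" by (intro cfun.subspace_sum[OF H1_subspace] \<Phi>(1) \<Psi>_Hz U)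
  fix j assume j: "j < N"
  have "piece N j (\<Sum>k<N. \<Phi> k (\<Psi> k U)) = (\<Sum>k<N. piece N j (\<Phi> k (\<Psi> k U)))" by (rule piece_sum) simp
  also have "\<dots> = (\<Sum>k<N. cscale (\<zeta> k ^ j) (\<Psi> k U))" using \<Phi>(2)[OF \<Psi>_Hz[OF U] j] by simp
  also have "\<dots> = piece N j U" by (rule piece_expand[OF j, symmetric])
  finally show "piece N j U = piece N j (\<Sum>k<N. \<Phi> k (\<Psi> k U))" by simp
qed

lemma \<Psi>_lin: "cfun.lin_on X (\<Psi> k)"
  unfolding cfun.lin_on_def
proof (intro conjI ballI allI)
  fix x y :: "'n cfun" and c
  show "\<Psi> k (x + y) = \<Psi> k x + \<Psi> k y"
    by (simp add: \<Psi>_def piece_add cfun.scale_right_distrib sum.distrib)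
  show "\<Psi> k (cscale c x) = cscale c (\<Psi> k x)"
    by (simp add: \<Psi>_def piece_scale cfun.scale_sum_right mult.commute)
qed

lemma \<Phi>_lin: "cfun.lin_on (Hz (\<zeta> k)) (\<Phi> k)"
  unfolding cfun.lin_on_def
proof (intro conjI ballI allI)
  fix x y :: "'n cfun" and c assume x: "x \<in> Hz (\<zeta> k)"
  have cx: "cscale c x \<in> Hz (\<zeta> k)" using Hz_subspace cfun.subspace_scale x by blast
  show "\<Phi> k (cscale c x) = cscale c (\<Phi> k x)"
  proof (rule pieces_eqI[OF N \<Phi>(1)[OF cx] H1_scale(1)[OF \<Phi>(1)[OF x]]])
    show "piece N j (\<Phi> k (cscale c x)) = piece N j (cscale c (\<Phi> k x))" if "j < N" for j
      unfolding piece_scale \<Phi>(2)[OF cx that] \<Phi>(2)[OF x that] by (rule cfun.scale_left_commute)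
  qed
  assume y: "y \<in> Hz (\<zeta> k)"
  have xy: "x + y \<in> Hz (\<zeta> k)" using Hz_subspace cfun.subspace_add x y by blast
  show "\<Phi> k (x + y) = \<Phi> k x + \<Phi> k y"
  proof (rule pieces_eqI[OF N \<Phi>(1)[OF xy] H1_add(1)[OF \<Phi>(1)[OF x] \<Phi>(1)[OF y]]])
    show "piece N j (\<Phi> k (x + y)) = piece N j (\<Phi> k x + \<Phi> k y)" if "j < N" for j
      unfolding piece_add \<Phi>(2)[OF xy that] \<Phi>(2)[OF x that] \<Phi>(2)[OF y that] by (rule cfun.scale_right_distrib)
  qed
qed

text \<open>The point \<open>j / (N m)\<close> with \<open>j = i m + q\<close> is the q-th grid
  point of the i-th sheet, so a function vanishing on the coarse grid is spread to one vanishing on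
  the fine grid. Scalars commute with G, which preserves the eigenspace condition.\<close>

lemma \<Phi>_Wsp:
  assumes m: "0 < m" and V: "V \<in> Wsp \<epsilon> m \<sigma>" shows "\<Phi> k V \<in> Wsp \<epsilon> (N * m) \<sigma>"
proof -
  have Vz: "V \<in> Hz (\<zeta> k)" using V Wsp_subset_Hz[OF m] by blast
  have V0: "\<And>q. q \<le> m \<Longrightarrow> V (real q / real m) = 0" and VG: "\<And>r. Gm \<epsilon> (V r) = of_real \<sigma> *s V r"
    using V by (auto simp: Wsp_def gridW_def)
  have val: "\<Phi> k V ((s + real i) / real N) = \<zeta> k ^ i *s V s" if "i < N" "s \<in> {0..1}" for i s
    using fun_cong[OF \<Phi>(2)[OF Vz that(1)], of s] that(2) by (simp add: piece_def cscale_def)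
  have "\<Phi> k V (real j / real (N * m)) = 0" if j: "j \<le> N * m" for j
  proof -
    obtain i q where iq: "i < N" "q \<le> m" "j = i * m + q"
    proof (cases "j = N * m")
      \<comment> \<open>The right end has quotient \<open>N\<close>, outside the range of sheets; it
        is treated as the last grid point of the last sheet.\<close>
      case True
      then show thesis using that[of "N - 1" m] N by (simp add: diff_mult_distrib)
    next
      case False
      then have "j < N * m" using j by simp
      then have "j div m < N" by (simp add: less_mult_imp_div_less)
      then show thesis using that[of "j div m" "j mod m"] m by (simp add: less_imp_le)
    qed
    have "real j / real (N * m) = (real q / real m + real i) / real N"
      using m N by (simp add: iq(3) field_simps)
    then show ?thesis using val[OF iq(1), of "real q / real m"] V0[OF iq(2)] iq(2) m by (simp add: vec_eq_iff)
  qed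
  moreover have "Gm \<epsilon> (\<Phi> k V r) = of_real \<sigma> *s \<Phi> k V r" for r
  proof (cases "r \<in> {0..1}")
    case True
    then obtain i s where ri: "i < N" "s \<in> {0..1}" "r = (s + real i) / real N" by (rule unit_cover[OF N])
    show ?thesis unfolding ri(3) val[OF ri(1,2)] Gm_scale VG by (simp add: vec_eq_iff)
  next
    case False
    then show ?thesis using H1_outside[OF \<Phi>(1)[OF Vz] False] by (simp add: Gm_def vec_eq_iff)
  qed
  ultimately show ?thesis using \<Phi>(1)[OF Vz] by (simp add: Wsp_def gridW_def)
qed

lemma \<Psi>_Wsp:
  assumes m: "0 < m" and U: "U \<in> Wsp \<epsilon> (N * m) \<sigma>" shows "\<Psi> k U \<in> Wsp \<epsilon> m \<sigma>"
proof -
  have UH: "U \<in> H1" and U0: "\<And>q. q \<le> N * m \<Longrightarrow> U (real q / real (N * m)) = 0" and UG: "\<And>r. Gm \<epsilon> (U r) = of_real \<sigma> *s U r"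
    using U by (auto simp: Wsp_def gridW_def)
  have "piece N j U \<in> Wsp \<epsilon> m \<sigma>" if j: "j < N" for j
  proof -
    have "piece N j U (real q / real m) = 0" if q: "q \<le> m" for q
    proof -
      have eq: "(real q / real m + real j) / real N = real (j * m + q) / real (N * m)" using m N by (simp add: field_simps)
      have "Suc j * m \<le> N * m" using j by (intro mult_le_mono1) simp
      then have "j * m + q \<le> N * m" using q by simp
      then show ?thesis using U0 by (simp only: piece_def eq) simp
    qed
    moreover have "Gm \<epsilon> (piece N j U r) = of_real \<sigma> *s piece N j U r" for r
      using UG by (simp add: piece_def vec_eq_iff[of 0])
    ultimately show ?thesis using piece_H1(1)[OF j UH] by (simp add: Wsp_def gridW_def)
  qed
  then show ?thesis unfolding \<Psi>_def
    by (intro cfun.subspace_sum[OF Wsp_subspace] cfun.subspace_scale[OF Wsp_subspace]) auto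
qed

lemma periodic_nat: "\<Gamma> (s + real j) = \<Gamma> s" "R (s + real j) = R s"
proof (induction j)
  case (Suc j)
  have eq: "s + real (Suc j) = (s + real j) + 1" by simp
  show "\<Gamma> (s + real (Suc j)) = \<Gamma> s" "R (s + real (Suc j)) = R s" unfolding eq per\<Gamma> perR by (fact Suc)+
qed simp_all

text \<open>For noninteger \<open>t\<close> the coefficients \<open>s \<mapsto> \<Gamma> (t * s)\<close> are not 1-periodic: the forms split along the
  N-fold cover only at the endpoints of the path.\<close>
lemma B_pieces:
  assumes \<tau>: "\<tau> = 0 \<or> \<tau> = 1" and U: "U \<in> H1"
  shows "B (real N * \<tau>) U U = of_nat N * (\<Sum>j<N. B \<tau> (piece N j U) (piece N j U))"
proof -
  have Nr: "real N \<noteq> 0" using N by simp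
  note A = cAt1[of "real N * \<tau>"] and E = cEt1[of "real N * \<tau>"]
  \<comment> \<open>For \<open>\<tau> = 0\<close> both sides vanish; for \<open>\<tau> = 1\<close>
    the argument becomes \<open>s + j\<close> and periodicity removes \<open>j\<close>. The factor
    \<open>N\<close> is the path parameter, matching the one produced by the derivative.\<close>
  have At: "At (real N * \<tau>) ((s + real j) / real N) = real N *\<^sub>R At \<tau> s" for s j
    using \<tau> Nr by (auto simp: At_def periodic_nat)
  have Et: "Et (real N * \<tau>) ((s + real j) / real N) = (real N)\<^sup>2 *\<^sub>R Et \<tau> s" for s j
    using \<tau> Nr by (auto simp: Et_def periodic_nat)
  have G: "GA \<epsilon> f \<in> L2" if "f \<in> L2" for f unfolding GA_def using L2_Gm[OF eps that] by auto
  have DAp: "AE s in UI. DA (At (real N * \<tau>)) U ((s + real j) / real N) = real N *\<^sub>R DA (At \<tau>) (piece N j U) s" if j: "j < N" for j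
    using piece_H1(2)[OF j U] AE_UI_unit
  proof eventually_elim
    case (elim s)
    have "hder U ((s + real j) / real N) = real N *\<^sub>R hder (piece N j U) s" using elim Nr by simp
    moreover have "piece N j U s = U ((s + real j) / real N)" using elim by (simp add: piece_def)
    ultimately show ?case
      by (simp add: DA_def At cmv_scaleR scaleR_add_right) (simp add: vec_eq_iff scaleR_conv_of_real[where 'a=complex])
  qed
  have EAp: "AE s in UI. EA (Et (real N * \<tau>)) U ((s + real j) / real N) = (real N)\<^sup>2 *\<^sub>R EA (Et \<tau>) (piece N j U) s
      \<and> U ((s + real j) / real N) = piece N j U s" if j: "j < N" for j
    using AE_UI_unit
  proof eventually_elim
    case (elim s)
    have "piece N j U s = U ((s + real j) / real N)" using elim by (simp add: piece_def)
    then show ?case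
      by (simp add: EA_def Et cmv_scaleR) (simp add: vec_eq_iff scaleR_conv_of_real[where 'a=complex])
  qed
  define g1 where "g1 r = cdot (GA \<epsilon> (DA (At (real N * \<tau>)) U) r) (DA (At (real N * \<tau>)) U r)" for r
  define g2 where "g2 r = cdot (GA \<epsilon> (EA (Et (real N * \<tau>)) U) r) (U r)" for r
  have i1: "integrable UI g1" unfolding g1_def by (intro L2_cdot_integrable G DA_L2 A U)
  have i2: "integrable UI g2" unfolding g2_def by (intro L2_cdot_integrable G EA_L2' E U H1_L2)
  have p: "piece N j U \<in> H1" if "j < N" for j using piece_H1(1)[OF that U] .
  have s1: "(\<integral>s. g1 ((s + real j) / real N) \<partial>UI)
      = of_real ((real N)\<^sup>2) * ipL2 (GA \<epsilon> (DA (At \<tau>) (piece N j U))) (DA (At \<tau>) (piece N j U))" if j: "j < N" for j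
  proof -
    have i: "integrable UI (\<lambda>s. cdot (GA \<epsilon> (DA (At \<tau>) (piece N j U)) s) (DA (At \<tau>) (piece N j U) s))"
      by (intro L2_cdot_integrable G DA_L2 cAt1 p j)
    have "(\<integral>s. g1 ((s + real j) / real N) \<partial>UI)
        = (\<integral>s. of_real ((real N)\<^sup>2) * cdot (GA \<epsilon> (DA (At \<tau>) (piece N j U)) s) (DA (At \<tau>) (piece N j U) s) \<partial>UI)"
    proof (rule integral_cong_AE)
      show "(\<lambda>s. g1 ((s + real j) / real N)) \<in> borel_measurable UI" using UI_affine_integrable[OF j i1] by simp
      show "(\<lambda>s. of_real ((real N)\<^sup>2) * cdot (GA \<epsilon> (DA (At \<tau>) (piece N j U)) s) (DA (At \<tau>) (piece N j U) s)) \<in> borel_measurable UI"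
        using i by (intro borel_measurable_integrable integrable_mult_right)
      show "AE s in UI. g1 ((s + real j) / real N) = of_real ((real N)\<^sup>2) * cdot (GA \<epsilon> (DA (At \<tau>) (piece N j U)) s) (DA (At \<tau>) (piece N j U) s)"
        using DAp[OF j]
        by eventually_elim (simp add: g1_def GA_def Gm_scaleR cdot_scaleR_left cdot_scaleR_right power2_eq_square)
    qed
    then show ?thesis by (simp add: ipL2_def)
  qed
  have s2: "(\<integral>s. g2 ((s + real j) / real N) \<partial>UI)
      = of_real ((real N)\<^sup>2) * ipL2 (GA \<epsilon> (EA (Et \<tau>) (piece N j U))) (piece N j U)" if j: "j < N" for j
  proof -
    have i: "integrable UI (\<lambda>s. cdot (GA \<epsilon> (EA (Et \<tau>) (piece N j U)) s) (piece N j U s))"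
      by (intro L2_cdot_integrable G EA_L2' cEt1 p j H1_L2)
    have "(\<integral>s. g2 ((s + real j) / real N) \<partial>UI)
        = (\<integral>s. of_real ((real N)\<^sup>2) * cdot (GA \<epsilon> (EA (Et \<tau>) (piece N j U)) s) (piece N j U s) \<partial>UI)"
    proof (rule integral_cong_AE)
      show "(\<lambda>s. g2 ((s + real j) / real N)) \<in> borel_measurable UI" using UI_affine_integrable[OF j i2] by simp
      show "(\<lambda>s. of_real ((real N)\<^sup>2) * cdot (GA \<epsilon> (EA (Et \<tau>) (piece N j U)) s) (piece N j U s)) \<in> borel_measurable UI"
        using i by (intro borel_measurable_integrable integrable_mult_right)
      show "AE s in UI. g2 ((s + real j) / real N) = of_real ((real N)\<^sup>2) * cdot (GA \<epsilon> (EA (Et \<tau>) (piece N j U)) s) (piece N j U s)"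
        using EAp[OF j] by eventually_elim (simp add: g2_def GA_def Gm_scaleR cdot_scaleR_left)
    qed
    then show ?thesis by (simp add: ipL2_def)
  qed
  have "B (real N * \<tau>) U U = (\<integral>r. g1 r \<partial>UI) + (\<integral>r. g2 r \<partial>UI)"
    unfolding B_eq[OF U U] Bgen_def ipL2_def g1_def g2_def ..
  \<comment> \<open>Each sheet contributes \<open>N^2\<close> from derivatives and coefficients, and
    the substitution contributes 1/N, so a factor \<open>N\<close> remains.\<close>
  also have "\<dots> = (1 / real N) *\<^sub>R (\<Sum>j<N. (\<integral>s. g1 ((s + real j) / real N) \<partial>UI) + (\<integral>s. g2 ((s + real j) / real N) \<partial>UI))"
    unfolding UI_cells[OF N i1] UI_cells[OF N i2] by (simp add: sum.distrib scaleR_add_right)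
  also have "\<dots> = (1 / real N) *\<^sub>R (\<Sum>j<N. of_real ((real N)\<^sup>2) * B \<tau> (piece N j U) (piece N j U))"
    by (intro arg_cong[where f = "\<lambda>x. (1 / real N) *\<^sub>R x"] sum.cong refl)
       (simp add: s1 s2 B_eq p Bgen_def distrib_left)
  also have "\<dots> = of_nat N * (\<Sum>j<N. B \<tau> (piece N j U) (piece N j U))"
    using Nr by (simp add: sum_distrib_left[symmetric] scaleR_conv_of_real power2_eq_square)
  finally show ?thesis .
qed

text \<open>Insert the Fourier expansion of the sheets: summing over the sheets removes all mixed
  terms between different modes. One factor \<open>N\<close> comes from the cutting, the other from
  orthogonality.\<close>

lemma B_decompose:
  assumes \<tau>: "\<tau> = 0 \<or> \<tau> = 1" and U: "U \<in> H1"
  shows "B (real N * \<tau>) U U = (of_nat N)\<^sup>2 * (\<Sum>k<N. B \<tau> (\<Psi> k U) (\<Psi> k U))"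
proof -
  note h = B_herm[of \<tau>] and s = H1_subspace
  have c: "cscale a (\<Psi> k U) \<in> H1" for a k by (intro H1_scale(1) \<Psi>_H1 U)
  have sm: "(\<Sum>k<N. cscale (a k) (\<Psi> k U)) \<in> H1" for a by (intro cfun.subspace_sum[OF s] c)
  have "B \<tau> (piece N j U) (piece N j U) = (\<Sum>k<N. \<Sum>l<N. (\<zeta> k ^ j * cnj (\<zeta> l ^ j)) * B \<tau> (\<Psi> k U) (\<Psi> l U))" if j: "j < N" for j
  proof -
    have "B \<tau> (piece N j U) (piece N j U) = (\<Sum>k<N. B \<tau> (cscale (\<zeta> k ^ j) (\<Psi> k U)) (\<Sum>l<N. cscale (\<zeta> l ^ j) (\<Psi> l U)))"
      unfolding piece_expand[OF j] by (rule cfun.herm_sum_left[OF s h]) (use c sm in auto)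
    also have "\<dots> = (\<Sum>k<N. \<Sum>l<N. B \<tau> (cscale (\<zeta> k ^ j) (\<Psi> k U)) (cscale (\<zeta> l ^ j) (\<Psi> l U)))"
      by (intro sum.cong refl cfun.herm_sum_right[OF s h]) (use c in auto)
    also have "\<dots> = (\<Sum>k<N. \<Sum>l<N. (\<zeta> k ^ j * cnj (\<zeta> l ^ j)) * B \<tau> (\<Psi> k U) (\<Psi> l U))"
      using \<Psi>_H1[OF U] c by (intro sum.cong refl) (simp add: cfun.herm_scale_left[OF s h] cfun.herm_scale_right[OF s h])
    finally show ?thesis .
  qed
  then have "(\<Sum>j<N. B \<tau> (piece N j U) (piece N j U))
      = (\<Sum>j<N. \<Sum>k<N. \<Sum>l<N. (\<zeta> k ^ j * cnj (\<zeta> l ^ j)) * B \<tau> (\<Psi> k U) (\<Psi> l U))" by simp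
  also have "\<dots> = (\<Sum>k<N. \<Sum>j<N. \<Sum>l<N. (\<zeta> k ^ j * cnj (\<zeta> l ^ j)) * B \<tau> (\<Psi> k U) (\<Psi> l U))" by (rule sum.swap)
  also have "\<dots> = (\<Sum>k<N. \<Sum>l<N. \<Sum>j<N. (\<zeta> k ^ j * cnj (\<zeta> l ^ j)) * B \<tau> (\<Psi> k U) (\<Psi> l U))"
    by (intro sum.cong refl sum.swap)
  also have "\<dots> = (\<Sum>k<N. \<Sum>l<N. (if l = k then of_nat N * B \<tau> (\<Psi> k U) (\<Psi> k U) else 0))"
  proof (intro sum.cong refl)
    fix k l assume "k \<in> {..<N}" "l \<in> {..<N}"
    then have kl: "k < N" "l < N" by auto
    show "(\<Sum>j<N. (\<zeta> k ^ j * cnj (\<zeta> l ^ j)) * B \<tau> (\<Psi> k U) (\<Psi> l U))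
        = (if l = k then of_nat N * B \<tau> (\<Psi> k U) (\<Psi> k U) else 0)"
      unfolding sum_distrib_right[symmetric] orth[OF kl] by simp
  qed
  also have "\<dots> = of_nat N * (\<Sum>k<N. B \<tau> (\<Psi> k U) (\<Psi> k U))"
    by (simp add: sum_distrib_left)
  finally show ?thesis unfolding B_pieces[OF \<tau> U] by (simp add: power2_eq_square mult.assoc)
qed

text \<open>The modes are a direct sum decomposition compatible with the grid spaces, and the form
  of the cover is \<open>N^2\<close> times the sum of the forms of the modes. A positive factor does
  not affect signs, so the splittings of the modes assemble to one of the cover.\<close>

lemma ix_additive:
  assumes \<tau>: "\<tau> = 0 \<or> \<tau> = 1" and m: "0 < m"
    and split: "\<And>k. k < N \<Longrightarrow> \<exists>S T. cfun.pos_split (Hz (\<zeta> k)) (Wsp \<epsilon> m 1) (Wsp \<epsilon> m (-1)) (B \<tau>) S T"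
  shows "ixm (N * m) 1 (B (real N * \<tau>)) = (\<Sum>k<N. ixm m (\<zeta> k) (B \<tau>))"
proof -
  obtain S T where ST: "\<And>k. k < N \<Longrightarrow> cfun.pos_split (Hz (\<zeta> k)) (Wsp \<epsilon> m 1) (Wsp \<epsilon> m (-1)) (B \<tau>) (S k) (T k)"
    using split by metis
  have Nm: "0 < N * m" using N m by simp
  have re: "Re (B (real N * \<tau>) x x) = (real N)\<^sup>2 * (\<Sum>k<N. Re (B \<tau> (\<Psi> k x) (\<Psi> k x)))" if "x \<in> Hz 1" for x
  proof -
    have "x \<in> H1" using that Hz_subset by blast
    from B_decompose[OF \<tau> this] show ?thesis by (simp add: power2_eq_square)
  qed
  have z: "B \<tau> 0 0 = 0" by (rule cfun.herm_zero_left[OF H1_subspace B_herm H1_zero])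
  have N2: "0 < (real N)\<^sup>2" using N by simp
  note ds = cfun.pos_split_direct_sum[where X = "Hz 1" and H = "\<lambda>k. Hz (\<zeta> k)" and \<Phi> = \<Phi> and \<Psi> = \<Psi> and N = N
      and Wp = "Wsp \<epsilon> (N * m) 1" and Wm = "Wsp \<epsilon> (N * m) (-1)" and Vp = "Wsp \<epsilon> m 1" and Vm = "Wsp \<epsilon> m (-1)"
      and B = "B (real N * \<tau>)" and b = "B \<tau>" and c = "(real N)\<^sup>2" and S = S and T = T,
      OF Hz_subspace Hz_subspace \<Phi>_lin \<Phi>_Hz \<Psi>_lin \<Psi>_Hz \<Psi>\<Phi> \<Phi>\<Psi> Wsp_subspace Wsp_subspace
        Wsp_subset_Hz[OF Nm] Wsp_subset_Hz[OF Nm] Wsp_subset_Hz[OF m] Wsp_subset_Hz[OF m]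
        \<Phi>_Wsp[OF m] \<Phi>_Wsp[OF m] \<Psi>_Wsp[OF m] \<Psi>_Wsp[OF m] z re N2 ST]
  have "ixm (N * m) 1 (B (real N * \<tau>)) = card (\<Union>k<N. \<Phi> k ` S k)"
    by (rule cfun.ix_eq[OF Wsp_subspace Wsp_subspace ds(1)])
  also have "\<dots> = (\<Sum>k<N. card (S k))" by (rule ds(2))
  also have "\<dots> = (\<Sum>k<N. ixm m (\<zeta> k) (B \<tau>))"
    using cfun.ix_eq[OF Wsp_subspace Wsp_subspace ST] by simp
  finally show ?thesis .
qed

text \<open>Additivity of the index is used at the two endpoints only; inside the path the forms of
  cover and modes are unrelated, and spectral flow does not see this because it is an index
  difference.\<close>

lemma spectral_flow_iterate:
  "spectral_flow (Hz 1) H1_inner (\<lambda>t. B (real N * t)) = (\<Sum>k<N. spectral_flow (Hz (\<zeta> k)) H1_inner B)"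
proof -
  have "0 \<le> real N" by simp
  from spectral_flow_eq_index_diff[OF this, of 1] obtain M where M: "0 < M"
    "\<And>m. M \<le> m \<Longrightarrow> spectral_flow (Hz 1) H1_inner (\<lambda>t. B (real N * t)) = int (ixm m 1 (B (real N))) - int (ixm m 1 (B 0))"
    by metis
  have "\<exists>m0. 0 < m0 \<and> (\<forall>m\<ge>m0. spectral_flow (Hz (\<zeta> k)) H1_inner B = int (ixm m (\<zeta> k) (B 1)) - int (ixm m (\<zeta> k) (B 0))
      \<and> (\<forall>t\<in>{0..1}. \<exists>S T. cfun.pos_split (Hz (\<zeta> k)) (Wsp \<epsilon> m 1) (Wsp \<epsilon> m (-1)) (B t) S T))" for k
    by (rule spectral_flow_eq_index_diff[of 1 "\<zeta> k"]) auto
  then obtain m0 where m0: "\<And>k. 0 < m0 k" "\<And>k m. m0 k \<le> m \<Longrightarrow> spectral_flow (Hz (\<zeta> k)) H1_inner B = int (ixm m (\<zeta> k) (B 1)) - int (ixm m (\<zeta> k) (B 0))"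
    "\<And>k m t. m0 k \<le> m \<Longrightarrow> t \<in> {0..1} \<Longrightarrow> \<exists>S T. cfun.pos_split (Hz (\<zeta> k)) (Wsp \<epsilon> m 1) (Wsp \<epsilon> m (-1)) (B t) S T"
    by metis
  \<comment> \<open>One grid fine enough for all modes at once; then the \<open>N * m\<close> grid
    on the cover is also fine enough, as it has at least \<open>m\<close> cells.\<close>
  define m where "m = M + (\<Sum>k<N. m0 k)"
  have mk: "m0 k \<le> m" if "k < N" for k
    using member_le_sum[of k "{..<N}" m0] that by (simp add: m_def)
  have m: "0 < m" using M by (simp add: m_def)
  have "M \<le> 1 * m" by (simp add: m_def)
  also have "\<dots> \<le> N * m" using N by (intro mult_le_mono1) simp
  finally have MN: "M \<le> N * m" .
  have a: "ixm (N * m) 1 (B (real N * \<tau>)) = (\<Sum>k<N. ixm m (\<zeta> k) (B \<tau>))" if "\<tau> = 0 \<or> \<tau> = 1" for \<tau>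
    by (rule ix_additive[OF that m]) (use m0(3)[OF mk] that in auto)
  have "spectral_flow (Hz 1) H1_inner (\<lambda>t. B (real N * t)) = (\<Sum>k<N. int (ixm m (\<zeta> k) (B 1))) - (\<Sum>k<N. int (ixm m (\<zeta> k) (B 0)))"
    unfolding M(2)[OF MN] using a[of 0] a[of 1] by simp
  also have "\<dots> = (\<Sum>k<N. spectral_flow (Hz (\<zeta> k)) H1_inner B)"
    using m0(2)[OF mk] by (simp add: sum_subtractf)
  finally show ?thesis .
qed

end

lemma smooth_mat_continuous:
  fixes f :: "real \<Rightarrow> real ^ 'n::finite ^ 'm::finite"
  assumes "smooth_mat f" shows "continuous_on UNIV f"
proof -
  have "continuous_on UNIV (\<lambda>s. f s $ i $ j)" for i j
  proof (rule differentiable_imp_continuous_on)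
    have "(deriv ^^ 0) (\<lambda>s. f s $ i $ j) differentiable at t" for t using assms unfolding smooth_mat_def by blast
    then show "(\<lambda>s. f s $ i $ j) differentiable_on UNIV" by (simp add: differentiable_on_def)
  qed
  then have "continuous_on UNIV (\<lambda>s. \<chi> i j. f s $ i $ j)" by (intro continuous_on_vec_lambda)
  then show ?thesis by simp
qed

theorem theorem5p3:
  fixes \<epsilon> :: "'n::finite \<Rightarrow> real"
    and \<Gamma> R :: "real \<Rightarrow> real ^ 'n ^ 'n"
    and N :: nat
  assumes eps: "\<forall>i. \<epsilon> i = 1 \<or> \<epsilon> i = -1"
    and smooth: "smooth_mat \<Gamma>" "smooth_mat R"
    and periodic: "\<forall>t. \<Gamma> (t + 1) = \<Gamma> t" "\<forall>t. R (t + 1) = R t"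
    and antisym: "\<forall>t. G_antisymmetric \<epsilon> (\<Gamma> t)"
    and sym: "\<forall>t. G_symmetric \<epsilon> (R t)"
    and N: "N \<ge> 1"
  shows "spectral_flow (Hz 1) H1_inner (\<lambda>t. Bform \<epsilon> \<Gamma> R (real N * t))
       = (\<Sum>k<N. spectral_flow (Hz (cis (2 * pi / real N) ^ k)) H1_inner (\<lambda>t. Bform \<epsilon> \<Gamma> R t))"
proof -
  interpret iterated \<epsilon> \<Gamma> R N
    by unfold_locales (use assms smooth_mat_continuous in auto)
  show ?thesis using spectral_flow_iterate unfolding \<zeta>_def .
qed

end
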